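(* Let $\Delta$ be a simplicial $(d-1)$-ball on $m+n$ vertices with $n$ vertices in the boundary, and assume that $\partial\Delta$ is a full subcomplex of $\Delta$. Then: (a) For every $0\le k\le\frac d2$, $h_k(\Delta,\partial\Delta)\le\binom{m+n-d+k-1}{k}-\binom{n-d+k-1}{k}$; equality holds for some $k_0\le\frac d2$ if and only if every non-face $\sigma$ of $\Delta$ of dimension $<k_0$ has all its vertices in $\partial\Delta$. (b) For every $\frac d2<k\le d$, $h_k(\Delta,\partial\Delta)\le\binom{m+n-1-k}{d-k}$; equality holds for some $k_0>\frac d2$ if and only if $\Delta$ has no non-face $\sigma$ of dimension $<d-k_0$. The bounds are tight: for every $n\ge d\ge0$ and $m\ge0$ there is a simplicial $(d-1)$-ball (on $m+n$ vertices, $n$ on the boundary, with full boundary) attaining the upper bounds for all $k$ simultaneously.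
   Context: A subcomplex $\Gamma\subseteq\Delta$ is full if every face of $\Delta$ whose vertices all lie in $\Gamma$ is a face of $\Gamma$. For a relative complex $(\Delta,\Gamma)$ of dimension $d-1$, with $f_i$ the number of $i$-dimensional faces of $\Delta$ not in $\Gamma$ (including $i=-1$), the $h$-vector is defined by $\sum_{k=0}^df_{k-1}t^k(1-t)^{d-k}=\sum_{k=0}^dh_kt^k$. A non-face is a vertex subset not in $\Delta$; its dimension is its cardinality minus one. Binomial coefficients $\binom{a}{b}$ for integer $a$, $b\ge0$ mean $a(a-1)\cdots(a-b+1)/b!$.
   Formalization: Balls have d ≥ 1, and tightness is stated for n ≥ d ≥ 2 and m ≥ 1, with n = 2 when d = 2; for the other printed parameters (m = 0, d ≤ 1, or d = 2 with n > 2) no ball with full boundary attaining the bounds exists. *)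

theory Defs
  imports "HOL-Analysis.Analysis" "HOL-Computational_Algebra.Polynomial"
begin

definition abstract_complex :: "'a set set \<Rightarrow> bool" where
  "abstract_complex \<Delta> \<longleftrightarrow>
     finite (\<Union>\<Delta>) \<and> {} \<in> \<Delta> \<and> (\<forall>\<sigma>\<in>\<Delta>. \<forall>\<tau>. \<tau> \<subseteq> \<sigma> \<longrightarrow> \<tau> \<in> \<Delta>)"

text \<open>There are no ghost vertices: the vertex set is the union of the faces.\<close>

definition complex_vertices :: "'a set set \<Rightarrow> 'a set" where
  "complex_vertices \<Delta> = \<Union>\<Delta>"

definition face_dim :: "'a set \<Rightarrow> int" where
  "face_dim \<sigma> = int (card \<sigma>) - 1"

definition nonface :: "'a set set \<Rightarrow> 'a set \<Rightarrow> bool" where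
  "nonface \<Delta> \<sigma> \<longleftrightarrow> \<sigma> \<subseteq> complex_vertices \<Delta> \<and> \<sigma> \<notin> \<Delta>"

definition full_subcomplex :: "'a set set \<Rightarrow> 'a set set \<Rightarrow> bool" where
  "full_subcomplex \<Gamma> \<Delta> \<longleftrightarrow>
     abstract_complex \<Gamma> \<and> \<Gamma> \<subseteq> \<Delta> \<and>
     (\<forall>\<sigma>\<in>\<Delta>. \<sigma> \<subseteq> complex_vertices \<Gamma> \<longrightarrow> \<sigma> \<in> \<Gamma>)"

text \<open>Points of the geometric realization are given by barycentric coordinates. For a
  finite complex the topology inherited from the product is the usual one.\<close>

definition geometric_realization :: "'a set set \<Rightarrow> ('a \<Rightarrow> real) topology" where
  "geometric_realization \<Delta> =
     subtopology (powertop_real UNIV)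
       {x. (\<forall>v. 0 \<le> x v) \<and> {v. x v \<noteq> 0} \<in> \<Delta> \<and> (\<Sum>v\<in>complex_vertices \<Delta>. x v) = 1}"

definition closed_unit_ball :: "nat \<Rightarrow> (nat \<Rightarrow> real) topology" where
  "closed_unit_ball e = subtopology (Euclidean_space e) {x. (\<Sum>i<e. (x i)\<^sup>2) \<le> 1}"

text \<open>The parameter \<open>e\<close> is the dimension of the ball.\<close>

definition simplicial_ball :: "nat \<Rightarrow> 'a set set \<Rightarrow> bool" where
  "simplicial_ball e \<Delta> \<longleftrightarrow>
     abstract_complex \<Delta> \<and> geometric_realization \<Delta> homeomorphic_space closed_unit_ball e"

text \<open>The boundary complex of an \<open>e\<close>-dimensional ball is generated by the faces of dimension
  \<open>e - 1\<close> (cardinality \<open>e\<close>) that lie in exactly one face of dimension \<open>e\<close> (cardinality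
  \<open>e + 1\<close>). The boundary of a single point is \<open>{{}}\<close>.\<close>

definition boundary_complex :: "nat \<Rightarrow> 'a set set \<Rightarrow> 'a set set" where
  "boundary_complex e \<Delta> =
     {\<tau>. \<exists>\<rho>\<in>\<Delta>. \<tau> \<subseteq> \<rho> \<and> card \<rho> = e \<and> (\<exists>!\<phi>. \<phi> \<in> \<Delta> \<and> card \<phi> = e + 1 \<and> \<rho> \<subseteq> \<phi>)}"

definition f_number :: "'a set set \<Rightarrow> 'a set set \<Rightarrow> int \<Rightarrow> nat" where
  "f_number \<Delta> \<Gamma> i = card {\<sigma> \<in> \<Delta> - \<Gamma>. face_dim \<sigma> = i}"

text \<open>For a relative complex of dimension \<open>d - 1\<close>, with \<open>[:0, 1:]\<close> the indeterminate \<open>t\<close> and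
  \<open>[:1, -1:]\<close> the polynomial \<open>1 - t\<close>.\<close>

definition h_number :: "nat \<Rightarrow> 'a set set \<Rightarrow> 'a set set \<Rightarrow> nat \<Rightarrow> int" where
  "h_number d \<Delta> \<Gamma> k =
     coeff (\<Sum>j\<le>d. of_nat (f_number \<Delta> \<Gamma> (int j - 1)) * [:0, 1:] ^ j * [:1, -1:] ^ (d - j)) k"

definition ball_with_full_boundary :: "nat \<Rightarrow> nat \<Rightarrow> nat \<Rightarrow> 'a set set \<Rightarrow> bool" where
  "ball_with_full_boundary d m n \<Delta> \<longleftrightarrow>
     1 \<le> d \<and> simplicial_ball (d - 1) \<Delta> \<and>
     card (complex_vertices \<Delta>) = m + n \<and>
     card (complex_vertices (boundary_complex (d - 1) \<Delta>)) = n \<and>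
     full_subcomplex (boundary_complex (d - 1) \<Delta>) \<Delta>"

text \<open>The upper entry of a binomial coefficient is an integer that may be negative. The library
  provides \<open>gchoose\<close> only over fields of characteristic zero, so the bounds are rationals.\<close>

definition bound_lower_half :: "nat \<Rightarrow> nat \<Rightarrow> nat \<Rightarrow> nat \<Rightarrow> rat" where
  "bound_lower_half d m n k =
     ((of_int (int m + int n - int d + int k - 1)) gchoose k) -
     ((of_int (int n - int d + int k - 1)) gchoose k)"

definition bound_upper_half :: "nat \<Rightarrow> nat \<Rightarrow> nat \<Rightarrow> nat \<Rightarrow> rat" where
  "bound_upper_half d m n k = (of_int (int m + int n - 1 - int k)) gchoose (d - k)"

end

theory Submission
  imports Defs "HOL-Homology.Homology" "HOL-Library.Z2" "HOL-Library.Function_Algebras"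
    "HOL-Computational_Algebra.Fraction_Field"
begin

text \<open>Singular homology of the ball, compared with simplicial chains modulo 2 through a Sperner
  labelling, shows that all links have the homology of balls and spheres. A complex of forms
  weighted by powers of distinct field elements, one for each vertex, then has
  dimension \<open>h_i\<close> in its top homology, so \<open>h_i \<ge> 0\<close> for every relative
  Cohen--Macaulay complex. Applied to the complement of the star of a vertex this gives
  \<open>h_j (lk v) \<le> h_j \<Delta>\<close>; applied to the deletion of a boundary vertex, which is
  Cohen--Macaulay because the boundary is full, it gives
  \<open>h_(i-1) (lk v) \<le> h_i \<Delta>\<close>. With the Dehn--Sommerville relations, summing over the
  vertices (McMullen) turns these into recursive inequalities for the interior
  \<open>h\<close>-numbers whose solutions are the stated bounds; equality forces the links to be
  neighborly. Balls attaining the bounds are obtained by sewing new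
  vertices, first onto the boundary of a cone over a simplex boundary and then into its
  interior; each sewing step is a sequence of bistellar flips, realized by explicit piecewise
  linear homeomorphisms.\<close>

section \<open>Simplicial chains modulo 2\<close>

text \<open>The links of a triangulated ball need not be balls or spheres, so an induction over
  links cannot stay with homeomorphisms; it runs on homology. Everything is arranged for
  characteristic 2, where boundaries, contractions and wedges need no signs. The price is the
  passage from integral singular homology: a cycle modulo 2 lifts only to a chain whose boundary is
  twice some \<open>w\<close> plus a part in the subspace, and the lift is corrected by the
  vanishing of homology one degree lower; in the top degree cyclicity, phrased with odd
  coefficients, replaces vanishing. The h-numbers are reached without face rings or systems of
  parameters: on a face with \<open>j\<close> vertices the forms of degree \<open>k\<close> killed
  by contraction with these vertices have dimension \<open>(d - j) choose k\<close>, the binomial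
  coefficient in the h-number of index \<open>d - k\<close>. Fullness of the boundary enters where a
  filling must avoid a boundary vertex: in the top degree it is corrected by the sum of all facets
  above a face, which is a cycle only at interior faces.\<close>

declare add_bit_eq_xor [simp del] mult_bit_eq_and [simp del] bit_not_zero_iff [simp del]
 bit_not_one_iff [simp del] minus_bit_def [simp del] divide_bit_def [simp del]
 uminus_bit_def [simp del] inverse_bit_def [simp del]

lemma bit_add_self [simp]: "(x::bit) + x = 0"
 by (cases x) auto

lemma bit_uminus [simp]: "- (x::bit) = x"
 by (metis bit_add_self minus_unique)

lemma bit_of_int_eq_0_iff: "(of_int n :: bit) = 0 \<longleftrightarrow> even n"
proof -
 have "(of_int n :: bit) = of_int (n mod 2) + of_int (2 * (n div 2))"
  by (metis mod_mult_div_eq of_int_add)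
 also have "\<dots> = of_int (n mod 2)" by simp
 finally show ?thesis by (cases "even n") (auto simp: even_iff_mod_2_eq_zero odd_iff_mod_2_eq_one)
qed

text \<open>The coefficient at \<open>\<rho>\<close> collects all cofaces, so no orientation is
  chosen; with values satisfying \<open>x + x = 0\<close> this is the simplicial boundary. The value
  type stays general because both bits and field elements occur.\<close>

definition bdr :: "'a set => ('a set => 'x::comm_monoid_add) => 'a set => 'x" where
 "bdr V c \<rho> = (\<Sum>v\<in>V-\<rho>. c (insert v \<rho>))"

definition basis_pt :: "'i => 'i => real" where
 "basis_pt i = (\<lambda>j. if j = i then 1 else 0)"

definition vertex_labels :: "nat => ('p => 'a) => ((nat => real) => 'p) => 'a set" where
 "vertex_labels p \<phi> f = (\<lambda>i. \<phi> (f (basis_pt i))) ` {..p}"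

text \<open>A vertex labelling turns a singular chain into a simplicial chain modulo 2; a singular
  simplex with a repeated label is degenerate and is discarded by the condition on
  \<open>card S\<close>.\<close>

definition label_chain :: "nat => ('p => 'a) => 'p chain => 'a set => bit" where
 "label_chain p \<phi> c S =
   (\<Sum>f\<in>Poly_Mapping.keys c. if vertex_labels p \<phi> f = S \<and> card S = Suc p
    then of_int (Poly_Mapping.lookup c f) else 0)"

lemma label_chain_superset:
 assumes "finite A" "Poly_Mapping.keys c \<subseteq> A"
 shows "label_chain p \<phi> c S = (\<Sum>f\<in>A. if vertex_labels p \<phi> f = S \<and> card S = Suc p
    then of_int (Poly_Mapping.lookup c f) else 0)"
 unfolding label_chain_def
 by (rule sum.mono_neutral_left) (use assms in \<open>auto simp: in_keys_iff\<close>)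

lemma label_chain_0 [simp]: "label_chain p \<phi> 0 S = 0"
 by (simp add: label_chain_def)

lemma label_chain_add: "label_chain p \<phi> (a + b) S = label_chain p \<phi> a S + label_chain p \<phi> b S"
proof -
 let ?A = "Poly_Mapping.keys a \<union> Poly_Mapping.keys b"
 have "finite ?A" "Poly_Mapping.keys (a+b) \<subseteq> ?A" using keys_add[of a b] by auto
 thus ?thesis
  using label_chain_superset[of ?A "a+b" p \<phi> S] label_chain_superset[of ?A a p \<phi> S]
   label_chain_superset[of ?A b p \<phi> S]
  by (auto simp: lookup_add sum.distrib[symmetric] intro!: sum.cong)
qed

lemma label_chain_cmul: "label_chain p \<phi> (frag_cmul k a) S = of_int k * label_chain p \<phi> a S"
proof -
 let ?A = "Poly_Mapping.keys a"
 have "finite ?A" "Poly_Mapping.keys (frag_cmul k a) \<subseteq> ?A" by (auto simp: keys_cmul)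
 thus ?thesis
  using label_chain_superset[of ?A "frag_cmul k a" p \<phi> S]
  by (auto simp: label_chain_def sum_distrib_left intro!: sum.cong)
qed

lemma label_chain_minus: "label_chain p \<phi> (- a) S = label_chain p \<phi> a S"
 using label_chain_cmul[of p \<phi> "-1" a S] by simp

lemma label_chain_diff: "label_chain p \<phi> (a - b) S = label_chain p \<phi> a S - label_chain p \<phi> b S"
 using label_chain_add[of p \<phi> a "-b" S] label_chain_minus[of p \<phi> b S] by simp

lemma label_chain_sum: "label_chain p \<phi> (sum g I) S = (\<Sum>i\<in>I. label_chain p \<phi> (g i) S)"
 by (induction I rule: infinite_finite_induct) (auto simp: label_chain_add)

lemma label_chain_of: "label_chain p \<phi> (frag_of f) S = (if vertex_labels p \<phi> f = S \<and> card S = Suc p then 1 else 0)"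
 by (simp only: label_chain_def keys_frag_of lookup_frag_of) simp

lemma bit_of_int_power [simp]: "of_int ((-1)^k) = (1::bit)"
 by (induction k) auto

lemma simplical_face_basis:
 "simplical_face k (basis_pt i) = basis_pt (if i < k then i else Suc i)"
 by (auto simp: simplical_face_def basis_pt_def fun_eq_iff)

lemma face_index_image:
 assumes k: "k \<le> Suc p"
 shows "(\<lambda>i. if i < k then i else Suc i) ` {..p} = {..Suc p} - {k}"
proof (rule Set.set_eqI)
 fix j
 show "(j \<in> (\<lambda>i. if i < k then i else Suc i) ` {..p}) = (j \<in> {..Suc p} - {k})"
 proof
  assume "j \<in> {..Suc p} - {k}"
  hence "j = (if (if j < k then j else j - 1) < k then (if j < k then j else j - 1)
    else Suc (if j < k then j else j - 1))" "(if j < k then j else j - 1) \<in> {..p}"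
   using k by auto
  thus "j \<in> (\<lambda>i. if i < k then i else Suc i) ` {..p}" by blast
 qed (use k in \<open>auto split: if_splits\<close>)
qed

lemma vertex_labels_face:
 assumes "k \<le> Suc p"
 shows "vertex_labels p \<phi> (singular_face (Suc p) k f) = (\<lambda>i. \<phi> (f (basis_pt i))) ` ({..Suc p} - {k})"
proof -
 have "vertex_labels p \<phi> (singular_face (Suc p) k f) =
   (\<lambda>i. \<phi> (f (basis_pt i))) ` ((\<lambda>i. if i < k then i else Suc i) ` {..p})"
  unfolding vertex_labels_def image_image singular_face_def
 proof (rule image_cong)
  fix i assume "i \<in> {..p}"
  hence "basis_pt i \<in> standard_simplex (Suc p - Suc 0)" by (simp add: basis_pt_def)
  thus "\<phi> (restrict (f \<circ> simplical_face k) (standard_simplex (Suc p - Suc 0)) (basis_pt i)) =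
     \<phi> (f (basis_pt (if i < k then i else Suc i)))"
   by (simp only: restrict_apply if_True o_apply simplical_face_basis)
 qed simp
 thus ?thesis by (simp only: face_index_image[OF assms])
qed

text \<open>The parity count of Sperner's lemma. Once \<open>S\<close> is known to consist of
  labels, distinct labels leave exactly one outside \<open>S\<close>, which accounts for one term on
  each side; with a repeated label both sides vanish.\<close>

lemma label_face_count:
 fixes w :: "nat => 'a"
 assumes V: "finite V" "w ` {..Suc p} \<subseteq> V"
 shows "(\<Sum>k\<le>Suc p. if w ` ({..Suc p} - {k}) = S \<and> card S = Suc p then 1 else 0::bit) =
   (\<Sum>v\<in>V-S. if w ` {..Suc p} = insert v S \<and> card (insert v S) = Suc (Suc p) then 1 else 0)"
proof (cases "card S = Suc p \<and> S \<subseteq> w ` {..Suc p}")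
 case False
 hence "(\<Sum>k\<le>Suc p. if w ` ({..Suc p} - {k}) = S \<and> card S = Suc p then 1 else 0::bit) = 0"
  by (intro sum.neutral) auto
 moreover have "(\<Sum>v\<in>V-S. if w ` {..Suc p} = insert v S \<and> card (insert v S) = Suc (Suc p) then 1 else 0::bit) = 0"
 proof (intro sum.neutral ballI)
  fix v assume v: "v \<in> V - S"
  have "\<not> (w ` {..Suc p} = insert v S \<and> card (insert v S) = Suc (Suc p))"
  proof
   assume a: "w ` {..Suc p} = insert v S \<and> card (insert v S) = Suc (Suc p)"
   hence "finite S" by (metis finite_atMost finite_imageI finite_insert)
   thus False using a v False by auto
  qed
  thus "(if w ` {..Suc p} = insert v S \<and> card (insert v S) = Suc (Suc p) then 1 else 0::bit) = 0" by simp
 qed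
 ultimately show ?thesis by simp
next
 case True
 hence S: "card S = Suc p" "S \<subseteq> w ` {..Suc p}" "finite S" by (auto intro: finite_subset)
 show ?thesis
 proof (cases "inj_on w {..Suc p}")
  case inj: True
  have cW: "card (w ` {..Suc p}) = Suc (Suc p)" using inj by (simp add: card_image)
  hence "card (w ` {..Suc p} - S) = 1" using S by (simp add: card_Diff_subset)
  then obtain v where v: "w ` {..Suc p} - S = {v}" using card_1_singletonE by blast
  hence "v \<in> w ` {..Suc p}" by blast
  then obtain k0 where k0: "k0 \<le> Suc p" "w k0 = v" by auto
  have *: "w ` ({..Suc p} - {k}) = S \<longleftrightarrow> k = k0" if "k \<le> Suc p" for k
  proof -
   have "w ` ({..Suc p} - {k}) = w ` {..Suc p} - {w k}"
    using that inj by (auto simp: inj_on_def)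
   moreover have "S = w ` {..Suc p} - {v}" using v S by blast
   moreover have "(w ` {..Suc p} - {w k} = w ` {..Suc p} - {v}) \<longleftrightarrow> w k = v"
   proof
    assume "w ` {..Suc p} - {w k} = w ` {..Suc p} - {v}"
    moreover have "v \<in> w ` {..Suc p}" using v by blast
    ultimately have "v \<in> w ` {..Suc p} - {v}" if "w k ~= v" using that by (metis DiffI singletonD)
    thus "w k = v" by (meson Diff_iff singletonI)
   qed simp
   ultimately show ?thesis using k0 that inj by (auto simp: inj_on_def)
  qed
  have "(\<Sum>k\<le>Suc p. if w ` ({..Suc p} - {k}) = S \<and> card S = Suc p then 1 else 0::bit) =
    (\<Sum>k\<le>Suc p. if k = k0 then 1 else 0)"
   using * S by (intro sum.cong) auto
  also have "\<dots> = 1" using k0 by (simp add: sum.delta)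
  finally have 1: "(\<Sum>k\<le>Suc p. if w ` ({..Suc p} - {k}) = S \<and> card S = Suc p then 1 else 0::bit) = 1" .
  have "w ` {..Suc p} = insert u S \<and> card (insert u S) = Suc (Suc p) \<longleftrightarrow> u = v" if "u \<in> V - S" for u
   using v S that by auto
  hence "(\<Sum>v\<in>V-S. if w ` {..Suc p} = insert v S \<and> card (insert v S) = Suc (Suc p) then 1 else 0::bit) =
    (\<Sum>u\<in>V-S. if u = v then 1 else 0)"
   by (intro sum.cong) auto
  also have "\<dots> = 1" using v V by (subst sum.delta) auto
  finally show ?thesis using 1 by simp
 next
  \<comment> \<open>The faces opposite to \<open>i\<close> and \<open>j\<close> carry the same
    labels and cancel; any other face still contains both, hence has too few labels to be
    \<open>S\<close>.\<close>
  case False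
  then obtain i j where ij: "i < j" "j \<le> Suc p" "w i = w j"
   unfolding inj_on_def by (metis atMost_iff linorder_neqE_nat)
  have W: "w ` ({..Suc p} - {i}) = w ` {..Suc p}" "w ` ({..Suc p} - {j}) = w ` {..Suc p}"
  proof -
   show "w ` ({..Suc p} - {i}) = w ` {..Suc p}"
   proof (intro equalityI subsetI)
    fix x assume "x \<in> w ` {..Suc p}"
    then obtain k where "k \<le> Suc p" "x = w k" by auto
    thus "x \<in> w ` ({..Suc p} - {i})"
     using ij by (cases "k = i") auto
   qed auto
   show "w ` ({..Suc p} - {j}) = w ` {..Suc p}"
   proof (intro equalityI subsetI)
    fix x assume "x \<in> w ` {..Suc p}"
    then obtain k where "k \<le> Suc p" "x = w k" by auto
    thus "x \<in> w ` ({..Suc p} - {j})"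
     using ij by (cases "k = j") (auto intro!: image_eqI[of _ _ i])
   qed auto
  qed
  have other: "\<not> (w ` ({..Suc p} - {k}) = S)" if "k \<le> Suc p" "k ~= i" "k ~= j" for k
  proof
   assume a: "w ` ({..Suc p} - {k}) = S"
   have "w ` ({..Suc p} - {k}) = w ` ({..Suc p} - {k} - {i})"
   proof (intro equalityI subsetI)
    fix x assume "x \<in> w ` ({..Suc p} - {k})"
    then obtain l where "l \<le> Suc p" "l ~= k" "x = w l" by auto
    thus "x \<in> w ` ({..Suc p} - {k} - {i})"
     using ij that by (cases "l = i") auto
   qed auto
   hence "card S \<le> card ({..Suc p} - {k} - {i})" using a by (metis card_image_le finite_Diff finite_atMost)
   also have "\<dots> = p" using that ij by (simp add: card_Diff_subset)
   finally show False using S by simp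
  qed
  have "(\<Sum>k\<le>Suc p. if w ` ({..Suc p} - {k}) = S \<and> card S = Suc p then 1 else 0::bit) =
    (\<Sum>k\<in>{i,j}. if w ` ({..Suc p} - {k}) = S \<and> card S = Suc p then 1 else 0)"
   using ij other by (intro sum.mono_neutral_right) auto
  also have "\<dots> = 0" using ij W by simp
  finally have 1: "(\<Sum>k\<le>Suc p. if w ` ({..Suc p} - {k}) = S \<and> card S = Suc p then 1 else 0::bit) = 0" .
  have "card (w ` {..Suc p}) \<le> Suc p"
   using W(1) card_image_le[of "{..Suc p} - {i}" w] ij by (simp add: card_Diff_subset)
  hence "(\<Sum>v\<in>V-S. if w ` {..Suc p} = insert v S \<and> card (insert v S) = Suc (Suc p) then 1 else 0::bit) = 0"
   by (intro sum.neutral) auto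
  thus ?thesis using 1 by simp
 qed
qed

text \<open>The signs of the singular boundary disappear modulo 2 and
  \<open>label_face_count\<close> settles each simplex. It makes labelling a chain map, which is how
  singular relations become simplicial ones.\<close>

lemma label_chain_boundary:
 assumes c: "singular_chain (Suc p) X c" and V: "finite V" "\<phi> ` topspace X \<subseteq> V"
 shows "label_chain p \<phi> (chain_boundary (Suc p) c) S = bdr V (label_chain (Suc p) \<phi> c) S"
 using c unfolding singular_chain_def
proof (induction rule: frag_induction)
 case (one f)
 hence "f (basis_pt i) \<in> topspace X" if "i \<le> Suc p" for i
  using that by (auto simp: singular_simplex_def continuous_map_def basis_pt_def)
 hence *: "(\<lambda>i. \<phi> (f (basis_pt i))) ` {..Suc p} \<subseteq> V" using V by auto
 have "label_chain p \<phi> (chain_boundary (Suc p) (frag_of f)) S =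
   (\<Sum>k\<le>Suc p. if (\<lambda>i. \<phi> (f (basis_pt i))) ` ({..Suc p} - {k}) = S \<and> card S = Suc p then 1 else 0)"
  unfolding chain_boundary_of label_chain_sum label_chain_cmul label_chain_of
  by (simp add: label_chain_sum label_chain_cmul label_chain_of vertex_labels_face del: sum.atMost_Suc cong: sum.cong)
   (auto intro!: sum.cong simp: vertex_labels_face label_chain_cmul label_chain_of)
 thus ?case
  unfolding label_face_count[OF V(1) *] bdr_def label_chain_of by (simp add: vertex_labels_def)
next
 case (diff a b)
 thus ?case
  by (simp add: chain_boundary_diff label_chain_diff bdr_def sum_subtractf)
qed (simp add: bdr_def)

section \<open>Geometric realizations and the affine simplices spanned by faces\<close>

definition realization :: "'a set => 'a set set => ('a => real) set" where
 "realization V K = {x. (\<forall>v. 0 \<le> x v) \<and> {v. x v ~= 0} \<in> K \<and> sum x V = 1}"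

definition rank_in :: "('a => nat) => 'a set => 'a => nat" where
 "rank_in g \<tau> v = card {u\<in>\<tau>. g u < g v}"

text \<open>The numbering \<open>g\<close> orders the vertices of all faces coherently, so that
  deleting \<open>v\<close> from \<open>\<tau>\<close> is the singular face number
  \<open>rank_in g \<tau> v\<close>. The restriction makes the map extensional, as singular
  simplices must be.\<close>

definition face_simplex :: "('a => nat) => 'a set => (nat => real) => 'a => real" where
 "face_simplex g \<tau> = restrict (\<lambda>t v. if v \<in> \<tau> then t (rank_in g \<tau> v) else 0) (standard_simplex (card \<tau> - 1))"

lemma rank_in_less:
 assumes "finite \<tau>" "u \<in> \<tau>" "g u < g v"
 shows "rank_in g \<tau> u < rank_in g \<tau> v"
proof -
 have "{w\<in>\<tau>. g w < g u} \<subseteq> {w\<in>\<tau>. g w < g v} - {u}" using assms by auto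
 hence "card {w\<in>\<tau>. g w < g u} \<le> card ({w\<in>\<tau>. g w < g v} - {u})"
  using assms by (intro card_mono) simp_all
 also have "\<dots> < card {w\<in>\<tau>. g w < g v}"
  using assms by (intro card_Diff1_less) simp_all
 finally show ?thesis by (simp add: rank_in_def)
qed

lemma rank_in_less_card:
 assumes "finite \<tau>" "v \<in> \<tau>"
 shows "rank_in g \<tau> v < card \<tau>"
proof -
 have "card {w\<in>\<tau>. g w < g v} \<le> card (\<tau> - {v})" using assms by (intro card_mono) auto
 also have "\<dots> < card \<tau>" using assms by (intro card_Diff1_less)
 finally show ?thesis by (simp add: rank_in_def)
qed

lemma rank_in_bij:
 assumes "finite \<tau>" "inj_on g \<tau>"
 shows "bij_betw (rank_in g \<tau>) \<tau> {..<card \<tau>}"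
proof -
 have lt: "rank_in g \<tau> u < rank_in g \<tau> v" if "u \<in> \<tau>" "v \<in> \<tau>" "g u < g v" for u v
  using that assms by (intro rank_in_less)
 have inj: "inj_on (rank_in g \<tau>) \<tau>"
 proof (rule inj_onI)
  fix u v assume uv: "u \<in> \<tau>" "v \<in> \<tau>" "rank_in g \<tau> u = rank_in g \<tau> v"
  hence "g u = g v" using lt[of u v] lt[of v u] by force
  thus "u = v" using uv assms by (auto simp: inj_on_def)
 qed
 have "rank_in g \<tau> v < card \<tau>" if "v \<in> \<tau>" for v
  using that assms by (intro rank_in_less_card)
 hence "rank_in g \<tau> ` \<tau> \<subseteq> {..<card \<tau>}" by auto
 moreover have "card (rank_in g \<tau> ` \<tau>) = card {..<card \<tau>}" using inj by (simp add: card_image)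
 ultimately have "rank_in g \<tau> ` \<tau> = {..<card \<tau>}" by (intro card_subset_eq) auto
 with inj show ?thesis by (simp add: bij_betw_def)
qed

lemma rank_in_remove:
 assumes "finite \<tau>" "v \<in> \<tau>" "u \<in> \<tau>" "u ~= v" "inj_on g \<tau>"
 shows "rank_in g (\<tau> - {v}) u = (if rank_in g \<tau> u < rank_in g \<tau> v then rank_in g \<tau> u else rank_in g \<tau> u - 1)"
  and "rank_in g \<tau> u ~= rank_in g \<tau> v"
proof -
 have ne: "g u ~= g v" using assms by (auto simp: inj_on_def)
 have lt: "rank_in g \<tau> u < rank_in g \<tau> v" if "u \<in> \<tau>" "v \<in> \<tau>" "g u < g v" for u v
  using that assms by (intro rank_in_less)
 show "rank_in g \<tau> u ~= rank_in g \<tau> v" using lt[of u v] lt[of v u] ne assms(2,3)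
  by (metis linorder_neqE_nat less_irrefl)
 show "rank_in g (\<tau> - {v}) u = (if rank_in g \<tau> u < rank_in g \<tau> v then rank_in g \<tau> u else rank_in g \<tau> u - 1)"
 proof (cases "g u < g v")
  case True
  hence "{w \<in> \<tau> - {v}. g w < g u} = {w \<in> \<tau>. g w < g u}" by auto
  thus ?thesis using lt[of u v] True assms by (simp add: rank_in_def)
 next
  case False
  hence "{w \<in> \<tau>. g w < g u} = insert v {w \<in> \<tau> - {v}. g w < g u}" using assms ne by auto
  hence "rank_in g \<tau> u = Suc (rank_in g (\<tau> - {v}) u)"
   using assms by (simp add: rank_in_def)
  moreover have "\<not> rank_in g \<tau> u < rank_in g \<tau> v" using lt[of v u] assms False ne by (meson linorder_neqE_nat less_asym)
  ultimately show ?thesis by simp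
 qed
qed

lemma face_simplex_in:
 assumes "finite V" "\<tau> \<subseteq> V" "inj_on g V" "\<tau> ~= {}" "t \<in> standard_simplex (card \<tau> - 1)"
 shows "face_simplex g \<tau> t \<in> realization V (Pow \<tau>)"
proof -
 have fin: "finite \<tau>" using assms finite_subset by auto
 have inj: "inj_on g \<tau>" using assms inj_on_subset by blast
 have c: "Suc (card \<tau> - 1) = card \<tau>" using assms fin by (simp add: card_gt_0_iff)
 have "(\<Sum>v\<in>V. if v \<in> \<tau> then t (rank_in g \<tau> v) else 0) = (\<Sum>v\<in>\<tau>. t (rank_in g \<tau> v))"
  using assms by (intro sum.mono_neutral_cong_right) auto
 also have "\<dots> = (\<Sum>i\<in>{..<card \<tau>}. t i)"
  by (rule sum.reindex_bij_betw[OF rank_in_bij[OF fin inj]])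
 also have "{..<card \<tau>} = {..card \<tau> - 1}" using c lessThan_Suc_atMost by metis
 finally have "(\<Sum>v\<in>V. if v \<in> \<tau> then t (rank_in g \<tau> v) else 0) = 1"
  using assms(5) by (simp add: standard_simplex_def)
 thus ?thesis using assms(5)
  by (auto simp: realization_def face_simplex_def standard_simplex_def)
qed

lemma powertop_real_eq: "subtopology (powertop_real UNIV) S = top_of_set S"
 by (simp add: euclidean_product_topology)

lemma continuous_on_coords:
 fixes f :: "'b::topological_space => 'a => real"
 shows "(\<And>v. continuous_on S (\<lambda>x. f x v)) ==> continuous_on S f"
 by (rule continuous_on_coordinatewise_then_product)

lemma continuous_on_coord [continuous_intros]: "continuous_on S (\<lambda>x::'a => real. x v)"
 by (rule continuous_on_subset[OF continuous_on_product_coordinates]) simp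

lemma face_simplex_singular:
 assumes "finite V" "\<tau> \<subseteq> V" "inj_on g V" "card \<tau> = Suc p"
 shows "singular_simplex p (top_of_set (realization V (Pow \<tau>))) (face_simplex g \<tau>)"
proof -
 have "\<tau> ~= {}" using assms by auto
 hence "face_simplex g \<tau> ` standard_simplex p \<subseteq> realization V (Pow \<tau>)"
  using face_simplex_in[OF assms(1,2,3)] assms by auto
 moreover have "continuous_on (standard_simplex p) (\<lambda>t v. if v \<in> \<tau> then t (rank_in g \<tau> v) else 0)"
 proof (rule continuous_on_coords)
  fix v show "continuous_on (standard_simplex p) (\<lambda>t. if v \<in> \<tau> then t (rank_in g \<tau> v) else 0)"
   by (cases "v \<in> \<tau>") (simp_all add: continuous_on_coord)
 qed
 hence "continuous_on (standard_simplex p) (face_simplex g \<tau>)"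
  by (rule continuous_on_eq) (simp add: face_simplex_def assms)
 moreover have "face_simplex g \<tau> \<in> extensional (standard_simplex p)"
  by (simp add: face_simplex_def assms)
 ultimately show ?thesis
  unfolding singular_simplex_def powertop_real_eq by auto
qed

lemma face_simplex_face:
 assumes "finite \<tau>" "inj_on g \<tau>" "card \<tau> = Suc (Suc p)" "v \<in> \<tau>"
 shows "singular_face (Suc p) (rank_in g \<tau> v) (face_simplex g \<tau>) = face_simplex g (\<tau> - {v})"
proof
 fix t
 have c: "card (\<tau> - {v}) = Suc p" using assms by simp
 have b: "rank_in g \<tau> v \<le> Suc p"
  using bij_betwE[OF rank_in_bij[OF assms(1,2)]] assms by fastforce
 show "singular_face (Suc p) (rank_in g \<tau> v) (face_simplex g \<tau>) t = face_simplex g (\<tau> - {v}) t"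
 proof (cases "t \<in> standard_simplex p")
  case False
  thus ?thesis by (simp add: singular_face_def face_simplex_def c)
 next
  case True
  hence "simplical_face (rank_in g \<tau> v) t \<in> standard_simplex (Suc p)"
   using simplical_face_in_standard_simplex[of "Suc p"] b by simp
  hence "singular_face (Suc p) (rank_in g \<tau> v) (face_simplex g \<tau>) t =
    (\<lambda>u. if u \<in> \<tau> then simplical_face (rank_in g \<tau> v) t (rank_in g \<tau> u) else 0)"
   using True by (simp add: singular_face_def face_simplex_def assms)
  also have "\<dots> = (\<lambda>u. if u \<in> \<tau> - {v} then t (rank_in g (\<tau> - {v}) u) else 0)"
  proof
   fix u
   show "(if u \<in> \<tau> then simplical_face (rank_in g \<tau> v) t (rank_in g \<tau> u) else 0) =
     (if u \<in> \<tau> - {v} then t (rank_in g (\<tau> - {v}) u) else 0)"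
    using rank_in_remove[OF assms(1,4) _ _ assms(2), of u] by (auto simp: simplical_face_def)
  qed
  also have "\<dots> = face_simplex g (\<tau> - {v}) t" using True by (simp add: face_simplex_def c)
  finally show ?thesis .
 qed
qed

lemma face_simplex_boundary:
 assumes "finite \<tau>" "inj_on g \<tau>" "card \<tau> = Suc (Suc p)"
 shows "chain_boundary (Suc p) (frag_of (face_simplex g \<tau>)) =
   (\<Sum>v\<in>\<tau>. frag_cmul ((-1) ^ rank_in g \<tau> v) (frag_of (face_simplex g (\<tau> - {v}))))"
proof -
 have "chain_boundary (Suc p) (frag_of (face_simplex g \<tau>)) =
   (\<Sum>k\<in>{..<card \<tau>}. frag_cmul ((-1) ^ k) (frag_of (singular_face (Suc p) k (face_simplex g \<tau>))))"
  using assms by (simp add: chain_boundary_of lessThan_Suc_atMost del: sum.lessThan_Suc)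
 also have "\<dots> = (\<Sum>v\<in>\<tau>. frag_cmul ((-1) ^ rank_in g \<tau> v) (frag_of (singular_face (Suc p) (rank_in g \<tau> v) (face_simplex g \<tau>))))"
  by (rule sum.reindex_bij_betw[OF rank_in_bij[OF assms(1,2)], symmetric])
 also have "\<dots> = (\<Sum>v\<in>\<tau>. frag_cmul ((-1) ^ rank_in g \<tau> v) (frag_of (face_simplex g (\<tau> - {v}))))"
  using face_simplex_face[OF assms] by (intro sum.cong) auto
 finally show ?thesis .
qed

section \<open>Sperner labelling by a largest barycentric coordinate\<close>

definition argmax :: "'a set => ('a => real) => 'a" where
 "argmax V x = (SOME v. v \<in> V \<and> (\<forall>u\<in>V. x u \<le> x v))"

lemma argmax:
 assumes "finite V" "V ~= {}"
 shows "argmax V x \<in> V" "u \<in> V ==> x u \<le> x (argmax V x)"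
proof -
 have "\<exists>v. v \<in> V \<and> (\<forall>u\<in>V. x u \<le> x v)"
 proof -
  have "Max (x ` V) \<in> x ` V" using assms by (intro Max_in) auto
  then obtain v where "v \<in> V" "x v = Max (x ` V)" by auto
  thus ?thesis using assms by (intro exI[of _ v]) auto
 qed
 from someI_ex[OF this] show "argmax V x \<in> V" "u \<in> V ==> x u \<le> x (argmax V x)"
  by (auto simp: argmax_def)
qed

lemma argmax_ge:
 assumes "finite V" "x \<in> realization V K"
 shows "1 / card V \<le> x (argmax V x)" "V ~= {}"
proof -
 show V: "V ~= {}" using assms by (auto simp: realization_def)
 have "1 = sum x V" using assms by (simp add: realization_def)
 also have "\<dots> \<le> (\<Sum>v\<in>V. x (argmax V x))" using argmax[OF assms(1) V] by (intro sum_mono) auto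
 finally show "1 / card V \<le> x (argmax V x)" using V assms(1)
  by (simp add: divide_le_eq card_gt_0_iff mult.commute)
qed

lemma argmax_support:
 assumes "finite V" "x \<in> realization V K"
 shows "argmax V x \<in> {v. x v ~= 0}"
proof -
 have "0 < 1 / real (card V)" using argmax_ge(2)[OF assms] assms(1) by (simp add: card_gt_0_iff)
 thus ?thesis using argmax_ge(1)[OF assms] by auto
qed

lemma argmax_in_face:
 assumes "finite V" "x \<in> realization V (Pow \<tau>)"
 shows "argmax V x \<in> \<tau>"
proof -
 have "{v. x v ~= 0} \<subseteq> \<tau>" using assms(2) by (simp add: realization_def)
 thus ?thesis using argmax_support[OF assms] by (rule subsetD)
qed

lemma singular_simplex_vertex:
 assumes "singular_simplex p (top_of_set Z) f" "i \<le> p"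
 shows "f (basis_pt i) \<in> Z"
proof -
 have "basis_pt i \<in> standard_simplex p" using assms(2) by (simp add: basis_pt_def)
 thus ?thesis using assms(1)
  unfolding singular_simplex_def powertop_real_eq by auto
qed

lemma realization_mono: "K \<subseteq> L ==> realization V K \<subseteq> realization V L"
 by (auto simp: realization_def)

text \<open>A Sperner-type fact: labelling each point of a subdivided face by the index of a largest
 barycentric coordinate covers that face exactly once modulo 2.\<close>

lemma sperner:
 assumes V: "finite V" and g: "inj_on g V" and \<tau>: "\<tau> \<subseteq> V" "card \<tau> = Suc p"
  and R: "continuous_on (realization V (Pow V)) R" "\<And>\<rho>. \<rho> \<subseteq> \<tau> ==> R ` realization V (Pow \<rho>) \<subseteq> realization V (Pow \<rho>)"
 shows "label_chain p (argmax V) ((singular_subdivision p ^^ n) (chain_map p R (frag_of (face_simplex g \<tau>)))) S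
   = (if S = \<tau> then 1 else 0)"
 using \<tau> R(2)
proof (induction p arbitrary: \<tau> S)
 let ?X = "\<lambda>\<rho>. top_of_set (realization V (Pow \<rho>))"
 have ch: "singular_chain p (?X \<tau>) ((singular_subdivision p ^^ n) (chain_map p R (frag_of (face_simplex g \<tau>))))"
  if "\<tau> \<subseteq> V" "card \<tau> = Suc p" "R ` realization V (Pow \<tau>) \<subseteq> realization V (Pow \<tau>)" for p \<tau> n
 proof -
  have "continuous_map (?X \<tau>) (?X \<tau>) R"
   using that R(1) realization_mono[of "Pow \<tau>" "Pow V" V] continuous_on_subset by (auto simp: Pow_mono)
  hence "singular_chain p (?X \<tau>) (chain_map p R (frag_of (face_simplex g \<tau>)))"
   using face_simplex_singular[OF V that(1) g that(2)]
   by (intro singular_chain_chain_map) (auto simp: singular_chain_of)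
  thus ?thesis
   by (induction n) (auto intro: singular_chain_singular_subdivision)
 qed
 \<comment> \<open>A largest coordinate is nonzero, so labels of points in the realization of
   \<open>\<tau>\<close> lie in \<open>\<tau>\<close>, and \<open>Suc p\<close> distinct ones
   exhaust it.\<close>
 have supp: "label_chain p (argmax V) c S = 0" if c: "singular_chain p (?X \<tau>) c" and "S ~= \<tau>" "\<tau> \<subseteq> V" "card \<tau> = Suc p" for p \<tau> c S
 proof -
  have "\<not> (vertex_labels p (argmax V) f = S \<and> card S = Suc p)" if f: "f \<in> Poly_Mapping.keys c" for f
  proof
   assume a: "vertex_labels p (argmax V) f = S \<and> card S = Suc p"
   have "singular_simplex p (?X \<tau>) f" using f c by (auto simp: singular_chain_def)
   hence "argmax V (f (basis_pt i)) \<in> \<tau>" if "i \<le> p" for i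
    using singular_simplex_vertex argmax_in_face[OF V] that by blast
   hence "S \<subseteq> \<tau>" using a by (auto simp: vertex_labels_def)
   hence "S = \<tau>" using a \<open>card \<tau> = Suc p\<close> V \<open>\<tau> \<subseteq> V\<close> by (metis card_subset_eq finite_subset)
   thus False using \<open>S ~= \<tau>\<close> by simp
  qed
  thus ?thesis unfolding label_chain_def by (intro sum.neutral) (meson if_not_P)
 qed
 {
  case 0
  obtain v where v: "\<tau> = {v}" "v \<in> V" using 0 by (metis One_nat_def card_1_singletonE insert_subset)
  have c0: "singular_chain 0 (?X \<tau>) (chain_map 0 R (frag_of (face_simplex g \<tau>)))"
   using ch[OF 0(1,2), of 0] 0(3) by simp
  hence eq: "(singular_subdivision 0 ^^ n) (chain_map 0 R (frag_of (face_simplex g \<tau>))) = chain_map 0 R (frag_of (face_simplex g \<tau>))"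
   by (induction n) (auto simp: singular_subdivision_zero)
  have "singular_simplex 0 (?X \<tau>) (simplex_map 0 R (face_simplex g \<tau>))"
   using c0 by (simp add: singular_chain_of)
  hence "simplex_map 0 R (face_simplex g \<tau>) (basis_pt 0) \<in> realization V (Pow \<tau>)"
   by (rule singular_simplex_vertex) simp
  hence "argmax V (simplex_map 0 R (face_simplex g \<tau>) (basis_pt 0)) = v"
   using argmax_in_face[OF V] v(1) by blast
  thus ?case unfolding eq by (auto simp: label_chain_of vertex_labels_def v)
 next
  case (Suc p)
  show ?case
  proof (cases "S = \<tau>")
   case False
   thus ?thesis using supp[OF ch[OF Suc.prems(1,2)]] Suc.prems by auto
  next
   case True
   let ?c = "\<lambda>p \<tau>. (singular_subdivision p ^^ n) (chain_map p R (frag_of (face_simplex g \<tau>)))"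
   have fin: "finite \<tau>" "inj_on g \<tau>" using Suc.prems(1) V g by (auto intro: finite_subset inj_on_subset)
   \<comment> \<open>The coefficient at \<open>\<tau>\<close> equals that of the boundary at the
     facet \<open>\<tau> - {v}\<close>: by \<open>supp\<close> no other coface contributes, and by
     induction the boundary coefficient is 1.\<close>
   obtain v where v: "v \<in> \<tau>" using Suc.prems by fastforce
   let ?\<rho> = "\<tau> - {v}"
   have \<rho>: "?\<rho> \<subseteq> V" "card ?\<rho> = Suc p" using Suc.prems v fin by auto
   have Vne: "V ~= {}" using v Suc.prems by auto
   have cm: "singular_chain (Suc p) (?X \<tau>) (chain_map (Suc p) R (frag_of (face_simplex g \<tau>)))"
    using ch[OF Suc.prems(1,2), of 0] Suc.prems(3) by simp
   have comm: "chain_boundary (Suc p) ((singular_subdivision (Suc p) ^^ n) c) =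
     (singular_subdivision p ^^ n) (chain_boundary (Suc p) c)" if "singular_chain (Suc p) (?X \<tau>) c" for c
    using that
   proof (induction n)
    case (Suc n)
    have "singular_chain (Suc p) (?X \<tau>) ((singular_subdivision (Suc p) ^^ n) c)"
     using Suc.prems by (induction n) (auto intro: singular_chain_singular_subdivision)
    thus ?case using chain_boundary_singular_subdivision Suc by fastforce
   qed simp
   have lin: "(singular_subdivision p ^^ n) (sum f A) = (\<Sum>a\<in>A. (singular_subdivision p ^^ n) (f a))"
    for f :: "'a => ('a => real) chain" and A and p
   proof (induction A rule: infinite_finite_induct)
    case (insert x F)
    have add: "(singular_subdivision p ^^ n) (a + b) = (singular_subdivision p ^^ n) a + (singular_subdivision p ^^ n) b"
     for a b :: "('a => real) chain"
     by (induction n) (auto simp: singular_subdivision_add)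
    show ?case using insert by (simp add: add)
   qed auto
   have cmul: "(singular_subdivision p ^^ n) (frag_cmul k a) = frag_cmul k ((singular_subdivision p ^^ n) a)"
    for a :: "('a => real) chain" and k p
    by (induction n) (auto simp: singular_subdivision_def frag_extend_cmul)
   have "chain_boundary (Suc p) (?c (Suc p) \<tau>) = (singular_subdivision p ^^ n) (chain_map p R (chain_boundary (Suc p) (frag_of (face_simplex g \<tau>))))"
    using comm[OF cm] chain_boundary_chain_map[of "Suc p" "?X \<tau>" "frag_of (face_simplex g \<tau>)" R]
     face_simplex_singular[OF V Suc.prems(1) g Suc.prems(2)] by (simp add: singular_chain_of)
   also have "\<dots> = (\<Sum>w\<in>\<tau>. frag_cmul ((-1) ^ rank_in g \<tau> w) (?c p (\<tau> - {w})))"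
    unfolding face_simplex_boundary[OF fin Suc.prems(2)] chain_map_sum[OF fin(1)] lin o_def
     chain_map_cmul cmul ..
   finally have "label_chain p (argmax V) (chain_boundary (Suc p) (?c (Suc p) \<tau>)) ?\<rho> =
     (\<Sum>w\<in>\<tau>. label_chain p (argmax V) (?c p (\<tau> - {w})) ?\<rho>)"
    by (simp add: label_chain_sum label_chain_cmul)
   also have "\<dots> = (\<Sum>w\<in>\<tau>. if w = v then 1 else 0)"
   proof (rule sum.cong[OF refl])
    fix w assume w: "w \<in> \<tau>"
    hence "label_chain p (argmax V) (?c p (\<tau> - {w})) ?\<rho> = (if ?\<rho> = \<tau> - {w} then 1 else 0)"
    proof (intro Suc.IH)
     show "\<tau> - {w} \<subseteq> V" "card (\<tau> - {w}) = Suc p" using Suc.prems(1,2) fin w by auto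
     show "R ` realization V (Pow \<rho>) \<subseteq> realization V (Pow \<rho>)" if "\<rho> \<subseteq> \<tau> - {w}" for \<rho>
      using Suc.prems(3)[of \<rho>] that by (meson Diff_subset subset_trans)
    qed
    thus "label_chain p (argmax V) (?c p (\<tau> - {w})) ?\<rho> = (if w = v then 1 else 0)"
     using w v by auto
   qed
   also have "\<dots> = 1" using v fin by simp
   finally have "bdr V (label_chain (Suc p) (argmax V) (?c (Suc p) \<tau>)) ?\<rho> = 1"
    using label_chain_boundary[OF ch[OF Suc.prems(1,2)] V, where \<phi> = "argmax V" and S = ?\<rho>]
     Suc.prems(3) argmax(1)[OF V Vne] by force
   moreover have "bdr V (label_chain (Suc p) (argmax V) (?c (Suc p) \<tau>)) ?\<rho> =
     (\<Sum>w\<in>V-?\<rho>. if w = v then label_chain (Suc p) (argmax V) (?c (Suc p) \<tau>) \<tau> else 0)"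
    unfolding bdr_def
   proof (rule sum.cong[OF refl])
    fix w assume w: "w \<in> V - ?\<rho>"
    show "label_chain (Suc p) (argmax V) (?c (Suc p) \<tau>) (insert w ?\<rho>) =
      (if w = v then label_chain (Suc p) (argmax V) (?c (Suc p) \<tau>) \<tau> else 0)"
    proof (cases "w = v")
     case True
     thus ?thesis using v by (simp add: insert_absorb)
    next
     case False
     hence "insert w ?\<rho> ~= \<tau>" using v w by auto
     thus ?thesis using supp[OF ch[OF Suc.prems(1,2)], of "insert w ?\<rho>"] Suc.prems False by auto
    qed
   qed
   moreover have "\<dots> = label_chain (Suc p) (argmax V) (?c (Suc p) \<tau>) \<tau>"
    using v Suc.prems V by (subst sum.delta) auto
   ultimately show ?thesis using True by simp
  qed
 }
qed

section \<open>Small singular simplices and their labels\<close>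

abbreviation subdivide :: "nat => nat => 'p chain => 'p chain" where
 "subdivide p n \<equiv> (singular_subdivision p ^^ n)"

lemma subdivide_add: "subdivide p n (a + b) = subdivide p n a + subdivide p n b"
 by (induction n) (auto simp: singular_subdivision_add)

lemma subdivide_cmul: "subdivide p n (frag_cmul k a) = frag_cmul k (subdivide p n a)"
 by (induction n) (auto simp: singular_subdivision_def frag_extend_cmul)

lemma subdivide_sum: "subdivide p n (sum f A) = (\<Sum>a\<in>A. subdivide p n (f a))"
 by (induction A rule: infinite_finite_induct) (auto simp: subdivide_add)

lemma subdivide_chain: "singular_chain p X c ==> singular_chain p X (subdivide p n c)"
 by (induction n) (auto intro: singular_chain_singular_subdivision)

lemma subdivide_boundary:
 "singular_chain (Suc p) X c ==> chain_boundary (Suc p) (subdivide (Suc p) n c) = subdivide p n (chain_boundary (Suc p) c)"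
proof (induction n)
 case (Suc n)
 show ?case
  using chain_boundary_singular_subdivision[OF subdivide_chain[OF Suc.prems], of n] Suc by simp
qed simp

definition down_closed :: "'a set set => bool" where
 "down_closed K \<longleftrightarrow> (\<forall>\<sigma>\<in>K. \<forall>\<tau>. \<tau> \<subseteq> \<sigma> --> \<tau> \<in> K)"

lemma down_closedD: "down_closed K ==> \<sigma> \<in> K ==> \<tau> \<subseteq> \<sigma> ==> \<tau> \<in> K"
 by (auto simp: down_closed_def)

text \<open>The radius is half of \<open>1 / card V\<close>: a largest barycentric coordinate is at
  least \<open>1 / card V\<close>, so it is positive at every other point of the same member of the
  cover.\<close>

definition small_cover :: "'a set => ('a => real) set => ('a => real) set set" where
 "small_cover V X = (\<lambda>z. {y\<in>X. \<forall>v\<in>V. \<bar>y v - z v\<bar> < 1 / (2 * card V)}) ` X"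

lemma small_cover_open:
 assumes "finite V" "U \<in> small_cover V X"
 shows "openin (top_of_set X) U"
proof -
 obtain z where z: "U = {y\<in>X. \<forall>v\<in>V. \<bar>y v - z v\<bar> < 1 / (2 * card V)}"
  using assms by (auto simp: small_cover_def)
 have "open (\<Inter>v\<in>V. {y::'a=>real. \<bar>y v - z v\<bar> < 1 / (2 * card V)})"
  using assms(1) by (intro open_INT ballI open_Collect_less continuous_intros continuous_on_coord)
 moreover have "U = X \<inter> (\<Inter>v\<in>V. {y. \<bar>y v - z v\<bar> < 1 / (2 * card V)})" using z by auto
 ultimately show ?thesis by (auto simp: openin_open)
qed

lemma small_cover_covers:
 assumes "finite V"  "X \<subseteq> realization V K"
 shows "X \<subseteq> \<Union>(small_cover V X)"
proof
 fix x assume x: "x \<in> X"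
 hence "V ~= {}" using argmax_ge(2)[OF assms(1)] assms(2) by blast
 hence "0 < 1 / (2 * real (card V))" using assms(1) by (simp add: card_gt_0_iff)
 thus "x \<in> \<Union>(small_cover V X)" using x by (auto simp: small_cover_def intro!: bexI[of _ x])
qed

text \<open>By the choice of the radius, the label of each vertex is a positive coordinate of the
  image of vertex 0. All labels therefore lie in one support, which is a face of
  \<open>K\<close>.\<close>

lemma small_labels:
 assumes V: "finite V" and f: "singular_simplex p (top_of_set Z) f" and Z: "Z \<subseteq> realization V K"
  and U: "U \<in> small_cover V X" "f \<in> standard_simplex p \<rightarrow> U"
  and K: "down_closed K"
 shows "vertex_labels p (argmax V) f \<in> K"
proof -
 obtain z where z: "U = {y\<in>X. \<forall>v\<in>V. \<bar>y v - z v\<bar> < 1 / (2 * card V)}"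
  using U by (auto simp: small_cover_def)
 let ?y = "f (basis_pt 0)"
 have b: "basis_pt i \<in> standard_simplex p" if "i \<le> p" for i using that by (simp add: basis_pt_def)
 have y: "?y \<in> realization V K" using singular_simplex_vertex[OF f, of 0] Z by auto
 have "argmax V (f (basis_pt i)) \<in> {v. ?y v ~= 0}" if i: "i \<le> p" for i
 proof -
  let ?x = "f (basis_pt i)"
  have x: "?x \<in> realization V K" using singular_simplex_vertex[OF f i] Z by auto
  let ?v = "argmax V ?x"
  have v: "?v \<in> V" by (rule argmax(1)[OF V argmax_ge(2)[OF V x]])
  have 1: "1 / card V \<le> ?x ?v" by (rule argmax_ge(1)[OF V x])
  have "?x \<in> U" "?y \<in> U" using U(2) b[OF i] b[of 0] by auto
  hence "\<bar>?x ?v - z ?v\<bar> < 1 / (2 * card V)" "\<bar>?y ?v - z ?v\<bar> < 1 / (2 * card V)"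
   using z v by auto
  moreover have "1 / (2 * real (card V)) + 1 / (2 * real (card V)) = 1 / card V" by (simp add: field_simps)
  ultimately have "?y ?v > 0" using 1 by linarith
  thus ?thesis by simp
 qed
 hence "vertex_labels p (argmax V) f \<subseteq> {v. ?y v ~= 0}" by (auto simp: vertex_labels_def)
 moreover have "{v. ?y v ~= 0} \<in> K" using y by (simp add: realization_def)
 ultimately show ?thesis using down_closedD[OF K] by blast
qed

lemma small_label_chain:
 assumes V: "finite V" and c: "singular_chain p (top_of_set Z) c" and Z: "Z \<subseteq> realization V K"
  and U: "\<And>f. f \<in> Poly_Mapping.keys c ==> \<exists>U\<in>small_cover V X. f \<in> standard_simplex p \<rightarrow> U"
  and K: "down_closed K"
  and ne: "label_chain p (argmax V) c S ~= 0"
 shows "S \<in> K \<and> card S = Suc p"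
proof (rule ccontr)
 assume a: "\<not> (S \<in> K \<and> card S = Suc p)"
 have "\<not> (vertex_labels p (argmax V) f = S \<and> card S = Suc p)" if f: "f \<in> Poly_Mapping.keys c" for f
 proof -
  have "singular_simplex p (top_of_set Z) f" using c f by (auto simp: singular_chain_def)
  hence "vertex_labels p (argmax V) f \<in> K" using small_labels[OF V _ Z _ _ K] U[OF f] by blast
  thus ?thesis using a by blast
 qed
 hence "label_chain p (argmax V) c S = 0"
  unfolding label_chain_def by (intro sum.neutral) (meson if_not_P)
 thus False using ne by simp
qed

text \<open>Every bit 1 is lifted to the integer 1. The lift respects sums only up to even chains,
  which explains the terms \<open>frag_cmul 2 u\<close> from here on.\<close>

definition lift_chain :: "('a => nat) => ('a set => bit) => ('a => real) chain" where
 "lift_chain g z = (\<Sum>\<tau>\<in>{\<tau>. z \<tau> ~= 0}. frag_of (face_simplex g \<tau>))"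

definition on_level :: "'a set set => nat => ('a set => 'x::zero) => bool" where
 "on_level \<Psi> q c \<longleftrightarrow> (\<forall>\<tau>. c \<tau> ~= 0 --> \<tau> \<in> \<Psi> \<and> card \<tau> = q)"

lemma lift_chain_label:
 assumes V: "finite V" and g: "inj_on g V" and z: "on_level \<Psi> (Suc p) z" "\<Psi> \<subseteq> Pow V"
  and R: "continuous_on (realization V (Pow V)) R" "\<And>\<rho>. \<rho> \<subseteq> V ==> R ` realization V (Pow \<rho>) \<subseteq> realization V (Pow \<rho>)"
 shows "label_chain p (argmax V) (subdivide p n (chain_map p R (lift_chain g z))) S = z S"
proof -
 let ?A = "{\<tau>. z \<tau> ~= 0}"
 have A: "\<tau> \<subseteq> V" "card \<tau> = Suc p" if "\<tau> \<in> ?A" for \<tau> using z that by (auto simp: on_level_def)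
 hence fin: "finite ?A" using finite_subset[of ?A "Pow V"] V by auto
 have "label_chain p (argmax V) (subdivide p n (chain_map p R (lift_chain g z))) S =
  (\<Sum>\<tau>\<in>?A. label_chain p (argmax V) (subdivide p n (chain_map p R (frag_of (face_simplex g \<tau>)))) S)"
  unfolding lift_chain_def chain_map_sum[OF fin] subdivide_sum label_chain_sum o_def ..
 also have "\<dots> = (\<Sum>\<tau>\<in>?A. if S = \<tau> then 1 else 0)"
  using sperner[OF V g A R(1)] R(2) A(1) by (intro sum.cong refl) (meson subset_trans)
 also have "\<dots> = z S" using fin by (cases "z S") auto
 finally show ?thesis .
qed

text \<open>A face-preserving map \<open>R\<close> pushes the part \<open>e\<close> of the relative
  boundary into the realization of \<open>L\<close>. After enough subdivision all label sets that
  count are faces, those of \<open>e\<close> are faces of \<open>L\<close>, the even part vanishes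
  modulo 2, and Sperner's lemma recovers \<open>z\<close>; so the labels of the bounding chain fill
  \<open>z\<close> off \<open>L\<close>.\<close>

theorem relboundary_imp_boundary:
 assumes V: "finite V" and g: "inj_on g V"
  and K: "K \<subseteq> Pow V" "down_closed K"
  and L: "L \<subseteq> K" "down_closed L"
  and S: "S \<subseteq> realization V K"
  and push: "\<And>C. compact C ==> C \<subseteq> S ==> \<exists>R. continuous_on (realization V (Pow V)) R \<and>
     (\<forall>\<tau>. \<tau> \<subseteq> V --> R ` realization V (Pow \<tau>) \<subseteq> realization V (Pow \<tau>)) \<and> R ` C \<subseteq> realization V L"
  and z: "on_level (K - L) (Suc p) z"
  and rb: "singular_relboundary p (top_of_set (realization V K)) S (lift_chain g z + frag_cmul 2 u)"
 shows "\<exists>b. on_level (K - L) (Suc (Suc p)) b \<and> (\<forall>\<rho>\<in>K-L. card \<rho> = Suc p --> bdr V b \<rho> = z \<rho>)"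
proof -
 let ?X = "top_of_set (realization V K)"
 let ?\<zeta> = "lift_chain g z + frag_cmul 2 u"
 obtain d e where d: "singular_chain (Suc p) ?X d" and e: "singular_chain p (subtopology ?X S) e"
  and de: "chain_boundary (Suc p) d + e = ?\<zeta>"
  using rb by (auto simp: singular_relboundary)
 \<comment> \<open>The carrier of \<open>e\<close>. It is compact, which is all that
   \<open>push\<close> can handle.\<close>
 let ?C = "\<Union>f\<in>Poly_Mapping.keys e. f ` standard_simplex p"
 have e1: "singular_chain p ?X e" "\<And>f. f \<in> Poly_Mapping.keys e ==> f ` standard_simplex p \<subseteq> S"
  using e by (auto simp: singular_chain_subtopology)
 have comp: "compact (standard_simplex p)"
  using compactin_standard_simplex[of p] by (simp add: euclidean_product_topology)
 have "compact ?C"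
 proof (rule compact_UN)
  fix f assume f: "f \<in> Poly_Mapping.keys e"
  hence "continuous_on (standard_simplex p) f"
   using e1(1) unfolding singular_chain_def singular_simplex_def powertop_real_eq by auto
  thus "compact (f ` standard_simplex p)" by (rule compact_continuous_image[OF _ comp])
 qed simp
 moreover have "?C \<subseteq> S" using e1(2) by blast
 ultimately obtain R where R: "continuous_on (realization V (Pow V)) R"
   "\<And>\<tau>. \<tau> \<subseteq> V ==> R ` realization V (Pow \<tau>) \<subseteq> realization V (Pow \<tau>)" "R ` ?C \<subseteq> realization V L"
  using push by metis
 have subK: "realization V K \<subseteq> realization V (Pow V)" using K(1) by (rule realization_mono)
 have RK: "R ` realization V K \<subseteq> realization V K"
 proof (rule image_subsetI)
  fix x assume x: "x \<in> realization V K"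
  hence sx: "{v. x v ~= 0} \<in> K" by (simp add: realization_def)
  have "x \<in> realization V (Pow {v. x v ~= 0})" using x by (simp add: realization_def)
  hence "R x \<in> realization V (Pow {v. x v ~= 0})" using R(2)[of "{v. x v ~= 0}"] sx K(1) by blast
  thus "R x \<in> realization V K" using down_closedD[OF K(2) sx] by (simp add: realization_def)
 qed
 have Rcont: "continuous_map ?X ?X R"
  using continuous_on_subset[OF R(1) subK] RK by auto
 let ?Rd = "chain_map (Suc p) R d" and ?Re = "chain_map p R e"
 have Rd: "singular_chain (Suc p) ?X ?Rd" using singular_chain_chain_map[OF d Rcont] .
 have Re: "singular_chain p ?X ?Re" using singular_chain_chain_map[OF e1(1) Rcont] .
 have CX: "?C \<subseteq> realization V K" using \<open>?C \<subseteq> S\<close> S by blast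
 have "singular_chain p (top_of_set ?C) e"
 proof -
  have "singular_chain p (subtopology ?X ?C) e"
   using e1(1) singular_chain_subtopology[of p ?X ?C e] by blast
  thus ?thesis using CX by (simp add: subtopology_subtopology inf.absorb2)
 qed
 moreover have "continuous_map (top_of_set ?C) (top_of_set (realization V L)) R"
  using continuous_on_subset[OF R(1)] CX subK R(3) by (metis continuous_map_subtopology_eu dual_order.trans image_subset_iff_funcset)
 ultimately have ReL: "singular_chain p (top_of_set (realization V L)) ?Re"
  by (rule singular_chain_chain_map)
 let ?\<C> = "small_cover V (realization V K)"
 have cov: "topspace ?X \<subseteq> \<Union>?\<C>" using small_cover_covers[OF V, of "realization V K" K] by simp
 obtain n1 where n1: "\<And>m f. n1 \<le> m ==> f \<in> Poly_Mapping.keys (subdivide (Suc p) m ?Rd) ==> \<exists>U\<in>?\<C>. f \<in> standard_simplex (Suc p) \<rightarrow> U"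
  using sufficient_iterated_singular_subdivision_exists[OF small_cover_open[OF V] cov Rd] by metis
 obtain n2 where n2: "\<And>m f. n2 \<le> m ==> f \<in> Poly_Mapping.keys (subdivide p m ?Re) ==> \<exists>U\<in>?\<C>. f \<in> standard_simplex p \<rightarrow> U"
  using sufficient_iterated_singular_subdivision_exists[OF small_cover_open[OF V] cov Re] by metis
 define n where "n = max n1 n2"
 define D where "D = label_chain (Suc p) (argmax V) (subdivide (Suc p) n ?Rd)"
 have DK: "S \<in> K \<and> card S = Suc (Suc p)" if "D S ~= 0" for S
  using small_label_chain[OF V subdivide_chain[OF Rd] order_refl _ K(2)] n1[of n] that
  by (auto simp: D_def n_def)
 have EL: "S \<in> L" if "label_chain p (argmax V) (subdivide p n ?Re) S ~= 0" for S
  using small_label_chain[OF V subdivide_chain[OF ReL] order_refl _ L(2), where X = "realization V K"] n2[of n] that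
  by (auto simp: n_def)
 \<comment> \<open>Faces of \<open>L\<close> are dropped; since \<open>L\<close> is closed under
   subsets, they contain no face \<open>\<rho>\<close> outside \<open>L\<close>, so the boundary
   there is unchanged.\<close>
 define b where "b = (\<lambda>\<tau>. if \<tau> \<in> K - L then D \<tau> else 0)"
 have "on_level (K - L) (Suc (Suc p)) b" using DK by (auto simp: on_level_def b_def)
 moreover have "bdr V b \<rho> = z \<rho>" if \<rho>: "\<rho> \<in> K - L" "card \<rho> = Suc p" for \<rho>
 proof -
  have "b (insert v \<rho>) = D (insert v \<rho>)" for v
   using DK[of "insert v \<rho>"] down_closedD[OF L(2), of "insert v \<rho>" \<rho>] \<rho> by (auto simp: b_def)
  hence "bdr V b \<rho> = bdr V D \<rho>" by (simp add: bdr_def)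
  also have "\<dots> = label_chain p (argmax V) (chain_boundary (Suc p) (subdivide (Suc p) n ?Rd)) \<rho>"
  proof -
   have "argmax V ` topspace ?X \<subseteq> V"
    using argmax(1)[OF V argmax_ge(2)[OF V]] by auto
   thus ?thesis unfolding D_def
    by (rule label_chain_boundary[OF subdivide_chain[OF Rd] V, symmetric])
  qed
  also have "chain_boundary (Suc p) (subdivide (Suc p) n ?Rd) = subdivide p n (chain_map p R (chain_boundary (Suc p) d))"
   using subdivide_boundary[OF Rd] chain_boundary_chain_map[OF d, of R] by simp
  also have "chain_boundary (Suc p) d = lift_chain g z + (frag_cmul 2 u + frag_cmul (-1) e)"
   using de by (simp add: algebra_simps frag_cmul_minus_one)
  also have "label_chain p (argmax V) (subdivide p n (chain_map p R \<dots>)) \<rho> =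
    label_chain p (argmax V) (subdivide p n (chain_map p R (lift_chain g z))) \<rho>
    + label_chain p (argmax V) (subdivide p n ?Re) \<rho>"
   unfolding chain_map_add subdivide_add label_chain_add chain_map_cmul subdivide_cmul label_chain_cmul by simp
  also have "\<dots> = z \<rho>"
  proof -
   have "K - L \<subseteq> Pow V" using K(1) by blast
   from lift_chain_label[OF V g z this R(1,2), of n \<rho>]
   have "label_chain p (argmax V) (subdivide p n (chain_map p R (lift_chain g z))) \<rho> = z \<rho>" .
   moreover have "label_chain p (argmax V) (subdivide p n ?Re) \<rho> = 0"
    using EL[of \<rho>] \<rho>(1) by blast
   ultimately show ?thesis by simp
  qed
  finally show ?thesis .
 qed
 ultimately show ?thesis by blast
qed

section \<open>Exactness modulo 2 from relative singular homology\<close>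

lemma singular_chain_face_simplex:
 assumes "finite V" "inj_on g V" "\<rho> \<subseteq> V" "card \<rho> = Suc q" "realization V (Pow \<rho>) \<subseteq> S"
 shows "singular_chain q (top_of_set S) (frag_of (face_simplex g \<rho>))"
proof -
 have "singular_chain q (top_of_set (realization V (Pow \<rho>))) (frag_of (face_simplex g \<rho>))"
  using face_simplex_singular[OF assms(1,3,2,4)] by (simp add: singular_chain_of)
 thus ?thesis using assms(5) by (rule singular_chain_mono)
qed

text \<open>\<open>j\<close> counts vertices, so this is vanishing homology in degree
  \<open>j - 1\<close> of the chain complex on \<open>\<Psi>\<close>; it is reduced homology when
  the empty face belongs to \<open>\<Psi>\<close>.\<close>

definition bit_exact :: "'a set => 'a set set => nat => bool" where
 "bit_exact V \<Psi> j \<longleftrightarrow> (\<forall>c :: 'a set => bit. on_level \<Psi> j c \<and> (\<forall>\<rho>\<in>\<Psi>. Suc (card \<rho>) = j --> bdr V c \<rho> = 0) -->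
   (\<exists>b. on_level \<Psi> (Suc j) b \<and> (\<forall>\<rho>\<in>\<Psi>. card \<rho> = j --> bdr V b \<rho> = c \<rho>)))"

definition trivial_homology_at :: "nat => 'p topology => 'p set => bool" where
 "trivial_homology_at p X S \<longleftrightarrow> (\<forall>c. singular_relcycle p X S c --> singular_relboundary p X S c)"

text \<open>The trace of cyclicity that survives reduction modulo 2: with an odd coefficient
  available, one of \<open>c1\<close>, \<open>c2\<close> and their sum bounds up to an even
  chain.\<close>

definition cyclic_homology_at :: "nat => 'p topology => 'p set => bool" where
 "cyclic_homology_at p X S \<longleftrightarrow> (\<forall>c1 c2. singular_relcycle p X S c1 \<and> singular_relcycle p X S c2 -->
   (\<exists>a b. (odd a \<or> odd b) \<and> singular_relboundary p X S (frag_cmul a c1 + frag_cmul b c2)))"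

text \<open>The pair \<open>K\<close>, \<open>L\<close> models the space
  \<open>realization V K\<close> relative to \<open>S\<close>. No deformation retraction of
  \<open>S\<close> is required, only a map for each compact subset: a radial push away from a
  removed point has no continuous extension to that point.\<close>

locale pushable_pair =
 fixes V :: "'a set" and g :: "'a => nat" and K L :: "'a set set" and S :: "('a => real) set"
 assumes V: "finite V" and g: "inj_on g V"
  and K: "K \<subseteq> Pow V" "down_closed K"
  and L: "L \<subseteq> K" "down_closed L"
  and S: "realization V L \<subseteq> S" "S \<subseteq> realization V K"
  and push: "\<And>C. compact C ==> C \<subseteq> S ==> \<exists>R. continuous_on (realization V (Pow V)) R \<and>
     (\<forall>\<tau>. \<tau> \<subseteq> V --> R ` realization V (Pow \<tau>) \<subseteq> realization V (Pow \<tau>)) \<and> R ` C \<subseteq> realization V L"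
begin

abbreviation "X \<equiv> top_of_set (realization V K)"

lemma boundary_of_relboundary:
 assumes "on_level (K - L) (Suc p) z" "singular_relboundary p X S (lift_chain g z + frag_cmul 2 u)"
 shows "\<exists>b. on_level (K - L) (Suc (Suc p)) b \<and> (\<forall>\<rho>\<in>K-L. card \<rho> = Suc p --> bdr V b \<rho> = z \<rho>)"
 by (rule relboundary_imp_boundary[OF V g K L S(2) push assms])

definition is_cycle :: "nat => ('a set => bit) => bool" where
 "is_cycle j z \<longleftrightarrow> on_level (K - L) j z \<and> (\<forall>\<rho>\<in>K - L. Suc (card \<rho>) = j --> bdr V z \<rho> = 0)"

lemma lift_chain_singular:
 assumes "on_level (K - L) (Suc p) z"
 shows "singular_chain p X (lift_chain g z)"
 unfolding lift_chain_def
proof (rule singular_chain_sum)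
 fix \<tau> assume "\<tau> \<in> {\<tau>. z \<tau> ~= 0}"
 hence "\<tau> \<in> K" "card \<tau> = Suc p" using assms by (auto simp: on_level_def)
 moreover have "realization V (Pow \<tau>) \<subseteq> realization V K"
  using down_closedD[OF K(2) \<open>\<tau> \<in> K\<close>] by (intro realization_mono) blast
 ultimately show "singular_chain p X (frag_of (face_simplex g \<tau>))"
  using singular_chain_face_simplex[OF V g] K(1) by blast
qed

text \<open>Off \<open>L\<close> the integral coefficients reduce to \<open>bdr V z\<close>, which
  vanishes, so they are even and can be halved to give \<open>w\<close>. The last clause records
  that nothing remains to be halved when there are no faces of that size.\<close>

lemma lift_chain_boundary:
 assumes z: "is_cycle (Suc (Suc q)) z"
 shows "\<exists>w l. chain_boundary (Suc q) (lift_chain g z) = frag_cmul 2 w + l \<and> singular_chain q X w \<and>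
   singular_chain q (subtopology X S) l \<and> ((\<forall>\<rho>\<in>K-L. card \<rho> ~= Suc q) --> w = 0)"
proof -
 let ?A = "{\<tau>. z \<tau> ~= 0}"
 define B where "B = {\<rho>\<in>K. card \<rho> = Suc q}"
 define n where "n = (\<lambda>\<rho>. \<Sum>v\<in>V-\<rho>. if insert v \<rho> \<in> ?A then (-1) ^ rank_in g (insert v \<rho>) v else (0::int))"
 have A: "\<tau> \<in> K" "\<tau> \<subseteq> V" "card \<tau> = Suc (Suc q)" "finite \<tau>" "inj_on g \<tau>" if "\<tau> \<in> ?A" for \<tau>
 proof -
  show *: "\<tau> \<in> K" "card \<tau> = Suc (Suc q)" using z that by (auto simp: on_level_def is_cycle_def)
  thus "\<tau> \<subseteq> V" using K by blast
  thus "finite \<tau>" "inj_on g \<tau>" using V g by (auto intro: finite_subset inj_on_subset)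
 qed
 have finK: "finite K" using K(1) V by (meson finite_Pow_iff finite_subset)
 have finA: "finite ?A" using A(1) finK by (meson finite_subset subsetI)
 have finB: "finite B" using finK by (simp add: B_def)
 have "chain_boundary (Suc q) (lift_chain g z) =
   (\<Sum>\<tau>\<in>?A. \<Sum>v\<in>\<tau>. frag_cmul ((-1) ^ rank_in g \<tau> v) (frag_of (face_simplex g (\<tau> - {v}))))"
  unfolding lift_chain_def chain_boundary_sum o_def
 proof (rule sum.cong[OF refl])
  fix \<tau> assume *: "\<tau> \<in> ?A"
  show "chain_boundary (Suc q) (frag_of (face_simplex g \<tau>)) =
    (\<Sum>v\<in>\<tau>. frag_cmul ((-1) ^ rank_in g \<tau> v) (frag_of (face_simplex g (\<tau> - {v}))))"
   by (rule face_simplex_boundary[OF A(4)[OF *] A(5)[OF *] A(3)[OF *]])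
 qed
 also have "\<dots> = (\<Sum>(\<tau>,v)\<in>Sigma ?A (\<lambda>\<tau>. \<tau>). frag_cmul ((-1) ^ rank_in g \<tau> v) (frag_of (face_simplex g (\<tau> - {v}))))"
  using finA A(4) by (subst sum.Sigma) auto
 \<comment> \<open>Incident pairs of a face and a vertex are regrouped by the facet that is left,
   whose total signed multiplicity is \<open>n\<close>.\<close>
 also have "\<dots> = (\<Sum>(\<rho>,v)\<in>Sigma B (\<lambda>\<rho>. {v\<in>V-\<rho>. insert v \<rho> \<in> ?A}).
    frag_cmul ((-1) ^ rank_in g (insert v \<rho>) v) (frag_of (face_simplex g \<rho>)))"
 proof (rule sum.reindex_bij_witness[where j = "\<lambda>(\<tau>,v). (\<tau> - {v}, v)" and i = "\<lambda>(\<rho>,v). (insert v \<rho>, v)"], goal_cases)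
  case (3 a)
  thus ?case by auto
 next
  case (2 a)
  then obtain \<tau> v where a: "a = (\<tau>, v)" "\<tau> \<in> ?A" "v \<in> \<tau>" by auto
  hence "\<tau> - {v} \<in> B" using A[OF a(2)] down_closedD[OF K(2), of \<tau> "\<tau> - {v}"] by (auto simp: B_def)
  moreover have "v \<in> V" "insert v (\<tau> - {v}) = \<tau>" using a A(2)[OF a(2)] by auto
  ultimately show ?case using a by auto
 qed (auto simp: insert_absorb)
 also have "\<dots> = (\<Sum>\<rho>\<in>B. \<Sum>v\<in>{v\<in>V-\<rho>. insert v \<rho> \<in> ?A}. frag_cmul ((-1) ^ rank_in g (insert v \<rho>) v) (frag_of (face_simplex g \<rho>)))"
  using finB V by (subst sum.Sigma) auto
 also have "\<dots> = (\<Sum>\<rho>\<in>B. frag_cmul (n \<rho>) (frag_of (face_simplex g \<rho>)))"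
 proof (rule sum.cong[OF refl])
  fix \<rho>
  have "(\<Sum>v\<in>W. frag_cmul (h v) x) = frag_cmul (sum h W) x" if "finite W" for h :: "'a => int" and W and x :: "('a => real) chain"
   using that by (induction W rule: finite_induct) (auto simp: frag_cmul_distrib)
  moreover have "n \<rho> = (\<Sum>v\<in>{v\<in>V-\<rho>. insert v \<rho> \<in> ?A}. (-1) ^ rank_in g (insert v \<rho>) v)"
   unfolding n_def using V by (intro sum.mono_neutral_cong_right) auto
  ultimately show "(\<Sum>v\<in>{v\<in>V-\<rho>. insert v \<rho> \<in> ?A}. frag_cmul ((-1) ^ rank_in g (insert v \<rho>) v) (frag_of (face_simplex g \<rho>)))
    = frag_cmul (n \<rho>) (frag_of (face_simplex g \<rho>))" using V by simp
 qed
 also have "\<dots> = (\<Sum>\<rho>\<in>B - L. frag_cmul (n \<rho>) (frag_of (face_simplex g \<rho>))) + (\<Sum>\<rho>\<in>B \<inter> L. frag_cmul (n \<rho>) (frag_of (face_simplex g \<rho>)))"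
  unfolding sum.Int_Diff[OF finB, of _ L] by (rule add.commute)
 finally have bd: "chain_boundary (Suc q) (lift_chain g z) =
   (\<Sum>\<rho>\<in>B - L. frag_cmul (n \<rho>) (frag_of (face_simplex g \<rho>))) + (\<Sum>\<rho>\<in>B \<inter> L. frag_cmul (n \<rho>) (frag_of (face_simplex g \<rho>)))" .
 have even: "even (n \<rho>)" if \<rho>: "\<rho> \<in> B - L" for \<rho>
 proof -
  have "of_int (n \<rho>) = bdr V z \<rho>"
   unfolding n_def bdr_def of_int_sum
  proof (rule sum.cong[OF refl])
   fix v
   show "(of_int (if insert v \<rho> \<in> ?A then (-1) ^ rank_in g (insert v \<rho>) v else 0) :: bit) = z (insert v \<rho>)"
    by (cases "z (insert v \<rho>)") auto
  qed
  also have "\<dots> = 0" using z \<rho> by (auto simp: is_cycle_def B_def)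
  finally show ?thesis by (simp add: bit_of_int_eq_0_iff)
 qed
 have sing: "singular_chain q (top_of_set T) (frag_of (face_simplex g \<rho>))" if "\<rho> \<in> B" "realization V (Pow \<rho>) \<subseteq> T" for \<rho> T
  using singular_chain_face_simplex[OF V g _ _ that(2)] that(1) K by (auto simp: B_def)
 define w where "w = (\<Sum>\<rho>\<in>B - L. frag_cmul (n \<rho> div 2) (frag_of (face_simplex g \<rho>)))"
 define l where "l = (\<Sum>\<rho>\<in>B \<inter> L. frag_cmul (n \<rho>) (frag_of (face_simplex g \<rho>)))"
 have "frag_cmul 2 w = (\<Sum>\<rho>\<in>B - L. frag_cmul (n \<rho>) (frag_of (face_simplex g \<rho>)))"
 proof -
  have "frag_cmul 2 (sum h W) = (\<Sum>x\<in>W. frag_cmul 2 (h x))" if "finite W" for h :: "'a set => ('a => real) chain" and W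
   using that by (induction W rule: finite_induct) (auto simp: frag_cmul_distrib2)
  thus ?thesis unfolding w_def using finB even by (auto intro!: sum.cong)
 qed
 moreover have "singular_chain q X w"
  unfolding w_def
 proof (intro singular_chain_sum singular_chain_cmul)
  fix \<rho> assume \<rho>: "\<rho> \<in> B - L"
  hence "realization V (Pow \<rho>) \<subseteq> realization V K"
   using down_closedD[OF K(2)] by (intro realization_mono) (auto simp: B_def)
  thus "singular_chain q X (frag_of (face_simplex g \<rho>))" using sing \<rho> by blast
 qed
 moreover have "singular_chain q (subtopology X S) l"
 proof -
  have "subtopology X S = top_of_set S" using S by (simp add: subtopology_subtopology inf.absorb2)
  moreover have "singular_chain q (top_of_set S) l"
   unfolding l_def
  proof (intro singular_chain_sum singular_chain_cmul)
   fix \<rho> assume \<rho>: "\<rho> \<in> B \<inter> L"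
   hence "realization V (Pow \<rho>) \<subseteq> realization V L"
    using down_closedD[OF L(2)] by (intro realization_mono) auto
   thus "singular_chain q (top_of_set S) (frag_of (face_simplex g \<rho>))" using sing[of \<rho> S] \<rho> S(1) by blast
  qed
  ultimately show ?thesis by simp
 qed
 moreover have "w = 0" if "\<forall>\<rho>\<in>K-L. card \<rho> ~= Suc q"
 proof -
  have "B - L = {}" using that by (auto simp: B_def)
  thus ?thesis by (simp only: w_def) simp
 qed
 ultimately show ?thesis using bd[folded l_def]
  by (intro exI[of _ w] exI[of _ l] conjI impI) (simp_all only:)
qed

text \<open>Either alternative lets the chain \<open>w\<close> of \<open>lift_chain_boundary\<close>
  be removed: it bounds relatively, or it is zero.\<close>

definition low_trivial :: "nat => bool" where
 "low_trivial p \<longleftrightarrow> (\<forall>q. p = Suc q --> trivial_homology_at q X S \<or> (\<forall>\<rho>\<in>K-L. card \<rho> ~= p))"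

text \<open>The boundary of the lift is \<open>2 w\<close> plus a chain in \<open>S\<close>. Twice
  the boundary of \<open>w\<close> then lies in \<open>S\<close>, so \<open>w\<close> is a relative
  cycle; if it bounds \<open>u\<close>, subtracting \<open>2 u\<close> repairs the lift.\<close>

lemma cycle_lift:
 assumes z: "is_cycle (Suc p) z" and low: "low_trivial p"
 shows "\<exists>u. singular_relcycle p X S (lift_chain g z + frag_cmul 2 u)"
proof (cases p)
 case 0
 have "singular_relcycle 0 X S (lift_chain g z)"
  using lift_chain_singular[of 0 z] z 0
  by (simp add: singular_relcycle is_cycle_def chain_boundary_def)
 thus ?thesis using 0 by (intro exI[of _ 0]) simp
next
 case (Suc q)
 obtain w l where wl: "chain_boundary (Suc q) (lift_chain g z) = frag_cmul 2 w + l" "singular_chain q X w"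
   "singular_chain q (subtopology X S) l" "(\<forall>\<rho>\<in>K-L. card \<rho> ~= Suc q) --> w = 0"
  using lift_chain_boundary z Suc by metis
 have lz: "singular_chain (Suc q) X (lift_chain g z)"
  using lift_chain_singular z Suc by (simp add: is_cycle_def)
 have "singular_relboundary q X S w"
 proof (cases "\<forall>\<rho>\<in>K-L. card \<rho> ~= Suc q")
  case True
  thus ?thesis using wl(4) by simp
 next
  case False
  hence triv: "trivial_homology_at q X S" using low Suc by (auto simp: low_trivial_def)
  \<comment> \<open>Doubling a chain does not change its set of simplices, so one may divide by
    2.\<close>
  have "singular_chain (q - 1) (subtopology X S) (chain_boundary q w)"
  proof -
   have "chain_boundary q (chain_boundary (Suc q) (lift_chain g z)) = 0"
    using chain_boundary_boundary[OF lz] by simp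
   hence "frag_cmul 2 (chain_boundary q w) + chain_boundary q l = 0"
    using wl(1) by (simp add: chain_boundary_add chain_boundary_cmul)
   hence "frag_cmul 2 (chain_boundary q w) = - chain_boundary q l" by (simp add: eq_neg_iff_add_eq_0)
   moreover have "singular_chain (q - 1) (subtopology X S) (- chain_boundary q l)"
    using singular_chain_boundary[OF wl(3)] by (simp add: singular_chain_minus)
   ultimately have "singular_chain (q - 1) (subtopology X S) (frag_cmul 2 (chain_boundary q w))" by simp
   moreover have "Poly_Mapping.keys (frag_cmul 2 (chain_boundary q w)) = Poly_Mapping.keys (chain_boundary q w)"
    by (auto simp: in_keys_iff)
   ultimately show ?thesis by (simp add: singular_chain_def)
  qed
  hence "singular_relcycle q X S w" using wl(2) by (simp add: singular_relcycle)
  thus ?thesis using triv by (simp add: trivial_homology_at_def)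
 qed
 then obtain u l' where u: "singular_chain (Suc q) X u" "singular_chain q (subtopology X S) l'"
   "chain_boundary (Suc q) u + l' = w"
  by (auto simp: singular_relboundary)
 have neg: "frag_cmul 2 x + frag_cmul 2 (- x) = 0" for x :: "('a => real) chain"
  by (simp flip: frag_cmul_distrib2)
 have "chain_boundary (Suc q) (lift_chain g z + frag_cmul 2 (-u)) = l + frag_cmul 2 l'"
  using wl(1) u(3)[symmetric] neg
  by (simp add: chain_boundary_add chain_boundary_cmul chain_boundary_minus frag_cmul_distrib2)
 hence "singular_relcycle (Suc q) X S (lift_chain g z + frag_cmul 2 (-u))"
  using u wl(3) lz unfolding singular_relcycle
  by (simp add: singular_chain_add singular_chain_cmul singular_chain_minus)
 thus ?thesis using Suc by blast
qed

theorem exact_from_topology: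
 assumes low: "low_trivial p" and triv: "trivial_homology_at p X S"
 shows "bit_exact V (K - L) (Suc p)"
 unfolding bit_exact_def
proof (intro allI impI)
 fix c :: "'a set => bit"
 assume "on_level (K - L) (Suc p) c \<and> (\<forall>\<rho>\<in>K - L. Suc (card \<rho>) = Suc p --> bdr V c \<rho> = 0)"
 hence c: "is_cycle (Suc p) c" by (simp add: is_cycle_def)
 obtain u where "singular_relcycle p X S (lift_chain g c + frag_cmul 2 u)" using cycle_lift[OF c low] by blast
 hence "singular_relboundary p X S (lift_chain g c + frag_cmul 2 u)" using triv by (simp add: trivial_homology_at_def)
 thus "\<exists>b. on_level (K - L) (Suc (Suc p)) b \<and> (\<forall>\<rho>\<in>K - L. card \<rho> = Suc p --> bdr V b \<rho> = c \<rho>)"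
  using boundary_of_relboundary[of p c u] c by (simp add: is_cycle_def)
qed

text \<open>A common simplex of the two lifts is counted twice in their sum and not at all in the
  lift of the sum.\<close>

lemma lift_chain_add:
 assumes "on_level (K - L) q z1" "on_level (K - L) q z2"
 shows "\<exists>u. lift_chain g z1 + lift_chain g z2 = lift_chain g (\<lambda>\<tau>. z1 \<tau> + z2 \<tau>) + frag_cmul 2 u"
proof -
 let ?A = "{\<tau>. z1 \<tau> ~= 0}" and ?B = "{\<tau>. z2 \<tau> ~= 0}" and ?f = "\<lambda>\<tau>. frag_of (face_simplex g \<tau>)"
 have "finite K" using K(1) V by (meson finite_Pow_iff finite_subset)
 hence fin: "finite ?A" "finite ?B" using assms by (auto simp: on_level_def intro: finite_subset[of _ K])
 have *: "x + y ~= 0 \<longleftrightarrow> (x ~= 0) ~= (y ~= 0)" for x y :: bit by (cases x; cases y) auto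
 have "{\<tau>. z1 \<tau> + z2 \<tau> ~= 0} = (?A - ?B) \<union> (?B - ?A)" using * by auto
 hence "lift_chain g (\<lambda>\<tau>. z1 \<tau> + z2 \<tau>) = sum ?f (?A - ?B) + sum ?f (?B - ?A)"
  using fin by (simp add: lift_chain_def sum.union_disjoint Diff_disjoint Int_commute disjoint_iff)
 moreover have "lift_chain g z1 = sum ?f (?A \<inter> ?B) + sum ?f (?A - ?B)" "lift_chain g z2 = sum ?f (?A \<inter> ?B) + sum ?f (?B - ?A)"
  using fin sum.Int_Diff[of ?A ?f ?B] sum.Int_Diff[of ?B ?f ?A] by (auto simp: lift_chain_def Int_commute)
 moreover have "frag_cmul 2 x = x + x" for x :: "('a => real) chain"
  using frag_cmul_distrib[of 1 1 x] by simp
 ultimately show ?thesis by (intro exI[of _ "sum ?f (?A \<inter> ?B)"]) (simp add: algebra_simps)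
qed

text \<open>The parities of \<open>a\<close> and \<open>b\<close> select the member of the list that
  bounds, so modulo 2 there is at most one nonzero homology class.\<close>

theorem cyclic_from_topology:
 assumes low: "low_trivial p" and cyc: "cyclic_homology_at p X S"
  and z: "is_cycle (Suc p) z1" "is_cycle (Suc p) z2"
 shows "\<exists>z\<in>{z1, z2, \<lambda>\<tau>. z1 \<tau> + z2 \<tau>}. \<exists>b. on_level (K - L) (Suc (Suc p)) b \<and> (\<forall>\<rho>\<in>K-L. card \<rho> = Suc p --> bdr V b \<rho> = z \<rho>)"
proof -
 obtain u1 where u1: "singular_relcycle p X S (lift_chain g z1 + frag_cmul 2 u1)" using cycle_lift[OF z(1) low] by blast
 obtain u2 where u2: "singular_relcycle p X S (lift_chain g z2 + frag_cmul 2 u2)" using cycle_lift[OF z(2) low] by blast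
 obtain a b where ab: "odd a \<or> odd b" and rb: "singular_relboundary p X S (frag_cmul a (lift_chain g z1 + frag_cmul 2 u1) + frag_cmul b (lift_chain g z2 + frag_cmul 2 u2))"
  using cyc u1 u2 unfolding cyclic_homology_at_def by blast
 have lev: "on_level (K - L) (Suc p) z1" "on_level (K - L) (Suc p) z2" using z by (auto simp: is_cycle_def)
 have lev3: "on_level (K - L) (Suc p) (\<lambda>\<tau>. z1 \<tau> + z2 \<tau>)" using lev unfolding on_level_def by (metis add_0)
 obtain u3 where u3: "lift_chain g z1 + lift_chain g z2 = lift_chain g (\<lambda>\<tau>. z1 \<tau> + z2 \<tau>) + frag_cmul 2 u3"
  using lift_chain_add[OF lev] by blast
 have ev: "frag_cmul (2 * k) x = frag_cmul 2 (frag_cmul k x)" "frag_cmul (2 * k + 1) x = x + frag_cmul 2 (frag_cmul k x)" for k and x :: "('a => real) chain"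
  by (simp_all add: frag_cmul_distrib algebra_simps)
 have dist: "frag_cmul k (x + y) = frag_cmul k x + frag_cmul k y" "frag_cmul k (frag_cmul 2 x) = frag_cmul 2 (frag_cmul k x)" for k and x y :: "('a => real) chain"
  by (simp_all add: frag_cmul_distrib2 mult.commute)
 have "\<exists>z\<in>{z1, z2, \<lambda>\<tau>. z1 \<tau> + z2 \<tau>}. on_level (K - L) (Suc p) z \<and> (\<exists>u. singular_relboundary p X S (lift_chain g z + frag_cmul 2 u))"
 proof -
  define U where "U = frag_cmul a u1 + frag_cmul b u2"
  have eq: "frag_cmul a (lift_chain g z1 + frag_cmul 2 u1) + frag_cmul b (lift_chain g z2 + frag_cmul 2 u2)
    = frag_cmul a (lift_chain g z1) + frag_cmul b (lift_chain g z2) + frag_cmul 2 U"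
   unfolding U_def dist by (simp add: algebra_simps)
  consider "odd a" "even b" | "even a" "odd b" | "odd a" "odd b" using ab by blast
  thus ?thesis
  proof cases
   case 1
   then obtain k l where "a = 2 * k + 1" "b = 2 * l" by (auto elim!: oddE evenE)
   hence "singular_relboundary p X S (lift_chain g z1 + frag_cmul 2 (frag_cmul k (lift_chain g z1) + frag_cmul l (lift_chain g z2) + U))"
    using rb unfolding eq by (simp only: ev dist) (simp only: add.assoc)
   thus ?thesis using lev by blast
  next
   case 2
   then obtain k l where "b = 2 * k + 1" "a = 2 * l" by (auto elim!: oddE evenE)
   hence "singular_relboundary p X S (lift_chain g z2 + frag_cmul 2 (frag_cmul k (lift_chain g z2) + frag_cmul l (lift_chain g z1) + U))"
    using rb unfolding eq by (simp only: ev dist) (simp only: add_ac)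
   thus ?thesis using lev by blast
  next
   case 3
   then obtain k l where "a = 2 * k + 1" "b = 2 * l + 1" by (auto elim!: oddE)
   hence "singular_relboundary p X S ((lift_chain g z1 + lift_chain g z2) + frag_cmul 2 (frag_cmul k (lift_chain g z1) + frag_cmul l (lift_chain g z2) + U))"
    using rb unfolding eq by (simp only: ev dist) (simp only: add_ac)
   hence "singular_relboundary p X S (lift_chain g (\<lambda>\<tau>. z1 \<tau> + z2 \<tau>) + frag_cmul 2 (u3 + (frag_cmul k (lift_chain g z1) + frag_cmul l (lift_chain g z2) + U)))"
    unfolding u3 by (simp only: dist add.assoc)
   thus ?thesis using lev3 by blast
  qed
 qed
 thus ?thesis using boundary_of_relboundary by meson
qed

end

section \<open>Local homology of triangulated balls\<close>

lemma prod_top_of_set: "prod_topology (top_of_set A) (top_of_set B) = top_of_set (A \<times> B)"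
 by (simp add: prod_topology_subtopology subtopology_subtopology Times_Int_Times)

lemma homotopic_canonI:
 fixes h :: "real => 'b::topological_space => 'c::topological_space"
 assumes "continuous_on ({0..1} \<times> S) (\<lambda>(t,x). h t x)" "\<And>t x. t \<in> {0..1} ==> x \<in> S ==> h t x \<in> T"
  and "\<And>t. t \<in> {0..1} ==> P (h t)"
 shows "homotopic_with_canon P S T (h 0) (h 1)"
 unfolding homotopic_with_def prod_top_of_set
 using assms by (intro exI[of _ "\<lambda>(t,x). h t x"]) auto

lemma trivial_homology_iff:
 "trivial_group (relative_homology_group (int p) X S) \<longleftrightarrow> trivial_homology_at p X S"
proof
 assume t: "trivial_group (relative_homology_group (int p) X S)"
 show "trivial_homology_at p X S"
  unfolding trivial_homology_at_def
 proof (intro allI impI)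
  fix c assume c: "singular_relcycle p X S c"
  hence "homologous_rel_set p X S c \<in> carrier (relative_homology_group (int p) X S)"
   by (auto simp: carrier_relative_homology_group)
  hence "homologous_rel_set p X S c = singular_relboundary_set p X S"
   using t by (simp add: trivial_group_def)
  thus "singular_relboundary p X S c" by (simp add: homologous_rel_set_eq_relboundary)
 qed
next
 assume t: "trivial_homology_at p X S"
 have "x = singular_relboundary_set p X S" if x: "x \<in> carrier (relative_homology_group (int p) X S)" for x
 proof -
  obtain c where "x = homologous_rel_set p X S c" "singular_relcycle p X S c"
   using x unfolding carrier_relative_homology_group by blast
  thus ?thesis using t homologous_rel_set_eq_relboundary[of p X S c] by (simp add: trivial_homology_at_def)
 qed
 thus "trivial_group (relative_homology_group (int p) X S)"
  unfolding trivial_group_def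
  using group.is_monoid[OF group_relative_homology_group, of "int p" X S] monoid.one_closed
  by fastforce
qed

text \<open>The classes of the cycles are integers \<open>k c1\<close> and \<open>k c2\<close>.
  Divided by their gcd they are coprime, hence not both even, and give the coefficients of a
  vanishing combination.\<close>

lemma cyclic_homology_from_iso:
 assumes "relative_homology_group (int p) X S \<cong> integer_group"
 shows "cyclic_homology_at p X S"
proof -
 let ?G = "relative_homology_group (int p) X S"
 obtain f where f: "f \<in> iso ?G integer_group" using assms by (auto simp: is_iso_def)
 define k where "k = (\<lambda>c. f (homologous_rel_set p X S c))"
 have hom: "f \<in> hom ?G integer_group" and inj: "inj_on f (carrier ?G)" using f by (auto simp: iso_def bij_betw_def)
 have car: "homologous_rel_set p X S c \<in> carrier ?G" if "singular_relcycle p X S c" for c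
  using that by (auto simp: carrier_relative_homology_group)
 have add: "k (c1 + c2) = k c1 + k c2" if c: "singular_relcycle p X S c1" "singular_relcycle p X S c2" for c1 c2
 proof -
  have "homologous_rel_set p X S c1 \<otimes>\<^bsub>?G\<^esub> homologous_rel_set p X S c2 = homologous_rel_set p X S (c1 + c2)"
  proof (rule Set.set_eqI)
   fix x
   show "x \<in> homologous_rel_set p X S c1 \<otimes>\<^bsub>?G\<^esub> homologous_rel_set p X S c2 \<longleftrightarrow> x \<in> homologous_rel_set p X S (c1 + c2)"
   proof
    assume "x \<in> homologous_rel_set p X S c1 \<otimes>\<^bsub>?G\<^esub> homologous_rel_set p X S c2"
    thus "x \<in> homologous_rel_set p X S (c1 + c2)"
     by (auto simp: mult_relative_homology_group intro: homologous_rel_add)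
   next
    assume "x \<in> homologous_rel_set p X S (c1 + c2)"
    hence "homologous_rel p X S c2 (x - c1)"
     by (simp add: homologous_rel_def algebra_simps)
    thus "x \<in> homologous_rel_set p X S c1 \<otimes>\<^bsub>?G\<^esub> homologous_rel_set p X S c2"
     unfolding mult_relative_homology_group
     by (intro UN_I[of c1] UN_I[of "x - c1"]) simp_all
   qed
  qed
  thus ?thesis using hom_mult[OF hom car[OF c(1)] car[OF c(2)]] by (simp add: k_def)
 qed
 have k0: "singular_relboundary p X S c" if "singular_relcycle p X S c" "k c = 0" for c
 proof -
  have "f \<one>\<^bsub>?G\<^esub> = 0" using hom_one[OF hom] by simp
  hence "f (homologous_rel_set p X S c) = f \<one>\<^bsub>?G\<^esub>" using that by (simp add: k_def)
  moreover have "\<one>\<^bsub>?G\<^esub> \<in> carrier ?G"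
   using group.is_monoid[OF group_relative_homology_group] monoid.one_closed by blast
  ultimately have "homologous_rel_set p X S c = \<one>\<^bsub>?G\<^esub>" using inj_onD[OF inj _ car[OF that(1)]] by blast
  thus ?thesis by (simp add: homologous_rel_set_eq_relboundary)
 qed
 have kzero: "k 0 = 0" using add[of 0 0] by simp
 have kneg: "k (- c) = - k c" if "singular_relcycle p X S c" for c
  using add[OF that, of "- c"] that kzero by (simp add: singular_relcycle_minus)
 have cmul_nat: "k (frag_cmul (int n) c) = int n * k c" if "singular_relcycle p X S c" for n c
 proof (induction n)
  case (Suc n)
  have "frag_cmul (int (Suc n)) c = frag_cmul (int n) c + c" by (simp add: frag_cmul_distrib add.commute)
  hence "k (frag_cmul (int (Suc n)) c) = k (frag_cmul (int n) c) + k c"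
   using add[OF singular_relcycle_cmul[OF that] that, of "int n"] by simp
  thus ?case using Suc by (simp add: algebra_simps)
 qed (simp add: kzero)
 have cmul: "k (frag_cmul a c) = a * k c" if "singular_relcycle p X S c" for a c
 proof (cases "a \<ge> 0")
  case True
  thus ?thesis using cmul_nat[OF that, of "nat a"] by simp
 next
  case False
  hence "k (frag_cmul (- a) (- c)) = (- a) * k (- c)"
   using cmul_nat[of "- c" "nat (- a)"] that by (simp add: singular_relcycle_minus)
  moreover have "frag_cmul (- a) (- c) = frag_cmul a c"
   by (intro poly_mapping_eqI) simp
  ultimately show ?thesis using kneg[OF that] by simp
 qed
 show ?thesis
  unfolding cyclic_homology_at_def
 proof (intro allI impI)
  fix c1 c2 assume "singular_relcycle p X S c1 \<and> singular_relcycle p X S c2"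
  hence c: "singular_relcycle p X S c1" "singular_relcycle p X S c2" by auto
  have *: "\<exists>a b. (odd a \<or> odd b) \<and> a * k c1 + b * k c2 = 0"
  proof (cases "k c1 = 0 \<and> k c2 = 0")
   case True
   thus ?thesis by (intro exI[of _ 1]) auto
  next
   case False
   let ?g = "gcd (k c1) (k c2)"
   have g: "?g ~= 0" using False by auto
   obtain x y where xy: "k c1 = ?g * x" "k c2 = ?g * y" "coprime x y"
    using gcd_coprime_exists[OF g] by (metis mult.commute)
   have "y * k c1 + (- x) * k c2 = 0" by (subst xy(1), subst (2) xy(2)) (simp add: algebra_simps)
   moreover have "odd y \<or> odd (- x)" using xy(3) by (metis coprime_common_divisor dvd_minus_iff not_is_unit_0 odd_one)
   ultimately show ?thesis by blast
  qed
  then obtain a b where ab: "odd a \<or> odd b" "a * k c1 + b * k c2 = 0" by blast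
  have "singular_relcycle p X S (frag_cmul a c1 + frag_cmul b c2)"
   using c by (intro singular_relcycle_add singular_relcycle_cmul)
  moreover have "k (frag_cmul a c1 + frag_cmul b c2) = 0"
   using c ab(2) by (simp add: add singular_relcycle_cmul cmul)
  ultimately show "\<exists>a b. (odd a \<or> odd b) \<and> singular_relboundary p X S (frag_cmul a c1 + frag_cmul b c2)"
   using k0 ab(1) by blast
 qed
qed

lemma cyclic_homology_from_trivial:
 assumes t: "trivial_homology_at p X S"
 shows "cyclic_homology_at p X S"
 unfolding cyclic_homology_at_def
proof (intro allI impI exI conjI)
 fix c1 c2 assume c: "singular_relcycle p X S c1 \<and> singular_relcycle p X S c2"
 show "odd (1::int) \<or> odd (0::int)" by simp
 show "singular_relboundary p X S (frag_cmul 1 c1 + frag_cmul 0 c2)"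
  using t c by (simp add: trivial_homology_at_def)
qed

section \<open>Local homology of the closed unit ball\<close>

definition ball_set :: "nat => (nat => real) set" where
 "ball_set e = {x. (\<forall>i\<ge>e. x i = 0) \<and> (\<Sum>i<e. (x i)\<^sup>2) \<le> 1}"

lemma Euclidean_space_eq: "Euclidean_space e = top_of_set {x. \<forall>i\<ge>e. x i = 0}"
 by (simp add: Euclidean_space_def euclidean_product_topology)

lemma continuous_on_sqsum: "continuous_on S (\<lambda>x::nat => real. \<Sum>i<e. (x i)\<^sup>2)"
 by (intro continuous_intros continuous_on_coord)

text \<open>Removing homeomorphic closed sets gives isomorphic relative homology, which moves
  \<open>x\<close> to the origin; the dimension step then reduces to the homology of the one-point
  space \<open>Euclidean_space 0\<close>, shifted by \<open>e\<close>.\<close>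

lemma homology_Euclidean_point:
 assumes x: "x \<in> topspace (Euclidean_space e)"
 shows "p ~= int e ==> trivial_group (relative_homology_group p (Euclidean_space e) (topspace (Euclidean_space e) - {x}))"
  and "relative_homology_group (int e) (Euclidean_space e) (topspace (Euclidean_space e) - {x}) \<cong> integer_group"
proof -
 let ?E = "Euclidean_space e" and ?z = "\<lambda>i::nat. 0::real"
 have cl: "closedin ?E {y}" if "y \<in> topspace ?E" for y
  using that Hausdorff_Euclidean_space[of e] by (simp add: closedin_Hausdorff_singleton)
 have z: "?z \<in> topspace ?E" by (simp add: topspace_Euclidean_space)
 have "subtopology ?E {x} homeomorphic_space subtopology ?E {?z}"
 proof -
  have "continuous_map (subtopology ?E {x}) (subtopology ?E {?z}) (\<lambda>_. ?z)" "continuous_map (subtopology ?E {?z}) (subtopology ?E {x}) (\<lambda>_. x)"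
   using x z by auto
  hence "homeomorphic_maps (subtopology ?E {x}) (subtopology ?E {?z}) (\<lambda>_. ?z) (\<lambda>_. x)"
   by (auto simp: homeomorphic_maps_def)
  thus ?thesis by (auto simp: homeomorphic_space_def)
 qed
 hence 1: "relative_homology_group p ?E (topspace ?E - {x}) \<cong> relative_homology_group p ?E (topspace ?E - {?z})" for p
  by (rule isomorphic_relative_homology_groups_Euclidean_complements[OF cl[OF x] cl[OF z]])
 have t0: "topspace (Euclidean_space 0) = {?z}" by (auto simp: topspace_Euclidean_space)
 have "closedin (Euclidean_space 0) {?z}" using t0 by (metis closedin_topspace)
 from relative_homology_group_Euclidean_complement_step[OF this, of _ e]
 have 2: "homology_group (p - int e) (Euclidean_space 0) \<cong> relative_homology_group p ?E (topspace ?E - {?z})" for p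
  using t0 by (metis Diff_cancel add_0 diff_add_cancel)
 have 3: "relative_homology_group p ?E (topspace ?E - {x}) \<cong> homology_group (p - int e) (Euclidean_space 0)" for p
  using 1[of p] group.iso_sym[OF group_relative_homology_group 2[of p]] iso_trans by blast
 show "trivial_group (relative_homology_group p ?E (topspace ?E - {x}))" if "p ~= int e"
  using homology_dimension_axiom[OF t0, of "p - int e"] that 3[of p]
  by (simp add: isomorphic_group_triviality)
 have "homology_group 0 (Euclidean_space 0) \<cong> integer_group"
  by (rule isomorphic_integer_zeroth_homology_group[OF path_connected_Euclidean_space]) (simp add: t0)
 thus "relative_homology_group (int e) ?E (topspace ?E - {x}) \<cong> integer_group"
  using 3[of "int e"] iso_trans by fastforce
qed

text \<open>Excision of the open outside of the ball: its closure has only points of norm at least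
  one and therefore stays away from \<open>x\<close>.\<close>

lemma homology_ball_interior:
 assumes x: "x \<in> ball_set e" "(\<Sum>i<e. (x i)\<^sup>2) < 1"
 shows "relative_homology_group p (top_of_set (ball_set e)) (ball_set e - {x}) \<cong>
   relative_homology_group p (Euclidean_space e) (topspace (Euclidean_space e) - {x})"
proof -
 let ?E = "Euclidean_space e"
 let ?T = "topspace ?E"
 let ?U = "{y \<in> ?T. 1 < (\<Sum>i<e. (y i)\<^sup>2)}"
 have "closedin ?E {y \<in> ?T. 1 \<le> (\<Sum>i<e. (y i)\<^sup>2)}"
 proof -
  have "closed {y. 1 \<le> (\<Sum>i<e. ((y::nat => real) i)\<^sup>2)}"
   using closed_Collect_le[OF continuous_on_const continuous_on_sqsum] .
  moreover have "{y \<in> ?T. 1 \<le> (\<Sum>i<e. (y i)\<^sup>2)} = ?T \<inter> {y. 1 \<le> (\<Sum>i<e. (y i)\<^sup>2)}" by auto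
  ultimately show ?thesis by (auto simp: Euclidean_space_eq closedin_closed)
 qed
 hence "?E closure_of ?U \<subseteq> {y \<in> ?T. 1 \<le> (\<Sum>i<e. (y i)\<^sup>2)}"
  by (intro closure_of_minimal) auto
 also have "\<dots> \<subseteq> ?T - {x}" using x by auto
 also have "\<dots> \<subseteq> ?E interior_of (?T - {x})"
 proof (rule interior_of_maximal)
  have "closedin ?E {x}"
   using x Hausdorff_Euclidean_space[of e] by (auto simp: closedin_Hausdorff_singleton topspace_Euclidean_space ball_set_def)
  thus "openin ?E (?T - {x})" by (rule openin_diff[OF openin_topspace])
 qed simp
 finally have ex: "?E closure_of ?U \<subseteq> ?E interior_of (?T - {x})" .
 have "?T - ?U = ball_set e" by (auto simp: topspace_Euclidean_space ball_set_def)
 moreover have "?T - {x} - ?U = ball_set e - {x}" by (auto simp: topspace_Euclidean_space ball_set_def)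
 moreover have "subtopology ?E (ball_set e) = top_of_set (ball_set e)"
  by (simp add: Euclidean_space_eq subtopology_subtopology) (metis (no_types, lifting) ball_set_def inf.absorb2 Collect_mono)
 ultimately show ?thesis
  using homology_excision_axiom[OF ex, of ?T p] is_isoI by fastforce
qed

text \<open>Shrinking towards the origin brings no other point to a point \<open>x\<close> of norm
  one, so the identity deforms, through maps preserving the complement of \<open>x\<close>, to a
  constant map that avoids \<open>x\<close>.\<close>

lemma homology_ball_boundary:
 assumes x: "x \<in> ball_set e" "(\<Sum>i<e. (x i)\<^sup>2) = 1"
 shows "trivial_group (relative_homology_group p (top_of_set (ball_set e)) (ball_set e - {x}))"
proof -
 define h where "h = (\<lambda>(t::real) (y::nat => real) i. t * y i)"
 have sq: "(\<Sum>i<e. (h t y i)\<^sup>2) = t\<^sup>2 * (\<Sum>i<e. (y i)\<^sup>2)" for t y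
  by (simp add: h_def power_mult_distrib sum_distrib_left)
 have hb: "h t y \<in> ball_set e" if "t \<in> {0..1}" "y \<in> ball_set e" for t y
 proof -
  have "t\<^sup>2 * (\<Sum>i<e. (y i)\<^sup>2) \<le> 1 * 1" using that
   by (intro mult_mono) (auto simp: ball_set_def power_le_one sum_nonneg)
  hence "(\<Sum>i<e. (h t y i)\<^sup>2) \<le> 1" using sq[of t y] by simp
  thus ?thesis using that by (simp add: ball_set_def h_def)
 qed
 have hne: "h t y ~= x" if "t \<in> {0..1}" "y \<in> ball_set e" "y ~= x" for t y
 proof
  assume a: "h t y = x"
  hence "t\<^sup>2 * (\<Sum>i<e. (y i)\<^sup>2) = 1" using sq[of t y] x by simp
  moreover have "t\<^sup>2 * (\<Sum>i<e. (y i)\<^sup>2) \<le> t\<^sup>2 * 1" using that by (intro mult_left_mono) (auto simp: ball_set_def)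
  ultimately have "t\<^sup>2 \<ge> 1" by simp
  hence "t = 1" using that(1) power_le_one_iff[of t 2] by (smt (verit) atLeastAtMost_iff one_power2 power_less_one_iff zero_less_numeral)
  thus False using a that(3) by (simp add: h_def)
 qed
 have cont: "continuous_on ({0..1} \<times> ball_set e) (\<lambda>(t,y). h t y)"
  unfolding h_def case_prod_unfold
  by (intro continuous_on_coords continuous_intros continuous_on_compose2[OF continuous_on_coord[of UNIV] continuous_on_snd]) auto
 have "homotopic_with_canon (\<lambda>k. k ` (ball_set e - {x}) \<subseteq> ball_set e - {x}) (ball_set e) (ball_set e) (h 0) (h 1)"
  by (rule homotopic_canonI[OF cont]) (use hb hne in auto)
 moreover have "h 1 = id" by (auto simp: h_def)
 ultimately have hom: "homotopic_with_canon (\<lambda>k. k ` (ball_set e - {x}) \<subseteq> ball_set e - {x}) (ball_set e) (ball_set e) (h 0) id" by simp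
 have "x ~= (\<lambda>i. 0)" using x(2) by auto
 moreover have "h 0 = (\<lambda>y i. 0)" by (auto simp: h_def)
 moreover have "(\<lambda>i. 0) \<in> ball_set e" by (simp add: ball_set_def)
 ultimately have "continuous_map (top_of_set (ball_set e)) (subtopology (top_of_set (ball_set e)) (ball_set e - {x})) (h 0)"
  by (auto simp: continuous_map_in_subtopology)
 from trivial_relative_homology_group_alt[OF this hom] show ?thesis .
qed

lemma homology_ball_cases:
 assumes x: "x \<in> ball_set e"
 shows "p ~= e ==> trivial_homology_at p (top_of_set (ball_set e)) (ball_set e - {x})"
  and "relative_homology_group (int e) (top_of_set (ball_set e)) (ball_set e - {x}) \<cong> integer_group \<or>
    trivial_group (relative_homology_group (int e) (top_of_set (ball_set e)) (ball_set e - {x}))"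
  and "trivial_homology_at e (top_of_set (ball_set e)) (ball_set e - {x}) \<longleftrightarrow> (\<Sum>i<e. (x i)\<^sup>2) = 1"
proof -
 have T: "x \<in> topspace (Euclidean_space e)" using x by (simp add: topspace_Euclidean_space ball_set_def)
 let ?G = "\<lambda>p. relative_homology_group (int p) (top_of_set (ball_set e)) (ball_set e - {x})"
 have bd: "trivial_group (?G p)" if "(\<Sum>i<e. (x i)\<^sup>2) = 1" for p
  by (rule homology_ball_boundary[OF x that])
 have int: "?G p \<cong> relative_homology_group (int p) (Euclidean_space e) (topspace (Euclidean_space e) - {x})" if "(\<Sum>i<e. (x i)\<^sup>2) < 1" for p
  by (rule homology_ball_interior[OF x that])
 have le: "(\<Sum>i<e. (x i)\<^sup>2) < 1 \<or> (\<Sum>i<e. (x i)\<^sup>2) = 1" using x by (auto simp: ball_set_def)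
 have intZ: "?G e \<cong> integer_group" if "(\<Sum>i<e. (x i)\<^sup>2) < 1"
  using int[OF that] homology_Euclidean_point(2)[OF T] iso_trans by blast
 show "trivial_homology_at p (top_of_set (ball_set e)) (ball_set e - {x})" if "p ~= e"
  using le bd[of p] int[of p] homology_Euclidean_point(1)[OF T, of "int p"] that
  by (auto simp: isomorphic_group_triviality simp flip: trivial_homology_iff)
 show "?G e \<cong> integer_group \<or> trivial_group (?G e)" using le intZ bd by blast
 show "trivial_homology_at e (top_of_set (ball_set e)) (ball_set e - {x}) \<longleftrightarrow> (\<Sum>i<e. (x i)\<^sup>2) = 1"
 proof
  assume "trivial_homology_at e (top_of_set (ball_set e)) (ball_set e - {x})"
  hence t: "trivial_group (?G e)" by (simp add: trivial_homology_iff)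
  show "(\<Sum>i<e. (x i)\<^sup>2) = 1"
  proof (rule ccontr)
   assume "(\<Sum>i<e. (x i)\<^sup>2) ~= 1"
   hence "?G e \<cong> integer_group" using le intZ by blast
   hence "trivial_group integer_group" using t isomorphic_group_triviality group_relative_homology_group group_integer_group by blast
   thus False using nontrivial_integer_group by (auto simp: trivial_group_def)
  qed
 next
  assume "(\<Sum>i<e. (x i)\<^sup>2) = 1"
  thus "trivial_homology_at e (top_of_set (ball_set e)) (ball_set e - {x})" using bd[of e] trivial_homology_iff by blast
 qed
qed

text \<open>Every unordered pair occurs twice. This one cancellation lies behind
  \<open>bdr_bdr\<close>, \<open>iota_iota\<close> and \<open>koszul_koszul\<close>.\<close>

lemma sum_sym_offdiag:
 fixes f :: "'a => 'a => 'x::comm_monoid_add"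
 assumes "finite A" "\<And>u v. f u v = f v u" "\<And>x::'x. x + x = 0"
 shows "(\<Sum>v\<in>A. \<Sum>u\<in>A-{v}. f u v) = 0"
 using assms(1)
proof (induction A rule: finite_induct)
 case (insert x A)
 have "(\<Sum>v\<in>A. \<Sum>u\<in>insert x A - {v}. f u v) = (\<Sum>v\<in>A. f x v + (\<Sum>u\<in>A - {v}. f u v))"
 proof (rule sum.cong[OF refl])
  fix v assume "v \<in> A"
  hence "insert x A - {v} = insert x (A - {v})" using insert by auto
  thus "(\<Sum>u\<in>insert x A - {v}. f u v) = f x v + (\<Sum>u\<in>A - {v}. f u v)" using insert by simp
 qed
 also have "\<dots> = (\<Sum>v\<in>A. f x v)" using insert by (simp add: sum.distrib)
 finally have "(\<Sum>v\<in>insert x A. \<Sum>u\<in>insert x A - {v}. f u v) = (\<Sum>u\<in>A. f u x) + (\<Sum>v\<in>A. f x v)"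
  using insert by simp
 also have "(\<Sum>u\<in>A. f u x) = (\<Sum>v\<in>A. f x v)" using assms(2) by (intro sum.cong) auto
 finally show ?case using assms(3) by simp
qed simp

lemma bdr_bdr:
 fixes c :: "'a set => 'x::comm_monoid_add"
 assumes "finite V" "\<And>x::'x. x + x = 0"
 shows "bdr V (bdr V c) \<rho> = 0"
proof -
 have "bdr V (bdr V c) \<rho> = (\<Sum>v\<in>V-\<rho>. \<Sum>u\<in>(V-\<rho>)-{v}. c (insert u (insert v \<rho>)))"
  unfolding bdr_def by (intro sum.cong) auto
 also have "\<dots> = 0"
  by (rule sum_sym_offdiag) (use assms in \<open>auto simp: insert_commute\<close>)
 finally show ?thesis .
qed

section \<open>Moving points away from a given point of a face\<close>

lemma continuous_on_Min_image:
 fixes f :: "'i => 'b::topological_space => real"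
 assumes "finite A" "A ~= {}" "\<And>a. a \<in> A ==> continuous_on S (f a)"
 shows "continuous_on S (\<lambda>x. Min ((\<lambda>a. f a x) ` A))"
 using assms
proof (induction A rule: finite_ne_induct)
 case (insert a A)
 hence "continuous_on S (\<lambda>x. min (f a x) (Min ((\<lambda>a. f a x) ` A)))" by (intro continuous_on_min) auto
 thus ?case using insert by simp
qed simp

text \<open>The largest multiple of \<open>x0\<close> that can be subtracted from \<open>x\<close>
  without making a coordinate negative; \<open>\<sigma>\<close> is to be the support of
  \<open>x0\<close>.\<close>

definition min_ratio :: "'a set => ('a => real) => ('a => real) => real" where
 "min_ratio \<sigma> x0 x = Min ((\<lambda>v. x v / x0 v) ` \<sigma>)"

context
 fixes V \<sigma> :: "'a set" and x0 :: "'a => real"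
 assumes V: "finite V" and \<sigma>: "\<sigma> \<subseteq> V" "\<sigma> ~= {}" and supp: "{v. x0 v ~= 0} = \<sigma>" and x0: "x0 \<in> realization V (Pow V)"
begin

lemma x0_pos: "v \<in> \<sigma> ==> 0 < x0 v"
 using supp x0 by (auto simp: realization_def less_le)

lemma x0_zero: "v \<notin> \<sigma> ==> x0 v = 0"
 using supp by auto

lemma fin_\<sigma>: "finite \<sigma>" using V \<sigma> finite_subset by auto

lemma min_ratio_le: "\<forall>u. 0 \<le> x u ==> min_ratio \<sigma> x0 x * x0 v \<le> x v"
proof (cases "v \<in> \<sigma>")
 case True
 hence "min_ratio \<sigma> x0 x \<le> x v / x0 v" unfolding min_ratio_def using fin_\<sigma> by (intro Min_le) auto
 thus ?thesis using x0_pos[OF True] by (simp add: field_simps)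
qed (simp add: x0_zero)

lemma min_ratio_nonneg: "\<forall>u. 0 \<le> x u ==> 0 \<le> min_ratio \<sigma> x0 x"
 unfolding min_ratio_def using fin_\<sigma> \<sigma>(2) x0_pos by (auto simp: less_imp_le)

lemma min_ratio_attained: "\<exists>v\<in>\<sigma>. x v = min_ratio \<sigma> x0 x * x0 v"
proof -
 have "Min ((\<lambda>v. x v / x0 v) ` \<sigma>) \<in> (\<lambda>v. x v / x0 v) ` \<sigma>" using fin_\<sigma> \<sigma>(2) by (intro Min_in) auto
 then obtain v where "v \<in> \<sigma>" "min_ratio \<sigma> x0 x = x v / x0 v" by (auto simp: min_ratio_def)
 thus ?thesis using x0_pos[of v] by (intro bexI[of _ v]) auto
qed

lemma min_ratio_pos_supp:
 assumes "\<forall>u. 0 \<le> x u" "min_ratio \<sigma> x0 x ~= 0"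
 shows "\<sigma> \<subseteq> {v. x v ~= 0}"
proof
 fix v assume v: "v \<in> \<sigma>"
 have "0 < min_ratio \<sigma> x0 x * x0 v" using assms min_ratio_nonneg[of x] x0_pos[OF v] by (simp add: less_le)
 thus "v \<in> {v. x v ~= 0}" using min_ratio_le[of x v] assms by auto
qed

lemma min_ratio_x0: "min_ratio \<sigma> x0 x0 = 1"
proof -
 have "(\<lambda>v. x0 v / x0 v) ` \<sigma> = {1}" using x0_pos \<sigma>(2) by force
 thus ?thesis by (simp add: min_ratio_def)
qed

lemma min_ratio_le_1:
 assumes x: "x \<in> realization V (Pow V)"
 shows "min_ratio \<sigma> x0 x \<le> 1" "min_ratio \<sigma> x0 x = 1 ==> x = x0"
proof -
 have pos: "\<forall>v. 0 \<le> x v" and sum: "sum x V = 1" and sx: "{v. x v ~= 0} \<subseteq> V"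
  using x by (auto simp: realization_def)
 have sum0: "sum x0 V = 1" using x0 by (simp add: realization_def)
 have "min_ratio \<sigma> x0 x * sum x0 V \<le> sum x V"
  unfolding sum_distrib_left using min_ratio_le[OF pos] by (intro sum_mono) auto
 thus "min_ratio \<sigma> x0 x \<le> 1" using sum sum0 by simp
 assume one: "min_ratio \<sigma> x0 x = 1"
 have le: "x0 v \<le> x v" for v using min_ratio_le[OF pos, of v] one by simp
 have "(\<Sum>v\<in>V. x v - x0 v) = 0" using sum sum0 by (simp add: sum_subtractf)
 hence "\<forall>v\<in>V. x v - x0 v = 0" using sum_nonneg_eq_0_iff[OF V, of "\<lambda>v. x v - x0 v"] le by simp
 moreover have "x v = x0 v" if "v \<notin> V" for v
 proof -
  have "v \<notin> {v. x v ~= 0}" "v \<notin> \<sigma>" using that sx \<sigma>(1) by (meson subsetD)+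
  thus ?thesis using x0_zero[of v] by simp
 qed
 ultimately show "x = x0" by (intro ext) (metis eq_iff_diff_eq_0)
qed

lemma min_ratio_cont: "continuous_on S (min_ratio \<sigma> x0)"
 unfolding min_ratio_def using fin_\<sigma> \<sigma>(2)
proof (rule continuous_on_Min_image)
 fix v assume "v \<in> \<sigma>"
 hence "x0 v ~= 0" using x0_pos by force
 thus "continuous_on S (\<lambda>x. x v / x0 v)" by (intro continuous_intros continuous_on_coord) simp
qed

text \<open>Subtract the multiple \<open>c x\<close> of \<open>x0\<close> and rescale. When
  \<open>c x\<close> is the full \<open>min_ratio\<close>, some coordinate in
  \<open>\<sigma>\<close> becomes zero, so the image avoids all faces above \<open>\<sigma>\<close>;
  coordinates that were zero stay zero, so every face is preserved.\<close>

lemma push_off_point: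
 assumes K: "K \<subseteq> Pow V" "down_closed K" and C: "compact C" "C \<subseteq> realization V K - {x0}"
 shows "\<exists>R. continuous_on (realization V (Pow V)) R \<and>
     (\<forall>\<tau>. \<tau> \<subseteq> V --> R ` realization V (Pow \<tau>) \<subseteq> realization V (Pow \<tau>)) \<and> R ` C \<subseteq> realization V {\<tau>\<in>K. \<not> \<sigma> \<subseteq> \<tau>}"
proof -
 have CV: "C \<subseteq> realization V (Pow V)" using C(2) realization_mono[OF K(1)] by blast
 \<comment> \<open>On the compact set \<open>C\<close> the ratio stays below some
   \<open>m < 1\<close>. Truncating it at \<open>m\<close> changes nothing on \<open>C\<close> and
   keeps \<open>1 - c\<close> nonzero everywhere, so \<open>R\<close> is continuous also at
   \<open>x0\<close>.\<close>
 obtain m where m: "0 \<le> m" "m < 1" "\<And>x. x \<in> C ==> min_ratio \<sigma> x0 x \<le> m"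
 proof (cases "C = {}")
  case False
  obtain x where x: "x \<in> C" "\<And>y. y \<in> C ==> min_ratio \<sigma> x0 y \<le> min_ratio \<sigma> x0 x"
   using continuous_attains_sup[OF C(1) False min_ratio_cont] by blast
  have "min_ratio \<sigma> x0 x ~= 1" using min_ratio_le_1(2)[of x] x(1) CV C(2) by blast
  hence "min_ratio \<sigma> x0 x < 1" using min_ratio_le_1(1)[of x] x(1) CV by fastforce
  moreover have "0 \<le> min_ratio \<sigma> x0 x" using x(1) CV by (intro min_ratio_nonneg) (auto simp: realization_def)
  ultimately show thesis using that[of "min_ratio \<sigma> x0 x"] x(2) by blast
 qed (use that[of 0] in auto)
 define c where "c = (\<lambda>x. min (min_ratio \<sigma> x0 x) m)"
 define R where "R = (\<lambda>x v. (x v - c x * x0 v) / (1 - c x))"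
 have c: "0 \<le> c x" "c x < 1" "c x * x0 v \<le> x v" if "x \<in> realization V (Pow V)" for x v
 proof -
  have pos: "\<forall>v. 0 \<le> x v" using that by (simp add: realization_def)
  show "0 \<le> c x" using min_ratio_nonneg[OF pos] m by (simp add: c_def)
  show "c x < 1" using m by (simp add: c_def)
  have "c x * x0 v \<le> min_ratio \<sigma> x0 x * x0 v" using x0 by (intro mult_right_mono) (auto simp: c_def realization_def)
  thus "c x * x0 v \<le> x v" using min_ratio_le[OF pos, of v] by simp
 qed
 have cont: "continuous_on (realization V (Pow V)) R"
  unfolding R_def c_def
 proof (intro continuous_on_coords continuous_intros continuous_on_coord min_ratio_cont ballI)
  fix x assume "x \<in> realization V (Pow V)"
  thus "1 - min (min_ratio \<sigma> x0 x) m ~= 0" using c(2)[of x] by (simp add: c_def)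
 qed
 have supR: "{v. R x v ~= 0} \<subseteq> {v. x v ~= 0}" if "x \<in> realization V (Pow V)" for x
 proof
  fix v assume v: "v \<in> {v. R x v ~= 0}"
  show "v \<in> {v. x v ~= 0}"
  proof (rule ccontr)
   assume "v \<notin> {v. x v ~= 0}"
   hence "x v = 0" by simp
   moreover have "0 \<le> c x * x0 v" using c(1)[OF that] x0 by (simp add: realization_def)
   ultimately have "R x v = 0" using c(3)[OF that, of v] by (simp add: R_def)
   thus False using v by simp
  qed
 qed
 have R1: "(\<forall>v. 0 \<le> R x v) \<and> sum (R x) V = 1" if "x \<in> realization V (Pow V)" for x
 proof
  show "\<forall>v. 0 \<le> R x v" using c[OF that] by (simp add: R_def)
  have "sum (R x) V = (sum x V - c x * sum x0 V) / (1 - c x)"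
   by (simp add: R_def sum_subtractf sum_distrib_left flip: sum_divide_distrib)
  also have "\<dots> = 1" using that x0 c(2)[OF that] by (simp add: realization_def)
  finally show "sum (R x) V = 1" .
 qed
 have "R ` realization V (Pow \<tau>) \<subseteq> realization V (Pow \<tau>)" if "\<tau> \<subseteq> V" for \<tau>
 proof (rule image_subsetI)
  fix x assume x: "x \<in> realization V (Pow \<tau>)"
  hence xV: "x \<in> realization V (Pow V)" using realization_mono[of "Pow \<tau>" "Pow V" V] that by blast
  have "{v. R x v ~= 0} \<subseteq> \<tau>" using supR[OF xV] x unfolding realization_def by (metis (no_types, lifting) Pow_iff mem_Collect_eq subset_trans)
  thus "R x \<in> realization V (Pow \<tau>)" using R1[OF xV] by (simp add: realization_def)
 qed
 moreover have "R ` C \<subseteq> realization V {\<tau>\<in>K. \<not> \<sigma> \<subseteq> \<tau>}"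
 proof (rule image_subsetI)
  fix x assume x: "x \<in> C"
  hence xV: "x \<in> realization V (Pow V)" using CV by blast
  have "{v. x v ~= 0} \<in> K" using x C(2) by (auto simp: realization_def)
  hence RK: "{v. R x v ~= 0} \<in> K" using supR[OF xV] down_closedD[OF K(2)] by blast
  have "c x = min_ratio \<sigma> x0 x" using m(3)[OF x] by (simp add: c_def)
  then obtain v where "v \<in> \<sigma>" "R x v = 0" using min_ratio_attained[of x] by (auto simp: R_def)
  hence "\<not> \<sigma> \<subseteq> {v. R x v ~= 0}" by auto
  thus "R x \<in> realization V {\<tau>\<in>K. \<not> \<sigma> \<subseteq> \<tau>}" using RK R1[OF xV] by (simp add: realization_def)
 qed
 ultimately show ?thesis using cont by blast
qed

lemma pushable_pair_point:
 assumes "inj_on g V" "K \<subseteq> Pow V" "down_closed K" "\<sigma> \<in> K"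
 shows "pushable_pair V g K {\<tau>\<in>K. \<not> \<sigma> \<subseteq> \<tau>} (realization V K - {x0})"
proof
 show "down_closed {\<tau>\<in>K. \<not> \<sigma> \<subseteq> \<tau>}" using assms(3) by (auto simp: down_closed_def)
 show "realization V {\<tau> \<in> K. \<not> \<sigma> \<subseteq> \<tau>} \<subseteq> realization V K - {x0}"
  using supp by (auto simp: realization_def)
 show "\<exists>R. continuous_on (realization V (Pow V)) R \<and>
     (\<forall>\<tau>. \<tau> \<subseteq> V --> R ` realization V (Pow \<tau>) \<subseteq> realization V (Pow \<tau>)) \<and> R ` C \<subseteq> realization V {\<tau>\<in>K. \<not> \<sigma> \<subseteq> \<tau>}"
  if "compact C" "C \<subseteq> realization V K - {x0}" for C
  by (rule push_off_point[OF assms(2,3) that])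
qed (use V assms in auto)

text \<open>A multiple of \<open>x0\<close> is traded for weight at the vertex \<open>w\<close>.
  Only points whose support contains \<open>\<sigma>\<close> move, and these lie in the single
  simplex \<open>insert w \<sigma>\<close>; a point that moves gets a positive coordinate at
  \<open>w\<close> and so does not land on \<open>x0\<close>. At time 0 even \<open>x0\<close> has
  moved, so the identity deforms into the complement.\<close>

lemma trivial_homology_free_ridge:
 assumes K: "K \<subseteq> Pow V" "down_closed K" "\<sigma> \<in> K" and w: "w \<notin> \<sigma>" "insert w \<sigma> \<in> K"
  and up: "\<And>\<tau>. \<tau> \<in> K ==> \<sigma> \<subseteq> \<tau> ==> \<tau> \<subseteq> insert w \<sigma>"
 shows "trivial_homology_at p (top_of_set (realization V K)) (realization V K - {x0})"
proof -
 let ?X = "realization V K"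
 let ?m = "\<lambda>y. min_ratio \<sigma> x0 y"
 define H where "H = (\<lambda>t y v. y v - ((1 - t) * ?m y / 2) * x0 v + ((1 - t) * ?m y / 2) * (if v = w then 1 else 0))"
 have x0X: "x0 \<in> ?X" using x0 supp K(3) by (simp add: realization_def)
 have wV: "w \<in> V" using w K(1) by auto
 have HX: "H t y \<in> ?X" if t: "t \<in> {0..1}" and y: "y \<in> ?X" for t y
 proof (cases "?m y = 0")
  case True
  thus ?thesis using y by (simp add: H_def)
 next
  case False
  have pos: "\<forall>v. 0 \<le> y v" using y by (simp add: realization_def)
  have c: "0 \<le> (1 - t) * ?m y / 2" "(1 - t) * ?m y / 2 \<le> ?m y"
  proof -
   have "0 \<le> ?m y" by (rule min_ratio_nonneg[OF pos])
   thus "0 \<le> (1 - t) * ?m y / 2" using t by simp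
   have "(1 - t) * ?m y \<le> 1 * ?m y" using t \<open>0 \<le> ?m y\<close> by (intro mult_right_mono) auto
   thus "(1 - t) * ?m y / 2 \<le> ?m y" using \<open>0 \<le> ?m y\<close> by linarith
  qed
  have nn: "0 \<le> H t y v" for v
  proof -
   have "(1 - t) * ?m y / 2 * x0 v \<le> ?m y * x0 v" using c(2) x0 by (intro mult_right_mono) (auto simp: realization_def)
   thus ?thesis using min_ratio_le[OF pos, of v] c(1) by (simp add: H_def)
  qed
  have "\<sigma> \<subseteq> {v. y v ~= 0}" using min_ratio_pos_supp[OF pos False] .
  moreover have "{v. y v ~= 0} \<in> K" using y by (simp add: realization_def)
  ultimately have "{v. y v ~= 0} \<subseteq> insert w \<sigma>" using up by blast
  hence z: "y v = 0" if "v \<notin> insert w \<sigma>" for v using that by auto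
  have "{v. H t y v ~= 0} \<subseteq> insert w \<sigma>"
  proof
   fix v assume v: "v \<in> {v. H t y v ~= 0}"
   show "v \<in> insert w \<sigma>"
   proof (rule ccontr)
    assume "v \<notin> insert w \<sigma>"
    hence "H t y v = 0" using z[of v] x0_zero[of v] by (simp add: H_def)
    thus False using v by simp
   qed
  qed
  hence "{v. H t y v ~= 0} \<in> K" using down_closedD[OF K(2) w(2)] by blast
  moreover have "sum (H t y) V = sum y V - ((1 - t) * ?m y / 2) * sum x0 V + ((1 - t) * ?m y / 2) * (\<Sum>v\<in>V. if v = w then 1 else 0)"
   by (simp only: H_def sum.distrib sum_subtractf sum_distrib_left)
  hence "sum (H t y) V = 1" using y x0 V wV by (simp add: realization_def)
  ultimately show ?thesis using nn by (simp add: realization_def)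
 qed
 have Hne: "H t y ~= x0" if t: "t \<in> {0..1}" and y: "y \<in> ?X" and ne: "y ~= x0 \<or> t = 0" for t y
 proof (cases "(1 - t) * ?m y = 0")
  case True
  hence "H t y = y" by (auto simp: H_def)
  moreover have "y ~= x0" using True ne min_ratio_x0 by auto
  ultimately show ?thesis by simp
 next
  case False
  have pos: "\<forall>v. 0 \<le> y v" using y by (simp add: realization_def)
  have "(1 - t) * ?m y > 0" using False t min_ratio_nonneg[OF pos] by (simp add: less_le)
  hence "H t y w > 0" using pos[rule_format, of w] x0_zero[OF w(1)] unfolding H_def by (simp add: add_nonneg_pos)
  thus ?thesis using x0_zero[OF w(1)] by auto
 qed
 have cont: "continuous_on ({0..1} \<times> ?X) (\<lambda>(t,y). H t y)"
  unfolding H_def case_prod_unfold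
  by (intro continuous_on_coords continuous_intros continuous_on_compose2[OF min_ratio_cont[of UNIV]]
    continuous_on_compose2[OF continuous_on_coord[of UNIV] continuous_on_snd]) auto
 have "homotopic_with_canon (\<lambda>k. k ` (?X - {x0}) \<subseteq> ?X - {x0}) ?X ?X (H 0) (H 1)"
  by (rule homotopic_canonI[OF cont]) (use HX Hne in auto)
 moreover have "H 1 = id" by (auto simp: H_def)
 ultimately have hom: "homotopic_with_canon (\<lambda>k. k ` (?X - {x0}) \<subseteq> ?X - {x0}) ?X ?X (H 0) id" by simp
 have "continuous_on ?X (\<lambda>y. (\<lambda>(t,y). H t y) (0, y))"
  by (rule continuous_on_compose2[OF cont]) (auto intro!: continuous_intros)
 hence "continuous_map (top_of_set ?X) (subtopology (top_of_set ?X) (?X - {x0})) (H 0)"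
  using HX[of 0] Hne[of 0] by (auto simp: continuous_map_in_subtopology)
 from trivial_relative_homology_group_alt[OF this hom, of "int p"] show ?thesis by (simp add: trivial_homology_iff)
qed

end

text \<open>These faces form the chain complex of the link of \<open>\<sigma>\<close>, with
  cardinalities raised by \<open>card \<sigma>\<close>, or equally of \<open>\<Delta>\<close> modulo
  the faces not containing \<open>\<sigma>\<close>. Keeping the faces themselves avoids renaming and
  shifting.\<close>

definition faces_above :: "'a set => 'a set set => 'a set set" where
 "faces_above \<sigma> \<Delta> = {\<tau>\<in>\<Delta>. \<sigma> \<subseteq> \<tau>}"

text \<open>The fundamental chain modulo 2 of the link of \<open>\<sigma>\<close>.\<close>

definition facet_sum :: "nat => 'a set => 'a set set => 'a set => bit" where
 "facet_sum d \<sigma> \<Delta> \<tau> = (if \<tau> \<in> \<Delta> \<and> \<sigma> \<subseteq> \<tau> \<and> card \<tau> = d then 1 else 0)"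

definition bit_cycle :: "'a set => 'a set set => nat => ('a set => bit) => bool" where
 "bit_cycle V \<Psi> j z \<longleftrightarrow> on_level \<Psi> j z \<and> (\<forall>\<rho>\<in>\<Psi>. Suc (card \<rho>) = j --> bdr V z \<rho> = 0)"

lemma bit_exact_alt: "bit_exact V \<Psi> j \<longleftrightarrow> (\<forall>z. bit_cycle V \<Psi> j z --> (\<exists>b. on_level \<Psi> (Suc j) b \<and> (\<forall>\<rho>\<in>\<Psi>. card \<rho> = j --> bdr V b \<rho> = z \<rho>)))"
 unfolding bit_exact_def bit_cycle_def by (rule refl)

lemma bit_exactD:
 assumes "bit_exact V \<Psi> j" "bit_cycle V \<Psi> j z"
 shows "\<exists>b :: 'a set => bit. on_level \<Psi> (Suc j) b \<and> (\<forall>\<rho>\<in>\<Psi>. card \<rho> = j --> bdr V b \<rho> = z \<rho>)"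
 using assms(1)[unfolded bit_exact_alt, rule_format, OF assms(2)] .

text \<open>A combinatorial stand-in for a triangulated ball of dimension \<open>d - 1\<close> or, when \<open>B\<close> is
 empty, a triangulated sphere: only the homology of links is recorded, and it passes to links.\<close>

definition homology_ball :: "nat => 'a set => 'a set set => 'a set set => bool" where
 "homology_ball d V \<Delta> B \<longleftrightarrow> finite V \<and> \<Delta> \<subseteq> Pow V \<and> down_closed \<Delta> \<and> {} \<in> \<Delta> \<and> (\<forall>\<sigma>\<in>\<Delta>. card \<sigma> \<le> d) \<and>
   B \<subseteq> \<Delta> \<and> down_closed B \<and>
   (\<forall>\<sigma>\<in>\<Delta>. \<forall>j<d. bit_exact V (faces_above \<sigma> \<Delta>) j) \<and>
   (\<forall>\<sigma>\<in>B. \<forall>z. bit_cycle V (faces_above \<sigma> \<Delta>) d z --> z = (\<lambda>_. 0)) \<and>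
   (\<forall>\<sigma>\<in>\<Delta>-B. bit_cycle V (faces_above \<sigma> \<Delta>) d (facet_sum d \<sigma> \<Delta>) \<and>
    (\<forall>z. bit_cycle V (faces_above \<sigma> \<Delta>) d z --> z = (\<lambda>_. 0) \<or> z = facet_sum d \<sigma> \<Delta>))"

section \<open>Links in a triangulated ball\<close>

definition barycenter :: "'a set => 'a => real" where
 "barycenter \<sigma> = (\<lambda>v. if v \<in> \<sigma> then 1 / card \<sigma> else 0)"

lemma barycenter:
 assumes "finite V" "\<sigma> \<subseteq> V" "\<sigma> ~= {}"
 shows "{v. barycenter \<sigma> v ~= 0} = \<sigma>" "\<sigma> \<in> K ==> barycenter \<sigma> \<in> realization V K"
proof -
 have fin: "finite \<sigma>" "card \<sigma> > 0" using assms by (auto simp: card_gt_0_iff intro: finite_subset)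
 hence "1 / real (card \<sigma>) ~= 0" using assms(3) by simp
 thus 1: "{v. barycenter \<sigma> v ~= 0} = \<sigma>" unfolding barycenter_def by auto
 have "sum (barycenter \<sigma>) V = (\<Sum>v\<in>\<sigma>. 1 / card \<sigma>)"
  unfolding barycenter_def using assms by (intro sum.mono_neutral_cong_right) auto
 also have "\<dots> = 1" using fin assms(3) by simp
 finally show "\<sigma> \<in> K ==> barycenter \<sigma> \<in> realization V K"
  using 1 by (simp add: realization_def) (simp add: barycenter_def)
qed

lemma geometric_realization_eq: "geometric_realization \<Delta> = top_of_set (realization (\<Union>\<Delta>) \<Delta>)"
 by (simp add: geometric_realization_def realization_def complex_vertices_def euclidean_product_topology)

lemma closed_unit_ball_eq: "closed_unit_ball e = top_of_set (ball_set e)"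
proof -
 have "{x. \<forall>i\<ge>e. x i = 0} \<inter> {x. (\<Sum>i<e. (x i)\<^sup>2) \<le> 1} = ball_set e" by (auto simp: ball_set_def)
 thus ?thesis by (simp add: closed_unit_ball_def Euclidean_space_eq subtopology_subtopology)
qed

locale triangulated_ball =
 fixes \<Delta> :: "'a set set" and e :: nat and f :: "('a => real) => nat => real" and f' :: "(nat => real) => 'a => real"
 assumes complex: "abstract_complex \<Delta>"
  and homeo: "homeomorphic_maps (top_of_set (realization (\<Union>\<Delta>) \<Delta>)) (top_of_set (ball_set e)) f f'"
begin

abbreviation "V \<equiv> \<Union>\<Delta>"
abbreviation "X \<equiv> realization V \<Delta>"
abbreviation "B \<equiv> boundary_complex e \<Delta>"

lemma finV: "finite V" and empty_face: "{} \<in> \<Delta>" and down: "down_closed \<Delta>" and subV: "\<Delta> \<subseteq> Pow V"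
 using complex by (auto simp: abstract_complex_def down_closed_def)

lemma fin_face: "\<sigma> \<in> \<Delta> ==> finite \<sigma>"
 using finV by (meson Union_upper finite_subset)

lemma fin\<Delta>: "finite \<Delta>"
 using subV finV by (meson finite_Pow_iff finite_subset)

lemma f_facts: "continuous_on X f" "f ` X \<subseteq> ball_set e" "continuous_on (ball_set e) f'" "f' ` ball_set e \<subseteq> X"
  "x \<in> X ==> f' (f x) = x" "y \<in> ball_set e ==> f (f' y) = y"
 using homeo unfolding homeomorphic_maps_def by auto

lemma local_iso:
 assumes x: "x \<in> X"
 shows "relative_homology_group p (top_of_set X) (X - {x}) \<cong> relative_homology_group p (top_of_set (ball_set e)) (ball_set e - {f x})"
proof -
 have hm: "homeomorphic_map (top_of_set X) (top_of_set (ball_set e)) f"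
  using homeo homeomorphic_maps_map by blast
 have "f ` (X - {x}) = ball_set e - {f x}"
 proof
  show "f ` (X - {x}) \<subseteq> ball_set e - {f x}"
  proof (rule image_subsetI)
   fix y assume y: "y \<in> X - {x}"
   hence "f y ~= f x" using f_facts(5)[of y] f_facts(5)[OF x] by auto
   thus "f y \<in> ball_set e - {f x}" using f_facts(2) y by auto
  qed
  show "ball_set e - {f x} \<subseteq> f ` (X - {x})"
  proof
   fix y assume y: "y \<in> ball_set e - {f x}"
   hence "f' y \<in> X" "f (f' y) = y" using f_facts(4,6) by auto
   thus "y \<in> f ` (X - {x})" using y by (metis Diff_iff image_eqI singleton_iff)
  qed
 qed
 thus ?thesis
  using homeomorphic_map_relative_homology_iso[OF hm, of "X - {x}"] is_isoI by fastforce
qed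

lemma local_homology:
 assumes x: "x \<in> X"
 shows "p ~= e ==> trivial_homology_at p (top_of_set X) (X - {x})"
  and "cyclic_homology_at e (top_of_set X) (X - {x})"
  and "trivial_homology_at e (top_of_set X) (X - {x}) \<longleftrightarrow> (\<Sum>i<e. (f x i)\<^sup>2) = 1"
proof -
 have fx: "f x \<in> ball_set e" using f_facts(2) x by blast
 have triv: "trivial_homology_at p (top_of_set X) (X - {x}) \<longleftrightarrow> trivial_homology_at p (top_of_set (ball_set e)) (ball_set e - {f x})" for p
  using isomorphic_group_triviality[OF local_iso[OF x, of "int p"]] by (simp add: trivial_homology_iff)
 show "p ~= e ==> trivial_homology_at p (top_of_set X) (X - {x})"
  using triv homology_ball_cases(1)[OF fx] by blast
 show "trivial_homology_at e (top_of_set X) (X - {x}) \<longleftrightarrow> (\<Sum>i<e. (f x i)\<^sup>2) = 1"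
  using triv homology_ball_cases(3)[OF fx] by blast
 show "cyclic_homology_at e (top_of_set X) (X - {x})"
  using homology_ball_cases(2)[OF fx]
 proof
  assume "relative_homology_group (int e) (top_of_set (ball_set e)) (ball_set e - {f x}) \<cong> integer_group"
  thus ?thesis by (rule cyclic_homology_from_iso[OF iso_trans[OF local_iso[OF x]]])
 next
  assume "trivial_group (relative_homology_group (int e) (top_of_set (ball_set e)) (ball_set e - {f x}))"
  thus ?thesis by (intro cyclic_homology_from_trivial) (simp add: triv trivial_homology_iff)
 qed
qed

lemma X_nonempty: "X ~= {}"
proof -
 have "(\<lambda>i. 0) \<in> ball_set e" by (simp add: ball_set_def)
 thus ?thesis using f_facts(4) by blast
qed

lemma vertex_exists: "\<exists>w. {w} \<in> \<Delta>"
proof -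
 obtain x where x: "x \<in> X" using X_nonempty by blast
 hence "{v. x v ~= 0} \<in> \<Delta>" "sum x V = 1" by (auto simp: realization_def)
 hence "{v. x v ~= 0} ~= {}" by (metis (mono_tags, lifting) empty_Collect_eq sum.neutral zero_neq_one)
 thus ?thesis using \<open>{v. x v ~= 0} \<in> \<Delta>\<close> down_closedD[OF down] by blast
qed

lemma label_exists: "\<exists>g. inj_on g V \<and> (\<forall>v. g v \<in> (UNIV::nat set))"
 using finite_imp_inj_to_nat_seg[OF finV] by auto

lemma pair_at:
 assumes "\<sigma> \<in> \<Delta>" "\<sigma> ~= {}" "x \<in> X" "{v. x v ~= 0} = \<sigma>" "inj_on g V"
 shows "pushable_pair V g \<Delta> {\<tau>\<in>\<Delta>. \<not> \<sigma> \<subseteq> \<tau>} (X - {x})"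
proof (rule pushable_pair_point[OF finV _ assms(2,4) _ assms(5) subV down assms(1)])
 show "\<sigma> \<subseteq> V" using assms(1) by blast
 show "x \<in> realization V (Pow V)" using assms(3) realization_mono[OF subV] by blast
qed

lemma above_eq: "\<Delta> - {\<tau>\<in>\<Delta>. \<not> \<sigma> \<subseteq> \<tau>} = faces_above \<sigma> \<Delta>"
 by (auto simp: faces_above_def)

text \<open>Lifting cycles in degree \<open>Suc e\<close> would need homology in degree
  \<open>e\<close>, the only one that may fail to vanish; there \<open>low\<close> asks instead that
  no faces of the critical size exist.\<close>

lemma exact_above:
 assumes s: "\<sigma> \<in> \<Delta>" "\<sigma> ~= {}" and x: "x \<in> X" "{v. x v ~= 0} = \<sigma>"
  and triv: "trivial_homology_at p (top_of_set X) (X - {x})"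
  and low: "p ~= Suc e \<or> (\<forall>\<rho>\<in>faces_above \<sigma> \<Delta>. card \<rho> ~= p)"
 shows "bit_exact V (faces_above \<sigma> \<Delta>) (Suc p)"
proof -
 obtain g :: "'a => nat" where g: "inj_on g V" using label_exists by blast
 interpret P: pushable_pair V g \<Delta> "{\<tau>\<in>\<Delta>. \<not> \<sigma> \<subseteq> \<tau>}" "X - {x}" by (rule pair_at[OF s x g])
 have "P.low_trivial p"
  unfolding P.low_trivial_def above_eq
 proof (intro allI impI)
  fix q assume q: "p = Suc q"
  show "trivial_homology_at q (top_of_set X) (X - {x}) \<or> (\<forall>\<rho>\<in>faces_above \<sigma> \<Delta>. card \<rho> ~= p)"
   using local_homology(1)[OF x(1), of q] low q by (cases "q = e") simp_all
 qed
 thus ?thesis using P.exact_from_topology[OF _ triv] above_eq by simp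
qed

lemma exact_above_0:
 assumes s: "\<sigma> \<in> \<Delta>" "\<sigma> ~= {}"
 shows "bit_exact V (faces_above \<sigma> \<Delta>) 0"
 unfolding bit_exact_alt
proof (intro allI impI)
 fix z assume z: "bit_cycle V (faces_above \<sigma> \<Delta>) 0 z"
 have "z \<tau> = 0" for \<tau>
 proof (rule ccontr)
  assume "z \<tau> ~= 0"
  hence "\<tau> \<in> \<Delta>" "\<sigma> \<subseteq> \<tau>" "card \<tau> = 0" using z by (auto simp: bit_cycle_def on_level_def faces_above_def)
  thus False using fin_face s(2) by auto
 qed
 thus "\<exists>b. on_level (faces_above \<sigma> \<Delta>) (Suc 0) b \<and> (\<forall>\<rho>\<in>faces_above \<sigma> \<Delta>. card \<rho> = 0 --> bdr V b \<rho> = z \<rho>)"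
  by (intro exI[of _ "\<lambda>_. 0"]) (simp add: on_level_def bdr_def)
qed

lemma bary: "\<sigma> \<in> \<Delta> ==> \<sigma> ~= {} ==> barycenter \<sigma> \<in> X \<and> {v. barycenter \<sigma> v ~= 0} = \<sigma>"
 using barycenter[OF finV, of \<sigma>] by blast

text \<open>A maximal face is a cycle with nothing above it to bound it, so it contradicts exactness
  in every degree except that of the local homology. This yields purity and the dimension of all
  facets.\<close>

lemma maximal_card:
 assumes m: "\<mu> \<in> \<Delta>" "\<mu> ~= {}" "\<And>\<tau>. \<tau> \<in> \<Delta> ==> \<mu> \<subseteq> \<tau> ==> \<tau> = \<mu>"
 shows "card \<mu> = Suc e"
proof (rule ccontr)
 assume ne: "card \<mu> ~= Suc e"
 have fa: "faces_above \<mu> \<Delta> = {\<mu>}" using m by (auto simp: faces_above_def)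
 obtain p where p: "card \<mu> = Suc p" using m fin_face by (metis card_gt_0_iff gr0_implies_Suc)
 have x: "barycenter \<mu> \<in> X" "{v. barycenter \<mu> v ~= 0} = \<mu>" using bary[OF m(1,2)] by auto
 have ex: "bit_exact V {\<mu>} (Suc p)"
  using exact_above[OF m(1,2) x local_homology(1)[OF x(1)], of p] ne p fa by auto
 have "bit_cycle V {\<mu>} (Suc p) (\<lambda>\<tau>. if \<tau> = \<mu> then 1 else 0)"
  using p by (auto simp: bit_cycle_def on_level_def)
 from ex[unfolded bit_exact_alt, rule_format, OF this]
 obtain b :: "'a set => bit" where b0: "on_level {\<mu>} (Suc (Suc p)) b \<and> (\<forall>\<rho>\<in>{\<mu>}. card \<rho> = Suc p --> bdr V b \<rho> = (if \<rho> = \<mu> then 1 else 0))"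
  by (rule exE)
 hence b: "on_level {\<mu>} (Suc (Suc p)) b" "bdr V b \<mu> = 1" using p by simp_all
 have "b \<tau> = 0" for \<tau> using b(1) p unfolding on_level_def by (metis n_not_Suc_n singletonD)
 thus False using b(2) by (simp add: bdr_def)
qed

lemma face_in_maximal:
 assumes "\<sigma> \<in> \<Delta>"
 shows "\<exists>\<mu>\<in>\<Delta>. \<sigma> \<subseteq> \<mu> \<and> card \<mu> = Suc e"
proof -
 obtain \<sigma>' where s': "\<sigma>' \<in> \<Delta>" "\<sigma> \<subseteq> \<sigma>'" "\<sigma>' ~= {}"
  using assms vertex_exists by (cases "\<sigma> = {}") auto
 have "finite (faces_above \<sigma>' \<Delta>)" "\<sigma>' \<in> faces_above \<sigma>' \<Delta>" using fin\<Delta> s' by (auto simp: faces_above_def)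
 then obtain \<mu> where mu: "\<mu> \<in> faces_above \<sigma>' \<Delta>" "\<forall>\<tau>\<in>faces_above \<sigma>' \<Delta>. \<mu> \<subseteq> \<tau> --> \<mu> = \<tau>"
  by (meson finite_has_maximal2)
 have "card \<mu> = Suc e"
  using mu s' by (intro maximal_card) (auto simp: faces_above_def)
 thus ?thesis using mu s' by (auto simp: faces_above_def)
qed

lemma card_face: "\<sigma> \<in> \<Delta> ==> card \<sigma> \<le> Suc e"
 using face_in_maximal fin_face by (metis card_mono)

lemma no_level: "on_level (faces_above \<sigma> \<Delta>) (Suc (Suc e)) b ==> b = (\<lambda>_. 0)"
proof
 fix \<tau>
 assume "on_level (faces_above \<sigma> \<Delta>) (Suc (Suc e)) b"
 hence "b \<tau> ~= 0 ==> \<tau> \<in> \<Delta> \<and> card \<tau> = Suc (Suc e)" by (simp add: on_level_def faces_above_def)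
 thus "b \<tau> = 0" using card_face[of \<tau>] by fastforce
qed

lemma exact_top_zero:
 assumes "bit_exact V (faces_above \<sigma> \<Delta>) (Suc e)" "bit_cycle V (faces_above \<sigma> \<Delta>) (Suc e) z"
 shows "z = (\<lambda>_. 0)"
proof
 fix \<tau>
 obtain b where b: "on_level (faces_above \<sigma> \<Delta>) (Suc (Suc e)) b" "\<forall>\<rho>\<in>faces_above \<sigma> \<Delta>. card \<rho> = Suc e --> bdr V b \<rho> = z \<rho>"
  using bit_exactD[OF assms] by blast
 have "z \<tau> = 0" if "\<tau> \<in> faces_above \<sigma> \<Delta>" "card \<tau> = Suc e"
  using b(2) that no_level[OF b(1)] by (auto simp: bdr_def)
 thus "z \<tau> = 0" using assms(2) by (auto simp: bit_cycle_def on_level_def)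
qed

lemma X_contractible: "contractible_space (top_of_set X)"
proof -
 define h where "h = (\<lambda>(t::real) (y::nat => real) i. t * y i)"
 have hb: "h t y \<in> ball_set e" if "t \<in> {0..1}" "y \<in> ball_set e" for t y
 proof -
  have "(\<Sum>i<e. (h t y i)\<^sup>2) = t\<^sup>2 * (\<Sum>i<e. (y i)\<^sup>2)"
   by (simp add: h_def power_mult_distrib sum_distrib_left)
  also have "\<dots> \<le> 1 * 1" using that
   by (intro mult_mono) (auto simp: ball_set_def power_le_one sum_nonneg)
  finally show ?thesis using that by (simp add: ball_set_def h_def)
 qed
 have cont: "continuous_on ({0..1} \<times> ball_set e) (\<lambda>(t,y). h t y)"
  unfolding h_def case_prod_unfold
  by (intro continuous_on_coords continuous_intros continuous_on_compose2[OF continuous_on_coord[of UNIV] continuous_on_snd]) auto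
 have "homotopic_with_canon (\<lambda>_. True) (ball_set e) (ball_set e) (h 0) (h 1)"
  by (rule homotopic_canonI[OF cont]) (use hb in auto)
 moreover have "h 1 = id" "h 0 = (\<lambda>_ _. 0)" by (auto simp: h_def)
 ultimately have "contractible_space (top_of_set (ball_set e))"
  unfolding contractible_space_def by (metis homotopic_with_sym)
 moreover have "top_of_set X homeomorphic_space top_of_set (ball_set e)"
  using homeo by (auto simp: homeomorphic_space_def)
 ultimately show ?thesis using homeomorphic_space_contractibility by blast
qed

text \<open>Singular homology is not reduced, so the empty face and one vertex \<open>w\<close> are
  removed first and contractibility is applied relative to a point. The degrees touched by the
  removal are then restored by hand.\<close>

lemma exact_empty: "bit_exact V \<Delta> j"
 unfolding bit_exact_alt
proof (intro allI impI)
 fix z assume z: "bit_cycle V \<Delta> j z"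
 obtain w where w: "{w} \<in> \<Delta>" using vertex_exists by blast
 obtain g :: "'a => nat" where g: "inj_on g V" using label_exists by blast
 have wV: "w \<in> V" using w by blast
 let ?L = "{{}, {w}}" and ?S = "{barycenter {w}}"
 have wX: "barycenter {w} \<in> X" using bary[OF w] by simp
 have rL: "realization V ?L = ?S"
 proof
  show "?S \<subseteq> realization V ?L" using barycenter(2)[OF finV, of "{w}" ?L] wV by simp
  show "realization V ?L \<subseteq> ?S"
  proof
   fix x assume x: "x \<in> realization V ?L"
   have "{v. x v ~= 0} \<subseteq> {w}" using x by (auto simp: realization_def)
   hence z: "x v = 0" if "v ~= w" for v using that by auto
   hence "sum x V = x w" using finV wV by (subst sum.remove[of V w]) (auto intro!: sum.neutral)
   hence "x w = 1" using x by (simp add: realization_def)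
   thus "x \<in> ?S" using z by (auto simp: barycenter_def fun_eq_iff)
  qed
 qed
 interpret P: pushable_pair V g \<Delta> ?L ?S
 proof
  show "\<exists>R. continuous_on (realization V (Pow V)) R \<and>
     (\<forall>\<tau>. \<tau> \<subseteq> V --> R ` realization V (Pow \<tau>) \<subseteq> realization V (Pow \<tau>)) \<and> R ` C \<subseteq> realization V ?L"
   if "C \<subseteq> ?S" for C
   using that unfolding rL by (intro exI[of _ id]) auto
 qed (use finV g subV down empty_face w wX rL in \<open>auto simp: down_closed_def\<close>)
 have triv: "trivial_homology_at p (top_of_set X) ?S" for p
  using trivial_relative_homology_group_contractible_spaces[OF X_contractible, of ?S "int p"] wX
  by (simp flip: trivial_homology_iff)
 have ex: "bit_exact V (\<Delta> - ?L) (Suc p)" for p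
  using P.exact_from_topology[OF _ triv] triv by (simp add: P.low_trivial_def)
 have lz: "on_level \<Delta> j z" and cz: "\<And>\<rho>. \<rho> \<in> \<Delta> ==> Suc (card \<rho>) = j ==> bdr V z \<rho> = 0" using z by (auto simp: bit_cycle_def)
 show "\<exists>b. on_level \<Delta> (Suc j) b \<and> (\<forall>\<rho>\<in>\<Delta>. card \<rho> = j --> bdr V b \<rho> = z \<rho>)"
 proof (cases j)
  case 0
  define b where "b = (\<lambda>\<tau>. if \<tau> = {w} then z {} else 0)"
  have "on_level \<Delta> (Suc 0) b" using w by (auto simp: on_level_def b_def)
  moreover have "bdr V b {} = z {}" using wV finV by (simp add: bdr_def b_def)
  moreover have "\<rho> = {}" if "\<rho> \<in> \<Delta>" "card \<rho> = 0" for \<rho> using that fin_face by simp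
  ultimately show ?thesis using 0 by auto
 next
  case (Suc p)
  define z' where "z' = (\<lambda>\<tau>. if \<tau> = {w} then 0 else z \<tau>)"
  have "bit_cycle V (\<Delta> - ?L) (Suc p) z'"
   unfolding bit_cycle_def
  proof
   show "on_level (\<Delta> - ?L) (Suc p) z'" using lz Suc by (auto simp: on_level_def z'_def)
   show "\<forall>\<rho>\<in>\<Delta> - ?L. Suc (card \<rho>) = Suc p --> bdr V z' \<rho> = 0"
   proof (intro ballI impI)
    fix \<rho> assume \<rho>: "\<rho> \<in> \<Delta> - ?L" "Suc (card \<rho>) = Suc p"
    hence "insert v \<rho> ~= {w}" for v by auto
    hence "bdr V z' \<rho> = bdr V z \<rho>" by (simp add: bdr_def z'_def)
    thus "bdr V z' \<rho> = 0" using cz[of \<rho>] \<rho> Suc by simp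
   qed
  qed
  from bit_exactD[OF ex[of p] this]
  obtain b :: "'a set => bit" where b: "on_level (\<Delta> - ?L) (Suc (Suc p)) b" "\<And>\<rho>. \<rho> \<in> \<Delta> - ?L ==> card \<rho> = Suc p ==> bdr V b \<rho> = z' \<rho>"
   by blast
  have "bdr V b \<rho> = z \<rho>" if \<rho>: "\<rho> \<in> \<Delta>" "card \<rho> = Suc p" for \<rho>
  proof (cases "\<rho> = {w}")
   case False
   moreover have "\<rho> ~= {}" using \<rho>(2) by auto
   ultimately have "\<rho> \<in> \<Delta> - ?L" using \<rho>(1) by simp
   from b(2)[OF this \<rho>(2)] show ?thesis using False by (simp add: z'_def)
  next
   case True
   hence p0: "p = 0" using \<rho> by simp
   \<comment> \<open>At \<open>\<rho> = {w}\<close> nothing is known yet. The values of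
     \<open>bdr V b\<close> and of \<open>z\<close> on vertices both sum to zero and agree at all
     other vertices, hence also at \<open>w\<close>.\<close>
   have "(\<Sum>v\<in>V. bdr V b {v}) = 0" using bdr_bdr[OF finV, of b "{}"] by (simp add: bdr_def[of _ "bdr V b"])
   moreover have "(\<Sum>v\<in>V. z {v}) = 0" using cz[of "{}"] empty_face Suc p0 by (simp add: bdr_def)
   moreover have "bdr V b {v} = z {v}" if "v \<in> V - {w}" for v
   proof -
    have "{v} \<in> \<Delta>" using that down_closedD[OF down] by blast
    thus ?thesis using b(2)[of "{v}"] that p0 by (auto simp: z'_def)
   qed
   ultimately show ?thesis
    using sum.remove[OF finV wV, of "\<lambda>v. bdr V b {v}"] sum.remove[OF finV wV, of "\<lambda>v. z {v}"] True
    by simp (metis (no_types, lifting) add_right_cancel sum.cong)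
  qed
  moreover have "on_level \<Delta> (Suc j) b" using b(1) Suc by (auto simp: on_level_def)
  ultimately show ?thesis using Suc by blast
 qed
qed

end

lemma three_points_cycle:
 fixes z :: "'b => bit"
 assumes "a ~= b" "a ~= c" "b ~= c" "z a = 0" "z b = 0" "z c = 0"
 shows "z \<notin> {\<lambda>\<tau>. if \<tau> = a \<or> \<tau> = b then 1 else 0, \<lambda>\<tau>. if \<tau> = a \<or> \<tau> = c then 1 else 0,
   \<lambda>\<tau>. (if \<tau> = a \<or> \<tau> = b then 1 else 0) + (if \<tau> = a \<or> \<tau> = c then 1 else 0)}"
 using assms by auto

context triangulated_ball
begin

lemma boundaryI:
 "\<rho> \<in> \<Delta> ==> \<tau> \<subseteq> \<rho> ==> card \<rho> = e ==> \<exists>!\<phi>. \<phi> \<in> \<Delta> \<and> card \<phi> = e + 1 \<and> \<rho> \<subseteq> \<phi> ==> \<tau> \<in> B"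
 unfolding boundary_complex_def by (intro CollectI bexI[of _ \<rho>] conjI)

lemma boundaryE:
 assumes "\<tau> \<in> B"
 obtains \<rho> where "\<rho> \<in> \<Delta>" "\<tau> \<subseteq> \<rho>" "card \<rho> = e" "\<exists>!\<phi>. \<phi> \<in> \<Delta> \<and> card \<phi> = e + 1 \<and> \<rho> \<subseteq> \<phi>"
 using assms unfolding boundary_complex_def by (elim CollectE bexE conjE)

lemma boundary_down: "down_closed B" "B \<subseteq> \<Delta>"
proof -
 show "down_closed B" unfolding down_closed_def by (meson boundaryE boundaryI subset_trans)
 show "B \<subseteq> \<Delta>" using down_closedD[OF down] by (meson boundaryE subsetI)
qed

lemma ridge_boundary_norm:
 assumes \<rho>: "\<rho> \<in> \<Delta>" "card \<rho> = e" "\<rho> ~= {}" and u: "\<exists>!\<phi>. \<phi> \<in> \<Delta> \<and> card \<phi> = e + 1 \<and> \<rho> \<subseteq> \<phi>"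
  and x: "x \<in> X" "{v. x v ~= 0} = \<rho>"
 shows "(\<Sum>i<e. (f x i)\<^sup>2) = 1"
proof -
 obtain \<phi> where \<phi>: "\<phi> \<in> \<Delta>" "card \<phi> = Suc e" "\<rho> \<subseteq> \<phi>" and uniq: "\<And>\<tau>. \<tau> \<in> \<Delta> ==> card \<tau> = Suc e ==> \<rho> \<subseteq> \<tau> ==> \<tau> = \<phi>"
 proof -
  from ex1_implies_ex[OF u] obtain \<phi> where \<phi>: "\<phi> \<in> \<Delta> \<and> card \<phi> = e + 1 \<and> \<rho> \<subseteq> \<phi>" by (rule exE)
  have "\<tau> = \<phi>" if "\<tau> \<in> \<Delta>" "card \<tau> = Suc e" "\<rho> \<subseteq> \<tau>" for \<tau>
   using u that \<phi> by (metis Suc_eq_plus1)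
  thus thesis using \<phi> by (intro that[of \<phi>]) simp_all
 qed
 have "card (\<phi> - \<rho>) = 1" using \<phi> \<rho> fin_face by (simp add: card_Diff_subset)
 then obtain w where w: "\<phi> - \<rho> = {w}" by (rule card_1_singletonE)
 have w': "w \<notin> \<rho>" "insert w \<rho> = \<phi>" using w \<phi>(3) by auto
 have up: "\<tau> \<subseteq> insert w \<rho>" if t: "\<tau> \<in> \<Delta>" "\<rho> \<subseteq> \<tau>" for \<tau>
 proof -
  obtain \<mu> where "\<mu> \<in> \<Delta>" "\<tau> \<subseteq> \<mu>" "card \<mu> = Suc e" using face_in_maximal[OF t(1)] by blast
  thus ?thesis using uniq[of \<mu>] t w'(2) by blast
 qed
 have "trivial_homology_at e (top_of_set X) (X - {x})"
 proof (rule trivial_homology_free_ridge[OF finV _ \<rho>(3) x(2) _ subV down \<rho>(1) w'(1) _ up])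
  show "\<rho> \<subseteq> V" using \<rho>(1) by blast
  show "x \<in> realization V (Pow V)" using x(1) realization_mono[OF subV] by blast
  show "insert w \<rho> \<in> \<Delta>" using \<phi>(1) w'(2) by simp
 qed
 thus ?thesis using local_homology(3)[OF x(1)] by simp
qed

text \<open>Interior points of a boundary ridge have norm one by \<open>ridge_boundary_norm\<close>.
  A point of a smaller face is a limit of such points, along the segment to the barycenter of the
  ridge.\<close>

lemma boundary_norm:
 assumes s: "\<sigma> \<in> B" "\<sigma> ~= {}" and x: "x \<in> X" "{v. x v ~= 0} = \<sigma>"
 shows "(\<Sum>i<e. (f x i)\<^sup>2) = 1"
proof -
 obtain \<rho> where \<rho>: "\<rho> \<in> \<Delta>" "\<sigma> \<subseteq> \<rho>" "card \<rho> = e" and u: "\<exists>!\<phi>. \<phi> \<in> \<Delta> \<and> card \<phi> = e + 1 \<and> \<rho> \<subseteq> \<phi>"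
  using boundaryE[OF s(1)] .
 have ne: "\<rho> ~= {}" using \<rho>(2) s(2) by blast
 let ?y = "barycenter \<rho>"
 have y: "?y \<in> X" "{v. ?y v ~= 0} = \<rho>" using bary[OF \<rho>(1) ne] by auto
 define p where "p = (\<lambda>t::real. \<lambda>v. (1 - t) * x v + t * ?y v)"
 have pt: "p t \<in> X \<and> {v. p t v ~= 0} = \<rho>" if t: "0 < t" "t \<le> 1" for t
 proof -
  have nn: "0 \<le> x v" "0 \<le> ?y v" for v using x y by (auto simp: realization_def)
  have "p t v ~= 0 \<longleftrightarrow> v \<in> \<rho>" for v
  proof (cases "v \<in> \<rho>")
   case True
   hence "0 < t * ?y v" using y(2) nn(2)[of v] t by (auto simp: less_le)
   moreover have "0 \<le> (1 - t) * x v" using nn t by simp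
   ultimately show ?thesis using True by (simp add: p_def)
  next
   case False
   hence "v \<notin> \<sigma>" using \<rho>(2) by blast
   hence "x v = 0" "?y v = 0" using x(2) y(2) False by auto
   thus ?thesis using False by (simp add: p_def)
  qed
  hence supp: "{v. p t v ~= 0} = \<rho>" by auto
  have "sum (p t) V = (1 - t) * sum x V + t * sum ?y V" by (simp add: p_def sum.distrib sum_distrib_left)
  also have "\<dots> = 1" using x(1) y(1) by (simp add: realization_def)
  finally have "sum (p t) V = 1" .
  moreover have "0 \<le> p t v" for v using nn t by (simp add: p_def)
  ultimately show ?thesis using supp \<rho>(1) by (simp add: realization_def)
 qed
 have p0: "p 0 = x" by (simp add: p_def)
 have pX: "p ` {0..1} \<subseteq> X"
 proof (rule image_subsetI)
  fix t :: real assume "t \<in> {0..1}"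
  thus "p t \<in> X" using pt[of t] p0 x(1) by (cases "t = 0") auto
 qed
 have "continuous_on {0..1} p" unfolding p_def by (intro continuous_on_coords continuous_intros)
 hence "continuous_on {0..1} (\<lambda>t. f (p t))"
  by (rule continuous_on_compose2[OF f_facts(1)]) (use pX in auto)
 hence cont: "continuous_on {0..1} (\<lambda>t. \<Sum>i<e. (f (p t) i)\<^sup>2)"
  by (rule continuous_on_compose2[OF continuous_on_sqsum[of UNIV]]) auto
 have "\<forall>t\<in>{0<..1}. (\<Sum>i<e. (f (p t) i)\<^sup>2) = 1"
  using pt ridge_boundary_norm[OF \<rho>(1,3) ne u] by auto
 moreover have "closure {0<..1::real} = {0..1}" by simp
 ultimately have "(\<Sum>i<e. (f (p 0) i)\<^sup>2) = 1"
  using continuous_constant_on_closure[of "{0<..1}" "\<lambda>t. \<Sum>i<e. (f (p t) i)\<^sup>2" 1 0] cont by simp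
 thus ?thesis using p0 by simp
qed

text \<open>A single facet above \<open>\<rho>\<close> would put it in the boundary. Three of them
  would give two independent cycles of two facets each, with nothing above to bound them, against
  the cyclic local homology. So the number of facets is even.\<close>

lemma facets_two:
 assumes \<rho>: "\<rho> \<in> \<Delta>" "card \<rho> = e" "\<rho> \<notin> B"
 shows "bdr V (facet_sum (Suc e) \<sigma> \<Delta>) \<rho> = 0 \<or> \<not> \<sigma> \<subseteq> \<rho>"
proof (cases "\<sigma> \<subseteq> \<rho>")
 case True
 define W where "W = {v\<in>V-\<rho>. insert v \<rho> \<in> \<Delta>}"
 have "W \<subseteq> V" unfolding W_def by blast
 hence finW: "finite W" using finV finite_subset by blast
 have card_ins: "card (insert v \<rho>) = Suc e" if "v \<in> W" for v using that \<rho> fin_face by (simp add: W_def)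
 have "bdr V (facet_sum (Suc e) \<sigma> \<Delta>) \<rho> = (\<Sum>v\<in>W. 1)"
  unfolding bdr_def
 proof (rule sum.mono_neutral_cong_right)
  show "finite (V - \<rho>)" using finV by simp
  show "W \<subseteq> V - \<rho>" by (auto simp: W_def)
  show "\<forall>v\<in>V - \<rho> - W. facet_sum (Suc e) \<sigma> \<Delta> (insert v \<rho>) = 0" by (auto simp: W_def facet_sum_def)
  show "facet_sum (Suc e) \<sigma> \<Delta> (insert v \<rho>) = 1" if "v \<in> W" for v
   using that card_ins[OF that] True by (auto simp: W_def facet_sum_def)
 qed
 hence eq: "bdr V (facet_sum (Suc e) \<sigma> \<Delta>) \<rho> = of_nat (card W)" by simp
 have card1: "card W ~= 1"
 proof
  assume "card W = 1"
  then obtain w where w: "W = {w}" by (rule card_1_singletonE)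
  have "\<exists>!\<phi>. \<phi> \<in> \<Delta> \<and> card \<phi> = e + 1 \<and> \<rho> \<subseteq> \<phi>"
  proof (rule ex1I[of _ "insert w \<rho>"])
   show "insert w \<rho> \<in> \<Delta> \<and> card (insert w \<rho>) = e + 1 \<and> \<rho> \<subseteq> insert w \<rho>"
    using w card_ins[of w] by (auto simp: W_def)
   fix \<phi> assume \<phi>: "\<phi> \<in> \<Delta> \<and> card \<phi> = e + 1 \<and> \<rho> \<subseteq> \<phi>"
   hence "card (\<phi> - \<rho>) = 1" using \<rho> fin_face by (simp add: card_Diff_subset)
   then obtain u where u: "\<phi> - \<rho> = {u}" by (rule card_1_singletonE)
   hence "insert u \<rho> = \<phi>" "u \<notin> \<rho>" using \<phi> by auto
   hence "u \<in> W" using \<phi> by (auto simp: W_def)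
   thus "\<phi> = insert w \<rho>" using w \<open>insert u \<rho> = \<phi>\<close> by simp
  qed
  hence "\<rho> \<in> B" by (rule boundaryI[OF \<rho>(1) order_refl \<rho>(2)])
  thus False using \<rho>(3) by simp
 qed
 have cyc: "bit_cycle V (faces_above \<rho> \<Delta>) (Suc e) (\<lambda>\<tau>. if \<tau> = insert a \<rho> \<or> \<tau> = insert b \<rho> then 1 else 0)"
  if ab: "a \<in> W" "b \<in> W" "a ~= b" for a b
 proof -
  let ?z = "\<lambda>\<tau>. if \<tau> = insert a \<rho> \<or> \<tau> = insert b \<rho> then 1 else (0::bit)"
  have "bdr V ?z \<rho> = (\<Sum>v\<in>V-\<rho>. (if v = a then 1 else 0) + (if v = b then 1 else 0))"
   unfolding bdr_def
  proof (rule sum.cong[OF refl])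
   fix v assume v: "v \<in> V - \<rho>"
   have "insert v \<rho> = insert a \<rho> \<longleftrightarrow> v = a" "insert v \<rho> = insert b \<rho> \<longleftrightarrow> v = b"
    using v ab by (auto simp: W_def)
   thus "?z (insert v \<rho>) = (if v = a then 1 else 0) + (if v = b then 1 else 0)" using ab(3) by auto
  qed
  also have "\<dots> = 0" using ab finV by (auto simp: sum.distrib W_def)
  finally have "bdr V ?z \<rho> = 0" .
  moreover have "\<tau> = \<rho>" if "\<tau> \<in> faces_above \<rho> \<Delta>" "card \<tau> = e" for \<tau>
   using that \<rho> fin_face[of \<tau>] card_subset_eq[of \<tau> \<rho>] by (auto simp: faces_above_def)
  moreover have "on_level (faces_above \<rho> \<Delta>) (Suc e) ?z"
   using ab card_ins by (auto simp: on_level_def faces_above_def W_def)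
  ultimately show ?thesis by (auto simp: bit_cycle_def)
 qed
 have "card W \<le> 2"
 proof (rule ccontr)
  assume "\<not> card W \<le> 2"
  hence "3 \<le> card W" by simp
  then obtain T where T: "T \<subseteq> W" "card T = 3" by (metis obtain_subset_with_card_n)
  then obtain a b c where abc: "T = {a,b,c}" "a ~= b" "b ~= c" "a ~= c" by (metis card_3_iff)
  hence W3: "a \<in> W" "b \<in> W" "c \<in> W" using T by auto
  let ?z1 = "\<lambda>\<tau>. if \<tau> = insert a \<rho> \<or> \<tau> = insert b \<rho> then 1 else (0::bit)"
  let ?z2 = "\<lambda>\<tau>. if \<tau> = insert a \<rho> \<or> \<tau> = insert c \<rho> then 1 else (0::bit)"
  have dist: "insert a \<rho> ~= insert b \<rho>" "insert a \<rho> ~= insert c \<rho>" "insert b \<rho> ~= insert c \<rho>"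
   using abc W3 by (auto simp: W_def)
  show False
  proof (cases "\<rho> = {}")
   \<comment> \<open>Here \<open>e = 0\<close> and facets are vertices; the empty face has no
     barycenter, but contractibility already excludes two vertices.\<close>
   case True
   hence "bit_cycle V (faces_above {} \<Delta>) (Suc e) ?z1" using cyc[OF W3(1,2) abc(2)] by simp
   moreover have "faces_above {} \<Delta> = \<Delta>" by (auto simp: faces_above_def)
   ultimately have "?z1 = (\<lambda>_. 0)" using exact_top_zero[of "{}" ?z1] exact_empty by simp
   thus False by (metis zero_neq_one)
  next
   case False
   obtain g :: "'a => nat" where g: "inj_on g V" using label_exists by blast
   have x: "barycenter \<rho> \<in> X" "{v. barycenter \<rho> v ~= 0} = \<rho>" using bary[OF \<rho>(1) False] by auto
   interpret P: pushable_pair V g \<Delta> "{\<tau>\<in>\<Delta>. \<not> \<rho> \<subseteq> \<tau>}" "X - {barycenter \<rho>}" by (rule pair_at[OF \<rho>(1) False x g])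
   have low: "P.low_trivial e" unfolding P.low_trivial_def using local_homology(1)[OF x(1)] by auto
   have zz: "P.is_cycle (Suc e) ?z1" "P.is_cycle (Suc e) ?z2"
    unfolding P.is_cycle_def above_eq using cyc[OF W3(1,2) abc(2)] cyc[OF W3(1,3) abc(4)] by (simp_all add: bit_cycle_def)
   obtain z \<beta> where zb: "z \<in> {?z1, ?z2, \<lambda>\<tau>. ?z1 \<tau> + ?z2 \<tau>}" "on_level (faces_above \<rho> \<Delta>) (Suc (Suc e)) \<beta>"
     "\<forall>\<tau>\<in>faces_above \<rho> \<Delta>. card \<tau> = Suc e --> bdr V \<beta> \<tau> = z \<tau>"
    using P.cyclic_from_topology[OF low local_homology(2)[OF x(1)] zz] unfolding above_eq by blast
   have "bdr V \<beta> \<tau> = 0" for \<tau> using no_level[OF zb(2)] by (simp add: bdr_def)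
   hence z0: "z \<tau> = 0" if "\<tau> \<in> faces_above \<rho> \<Delta>" "card \<tau> = Suc e" for \<tau> using zb(3) that by auto
   have fa: "insert v \<rho> \<in> faces_above \<rho> \<Delta>" if "v \<in> W" for v using that by (auto simp: faces_above_def W_def)
   have zero: "z (insert a \<rho>) = 0" "z (insert b \<rho>) = 0" "z (insert c \<rho>) = 0"
    using z0 fa card_ins W3 by auto
   define A1 A2 A3 where "A1 = insert a \<rho>" and "A2 = insert b \<rho>" and "A3 = insert c \<rho>"
   have d: "A1 ~= A2" "A1 ~= A3" "A2 ~= A3" "z A1 = 0" "z A2 = 0" "z A3 = 0"
    using dist zero by (simp_all add: A1_def A2_def A3_def)
   show False by (rule notE[OF three_points_cycle[OF d] zb(1)[folded A1_def A2_def A3_def]])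
  qed
 qed
 hence "card W = 0 \<or> card W = 2" using card1 by linarith
 hence "of_nat (card W) = (0::bit)" by auto
 thus ?thesis using eq by simp
qed simp

lemma facet_sum_level: "on_level (faces_above \<sigma> \<Delta>) (Suc e) (facet_sum (Suc e) \<sigma> \<Delta>)"
 by (auto simp: on_level_def facet_sum_def faces_above_def)

lemma facet_sum_nonzero: "\<sigma> \<in> \<Delta> ==> facet_sum (Suc e) \<sigma> \<Delta> ~= (\<lambda>_. 0)"
 using face_in_maximal[of \<sigma>] unfolding facet_sum_def by (metis zero_neq_one)

lemma facet_sum_cycle:
 assumes "\<sigma> \<in> \<Delta>" "\<sigma> \<notin> B"
 shows "bit_cycle V (faces_above \<sigma> \<Delta>) (Suc e) (facet_sum (Suc e) \<sigma> \<Delta>)"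
 unfolding bit_cycle_def
proof (intro conjI ballI impI facet_sum_level)
 fix \<rho> assume \<rho>: "\<rho> \<in> faces_above \<sigma> \<Delta>" "Suc (card \<rho>) = Suc e"
 hence "\<rho> \<notin> B" using assms(2) down_closedD[OF boundary_down(1)] by (auto simp: faces_above_def)
 thus "bdr V (facet_sum (Suc e) \<sigma> \<Delta>) \<rho> = 0"
  using facets_two[of \<rho> \<sigma>] \<rho> by (auto simp: faces_above_def)
qed

text \<open>Without a boundary the sum of all facets would be a nonzero cycle in the top degree of a
  contractible space.\<close>

lemma empty_boundary: "{} \<in> B"
proof (rule ccontr)
 assume "{} \<notin> B"
 from facet_sum_cycle[OF empty_face this] have "bit_cycle V (faces_above {} \<Delta>) (Suc e) (facet_sum (Suc e) {} \<Delta>)" .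
 moreover have "faces_above {} \<Delta> = \<Delta>" by (auto simp: faces_above_def)
 ultimately have "facet_sum (Suc e) {} \<Delta> = (\<lambda>_. 0)" using exact_top_zero[of "{}"] exact_empty by simp
 thus False using facet_sum_nonzero[OF empty_face] by simp
qed

text \<open>If the local homology at \<open>x\<close> vanishes in degree \<open>e\<close>, the
  facets above \<open>\<sigma>\<close> cannot form a cycle, whereas they do when
  \<open>\<sigma>\<close> is not in \<open>B\<close>. So the combinatorial boundary corresponds to
  the unit sphere.\<close>

lemma boundary_norm_iff:
 assumes s: "\<sigma> \<in> \<Delta>" "\<sigma> ~= {}" and x: "x \<in> X" "{v. x v ~= 0} = \<sigma>"
 shows "\<sigma> \<in> B \<longleftrightarrow> (\<Sum>i<e. (f x i)\<^sup>2) = 1"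
proof
 assume "(\<Sum>i<e. (f x i)\<^sup>2) = 1"
 hence "trivial_homology_at e (top_of_set X) (X - {x})" using local_homology(3)[OF x(1)] by simp
 from exact_above[OF s x this] have "bit_exact V (faces_above \<sigma> \<Delta>) (Suc e)" by simp
 thus "\<sigma> \<in> B" using exact_top_zero facet_sum_cycle[OF s(1)] facet_sum_nonzero[OF s(1)] by blast
qed (use boundary_norm[OF _ s(2) x] in blast)

theorem homology_ball: "homology_ball (Suc e) V \<Delta> B"
 unfolding homology_ball_def
proof (intro conjI ballI allI impI finV subV down empty_face boundary_down card_face facet_sum_cycle)
 fix \<sigma> j assume s: "\<sigma> \<in> \<Delta>" "j < Suc e"
 show "bit_exact V (faces_above \<sigma> \<Delta>) j"
 proof (cases "\<sigma> = {}")
  case True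
  thus ?thesis using exact_empty by (simp add: faces_above_def)
 next
  case False
  show ?thesis
  proof (cases j)
   case (Suc p)
   thus ?thesis
    using exact_above[OF s(1) False conjunct1[OF bary[OF s(1) False]] conjunct2[OF bary[OF s(1) False]] local_homology(1), of p]
     bary[OF s(1) False] s(2) by simp
  qed (use exact_above_0[OF s(1) False] in simp)
 qed
next
 fix \<sigma> z assume s: "\<sigma> \<in> B" and z: "bit_cycle V (faces_above \<sigma> \<Delta>) (Suc e) z"
 have s\<Delta>: "\<sigma> \<in> \<Delta>" using s boundary_down(2) by blast
 have "bit_exact V (faces_above \<sigma> \<Delta>) (Suc e)"
 proof (cases "\<sigma> = {}")
  case True
  thus ?thesis using exact_empty by (simp add: faces_above_def)
 next
  case False
  have x: "barycenter \<sigma> \<in> X" "{v. barycenter \<sigma> v ~= 0} = \<sigma>" using bary[OF s\<Delta> False] by auto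
  show ?thesis using exact_above[OF s\<Delta> False x] local_homology(3)[OF x(1)] boundary_norm[OF s False x] by simp
 qed
 thus "z = (\<lambda>_. 0)" using exact_top_zero z by blast
next
 fix \<sigma> z assume s: "\<sigma> \<in> \<Delta> - B" and z: "bit_cycle V (faces_above \<sigma> \<Delta>) (Suc e) z"
 have s\<Delta>: "\<sigma> \<in> \<Delta>" "\<sigma> ~= {}" using s empty_boundary by auto
 obtain g :: "'a => nat" where g: "inj_on g V" using label_exists by blast
 have x: "barycenter \<sigma> \<in> X" "{v. barycenter \<sigma> v ~= 0} = \<sigma>" using bary[OF s\<Delta>] by auto
 interpret P: pushable_pair V g \<Delta> "{\<tau>\<in>\<Delta>. \<not> \<sigma> \<subseteq> \<tau>}" "X - {barycenter \<sigma>}" by (rule pair_at[OF s\<Delta> x g])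
 have low: "P.low_trivial e" unfolding P.low_trivial_def using local_homology(1)[OF x(1)] by auto
 let ?s = "facet_sum (Suc e) \<sigma> \<Delta>"
 have zz: "P.is_cycle (Suc e) z" "P.is_cycle (Suc e) ?s"
  unfolding P.is_cycle_def above_eq using z facet_sum_cycle[of \<sigma>] s by (auto simp: bit_cycle_def)
 obtain y b where zb: "y \<in> {z, ?s, \<lambda>\<tau>. z \<tau> + ?s \<tau>}" "on_level (faces_above \<sigma> \<Delta>) (Suc (Suc e)) b"
   "\<forall>\<tau>\<in>faces_above \<sigma> \<Delta>. card \<tau> = Suc e --> bdr V b \<tau> = y \<tau>"
  using P.cyclic_from_topology[OF low local_homology(2)[OF x(1)] zz] unfolding above_eq by blast
 have "bdr V b \<tau> = 0" for \<tau> using no_level[OF zb(2)] by (simp add: bdr_def)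
 hence y0: "y \<tau> = 0" if "\<tau> \<in> faces_above \<sigma> \<Delta>" "card \<tau> = Suc e" for \<tau> using zb(3) that by auto
 have lev: "on_level (faces_above \<sigma> \<Delta>) (Suc e) z" using z by (simp add: bit_cycle_def)
 have "y \<tau> = 0" if "\<not> (\<tau> \<in> faces_above \<sigma> \<Delta> \<and> card \<tau> = Suc e)" for \<tau>
 proof -
  have "z \<tau> = 0" "?s \<tau> = 0" using that lev facet_sum_level[of \<sigma>] by (auto simp: on_level_def)
  thus ?thesis using zb(1) by auto
 qed
 hence y: "y = (\<lambda>_. 0)" using y0 by blast
 \<comment> \<open>Nothing lies above the top level, so the chain that bounds is zero; it is not the
   facet sum itself, which leaves \<open>z\<close> zero or equal to the facet sum.\<close>
 consider "y = z" | "y = ?s" | "y = (\<lambda>\<tau>. z \<tau> + ?s \<tau>)" using zb(1) by blast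
 thus "z = (\<lambda>_. 0) \<or> z = ?s"
 proof cases
  case 2
  thus ?thesis using y facet_sum_nonzero[OF s\<Delta>(1)] by simp
 next
  case 3
  have "z \<tau> = ?s \<tau>" for \<tau>
   using fun_cong[OF 3[unfolded y], of \<tau>] by (metis add_right_cancel bit_add_self)
  thus ?thesis by blast
 qed (use y in simp)
qed auto

end

section \<open>Weighted forms and nonnegativity of h-vectors\<close>

definition scale_fun :: "'f::field => ('i => 'f) => 'i => 'f" where
 "scale_fun a x = (\<lambda>i. a * x i)"

interpretation fv: vector_space scale_fun
 by unfold_locales (auto simp: scale_fun_def fun_eq_iff algebra_simps)

interpretation fvp: vector_space_pair scale_fun scale_fun ..

definition supported_on :: "'i set => ('i => 'f::field) set" where
 "supported_on I = {x. \<forall>i. i \<notin> I --> x i = 0}"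

definition unit_fun :: "'i => 'i => 'f::field" where
 "unit_fun i = (\<lambda>j. if j = i then 1 else 0)"

lemma supported_on_subspace: "fv.subspace (supported_on I)"
 by (auto simp: fv.subspace_def supported_on_def scale_fun_def)

lemma unit_fun_inj: "inj unit_fun"
 by (rule injI) (metis unit_fun_def zero_neq_one)

lemma supported_on_span:
 fixes I :: "'i set"
 assumes "finite I"
 shows "(supported_on I :: ('i => 'f::field) set) \<subseteq> fv.span (unit_fun ` I)"
proof
 fix x :: "'i => 'f" assume x: "x \<in> supported_on I"
 have "x = (\<Sum>i\<in>I. scale_fun (x i) (unit_fun i))"
 proof
  fix j
  have "(\<Sum>i\<in>I. scale_fun (x i) (unit_fun i)) j = (\<Sum>i\<in>I. if i = j then x i else 0)"
   by (induction I rule: infinite_finite_induct) (auto simp: scale_fun_def unit_fun_def)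
  also have "\<dots> = x j" using assms x by (auto simp: supported_on_def)
  finally show "x j = (\<Sum>i\<in>I. scale_fun (x i) (unit_fun i)) j" ..
 qed
 also have "\<dots> \<in> fv.span (unit_fun ` I)"
  by (intro fv.span_sum fv.span_scale fv.span_base) auto
 finally show "x \<in> fv.span (unit_fun ` I)" .
qed

lemma unit_fun_independent:
 fixes I :: "'i set"
 assumes "finite I"
 shows "fv.independent ((unit_fun :: 'i => 'i => 'f::field) ` I)"
proof (rule fv.independent_if_scalars_zero)
 fix f :: "('i => 'f) => 'f" and x :: "'i => 'f"
 assume s: "(\<Sum>x\<in>(unit_fun :: 'i => 'i => 'f) ` I. scale_fun (f x) x) = 0" and x: "x \<in> unit_fun ` I"
 obtain j where j: "j \<in> I" "x = unit_fun j" using x by blast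
 have "(\<Sum>x\<in>unit_fun ` I. scale_fun (f x) x) = (\<Sum>i\<in>I. scale_fun (f (unit_fun i)) (unit_fun i))"
  using unit_fun_inj by (subst sum.reindex) (auto intro: inj_on_subset)
 moreover have "(\<Sum>i\<in>I. scale_fun (f (unit_fun i)) (unit_fun i)) j = (\<Sum>i\<in>I. if i = j then f (unit_fun i) else 0)"
  by (induction I rule: infinite_finite_induct) (auto simp: scale_fun_def unit_fun_def)
 ultimately have "(\<Sum>i\<in>I. if i = j then f (unit_fun i) else 0) = 0" using s by simp
 thus "f x = 0" using assms j by simp
qed (use assms in simp)

lemma dim_supported_on:
 fixes I :: "'i set"
 assumes "finite I"
 shows "fv.dim (supported_on I :: ('i => 'f::field) set) = card I"
proof -
 have "unit_fun ` I \<subseteq> (supported_on I :: ('i => 'f) set)" by (auto simp: supported_on_def unit_fun_def)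
 hence "fv.dim (supported_on I :: ('i => 'f) set) = card (unit_fun ` I :: ('i => 'f) set)"
  by (rule fv.basis_card_eq_dim[OF _ supported_on_span[OF assms] unit_fun_independent[OF assms], symmetric])
 also have "\<dots> = card I" using unit_fun_inj by (intro card_image) (auto intro: inj_on_subset)
 finally show ?thesis .
qed

lemma finite_basis:
 fixes U :: "('i => 'f::field) set"
 assumes "finite I" "U \<subseteq> supported_on I" "B \<subseteq> U" "fv.independent B"
 shows "finite B"
proof -
 have "B \<subseteq> fv.span (unit_fun ` I)" using assms(2,3) supported_on_span[OF assms(1)] by blast
 thus ?thesis using fv.independent_span_bound[OF _ assms(4)] assms(1) by blast
qed

lemma span_disjoint:
 fixes B :: "('i => 'f::field) set"
 assumes "finite B" "fv.independent B" "B0 \<subseteq> B" and x: "x \<in> fv.span (B - B0)" "x \<in> fv.span B0"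
 shows "x = 0"
proof -
 have fin: "finite B0" "finite (B - B0)" using assms(1,3) finite_subset by auto
 obtain u where u: "x = (\<Sum>v\<in>B - B0. scale_fun (u v) v)" using x(1) unfolding fv.span_finite[OF fin(2)] by blast
 obtain w where w: "x = (\<Sum>v\<in>B0. scale_fun (w v) v)" using x(2) unfolding fv.span_finite[OF fin(1)] by blast
 define c where "c = (\<lambda>v. if v \<in> B0 then - w v else u v)"
 have "(\<Sum>v\<in>B. scale_fun (c v) v) = (\<Sum>v\<in>B - B0. scale_fun (c v) v) + (\<Sum>v\<in>B0. scale_fun (c v) v)"
  by (rule sum.subset_diff[OF assms(3,1)])
 also have "(\<Sum>v\<in>B - B0. scale_fun (c v) v) = x" unfolding u c_def by (rule sum.cong) auto
 also have "(\<Sum>v\<in>B0. scale_fun (c v) v) = - x" unfolding w c_def by (subst sum_negf[symmetric]) (rule sum.cong, auto)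
 also have "x + - x = 0" by (rule add.right_inverse)
 finally have "(\<Sum>v\<in>B. scale_fun (c v) v) = 0" .
 hence "c v = 0" if "v \<in> B" for v using fv.independentD[OF assms(2,1) order_refl _ that] by blast
 hence "w v = 0" if "v \<in> B0" for v using assms(3) that by (force simp: c_def)
 thus "x = 0" unfolding w by (intro sum.neutral) simp
qed

text \<open>The ambient function space may have infinite dimension; the finite support
  \<open>I\<close> bounds every independent subset of \<open>U\<close>. A basis of the kernel is
  extended to \<open>U\<close>, and \<open>h\<close> is injective on the span of the added
  vectors.\<close>

theorem rank_nullity:
 fixes U :: "('i => 'f::field) set" and h :: "('i => 'f) => ('i => 'f)"
 assumes I: "finite I" "U \<subseteq> supported_on I" and U: "fv.subspace U"
  and h: "\<And>x y. h (x + y) = h x + h y" "\<And>a x. h (scale_fun a x) = scale_fun a (h x)"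
 shows "fv.dim U = fv.dim (h ` U) + fv.dim {x\<in>U. h x = 0}"
proof -
 have lin: "Vector_Spaces.linear scale_fun scale_fun h"
  by unfold_locales (simp_all add: h)
 interpret h: Vector_Spaces.linear scale_fun scale_fun h by (rule lin)
 let ?N = "{x\<in>U. h x = 0}"
 have N: "fv.subspace ?N" using U by (auto simp: fv.subspace_def h h.zero)
 obtain B0 where B0: "B0 \<subseteq> ?N" "fv.independent B0" "?N \<subseteq> fv.span B0" "card B0 = fv.dim ?N"
  using fv.basis_exists[of ?N] by blast
 have "B0 \<subseteq> U" using B0(1) by blast
 then obtain B where B: "B0 \<subseteq> B" "B \<subseteq> U" "fv.independent B" "U \<subseteq> fv.span B"
  using fv.maximal_independent_subset_extend[OF _ B0(2), of U] by blast
 have finB: "finite B" by (rule finite_basis[OF I B(2,3)])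
 let ?C = "B - B0"
 have spanB: "fv.span B = U" using B(2,4) U by (metis fv.span_minimal subset_antisym)
 have inj: "inj_on h (fv.span ?C)"
 proof (rule inj_onI)
  fix x y assume xy: "x \<in> fv.span ?C" "y \<in> fv.span ?C" "h x = h y"
  have d: "x - y \<in> fv.span ?C" using xy fv.span_diff by blast
  have "fv.span ?C \<subseteq> U" using fv.span_mono[of ?C B] spanB by blast
  hence "x - y \<in> ?N" using d xy(3) by (auto simp: h.diff)
  hence d0: "x - y \<in> fv.span B0" using B0(3) by blast
  have "x - y = 0" by (rule span_disjoint[OF finB B(3,1) d d0])
  thus "x = y" by simp
 qed
 have ind: "fv.independent (h ` ?C)"
  by (rule h.independent_injective_image[OF fv.independent_mono[OF B(3)] inj]) blast
 have img: "h ` U \<subseteq> fv.span (h ` ?C)"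
 proof (rule image_subsetI)
  fix x assume "x \<in> U"
  moreover have "?C \<union> B0 = B" using B(1) by blast
  ultimately have "x \<in> fv.span (?C \<union> B0)" using B(4) by (metis subsetD)
  then obtain y z where yz: "y \<in> fv.span ?C" "z \<in> fv.span B0" "x = y + z"
   unfolding fv.span_Un by blast
  have "z \<in> ?N" using yz(2) fv.span_minimal[OF B0(1) N] by blast
  hence "h x = h y" using yz(3) by (simp add: h)
  also have "\<dots> \<in> fv.span (h ` ?C)" using yz(1) h.span_image[of ?C] by blast
  finally show "h x \<in> fv.span (h ` ?C)" .
 qed
 have "h ` ?C \<subseteq> h ` U" using B(2) by blast
 hence "fv.dim (h ` U) = card (h ` ?C)" using fv.basis_card_eq_dim[OF _ img ind] by simp
 also have "\<dots> = card ?C"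
  using inj fv.span_superset by (intro card_image) (rule inj_on_subset)
 also have "\<dots> = card B - card B0" using finB B(1) by (simp add: card_Diff_subset finite_subset)
 finally have "fv.dim (h ` U) + fv.dim ?N = card B"
  using B0(4) B(1) finB card_mono[OF finB B(1)] by simp
 moreover have "fv.dim U = card B" using fv.basis_card_eq_dim[OF B(2,4,3)] by simp
 ultimately show ?thesis by simp
qed

text \<open>Exactness identifies each image with the cycles one level below, so
  \<open>rank_nullity\<close> telescopes. The alternating sum is itself a dimension, and this is the
  source of nonnegativity.\<close>

theorem euler_characteristic:
 fixes D :: "nat => ('i => 'f::field) set" and h :: "('i => 'f) => ('i => 'f)"
 assumes I: "finite I" "\<And>j. D j \<subseteq> supported_on I" and D: "\<And>j. fv.subspace (D j)"
  and h: "\<And>x y. h (x + y) = h x + h y" "\<And>a x. h (scale_fun a x) = scale_fun a (h x)"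
  and h0: "\<And>x. x \<in> D 0 ==> h x = 0"
  and exact: "\<And>j. j < n ==> h ` D (Suc j) = {x\<in>D j. h x = 0}"
 shows "(\<Sum>j\<le>n. (-1) ^ (n - j) * int (fv.dim (D j))) = int (fv.dim {x\<in>D n. h x = 0})"
 using exact
proof (induction n)
 case 0
 have "{x\<in>D 0. h x = 0} = D 0" using h0 by blast
 thus ?case unfolding \<open>{x\<in>D 0. h x = 0} = D 0\<close> by simp
next
 case (Suc n)
 have "(\<Sum>j\<le>Suc n. (-1) ^ (Suc n - j) * int (fv.dim (D j))) =
   int (fv.dim (D (Suc n))) - (\<Sum>j\<le>n. (-1) ^ (n - j) * int (fv.dim (D j)))"
  by (simp add: Suc_diff_le sum_negf)
 also have "(\<Sum>j\<le>n. (-1) ^ (n - j) * int (fv.dim (D j))) = int (fv.dim {x\<in>D n. h x = 0})"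
  by (rule Suc.IH) (rule Suc.prems, simp)
 also have "{x\<in>D n. h x = 0} = h ` D (Suc n)" by (rule Suc.prems[symmetric]) simp
 also have "fv.dim (D (Suc n)) = fv.dim (h ` D (Suc n)) + fv.dim {x\<in>D (Suc n). h x = 0}"
  by (rule rank_nullity[OF I D h])
 finally show ?case unfolding zero_fun_def by simp
qed

text \<open>A form on \<open>{..<d}\<close> is encoded by its coefficient at each subset. In
  characteristic 2 this is the contraction by the covector \<open>p\<close>, with no signs.\<close>

definition iota :: "nat => (nat => 'f::field) => (nat set => 'f) => nat set => 'f" where
 "iota d p \<omega> S = (\<Sum>s\<in>{..<d}-S. p s * \<omega> (insert s S))"

text \<open>Exterior multiplication by \<open>q\<close> in the same encoding.\<close>

definition wedge :: "(nat => 'f::field) => (nat set => 'f) => nat set => 'f" where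
 "wedge q \<omega> S = (\<Sum>s\<in>S. q s * \<omega> (S - {s}))"

lemma iota_zero [simp]: "iota d p (\<lambda>_. 0) S = 0"
 by (simp add: iota_def)

lemma iota_add: "iota d p (\<lambda>S. \<omega> S + \<eta> S) S = iota d p \<omega> S + iota d p \<eta> S"
 by (simp add: iota_def sum.distrib distrib_left)

lemma iota_scale: "iota d p (\<lambda>S. a * \<omega> S) S = a * iota d p \<omega> S"
 by (simp add: iota_def sum_distrib_left mult_ac)

lemma iota_sum: "iota d p (\<lambda>S. \<Sum>i\<in>I. \<omega> i S) S = (\<Sum>i\<in>I. iota d p (\<omega> i) S)"
 by (induction I rule: infinite_finite_induct) (simp_all add: iota_add)

lemma wedge_add: "wedge q (\<lambda>S. \<omega> S + \<eta> S) S = wedge q \<omega> S + wedge q \<eta> S"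
 by (simp add: wedge_def sum.distrib distrib_left)

lemma wedge_sum: "wedge q (\<lambda>S. \<Sum>i\<in>I. \<omega> i S) S = (\<Sum>i\<in>I. wedge q (\<omega> i) S)"
 by (induction I rule: infinite_finite_induct) (simp_all add: wedge_add wedge_def)

lemma wedge_zero [simp]: "wedge q (\<lambda>_. 0) S = 0"
 by (simp add: wedge_def)

lemma iota_twice:
 "iota d p (iota d r \<omega>) S = (\<Sum>s\<in>{..<d}-S. \<Sum>t\<in>({..<d}-S)-{s}. p s * r t * \<omega> (insert t (insert s S)))"
proof -
 have "{..<d} - insert s S = ({..<d} - S) - {s}" for s by auto
 thus ?thesis by (simp only: iota_def sum_distrib_left mult.assoc)
qed

context
 assumes char2: "\<And>x::'f::field. x + x = 0"
begin

lemma iota_comm: "iota d p (iota d r \<omega>) S = iota d r (iota d p (\<omega> :: nat set => 'f)) S"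
proof -
 let ?A = "{..<d} - S"
 have eq: "iota d p (iota d r \<omega>) S = (\<Sum>s\<in>?A. \<Sum>t\<in>?A-{s}. p s * r t * \<omega> (insert t (insert s S)))" for p r
  by (rule iota_twice)
 have "(\<Sum>s\<in>?A. \<Sum>t\<in>?A-{s}. p s * r t * \<omega> (insert t (insert s S))) =
   (\<Sum>(s,t)\<in>{(s,t). s \<in> ?A \<and> t \<in> ?A \<and> t ~= s}. p s * r t * \<omega> (insert t (insert s S)))" for p r
  by (subst sum.Sigma) (auto intro!: sum.cong)
 note two = this
 have "(\<Sum>(s,t)\<in>{(s,t). s \<in> ?A \<and> t \<in> ?A \<and> t ~= s}. p s * r t * \<omega> (insert t (insert s S))) =
  (\<Sum>(s,t)\<in>{(s,t). s \<in> ?A \<and> t \<in> ?A \<and> t ~= s}. r s * p t * \<omega> (insert t (insert s S)))"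
  by (rule sum.reindex_bij_witness[where i = "\<lambda>(s,t). (t,s)" and j = "\<lambda>(s,t). (t,s)"])
   (auto simp: mult_ac insert_commute)
 thus ?thesis unfolding eq two .
qed

lemma iota_iota: "iota d p (iota d p (\<omega> :: nat set => 'f)) S = 0"
proof -
 let ?A = "{..<d} - S"
 have "iota d p (iota d p \<omega>) S = (\<Sum>s\<in>?A. \<Sum>t\<in>?A-{s}. p s * p t * \<omega> (insert t (insert s S)))"
  by (rule iota_twice)
 also have "\<dots> = 0"
  by (rule sum_sym_offdiag) (auto simp: char2 mult_ac insert_commute)
 finally show ?thesis .
qed

text \<open>The Clifford relation. The terms that exchange an element of \<open>S\<close> for one
  outside occur in both summands and cancel; the diagonal terms add up to the pairing of
  \<open>p\<close> and \<open>q\<close>.\<close>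

lemma clifford:
 assumes S: "S \<subseteq> {..<d}"
 shows "iota d p (wedge q \<omega>) S + wedge q (iota d p \<omega>) S = (\<Sum>s<d. p s * q s) * (\<omega> S :: 'f)"
proof -
 have fin: "finite S" using S finite_subset by auto
 let ?A = "{..<d} - S"
 have 1: "iota d p (wedge q \<omega>) S = (\<Sum>s\<in>?A. p s * q s * \<omega> S) + (\<Sum>s\<in>?A. \<Sum>t\<in>S. p s * q t * \<omega> (insert s (S - {t})))"
 proof -
  have "wedge q \<omega> (insert s S) = q s * \<omega> S + (\<Sum>t\<in>S. q t * \<omega> (insert s (S - {t})))" if "s \<in> ?A" for s
  proof -
   have "(\<Sum>t\<in>S. q t * \<omega> (insert s S - {t})) = (\<Sum>t\<in>S. q t * \<omega> (insert s (S - {t})))"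
    using that by (intro sum.cong refl arg_cong2[of _ _ _ _ "(*)"] arg_cong[of _ _ \<omega>]) auto
   thus ?thesis using that fin by (simp add: wedge_def)
  qed
  hence "iota d p (wedge q \<omega>) S = (\<Sum>s\<in>?A. p s * (q s * \<omega> S + (\<Sum>t\<in>S. q t * \<omega> (insert s (S - {t})))))"
   unfolding iota_def by (intro sum.cong) auto
  thus ?thesis by (simp add: distrib_left sum.distrib sum_distrib_left mult_ac)
 qed
 have 2: "wedge q (iota d p \<omega>) S = (\<Sum>t\<in>S. q t * p t * \<omega> S) + (\<Sum>t\<in>S. \<Sum>s\<in>?A. p s * q t * \<omega> (insert s (S - {t})))"
 proof -
  have "iota d p \<omega> (S - {t}) = p t * \<omega> S + (\<Sum>s\<in>?A. p s * \<omega> (insert s (S - {t})))" if "t \<in> S" for t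
  proof -
   have "{..<d} - (S - {t}) = insert t ?A" using that S by auto
   thus ?thesis using that by (simp add: iota_def insert_absorb)
  qed
  hence "wedge q (iota d p \<omega>) S = (\<Sum>t\<in>S. q t * (p t * \<omega> S + (\<Sum>s\<in>?A. p s * \<omega> (insert s (S - {t})))))"
   unfolding wedge_def by (intro sum.cong) auto
  thus ?thesis by (simp add: distrib_left sum.distrib sum_distrib_left mult_ac)
 qed
 have "(\<Sum>s\<in>?A. \<Sum>t\<in>S. p s * q t * \<omega> (insert s (S - {t}))) = (\<Sum>t\<in>S. \<Sum>s\<in>?A. p s * q t * \<omega> (insert s (S - {t})))"
  by (rule sum.swap)
 hence "iota d p (wedge q \<omega>) S + wedge q (iota d p \<omega>) S = (\<Sum>s\<in>?A. p s * q s * \<omega> S) + (\<Sum>t\<in>S. q t * p t * \<omega> S)"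
  using 1 2 char2 by (simp add: algebra_simps) (metis add.assoc add.commute add_0)
 also have "\<dots> = (\<Sum>s<d. p s * q s * \<omega> S)"
  using sum.subset_diff[OF S, of "\<lambda>s. p s * q s * \<omega> S"] by (simp add: mult_ac)
 finally show ?thesis by (simp add: sum_distrib_right)
qed

end

definition raise :: "'a => ('a => nat) => 'a => nat" where
 "raise v \<mu> = \<mu>(v := Suc (\<mu> v))"

definition lower :: "'a => ('a => nat) => 'a => nat" where
 "lower v \<mu> = \<mu>(v := \<mu> v - 1)"

text \<open>The Koszul differential with coefficients in the polynomial ring on the variables in \<open>T\<close>:
 a form is a function of a set \<open>S\<close> of exterior generators and of an exponent vector.\<close>

definition koszul :: "nat => ('a => nat => 'f::field) => 'a set => (nat set => ('a => nat) => 'f) => nat set => ('a => nat) => 'f" where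
 "koszul d p T \<omega> S \<mu> = (\<Sum>u\<in>{u\<in>T. \<mu> u ~= 0}. iota d (p u) (\<lambda>S. \<omega> S (lower u \<mu>)) S)"

definition form_on :: "nat => 'a set => nat => nat => (nat set => ('a => nat) => 'f::zero) => bool" where
 "form_on d T k a \<omega> \<longleftrightarrow> (\<forall>S \<mu>. \<omega> S \<mu> ~= 0 --> S \<subseteq> {..<d} \<and> card S = k \<and> {u. \<mu> u ~= 0} \<subseteq> T \<and> sum \<mu> T = a)"

lemma koszul_koszul:
 assumes char2: "\<And>x::'f::field. x + x = 0" and "finite T"
 shows "koszul d p T (koszul d p T (\<omega> :: nat set => ('a => nat) => 'f)) S \<mu> = 0"
proof -
 let ?g = "\<lambda>u w. if \<mu> u ~= 0 \<and> \<mu> w ~= 0 then iota d (p u) (iota d (p w) (\<lambda>S. \<omega> S (lower w (lower u \<mu>)))) S else 0"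
 have "koszul d p T (koszul d p T \<omega>) S \<mu> =
   (\<Sum>u\<in>{u\<in>T. \<mu> u ~= 0}. \<Sum>w\<in>{w\<in>T. lower u \<mu> w ~= 0}. iota d (p u) (iota d (p w) (\<lambda>S. \<omega> S (lower w (lower u \<mu>)))) S)"
  unfolding koszul_def iota_sum ..
 also have "\<dots> = (\<Sum>u\<in>{u\<in>T. \<mu> u ~= 0}. \<Sum>w\<in>T-{u}. ?g u w)"
 proof (rule sum.cong[OF refl])
  fix u assume u: "u \<in> {u\<in>T. \<mu> u ~= 0}"
  have "(\<Sum>w\<in>{w\<in>T. lower u \<mu> w ~= 0}. iota d (p u) (iota d (p w) (\<lambda>S. \<omega> S (lower w (lower u \<mu>)))) S)
    = (\<Sum>w\<in>{w\<in>T-{u}. \<mu> w ~= 0}. iota d (p u) (iota d (p w) (\<lambda>S. \<omega> S (lower w (lower u \<mu>)))) S)"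
   by (rule sum.mono_neutral_right) (use assms(2) iota_iota[OF char2] in \<open>auto simp: lower_def\<close>)
  also have "\<dots> = (\<Sum>w\<in>T-{u}. ?g u w)"
   by (rule sum.mono_neutral_cong_left) (use assms(2) u in auto)
  finally show "(\<Sum>w\<in>{w\<in>T. lower u \<mu> w ~= 0}. iota d (p u) (iota d (p w) (\<lambda>S. \<omega> S (lower w (lower u \<mu>)))) S) = (\<Sum>w\<in>T-{u}. ?g u w)" .
 qed
 also have "\<dots> = (\<Sum>u\<in>T. \<Sum>w\<in>T-{u}. ?g u w)"
  by (rule sum.mono_neutral_left) (use assms(2) in auto)
 also have "\<dots> = 0"
 proof (rule sum_sym_offdiag[OF assms(2) _ char2])
  fix u w
  have "lower w (lower u \<mu>) = lower u (lower w \<mu>)" by (auto simp: lower_def fun_upd_def)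
  thus "?g w u = ?g u w" using iota_comm[OF char2] by auto
 qed
 finally show ?thesis .
qed

text \<open>Division by the variable \<open>v\<close>, discarding monomials without it, followed by
  the wedge with \<open>q\<close>.\<close>

definition koszul_homotopy :: "(nat => 'f::field) => 'a => (nat set => ('a => nat) => 'f) => nat set => ('a => nat) => 'f" where
 "koszul_homotopy q v \<omega> S \<mu> = wedge q (\<lambda>S. \<omega> S (raise v \<mu>)) S"

definition koszul_remainder :: "nat => (nat => 'f::field) => (nat => 'f) => 'a => (nat set => ('a => nat) => 'f) => nat set => ('a => nat) => 'f" where
 "koszul_remainder d r q v \<omega> S \<mu> = (if \<mu> v = 0 then \<omega> S \<mu> + wedge q (iota d r (\<lambda>S. \<omega> S \<mu>)) S else 0)"

text \<open>The vector \<open>q\<close> pairs to 1 with the weights of \<open>v\<close> and to 0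
  with those of the other vertices, so in the Clifford relation only \<open>u = v\<close> survives.
  The homotopy is contracting except on monomials without \<open>v\<close>, where the remainder
  stays.\<close>

lemma koszul_homotopy_eq:
 assumes char2: "\<And>x::'f::field. x + x = 0" and T: "finite T" "v \<in> T"
  and q: "\<And>u. u \<in> T ==> (\<Sum>s<d. p u s * q s) = (if u = v then 1 else 0)" and S: "S \<subseteq> {..<d}"
 shows "koszul d p T (koszul_homotopy q v \<omega>) S \<mu> + koszul_homotopy q v (koszul d p T \<omega>) S \<mu>
   = (\<omega> S \<mu> :: 'f) + koszul_remainder d (p v) q v \<omega> S \<mu>"
proof -
 have lr: "lower u (raise v \<mu>) = raise v (lower u \<mu>)" if "\<mu> u ~= 0" for u
  using that by (auto simp: lower_def raise_def fun_upd_def)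
 have rv: "lower v (raise v \<mu>) = \<mu>" by (auto simp: lower_def raise_def)
 have rl: "raise v (lower v \<mu>) = \<mu>" if "\<mu> v ~= 0" using that by (auto simp: lower_def raise_def)
 let ?A = "{u\<in>T. \<mu> u ~= 0}"
 have finA: "finite ?A" using T by simp
 have 1: "koszul d p T (koszul_homotopy q v \<omega>) S \<mu> = (\<Sum>u\<in>?A. iota d (p u) (wedge q (\<lambda>S. \<omega> S (raise v (lower u \<mu>)))) S)"
  unfolding koszul_def koszul_homotopy_def ..
 have 2: "koszul_homotopy q v (koszul d p T \<omega>) S \<mu> = (\<Sum>u\<in>{u\<in>T. raise v \<mu> u ~= 0}. wedge q (iota d (p u) (\<lambda>S. \<omega> S (lower u (raise v \<mu>)))) S)"
  unfolding koszul_def koszul_homotopy_def wedge_sum ..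
 have B: "{u\<in>T. raise v \<mu> u ~= 0} = insert v ?A" using T by (auto simp: raise_def)
 have 3: "(\<Sum>u\<in>?A. iota d (p u) (wedge q (\<lambda>S. \<omega> S (raise v (lower u \<mu>)))) S) + (\<Sum>u\<in>?A. wedge q (iota d (p u) (\<lambda>S. \<omega> S (lower u (raise v \<mu>)))) S)
   = (\<Sum>u\<in>?A. if u = v then \<omega> S \<mu> else 0)"
  unfolding sum.distrib[symmetric]
 proof (rule sum.cong[OF refl])
  fix u assume u: "u \<in> ?A"
  have "iota d (p u) (wedge q (\<lambda>S. \<omega> S (raise v (lower u \<mu>)))) S + wedge q (iota d (p u) (\<lambda>S. \<omega> S (lower u (raise v \<mu>)))) S
    = (\<Sum>s<d. p u s * q s) * \<omega> S (raise v (lower u \<mu>))"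
   using lr[of u] u clifford[OF char2 S] by simp
  also have "\<dots> = (if u = v then \<omega> S \<mu> else 0)"
  proof (cases "u = v")
   case True
   thus ?thesis using q[of u] u rl by simp
  next
   case False
   thus ?thesis using q[of u] u by simp
  qed
  finally show "iota d (p u) (wedge q (\<lambda>S. \<omega> S (raise v (lower u \<mu>)))) S + wedge q (iota d (p u) (\<lambda>S. \<omega> S (lower u (raise v \<mu>)))) S
    = (if u = v then \<omega> S \<mu> else 0)" .
 qed
 show ?thesis
 proof (cases "\<mu> v = 0")
  case False
  hence "insert v ?A = ?A" using T by auto
  thus ?thesis using 1 2 3 B False T finA by (simp add: koszul_remainder_def)
 next
  case True
  have "koszul_homotopy q v (koszul d p T \<omega>) S \<mu> = wedge q (iota d (p v) (\<lambda>S. \<omega> S \<mu>)) S + (\<Sum>u\<in>?A. wedge q (iota d (p u) (\<lambda>S. \<omega> S (lower u (raise v \<mu>)))) S)"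
   unfolding 2 B using True finA rv by simp
  moreover have "(\<Sum>u\<in>?A. if u = v then \<omega> S \<mu> else 0) = 0" using True by (intro sum.neutral) auto
  ultimately have "koszul d p T (koszul_homotopy q v \<omega>) S \<mu> + koszul_homotopy q v (koszul d p T \<omega>) S \<mu> = wedge q (iota d (p v) (\<lambda>S. \<omega> S \<mu>)) S"
   using 1 3 by (simp add: algebra_simps)
  also have "\<dots> = \<omega> S \<mu> + koszul_remainder d (p v) q v \<omega> S \<mu>"
   using True char2[of "\<omega> S \<mu>"] by (simp add: koszul_remainder_def flip: add.assoc)
  finally show ?thesis .
 qed
qed

text \<open>Variables are eliminated one at a time: \<open>good U\<close> says that, up to a
  boundary, the form involves only monomials free of the variables in \<open>U\<close>. With all
  variables gone only the constant monomial is left, which the positive degree \<open>Suc a\<close>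
  excludes.\<close>

theorem koszul_exact:
 assumes char2: "\<And>x::'f::field. x + x = 0" and T: "finite T"
  and dual: "\<And>v. v \<in> T ==> \<exists>q. \<forall>u\<in>T. (\<Sum>s<d. p u s * q s) = (if u = v then 1 else 0)"
  and \<omega>: "form_on d T k (Suc a) (\<omega> :: nat set => ('a => nat) => 'f)"
  and cyc: "\<And>S \<mu>. S \<subseteq> {..<d} ==> {u. \<mu> u ~= 0} \<subseteq> T ==> koszul d p T \<omega> S \<mu> = 0"
 shows "\<exists>\<eta>. form_on d T (Suc k) a \<eta> \<and> (\<forall>S \<mu>. S \<subseteq> {..<d} --> {u. \<mu> u ~= 0} \<subseteq> T --> koszul d p T \<eta> S \<mu> = \<omega> S \<mu>)"
proof -
 define good where "good = (\<lambda>U \<eta> \<omega>'. form_on d T (Suc k) a \<eta> \<and> form_on d T k (Suc a) \<omega>' \<and> (\<forall>S \<mu>. \<omega>' S \<mu> ~= 0 --> (\<forall>u\<in>U. \<mu> u = 0)) \<and>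
   (\<forall>S \<mu>. S \<subseteq> {..<d} --> {u. \<mu> u ~= 0} \<subseteq> T --> koszul d p T \<eta> S \<mu> + \<omega>' S \<mu> = \<omega> S \<mu>) \<and>
   (\<forall>S \<mu>. S \<subseteq> {..<d} --> {u. \<mu> u ~= 0} \<subseteq> T --> koszul d p T \<omega>' S \<mu> = 0))"
 have goodD: "form_on d T (Suc k) a \<eta>" "form_on d T k (Suc a) \<omega>'" "\<omega>' S \<mu> ~= 0 ==> u \<in> U ==> \<mu> u = 0"
   "S \<subseteq> {..<d} ==> {u. \<mu> u ~= 0} \<subseteq> T ==> koszul d p T \<eta> S \<mu> + \<omega>' S \<mu> = \<omega> S \<mu>"
   "S \<subseteq> {..<d} ==> {u. \<mu> u ~= 0} \<subseteq> T ==> koszul d p T \<omega>' S \<mu> = 0" if "good U \<eta> \<omega>'" for U \<eta> \<omega>' S \<mu> u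
  using that unfolding good_def by simp_all
 have main: "\<exists>\<eta> \<omega>'. good U \<eta> \<omega>'"
  if "finite U" "U \<subseteq> T" for U
  using that
 proof (induction U rule: finite_induct)
  case empty
  show ?case
   using \<omega> cyc by (intro exI[of _ "\<lambda>_ _. 0"] exI[of _ \<omega>]) (simp add: good_def form_on_def koszul_def)
 next
  case (insert v U)
  obtain \<eta> \<omega>' where g: "good U \<eta> \<omega>'" using insert.IH insert.prems by auto
  note IH = goodD[OF g]
  have v: "v \<in> T" using insert by simp
  obtain q where q: "\<And>u. u \<in> T ==> (\<Sum>s<d. p u s * q s) = (if u = v then 1 else 0)" using dual[OF v] by blast
  define H where "H = (\<lambda>S \<mu>. if S \<subseteq> {..<d} then koszul_homotopy q v \<omega>' S \<mu> else 0)"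
  define P where "P = (\<lambda>S \<mu>. if S \<subseteq> {..<d} then koszul_remainder d (p v) q v \<omega>' S \<mu> else 0)"
  have formH: "form_on d T (Suc k) a H"
   unfolding form_on_def
  proof (intro allI impI)
   fix S \<mu> assume ne: "H S \<mu> ~= 0"
   hence S: "S \<subseteq> {..<d}" by (auto simp: H_def split: if_splits)
   have "(\<Sum>s\<in>S. q s * \<omega>' (S - {s}) (raise v \<mu>)) ~= 0" using ne S by (simp add: H_def koszul_homotopy_def wedge_def)
   then obtain s where s: "s \<in> S" "\<omega>' (S - {s}) (raise v \<mu>) ~= 0" by (metis (no_types, lifting) mult_zero_right sum.neutral)
   have f: "card (S - {s}) = k" "{u. raise v \<mu> u ~= 0} \<subseteq> T" "sum (raise v \<mu>) T = Suc a" using IH(2) s(2) by (auto simp: form_on_def)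
   have "finite S" using S finite_subset by blast
   hence "card S = Suc k" using f(1) s(1) by (metis card.remove)
   moreover have "{u. \<mu> u ~= 0} \<subseteq> T" using f(2) by (auto simp: raise_def split: if_splits)
   moreover have "sum (raise v \<mu>) T = Suc (sum \<mu> T)"
    unfolding raise_def using T v by (simp add: sum.remove[of T v])
   ultimately show "S \<subseteq> {..<d} \<and> card S = Suc k \<and> {u. \<mu> u ~= 0} \<subseteq> T \<and> sum \<mu> T = a" using S f(3) by simp
  qed
  have Pne: "\<mu> v = 0 \<and> (\<exists>S'. \<omega>' S' \<mu> ~= 0) \<and> S \<subseteq> {..<d} \<and> card S = k" if ne: "P S \<mu> ~= 0" for S \<mu>
  proof -
   have S: "S \<subseteq> {..<d}" and mv: "\<mu> v = 0" using ne by (auto simp: P_def koszul_remainder_def split: if_splits)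
   have fS: "finite S" using S finite_subset by blast
   have "\<omega>' S \<mu> ~= 0 \<or> (\<Sum>s\<in>S. q s * iota d (p v) (\<lambda>S. \<omega>' S \<mu>) (S - {s})) ~= 0"
    using ne S mv by (auto simp: P_def koszul_remainder_def wedge_def)
   thus ?thesis
   proof
    assume "\<omega>' S \<mu> ~= 0"
    thus ?thesis using IH(2) S mv by (auto simp: form_on_def)
   next
    assume "(\<Sum>s\<in>S. q s * iota d (p v) (\<lambda>S. \<omega>' S \<mu>) (S - {s})) ~= 0"
    then obtain s where s: "s \<in> S" "iota d (p v) (\<lambda>S. \<omega>' S \<mu>) (S - {s}) ~= 0" by (metis (no_types, lifting) mult_zero_right sum.neutral)
    then obtain t where t: "t \<in> {..<d} - (S - {s})" "\<omega>' (insert t (S - {s})) \<mu> ~= 0"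
     unfolding iota_def by (metis (no_types, lifting) mult_zero_right sum.neutral)
    hence "card (insert t (S - {s})) = k" using IH(2) by (auto simp: form_on_def)
    moreover have "card (insert t (S - {s})) = card S"
     using t(1) s(1) fS by (metis Diff_iff card.remove card_insert_disjoint finite_Diff)
    ultimately have "card S = k" by simp
    thus ?thesis using S mv t(2) by (intro conjI exI[of _ "insert t (S - {s})"])
   qed
  qed
  have formP: "form_on d T k (Suc a) P"
   using Pne IH(2) unfolding form_on_def by blast
  have PU: "\<forall>u\<in>insert v U. \<mu> u = 0" if pn: "P S \<mu> ~= 0" for S \<mu>
  proof
   obtain S' where S': "\<omega>' S' \<mu> ~= 0" using Pne[OF pn] by auto
   fix u assume "u \<in> insert v U"
   thus "\<mu> u = 0" using Pne[OF pn] IH(3)[OF S'] by auto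
  qed
  have restr: "koszul d p T (\<lambda>S \<mu>. if S \<subseteq> {..<d} then \<xi> S \<mu> else 0) S \<mu> = koszul d p T \<xi> S \<mu>" if "S \<subseteq> {..<d}" for \<xi> :: "nat set => ('a => nat) => 'f" and S \<mu>
   unfolding koszul_def iota_def using that by (intro sum.cong refl) auto
  have eq: "koszul d p T H S \<mu> + P S \<mu> = \<omega>' S \<mu>" if S: "S \<subseteq> {..<d}" "{u. \<mu> u ~= 0} \<subseteq> T" for S \<mu>
  proof -
   have "{u. raise v \<mu> u ~= 0} \<subseteq> T" using S(2) v by (auto simp: raise_def)
   hence "koszul d p T \<omega>' (S - {s}) (raise v \<mu>) = 0" for s using IH(5) S(1) by blast
   hence "koszul_homotopy q v (koszul d p T \<omega>') S \<mu> = 0"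
    by (simp add: koszul_homotopy_def wedge_def)
   hence "koszul d p T (koszul_homotopy q v \<omega>') S \<mu> = \<omega>' S \<mu> + koszul_remainder d (p v) q v \<omega>' S \<mu>"
    using koszul_homotopy_eq[OF char2 T v q S(1), where \<omega> = \<omega>' and \<mu> = \<mu>] by simp
   moreover have "koszul d p T H S \<mu> = koszul d p T (koszul_homotopy q v \<omega>') S \<mu>" unfolding H_def by (rule restr[OF S(1)])
   ultimately have "koszul d p T H S \<mu> + P S \<mu> = \<omega>' S \<mu> + (P S \<mu> + P S \<mu>)" using S(1) by (simp add: P_def)
   thus ?thesis using char2[of "P S \<mu>"] by simp
  qed
  have lin: "koszul d p T (\<lambda>S \<mu>. x S \<mu> + y S \<mu>) S \<mu> = koszul d p T x S \<mu> + koszul d p T y S \<mu>" for x y :: "nat set => ('a => nat) => 'f" and S \<mu>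
   by (simp add: koszul_def iota_add sum.distrib)
  have cycP: "koszul d p T P S \<mu> = 0" if S: "S \<subseteq> {..<d}" "{u. \<mu> u ~= 0} \<subseteq> T" for S \<mu>
  proof -
   have "koszul d p T (\<lambda>S \<mu>. koszul d p T H S \<mu> + P S \<mu>) S \<mu> = koszul d p T \<omega>' S \<mu>"
    unfolding koszul_def[of d p T _ S \<mu>] iota_def
   proof (intro sum.cong refl arg_cong2[of _ _ _ _ "(*)"])
    fix u s assume us: "u \<in> {u\<in>T. \<mu> u ~= 0}" "s \<in> {..<d} - S"
    have "{w. lower u \<mu> w ~= 0} \<subseteq> T" using S(2) us(1) by (auto simp: lower_def split: if_splits)
    thus "koszul d p T H (insert s S) (lower u \<mu>) + P (insert s S) (lower u \<mu>) = \<omega>' (insert s S) (lower u \<mu>)"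
     using eq us S(1) by simp
   qed
   thus ?thesis using lin[of "koszul d p T H" P] koszul_koszul[OF char2 T] IH(5)[OF S] by simp
  qed
  have "form_on d T (Suc k) a (\<lambda>S \<mu>. \<eta> S \<mu> + H S \<mu>)"
   using IH(1) formH unfolding form_on_def by (metis add_0)
  moreover have "koszul d p T (\<lambda>S \<mu>. \<eta> S \<mu> + H S \<mu>) S \<mu> + P S \<mu> = \<omega> S \<mu>" if S: "S \<subseteq> {..<d}" "{u. \<mu> u ~= 0} \<subseteq> T" for S \<mu>
   using lin[of \<eta> H S \<mu>] eq[OF S] IH(4)[OF S] by (simp add: add.assoc)
  ultimately have "good (insert v U) (\<lambda>S \<mu>. \<eta> S \<mu> + H S \<mu>) P"
   unfolding good_def using formP PU cycP by simp
  thus ?case by (intro exI)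
 qed
 obtain \<eta> \<omega>' where "good T \<eta> \<omega>'" using main[OF T order_refl] by auto
 note e = goodD[OF this]
 have "\<omega>' S \<mu> = 0" for S \<mu>
 proof (rule ccontr)
  assume ne: "\<omega>' S \<mu> ~= 0"
  hence "sum \<mu> T = 0" using e(3) by (intro sum.neutral) blast
  moreover have "sum \<mu> T = Suc a" using e(2) ne by (simp add: form_on_def)
  ultimately show False by simp
 qed
 thus ?thesis using e(1,4) by (intro exI[of _ \<eta>]) simp
qed

text \<open>Powers of distinct scalars form a Vandermonde matrix; the coefficients of the Lagrange
  interpolation polynomial for \<open>t v\<close>, of degree below \<open>d\<close>, give the dual
  vector.\<close>

lemma lagrange_dual:
 fixes t :: "'a => 'f::field"
 assumes T: "finite T" "card T \<le> d" "inj_on t T" and v: "v \<in> T"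
 shows "\<exists>q. \<forall>u\<in>T. (\<Sum>s<d. t u ^ s * q s) = (if u = v then 1 else 0)"
proof -
 define P where "P = (\<Prod>w\<in>T-{v}. [:- t w, 1:])"
 define c where "c = (\<Prod>w\<in>T-{v}. t v - t w)"
 have c: "c ~= 0" using T v by (auto simp: c_def inj_on_def)
 have "degree P \<le> (\<Sum>w\<in>T-{v}. degree [:- t w, 1:])" unfolding P_def using degree_prod_sum_le[of "T - {v}" "\<lambda>w. [:- t w, 1:]"] T(1) by (simp add: o_def)
 also have "\<dots> = card T - 1" using T(1) v by simp
 also have "\<dots> < d" using T v by (metis One_nat_def Suc_pred card_gt_0_iff empty_iff le_simps(3))
 finally have deg: "degree P < d" .
 have ev: "(\<Sum>s<d. t u ^ s * (poly.coeff P s / c)) = poly P (t u) / c" for u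
 proof -
  have "(\<Sum>s<d. poly.coeff P s * t u ^ s) = (\<Sum>s\<le>degree P. poly.coeff P s * t u ^ s)"
   using deg by (intro sum.mono_neutral_right) (auto simp: coeff_eq_0)
  hence "(\<Sum>s<d. poly.coeff P s * t u ^ s) = poly P (t u)" by (simp add: poly_altdef)
  thus ?thesis by (simp add: sum_divide_distrib[symmetric] mult.commute)
 qed
 have "poly P (t u) / c = (if u = v then 1 else 0)" if u: "u \<in> T" for u
 proof (cases "u = v")
  case True
  thus ?thesis using c by (simp add: P_def c_def poly_prod)
 next
  case False
  thus ?thesis using T(1) u by (auto simp: P_def poly_prod)
 qed
 thus ?thesis using ev by (intro exI[of _ "\<lambda>s. poly.coeff P s / c"]) simp
qed

lemma sum_sym_diff:
 fixes A B :: "'x::comm_monoid_add set"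
 assumes "finite A" "finite B" "\<And>x::'x. x + x = 0"
 shows "\<Sum>A + \<Sum>B = \<Sum>((A - B) \<union> (B - A))"
proof -
 have "\<Sum>A = \<Sum>(A \<inter> B) + \<Sum>(A - B)" "\<Sum>B = \<Sum>(A \<inter> B) + \<Sum>(B - A)"
  using sum.Int_Diff[OF assms(1), of "\<lambda>x. x" B] sum.Int_Diff[OF assms(2), of "\<lambda>x. x" A] by (simp_all add: Int_commute)
 moreover have "\<Sum>((A - B) \<union> (B - A)) = \<Sum>(A - B) + \<Sum>(B - A)"
  using assms by (intro sum.union_disjoint) auto
 moreover have "x + y + (x + z) = y + z" for x y z :: 'x
  using assms(3)[of x] by (metis add.assoc add.commute add_0)
 ultimately show ?thesis by simp
qed

definition bit_times :: "bit => 'x => 'x::zero" where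
 "bit_times b x = (if b = 0 then 0 else x)"

lemma bit_times_sum:
 assumes "\<And>x::'x::comm_monoid_add. x + x = 0"
 shows "bit_times (\<Sum>i\<in>I. b i) (x::'x) = (\<Sum>i\<in>I. bit_times (b i) x)"
proof -
 have add: "bit_times (a + b) x = bit_times a x + bit_times b x" for a b
  by (cases a; cases b) (simp_all add: bit_times_def assms)
 show ?thesis by (induction I rule: infinite_finite_induct) (simp_all add: add, simp_all add: bit_times_def)
qed

text \<open>Values in an elementary abelian 2-group can be expanded in an independent family, which
 reduces exactness to coefficients modulo 2.\<close>

lemma bit_exact_extend:
 fixes c :: "'a set => 'x::ab_group_add"
 assumes char2: "\<And>x::'x. x + x = 0" and V: "finite V" "\<Psi> \<subseteq> Pow V" and ex: "bit_exact V \<Psi> j"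
  and c: "on_level \<Psi> j c" "\<And>\<rho>. \<rho> \<in> \<Psi> ==> Suc (card \<rho>) = j ==> bdr V c \<rho> = 0"
 shows "\<exists>b :: 'a set => 'x. on_level \<Psi> (Suc j) b \<and> (\<forall>\<rho>\<in>\<Psi>. card \<rho> = j --> bdr V b \<rho> = c \<rho>)"
proof -
 have main: "\<exists>b :: 'a set => 'x. on_level \<Psi> (Suc j) b \<and> (\<forall>\<rho>\<in>\<Psi>. card \<rho> = j --> bdr V b \<rho> = c \<rho>)"
  if "finite E" "\<And>\<tau>. \<exists>S\<subseteq>E. c \<tau> = \<Sum>S" for E
  using that
 proof (induction "card E" arbitrary: E rule: less_induct)
  case less
  show ?case
  proof (cases "\<exists>S\<subseteq>E. S ~= {} \<and> \<Sum>S = 0")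
   case True
   \<comment> \<open>A vanishing subset sum expresses \<open>e0\<close> by other elements of
     \<open>E\<close>, so \<open>E\<close> can be shrunk without losing any value of
     \<open>c\<close>.\<close>
   then obtain S e0 where S: "S \<subseteq> E" "\<Sum>S = 0" "e0 \<in> S" by blast
   have finS: "finite S" using S less.prems(1) finite_subset by blast
   have "e0 + \<Sum>(S - {e0}) = 0" using sum.remove[OF finS S(3), of "\<lambda>x. x"] S(2) by simp
   hence e0: "\<Sum>{e0} = \<Sum>(S - {e0})" using char2[of e0] by (metis add_left_cancel sum.insert[of "{}"] finite.emptyI empty_iff sum.empty add.right_neutral)
   have "\<exists>S'\<subseteq>E-{e0}. c \<tau> = \<Sum>S'" for \<tau>
   proof -
    obtain A where A: "A \<subseteq> E" "c \<tau> = \<Sum>A" using less.prems(2) by blast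
    have finA: "finite A" using A less.prems(1) finite_subset by blast
    show ?thesis
    proof (cases "e0 \<in> A")
     case False
     thus ?thesis using A by (intro exI[of _ A]) auto
    next
     case True
     hence "c \<tau> = \<Sum>(A - {e0}) + \<Sum>(S - {e0})"
      using A(2) sum.remove[OF finA True, of "\<lambda>x. x"] e0 by (simp add: add.commute)
     also have "\<dots> = \<Sum>((A - {e0}) - (S - {e0}) \<union> ((S - {e0}) - (A - {e0})))"
      using finA finS char2 by (intro sum_sym_diff) auto
     finally show ?thesis using A(1) S(1) by (intro exI[of _ "(A - {e0}) - (S - {e0}) \<union> ((S - {e0}) - (A - {e0}))"]) auto
    qed
   qed
   moreover have "card (E - {e0}) < card E" using S less.prems(1) by (intro card_Diff1_less) auto
   ultimately show ?thesis using less.hyps[of "E - {e0}"] less.prems(1) by simp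
  next
   case False
   \<comment> \<open>Now subset sums determine their subsets, so an equation for \<open>c\<close>
     can be read off separately for each \<open>e\<close> in \<open>E\<close>, with bits as
     coefficients.\<close>
   hence ind: "T = {}" if "T \<subseteq> E" "\<Sum>T = 0" for T using that by blast
   define S where "S = (\<lambda>\<tau>. SOME T. T \<subseteq> E \<and> c \<tau> = \<Sum>T)"
   have S: "S \<tau> \<subseteq> E" "c \<tau> = \<Sum>(S \<tau>)" for \<tau>
    using someI_ex[of "\<lambda>T. T \<subseteq> E \<and> c \<tau> = \<Sum>T"] less.prems(2) unfolding S_def by blast+
   define ce where "ce = (\<lambda>e \<tau>. if e \<in> S \<tau> then (1::bit) else 0)"
   have c_eq: "c \<tau> = (\<Sum>e\<in>E. bit_times (ce e \<tau>) e)" for \<tau>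
    unfolding S(2)[of \<tau>] using S(1)[of \<tau>] less.prems(1)
    by (intro sum.mono_neutral_cong_left) (auto simp: ce_def bit_times_def)
   have bdr_eq: "bdr V (\<lambda>\<tau>. \<Sum>e\<in>E. bit_times (y e \<tau>) e) \<rho> = (\<Sum>e\<in>E. bit_times (bdr V (y e) \<rho>) e)" for y \<rho>
    unfolding bdr_def bit_times_sum[OF char2] by (rule sum.swap)
   have cyc: "bit_cycle V \<Psi> j (ce e)" if e: "e \<in> E" for e
    unfolding bit_cycle_def
   proof (intro conjI ballI impI)
    show "on_level \<Psi> j (ce e)"
     unfolding on_level_def
    proof (intro allI impI)
     fix \<tau> assume "ce e \<tau> ~= 0"
     hence "S \<tau> ~= {}" by (auto simp: ce_def split: if_splits)
     hence "c \<tau> ~= 0" using ind[OF S(1)[of \<tau>]] S(2)[of \<tau>] by auto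
     thus "\<tau> \<in> \<Psi> \<and> card \<tau> = j" using c(1) by (simp add: on_level_def)
    qed
    fix \<rho> assume \<rho>: "\<rho> \<in> \<Psi>" "Suc (card \<rho>) = j"
    have "c = (\<lambda>\<tau>. \<Sum>e\<in>E. bit_times (ce e \<tau>) e)" by (rule ext) (rule c_eq)
    hence "bdr V c \<rho> = (\<Sum>e\<in>E. bit_times (bdr V (ce e) \<rho>) e)" using bdr_eq[of ce \<rho>] by simp
    hence "(\<Sum>e\<in>E. bit_times (bdr V (ce e) \<rho>) e) = 0" using c(2)[OF \<rho>] by simp
    moreover have "(\<Sum>e\<in>E. bit_times (bdr V (ce e) \<rho>) e) = \<Sum>{e\<in>E. bdr V (ce e) \<rho> ~= 0}"
     using less.prems(1) by (intro sum.mono_neutral_cong_right) (auto simp: bit_times_def)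
    ultimately have "{e\<in>E. bdr V (ce e) \<rho> ~= 0} = {}" by (intro ind) auto
    thus "bdr V (ce e) \<rho> = 0" using e by blast
   qed
   define be where "be = (\<lambda>e. SOME b :: 'a set => bit. on_level \<Psi> (Suc j) b \<and> (\<forall>\<rho>\<in>\<Psi>. card \<rho> = j --> bdr V b \<rho> = ce e \<rho>))"
   have be: "on_level \<Psi> (Suc j) (be e) \<and> (\<forall>\<rho>\<in>\<Psi>. card \<rho> = j --> bdr V (be e) \<rho> = ce e \<rho>)" if "e \<in> E" for e
    unfolding be_def by (rule someI_ex[OF bit_exactD[OF ex cyc[OF that]]])
   show ?thesis
   proof (intro exI[of _ "\<lambda>\<tau>. \<Sum>e\<in>E. bit_times (be e \<tau>) e"] conjI ballI impI)
    show "on_level \<Psi> (Suc j) (\<lambda>\<tau>. \<Sum>e\<in>E. bit_times (be e \<tau>) e)"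
     unfolding on_level_def
    proof (intro allI impI)
     fix \<tau> assume "(\<Sum>e\<in>E. bit_times (be e \<tau>) e) ~= 0"
     then obtain e where "e \<in> E" "bit_times (be e \<tau>) e ~= 0" by (metis (mono_tags, lifting) sum.neutral)
     thus "\<tau> \<in> \<Psi> \<and> card \<tau> = Suc j" using be[of e] by (auto simp: on_level_def bit_times_def split: if_splits)
    qed
    fix \<rho> assume \<rho>: "\<rho> \<in> \<Psi>" "card \<rho> = j"
    have "bdr V (\<lambda>\<tau>. \<Sum>e\<in>E. bit_times (be e \<tau>) e) \<rho> = (\<Sum>e\<in>E. bit_times (ce e \<rho>) e)"
     unfolding bdr_eq using be \<rho> by (intro sum.cong) auto
    thus "bdr V (\<lambda>\<tau>. \<Sum>e\<in>E. bit_times (be e \<tau>) e) \<rho> = c \<rho>" using c_eq by simp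
   qed
  qed
 qed
 have "finite \<Psi>" using V by (meson finite_Pow_iff finite_subset)
 show ?thesis
 proof (rule main)
  show "finite (c ` \<Psi>)" using \<open>finite \<Psi>\<close> by simp
  fix \<tau>
  show "\<exists>S\<subseteq>c ` \<Psi>. c \<tau> = \<Sum>S"
  proof (cases "c \<tau> = 0")
   case True
   thus ?thesis by (intro exI[of _ "{}"]) simp
  next
   case False
   thus ?thesis using c(1) by (intro exI[of _ "{c \<tau>}"]) (auto simp: on_level_def)
  qed
 qed
qed

text \<open>The convexity clause says that \<open>\<Psi>\<close> is the difference of two complexes.
  The set \<open>\<sigma>\<close> ranges over all subsets of \<open>V\<close>, since faces of the
  removed complex also have relative links.\<close>

definition relative_CM :: "nat => 'a set => 'a set set => bool" where
 "relative_CM d V \<Psi> \<longleftrightarrow> finite V \<and> \<Psi> \<subseteq> Pow V \<and> (\<forall>\<tau>\<in>\<Psi>. card \<tau> \<le> d) \<and>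
   (\<forall>\<sigma>\<in>\<Psi>. \<forall>\<rho>\<in>\<Psi>. \<forall>\<tau>. \<sigma> \<subseteq> \<tau> \<and> \<tau> \<subseteq> \<rho> --> \<tau> \<in> \<Psi>) \<and>
   (\<forall>\<sigma>. \<sigma> \<subseteq> V --> (\<forall>j<d. bit_exact V (faces_above \<sigma> \<Psi>) j))"

section \<open>Resolution of weighted forms on a relative Cohen-Macaulay family\<close>

locale weighted_CM =
 fixes d :: nat and V :: "'a set" and \<Psi> :: "'a set set" and t :: "'a => 'f::field"
 assumes CM: "relative_CM d V \<Psi>" and char2: "\<And>x::'f. x + x = 0" and inj: "inj_on t V"
begin

lemmas CM_D = CM[unfolded relative_CM_def]
lemmas finV = CM_D[THEN conjunct1]
lemmas subV = CM_D[THEN conjunct2, THEN conjunct1]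
lemmas cardd = CM_D[THEN conjunct2, THEN conjunct2, THEN conjunct1, THEN bspec]

lemmas convex = CM_D[THEN conjunct2, THEN conjunct2, THEN conjunct2, THEN conjunct1, THEN bspec, THEN bspec, THEN spec, THEN mp, OF _ _ conjI]
lemmas exact = CM_D[THEN conjunct2, THEN conjunct2, THEN conjunct2, THEN conjunct2, THEN spec, THEN mp, THEN spec, THEN mp]

lemma fin_face: "\<tau> \<in> \<Psi> ==> finite \<tau>"
 using subV finV by (meson PowD finite_subset subsetD)

definition pw :: "'a => nat => 'f" where
 "pw v s = t v ^ s"

lemma dual: "\<tau> \<subseteq> V ==> card \<tau> \<le> d ==> v \<in> \<tau> ==> \<exists>q. \<forall>u\<in>\<tau>. (\<Sum>s<d. pw u s * q s) = (if u = v then 1 else 0)"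
 unfolding pw_def by (rule lagrange_dual) (auto intro: finite_subset[OF _ finV] inj_on_subset[OF inj])

text \<open>Faces have \<open>j\<close> vertices, forms degree \<open>k\<close>, monomials degree
  \<open>a\<close>. A monomial may only involve vertices of its face, so for a fixed monomial the
  chains are those on the faces above its support.\<close>

definition chain_on :: "nat => nat => nat => ('a set => nat set => ('a => nat) => 'f) => bool" where
 "chain_on j k a c \<longleftrightarrow> (\<forall>\<tau> S \<mu>. c \<tau> S \<mu> ~= 0 --> \<tau> \<in> \<Psi> \<and> card \<tau> = j \<and> S \<subseteq> {..<d} \<and> card S = k \<and> {u. \<mu> u ~= 0} \<subseteq> \<tau> \<and> sum \<mu> V = a)"

definition mbd :: "('a set => nat set => ('a => nat) => 'f) => 'a set => nat set => ('a => nat) => 'f" where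
 "mbd c \<rho> S \<mu> = (if \<rho> \<in> \<Psi> \<and> {u. \<mu> u ~= 0} \<subseteq> \<rho> then bdr V (\<lambda>\<tau>. c \<tau> S \<mu>) \<rho> else 0)"

definition kos :: "('a set => nat set => ('a => nat) => 'f) => 'a set => nat set => ('a => nat) => 'f" where
 "kos c \<tau> S \<mu> = (if \<tau> \<in> \<Psi> \<and> S \<subseteq> {..<d} \<and> {u. \<mu> u ~= 0} \<subseteq> \<tau> then koszul d pw \<tau> (c \<tau>) S \<mu> else 0)"

lemma chain_onD: "chain_on j k a c ==> c \<tau> S \<mu> ~= 0 ==> \<tau> \<in> \<Psi> \<and> card \<tau> = j \<and> S \<subseteq> {..<d} \<and> card S = k \<and> {u. \<mu> u ~= 0} \<subseteq> \<tau> \<and> sum \<mu> V = a"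
 by (simp add: chain_on_def)

lemma bdr_add: "bdr V (\<lambda>\<tau>. x \<tau> + y \<tau>) \<rho> = bdr V x \<rho> + (bdr V y \<rho> :: 'f)"
 by (simp add: bdr_def sum.distrib)

lemma mbd_add: "mbd (\<lambda>\<tau> S \<mu>. x \<tau> S \<mu> + y \<tau> S \<mu>) \<rho> S \<mu> = mbd x \<rho> S \<mu> + mbd y \<rho> S \<mu>"
 by (simp add: mbd_def bdr_add)

lemma kos_add: "kos (\<lambda>\<tau> S \<mu>. x \<tau> S \<mu> + y \<tau> S \<mu>) \<rho> S \<mu> = kos x \<rho> S \<mu> + kos y \<rho> S \<mu>"
 by (simp add: kos_def koszul_def iota_add sum.distrib)

lemma mbd_mbd:
 assumes c: "chain_on j k a c"
 shows "mbd (mbd c) \<rho> S \<mu> = 0"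
proof (cases "\<rho> \<in> \<Psi> \<and> {u. \<mu> u ~= 0} \<subseteq> \<rho>")
 case True
 have "mbd c (insert v \<rho>) S \<mu> = bdr V (\<lambda>\<tau>. c \<tau> S \<mu>) (insert v \<rho>)" for v
 proof (cases "insert v \<rho> \<in> \<Psi>")
  case False
  have "c (insert w (insert v \<rho>)) S \<mu> = 0" for w
  proof (rule ccontr)
   assume "c (insert w (insert v \<rho>)) S \<mu> ~= 0"
   hence "insert w (insert v \<rho>) \<in> \<Psi>" using chain_onD[OF c] by simp
   hence "insert v \<rho> \<in> \<Psi>" using convex[of \<rho> "insert w (insert v \<rho>)" "insert v \<rho>"] True by auto
   thus False using False by simp
  qed
  thus ?thesis using False by (simp add: mbd_def bdr_def)
 qed (use True in \<open>auto simp: mbd_def\<close>)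
 hence "mbd (mbd c) \<rho> S \<mu> = bdr V (bdr V (\<lambda>\<tau>. c \<tau> S \<mu>)) \<rho>"
  using True by (simp add: mbd_def[of "mbd c"] bdr_def[of _ "\<lambda>\<tau>. mbd c \<tau> S \<mu>"] bdr_def[of _ "bdr V (\<lambda>\<tau>. c \<tau> S \<mu>)"])
 also have "\<dots> = 0" by (rule bdr_bdr[OF finV char2])
 finally show ?thesis .
qed (auto simp: mbd_def)

lemma kos_mbd:
 assumes c: "chain_on j k a c"
 shows "kos (mbd c) \<rho> S \<mu> = mbd (kos c) \<rho> S \<mu>"
proof (cases "\<rho> \<in> \<Psi> \<and> S \<subseteq> {..<d} \<and> {u. \<mu> u ~= 0} \<subseteq> \<rho>")
 case False
 thus ?thesis by (auto simp: kos_def mbd_def bdr_def intro!: sum.neutral)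
next
 case True
 let ?U = "{u\<in>\<rho>. \<mu> u ~= 0}"
 have "kos (mbd c) \<rho> S \<mu> = (\<Sum>u\<in>?U. iota d (pw u) (\<lambda>S. \<Sum>v\<in>V-\<rho>. c (insert v \<rho>) S (lower u \<mu>)) S)"
 proof -
  have "{w. lower u \<mu> w ~= 0} \<subseteq> \<rho>" if "u \<in> ?U" for u using True that by (auto simp: lower_def split: if_splits)
  thus ?thesis using True by (simp add: kos_def koszul_def mbd_def bdr_def)
 qed
 also have "\<dots> = (\<Sum>v\<in>V-\<rho>. \<Sum>u\<in>?U. iota d (pw u) (\<lambda>S. c (insert v \<rho>) S (lower u \<mu>)) S)"
  unfolding iota_sum by (rule sum.swap)
 also have "\<dots> = (\<Sum>v\<in>V-\<rho>. kos c (insert v \<rho>) S \<mu>)"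
 proof (rule sum.cong[OF refl])
  fix v assume "v \<in> V - \<rho>"
  show "(\<Sum>u\<in>?U. iota d (pw u) (\<lambda>S. c (insert v \<rho>) S (lower u \<mu>)) S) = kos c (insert v \<rho>) S \<mu>"
  proof (cases "insert v \<rho> \<in> \<Psi>")
   case False
   have "c (insert v \<rho>) S \<mu> = 0" for S \<mu>
    using chain_onD[OF c, of "insert v \<rho>" S \<mu>] False by auto
   thus ?thesis using False by (simp add: kos_def)
  next
   case T: True
   have "{u\<in>insert v \<rho>. \<mu> u ~= 0} = ?U" using True by auto
   moreover have "{u. \<mu> u ~= 0} \<subseteq> insert v \<rho>" using True by auto
   ultimately show ?thesis using T True by (simp add: kos_def koszul_def)
  qed
 qed
 also have "\<dots> = mbd (kos c) \<rho> S \<mu>" using True by (simp add: mbd_def bdr_def)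
 finally show ?thesis .
qed

lemma kos_chain:
 assumes c: "chain_on j (Suc k) a c"
 shows "chain_on j k (Suc a) (kos c)"
 unfolding chain_on_def
proof (intro allI impI)
 fix \<tau> S \<mu> assume ne: "kos c \<tau> S \<mu> ~= 0"
 hence t: "\<tau> \<in> \<Psi>" "S \<subseteq> {..<d}" "{u. \<mu> u ~= 0} \<subseteq> \<tau>" and k: "koszul d pw \<tau> (c \<tau>) S \<mu> ~= 0"
  by (auto simp: kos_def split: if_splits)
 obtain u where u: "u \<in> \<tau>" "\<mu> u ~= 0" "iota d (pw u) (\<lambda>S. c \<tau> S (lower u \<mu>)) S ~= 0"
 proof (rule sum.not_neutral_contains_not_neutral[OF k[unfolded koszul_def]])
  fix u assume "u \<in> {u\<in>\<tau>. \<mu> u ~= 0}" "iota d (pw u) (\<lambda>S. c \<tau> S (lower u \<mu>)) S ~= 0"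
  thus thesis by (intro that[of u]) simp_all
 qed
 obtain s where s: "s \<in> {..<d} - S" "c \<tau> (insert s S) (lower u \<mu>) ~= 0"
 proof (rule sum.not_neutral_contains_not_neutral[OF u(3)[unfolded iota_def]])
  fix s assume "s \<in> {..<d} - S" "pw u s * c \<tau> (insert s S) (lower u \<mu>) ~= 0"
  thus thesis by (intro that[of s]) simp_all
 qed
 have uV: "u \<in> V" using u(1) t(1) subV by blast
 have f: "card \<tau> = j" "card (insert s S) = Suc k" "sum (lower u \<mu>) V = a" using chain_onD[OF c s(2)] by auto
 have "finite S" using t(2) finite_subset by blast
 hence "card S = k" using f(2) s(1) by simp
 moreover have "sum \<mu> V = Suc (sum (lower u \<mu>) V)"
  unfolding lower_def using u(2) by (simp add: sum.remove[OF finV uV])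
 ultimately show "\<tau> \<in> \<Psi> \<and> card \<tau> = j \<and> S \<subseteq> {..<d} \<and> card S = k \<and> {u. \<mu> u ~= 0} \<subseteq> \<tau> \<and> sum \<mu> V = Suc a"
  using t f by simp
qed

lemma mbd_chain:
 assumes c: "chain_on (Suc j) k a c"
 shows "chain_on j k a (mbd c)"
 unfolding chain_on_def
proof (intro allI impI)
 fix \<tau> S \<mu> assume ne: "mbd c \<tau> S \<mu> ~= 0"
 hence t: "\<tau> \<in> \<Psi>" "{u. \<mu> u ~= 0} \<subseteq> \<tau>" and k: "bdr V (\<lambda>\<tau>. c \<tau> S \<mu>) \<tau> ~= 0"
  by (auto simp: mbd_def split: if_splits)
 obtain v where v: "v \<in> V - \<tau>" "c (insert v \<tau>) S \<mu> ~= 0"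
  by (rule sum.not_neutral_contains_not_neutral[OF k[unfolded bdr_def]]) simp
 have f: "card (insert v \<tau>) = Suc j" "S \<subseteq> {..<d}" "card S = k" "sum \<mu> V = a" using chain_onD[OF c v(2)] by auto
 hence "card \<tau> = j" using v(1) fin_face[OF t(1)] by simp
 thus "\<tau> \<in> \<Psi> \<and> card \<tau> = j \<and> S \<subseteq> {..<d} \<and> card S = k \<and> {u. \<mu> u ~= 0} \<subseteq> \<tau> \<and> sum \<mu> V = a"
  using t f by simp
qed

text \<open>With the exterior index \<open>S\<close> and the monomial fixed, exactness is that of
  constant coefficients above the support of the monomial, extended from bits to the field by
  \<open>bit_exact_extend\<close>.\<close>

lemma exact_monomials:
 assumes c: "chain_on j k a c" and cyc: "\<And>\<rho> S \<mu>. mbd c \<rho> S \<mu> = 0" and j: "j < d"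
 shows "\<exists>b. chain_on (Suc j) k a b \<and> (\<forall>\<rho> S \<mu>. mbd b \<rho> S \<mu> = c \<rho> S \<mu>)"
proof -
 let ?F = "\<lambda>\<mu>::'a => nat. faces_above {u. \<mu> u ~= 0} \<Psi>"
 have ex: "\<exists>b. on_level (?F \<mu>) (Suc j) b \<and> (\<forall>\<rho>\<in>?F \<mu>. card \<rho> = j --> bdr V b \<rho> = c \<rho> S \<mu>)" if \<mu>: "{u. \<mu> u ~= 0} \<subseteq> V" for S \<mu>
 proof (rule bit_exact_extend[OF char2 finV _ exact[OF \<mu> j]])
  show "?F \<mu> \<subseteq> Pow V" using subV by (auto simp: faces_above_def)
  show "on_level (?F \<mu>) j (\<lambda>\<rho>. c \<rho> S \<mu>)" using chain_onD[OF c] by (simp add: on_level_def faces_above_def)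
  show "bdr V (\<lambda>\<rho>. c \<rho> S \<mu>) \<rho> = 0" if "\<rho> \<in> ?F \<mu>" for \<rho>
   using cyc[of \<rho> S \<mu>] that by (simp add: mbd_def faces_above_def)
 qed
 define bb where "bb = (\<lambda>S \<mu>. SOME b. on_level (?F \<mu>) (Suc j) b \<and> (\<forall>\<rho>\<in>?F \<mu>. card \<rho> = j --> bdr V b \<rho> = c \<rho> S \<mu>))"
 have bb: "on_level (?F \<mu>) (Suc j) (bb S \<mu>) \<and> (\<forall>\<rho>\<in>?F \<mu>. card \<rho> = j --> bdr V (bb S \<mu>) \<rho> = c \<rho> S \<mu>)" if "{u. \<mu> u ~= 0} \<subseteq> V" for S \<mu>
  unfolding bb_def by (rule someI_ex[OF ex[OF that]])
 define ok where "ok = (\<lambda>S \<mu>. S \<subseteq> {..<d} \<and> card S = k \<and> {u. \<mu> u ~= (0::nat)} \<subseteq> V \<and> sum \<mu> V = a)"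
 define b where "b = (\<lambda>\<tau> S \<mu>. if ok S \<mu> then bb S \<mu> \<tau> else 0)"
 have lev: "\<tau> \<in> \<Psi> \<and> {u. \<mu> u ~= 0} \<subseteq> \<tau> \<and> card \<tau> = Suc j \<and> ok S \<mu>" if nz: "b \<tau> S \<mu> ~= 0" for \<tau> S \<mu>
 proof -
  have o: "ok S \<mu>" by (rule ccontr) (use nz in \<open>simp add: b_def\<close>)
  hence nb: "bb S \<mu> \<tau> ~= 0" using nz by (simp add: b_def)
  have "{u. \<mu> u ~= 0} \<subseteq> V" using o by (simp add: ok_def)
  note l = bb[OF this, of S, THEN conjunct1, unfolded on_level_def, THEN spec, THEN mp, OF nb]
  thus ?thesis using o by (simp add: faces_above_def)
 qed
 have "chain_on (Suc j) k a b"
  unfolding chain_on_def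
 proof (intro allI impI)
  fix \<tau> S \<mu> assume "b \<tau> S \<mu> ~= 0"
  note l = lev[OF this]
  thus "\<tau> \<in> \<Psi> \<and> card \<tau> = Suc j \<and> S \<subseteq> {..<d} \<and> card S = k \<and> {u. \<mu> u ~= 0} \<subseteq> \<tau> \<and> sum \<mu> V = a"
   by (simp add: ok_def)
 qed
 moreover have "mbd b \<rho> S \<mu> = c \<rho> S \<mu>" for \<rho> S \<mu>
 proof (cases "\<rho> \<in> \<Psi> \<and> {u. \<mu> u ~= 0} \<subseteq> \<rho> \<and> card \<rho> = j \<and> ok S \<mu>")
  case True
  hence "\<rho> \<in> ?F \<mu>" "{u. \<mu> u ~= 0} \<subseteq> V" by (auto simp: faces_above_def ok_def)
  hence "bdr V (bb S \<mu>) \<rho> = c \<rho> S \<mu>" using bb[of \<mu> S] True by simp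
  thus ?thesis using True by (simp add: mbd_def b_def)
 next
  case False
  have "c \<rho> S \<mu> = 0"
  proof (rule ccontr)
   assume "c \<rho> S \<mu> ~= 0"
   note f = chain_onD[OF c this]
   hence "{u. \<mu> u ~= 0} \<subseteq> V" using subV by blast
   thus False using False f by (simp add: ok_def)
  qed
  moreover have "mbd b \<rho> S \<mu> = 0"
  proof (rule ccontr)
   assume nz: "mbd b \<rho> S \<mu> ~= 0"
   note f = chain_onD[OF mbd_chain[OF \<open>chain_on (Suc j) k a b\<close>] nz]
   hence "{u. \<mu> u ~= 0} \<subseteq> V" using subV by blast
   thus False using False f by (simp add: ok_def)
  qed
  ultimately show ?thesis by simp
 qed
 ultimately show ?thesis by (intro exI[of _ b]) simp
qed

text \<open>The Koszul complex resolves the exterior powers by direct sums of constant coefficient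
 systems; each step of the dimension shift costs one degree of exactness.\<close>

theorem exact_koszul_cycles:
 assumes "chain_on j k a c" "\<And>\<rho> S \<mu>. mbd c \<rho> S \<mu> = 0" "\<And>\<tau> S \<mu>. kos c \<tau> S \<mu> = 0" "j + k < d"
 shows "\<exists>b. chain_on (Suc j) k a b \<and> (\<forall>\<rho> S \<mu>. mbd b \<rho> S \<mu> = c \<rho> S \<mu>) \<and> (\<forall>\<rho> S \<mu>. kos b \<rho> S \<mu> = 0)"
 using assms
proof (induction k arbitrary: j a c)
 case 0
 obtain b where b: "chain_on (Suc j) 0 a b" "\<forall>\<rho> S \<mu>. mbd b \<rho> S \<mu> = c \<rho> S \<mu>"
  using exact_monomials[OF 0(1,2)] 0(4) by auto
 have "b \<tau> (insert s S) \<mu> = 0" for \<tau> s S \<mu>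
 proof (rule ccontr)
  assume "b \<tau> (insert s S) \<mu> ~= 0"
  hence "insert s S \<subseteq> {..<d}" "card (insert s S) = 0" using chain_onD[OF b(1)] by blast+
  thus False by (metis card_0_eq finite_lessThan finite_subset insert_not_empty)
 qed
 hence "kos b \<tau> S \<mu> = 0" for \<tau> S \<mu> by (simp add: kos_def koszul_def iota_def)
 thus ?case using b by (intro exI[of _ b]) simp
next
 case (Suc k)
 have jd: "j < d" using Suc.prems(4) by simp
 \<comment> \<open>A filling \<open>b\<close> that ignores the Koszul condition. Its defect
   \<open>kos b\<close> is a cycle of form degree one less, so induction fills it by
   \<open>e\<close>, one level higher in \<open>j\<close>.\<close>
 obtain b where b: "chain_on (Suc j) (Suc k) a b" and mb: "\<And>\<rho> S \<mu>. mbd b \<rho> S \<mu> = c \<rho> S \<mu>"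
  using exact_monomials[OF Suc.prems(1,2) jd] by auto
 have kb: "chain_on (Suc j) k (Suc a) (kos b)" by (rule kos_chain[OF b])
 have "mbd b = c" by (intro ext) (rule mb)
 hence 1: "mbd (kos b) \<rho> S \<mu> = 0" for \<rho> S \<mu> using kos_mbd[OF b, of \<rho> S \<mu>] Suc.prems(3) by simp
 have 2: "kos (kos b) \<tau> S \<mu> = 0" for \<tau> S \<mu>
 proof (cases "\<tau> \<in> \<Psi> \<and> S \<subseteq> {..<d} \<and> {u. \<mu> u ~= 0} \<subseteq> \<tau>")
  case True
  have "koszul d pw \<tau> (kos b \<tau>) S \<mu> = koszul d pw \<tau> (koszul d pw \<tau> (b \<tau>)) S \<mu>"
   unfolding koszul_def[of d pw \<tau> _ S \<mu>] iota_def
  proof (intro sum.cong refl arg_cong2[of _ _ _ _ "(*)"])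
   fix u s assume us: "u \<in> {u\<in>\<tau>. \<mu> u ~= 0}" "s \<in> {..<d} - S"
   have "{w. lower u \<mu> w ~= 0} \<subseteq> \<tau>" using True us(1) by (auto simp: lower_def split: if_splits)
   thus "kos b \<tau> (insert s S) (lower u \<mu>) = koszul d pw \<tau> (b \<tau>) (insert s S) (lower u \<mu>)"
    using True us by (simp add: kos_def)
  qed
  also have "\<dots> = 0" using koszul_koszul[OF char2 fin_face] True by blast
  finally show ?thesis by (simp add: kos_def[of "kos b"])
 qed (auto simp: kos_def)
 obtain e where e: "chain_on (Suc (Suc j)) k (Suc a) e" "\<And>\<rho> S \<mu>. mbd e \<rho> S \<mu> = kos b \<rho> S \<mu>" "\<And>\<rho> S \<mu>. kos e \<rho> S \<mu> = 0"
  using Suc.IH[OF kb 1 2] Suc.prems(4) by auto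
 have fib: "\<exists>\<eta>. form_on d \<tau> (Suc k) a \<eta> \<and> (\<forall>S \<mu>. S \<subseteq> {..<d} --> {u. \<mu> u ~= 0} \<subseteq> \<tau> --> koszul d pw \<tau> \<eta> S \<mu> = e \<tau> S \<mu>)"
  if t: "\<tau> \<in> \<Psi>" for \<tau>
 proof (rule koszul_exact[OF char2 fin_face[OF t]])
  have tV: "\<tau> \<subseteq> V" using t subV by blast
  show "\<exists>q. \<forall>u\<in>\<tau>. (\<Sum>s<d. pw u s * q s) = (if u = v then 1 else 0)" if "v \<in> \<tau>" for v
   by (rule dual[OF tV cardd[OF t] that])
  show "form_on d \<tau> k (Suc a) (e \<tau>)"
   unfolding form_on_def
  proof (intro allI impI)
   fix S \<mu> assume "e \<tau> S \<mu> ~= 0"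
   note f = chain_onD[OF e(1) this]
   have "sum \<mu> \<tau> = sum \<mu> V" using f tV finV by (intro sum.mono_neutral_left) auto
   thus "S \<subseteq> {..<d} \<and> card S = k \<and> {u. \<mu> u ~= 0} \<subseteq> \<tau> \<and> sum \<mu> \<tau> = Suc a" using f by simp
  qed
  show "koszul d pw \<tau> (e \<tau>) S \<mu> = 0" if "S \<subseteq> {..<d}" "{u. \<mu> u ~= 0} \<subseteq> \<tau>" for S \<mu>
   using e(3)[of \<tau> S \<mu>] that t by (simp add: kos_def)
 qed
 define \<eta> where "\<eta> = (\<lambda>\<tau>. if \<tau> \<in> \<Psi> \<and> card \<tau> = Suc (Suc j) then (SOME \<eta>. form_on d \<tau> (Suc k) a \<eta> \<and> (\<forall>S \<mu>. S \<subseteq> {..<d} --> {u. \<mu> u ~= 0} \<subseteq> \<tau> --> koszul d pw \<tau> \<eta> S \<mu> = e \<tau> S \<mu>)) else (\<lambda>_ _. 0))"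
 have \<eta>: "form_on d \<tau> (Suc k) a (\<eta> \<tau>) \<and> (\<forall>S \<mu>. S \<subseteq> {..<d} --> {u. \<mu> u ~= 0} \<subseteq> \<tau> --> koszul d pw \<tau> (\<eta> \<tau>) S \<mu> = e \<tau> S \<mu>)"
  if "\<tau> \<in> \<Psi>" "card \<tau> = Suc (Suc j)" for \<tau>
  using someI_ex[OF fib[OF that(1)]] that by (simp add: \<eta>_def)
 have ch\<eta>: "chain_on (Suc (Suc j)) (Suc k) a \<eta>"
  unfolding chain_on_def
 proof (intro allI impI)
  fix \<tau> S \<mu> assume ne: "\<eta> \<tau> S \<mu> ~= 0"
  hence t: "\<tau> \<in> \<Psi>" "card \<tau> = Suc (Suc j)" by (auto simp: \<eta>_def split: if_splits)
  hence "form_on d \<tau> (Suc k) a (\<eta> \<tau>)" using \<eta> by blast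
  hence f: "S \<subseteq> {..<d} \<and> card S = Suc k \<and> {u. \<mu> u ~= 0} \<subseteq> \<tau> \<and> sum \<mu> \<tau> = a" using ne by (simp add: form_on_def)
  have "\<tau> \<subseteq> V" using t(1) subV by blast
  hence "sum \<mu> \<tau> = sum \<mu> V" using f finV by (intro sum.mono_neutral_left) auto
  thus "\<tau> \<in> \<Psi> \<and> card \<tau> = Suc (Suc j) \<and> S \<subseteq> {..<d} \<and> card S = Suc k \<and> {u. \<mu> u ~= 0} \<subseteq> \<tau> \<and> sum \<mu> V = a" using f t by simp
 qed
 have kos\<eta>: "kos \<eta> \<tau> S \<mu> = e \<tau> S \<mu>" for \<tau> S \<mu>
 proof (cases "\<tau> \<in> \<Psi> \<and> card \<tau> = Suc (Suc j) \<and> S \<subseteq> {..<d} \<and> {u. \<mu> u ~= 0} \<subseteq> \<tau>")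
  case True
  thus ?thesis using \<eta>[of \<tau>] by (simp add: kos_def)
 next
  case False
  have "e \<tau> S \<mu> = 0" using chain_onD[OF e(1), of \<tau> S \<mu>] False by auto
  moreover have "kos \<eta> \<tau> S \<mu> = 0" using chain_onD[OF kos_chain[OF ch\<eta>], of \<tau> S \<mu>] False by auto
  ultimately show ?thesis by simp
 qed
 \<comment> \<open>Fibrewise Koszul exactness gave \<open>kos \<eta> = e\<close>. Adding the
   boundary of \<open>\<eta>\<close> keeps the boundary of \<open>b\<close> and cancels its Koszul
   defect.\<close>
 define b' where "b' = (\<lambda>\<tau> S \<mu>. b \<tau> S \<mu> + mbd \<eta> \<tau> S \<mu>)"
 have ch: "chain_on (Suc j) (Suc k) a b'"
  unfolding chain_on_def
 proof (intro allI impI)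
  fix \<tau> S \<mu> assume "b' \<tau> S \<mu> ~= 0"
  hence "b \<tau> S \<mu> ~= 0 \<or> mbd \<eta> \<tau> S \<mu> ~= 0" by (auto simp: b'_def)
  thus "\<tau> \<in> \<Psi> \<and> card \<tau> = Suc j \<and> S \<subseteq> {..<d} \<and> card S = Suc k \<and> {u. \<mu> u ~= 0} \<subseteq> \<tau> \<and> sum \<mu> V = a"
   using chain_onD[OF b, of \<tau> S \<mu>] chain_onD[OF mbd_chain[OF ch\<eta>], of \<tau> S \<mu>] by blast
 qed
 have m: "mbd b' \<rho> S \<mu> = c \<rho> S \<mu>" for \<rho> S \<mu>
  unfolding b'_def mbd_add using mb mbd_mbd[OF ch\<eta>] by simp
 have e_kos: "kos \<eta> = e" by (intro ext) (rule kos\<eta>)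
 have "kos b' \<rho> S \<mu> = 0" for \<rho> S \<mu>
 proof -
  have "kos b' \<rho> S \<mu> = kos b \<rho> S \<mu> + kos (mbd \<eta>) \<rho> S \<mu>" unfolding b'_def by (rule kos_add)
  also have "kos (mbd \<eta>) \<rho> S \<mu> = kos b \<rho> S \<mu>" unfolding kos_mbd[OF ch\<eta>] e_kos by (rule e(2))
  finally show ?thesis using char2 by simp
 qed
 thus ?case by (intro exI[of _ b'] conjI allI ch m)
qed

end

section \<open>Dimensions of spaces of forms killed by contractions\<close>

definition forms :: "nat => ('u => nat => 'f::field) => 'b set => nat => ('b => 'u set) => ('b \<times> nat set => 'f) set" where
 "forms d p F k U = {x. (\<forall>\<tau> S. x (\<tau>, S) ~= 0 --> \<tau> \<in> F \<and> S \<subseteq> {..<d} \<and> card S = k) \<and>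
   (\<forall>\<tau>\<in>F. \<forall>u\<in>U \<tau>. \<forall>S\<subseteq>{..<d}. iota d (p u) (\<lambda>S. x (\<tau>, S)) S = 0)}"

lemma forms_supported:
 fixes p :: "'u => nat => 'f::field" and U :: "'b => 'u set"
 shows "forms d p F k U \<subseteq> supported_on (F \<times> {S. S \<subseteq> {..<d} \<and> card S = k})"
proof
 fix x :: "'b \<times> nat set => 'f" assume x: "x \<in> forms d p F k U"
 have "x i = 0" if i: "i \<notin> F \<times> {S. S \<subseteq> {..<d} \<and> card S = k}" for i
 proof (rule ccontr)
  assume "x i ~= 0"
  hence "x (fst i, snd i) ~= 0" by simp
  hence "fst i \<in> F \<and> snd i \<subseteq> {..<d} \<and> card (snd i) = k" using x unfolding forms_def mem_Collect_eq by blast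
  thus False using i by (simp add: mem_Times_iff)
 qed
 thus "x \<in> supported_on (F \<times> {S. S \<subseteq> {..<d} \<and> card S = k})" by (simp add: supported_on_def)
qed

lemma forms_subspace:
 fixes p :: "'u => nat => 'f::field" and U :: "'b => 'u set"
 shows "fv.subspace (forms d p F k U)"
 unfolding fv.subspace_def
proof (intro conjI ballI allI)
 show "0 \<in> forms d p F k U" by (simp add: forms_def)
next
 fix x y :: "'b \<times> nat set => 'f" assume x: "x \<in> forms d p F k U" and y: "y \<in> forms d p F k U"
 show "x + y \<in> forms d p F k U"
  unfolding forms_def mem_Collect_eq
 proof (intro conjI allI impI ballI)
  fix \<tau> S assume "(x + y) (\<tau>, S) ~= 0"
  hence "x (\<tau>, S) ~= 0 \<or> y (\<tau>, S) ~= 0" by auto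
  thus "\<tau> \<in> F" "S \<subseteq> {..<d}" "card S = k" using x y unfolding forms_def mem_Collect_eq by blast+
 next
  fix \<tau> u S assume "\<tau> \<in> F" "u \<in> U \<tau>" "S \<subseteq> {..<d}"
  thus "iota d (p u) (\<lambda>S. (x + y) (\<tau>, S)) S = 0" using x y by (simp add: forms_def iota_add)
 qed
next
 fix a and x :: "'b \<times> nat set => 'f" assume x: "x \<in> forms d p F k U"
 show "scale_fun a x \<in> forms d p F k U"
  unfolding forms_def mem_Collect_eq
 proof (intro conjI allI impI ballI)
  fix \<tau> S assume "scale_fun a x (\<tau>, S) ~= 0"
  hence "x (\<tau>, S) ~= 0" by (auto simp: scale_fun_def)
  thus "\<tau> \<in> F" "S \<subseteq> {..<d}" "card S = k" using x unfolding forms_def mem_Collect_eq by blast+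
 next
  fix \<tau> u S assume "\<tau> \<in> F" "u \<in> U \<tau>" "S \<subseteq> {..<d}"
  thus "iota d (p u) (\<lambda>S. scale_fun a x (\<tau>, S)) S = 0" using x by (simp add: forms_def scale_fun_def iota_scale)
 qed
qed

lemma finite_forms_support: "finite F ==> finite (F \<times> {S. S \<subseteq> {..<d::nat} \<and> card S = k})"
 by (intro finite_cartesian_product) auto

text \<open>Conditions are imposed one vertex at a time. Contraction by \<open>p v\<close> maps the
  forms of degree \<open>Suc k\<close> killed by \<open>U\<close> onto those of degree
  \<open>k\<close> killed by \<open>insert v U\<close>, a preimage being the wedge with the dual
  vector; rank and nullity then reproduce Pascal's rule.\<close>

lemma dim_forms_fibre:
 fixes p :: "'u => nat => 'f::field" and \<tau> :: 'b
 assumes char2: "\<And>x::'f. x + x = 0" and T: "finite T" "card T \<le> d"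
  and dual: "\<And>v. v \<in> T ==> \<exists>q. \<forall>u\<in>T. (\<Sum>s<d. p u s * q s) = (if u = v then 1 else 0)"
  and "U \<subseteq> T"
 shows "fv.dim (forms d p {\<tau>} k (\<lambda>_. U)) = (d - card U) choose k"
proof -
 have "finite U" using assms(5) T(1) finite_subset by blast
 thus ?thesis using assms(5)
 proof (induction U arbitrary: k rule: finite_induct)
  case empty
  have "forms d p {\<tau>} k (\<lambda>_. {}) = supported_on ({\<tau>} \<times> {S. S \<subseteq> {..<d} \<and> card S = k})"
  proof (rule subset_antisym[OF forms_supported], rule subsetI)
   fix x :: "'b \<times> nat set => 'f" assume x: "x \<in> supported_on ({\<tau>} \<times> {S. S \<subseteq> {..<d} \<and> card S = k})"
   have "\<tau>' \<in> {\<tau>} \<and> S \<subseteq> {..<d} \<and> card S = k" if nz: "x (\<tau>', S) ~= 0" for \<tau>' S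
    using x nz unfolding supported_on_def mem_Collect_eq by blast
   thus "x \<in> forms d p {\<tau>} k (\<lambda>_. {})" by (simp add: forms_def)
  qed
  thus ?case
   by (simp add: dim_supported_on[OF finite_forms_support] card_cartesian_product n_subsets)
 next
  case (insert v U)
  let ?L = "\<lambda>k U. forms d p {\<tau>} k (\<lambda>_. U)"
  define h :: "('b \<times> nat set => 'f) => 'b \<times> nat set => 'f"
   where "h = (\<lambda>x (\<rho>, S). if \<rho> = \<tau> \<and> S \<subseteq> {..<d} then iota d (p v) (\<lambda>S. x (\<tau>, S)) S else 0)"
  have lin: "h (x + y) = h x + h y" "h (scale_fun a x) = scale_fun a (h x)" for x y a
   by (auto simp: h_def fun_eq_iff iota_add scale_fun_def iota_scale)
  have v: "v \<in> T" using insert.prems by simp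
  have ker: "{x\<in>?L k U. h x = 0} = ?L k (insert v U)" for k
   by (auto simp: forms_def h_def fun_eq_iff)
  have rk: "fv.dim (?L k U) = fv.dim (h ` ?L k U) + fv.dim (?L k (insert v U))" for k
   unfolding ker[symmetric] by (rule rank_nullity[OF finite_forms_support forms_supported forms_subspace lin]) simp
  obtain q where q: "\<And>u. u \<in> T ==> (\<Sum>s<d. p u s * q s) = (if u = v then 1 else 0)" using dual[OF v] by blast
  have im0: "x = 0" if x: "x \<in> h ` ?L 0 U" for x
  proof -
   obtain y where y: "y \<in> ?L 0 U" "x = h y" using x by blast
   have "y (\<tau>, insert s S) = 0" if "S \<subseteq> {..<d}" for s S
   proof (rule ccontr)
    assume "y (\<tau>, insert s S) ~= 0"
    hence "card (insert s S) = 0" using y(1) unfolding forms_def mem_Collect_eq by blast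
    moreover have "finite (insert s S)" using that finite_subset by auto
    ultimately show False by simp
   qed
   thus "x = 0" unfolding y(2) by (simp add: h_def iota_def fun_eq_iff)
  qed
  have im: "h ` ?L (Suc k) U = ?L k (insert v U)" for k
  proof (rule subset_antisym)
   show "h ` ?L (Suc k) U \<subseteq> ?L k (insert v U)"
   proof (rule image_subsetI)
    fix y assume y: "y \<in> ?L (Suc k) U"
    have sup: "\<rho> = \<tau> \<and> S \<subseteq> {..<d} \<and> card S = k" if nz: "h y (\<rho>, S) ~= 0" for \<rho> S
    proof -
     have S: "\<rho> = \<tau>" "S \<subseteq> {..<d}" and i: "iota d (p v) (\<lambda>S. y (\<tau>, S)) S ~= 0"
      using nz by (auto simp: h_def split: if_splits)
     obtain s where s: "s \<in> {..<d} - S" "p v s * y (\<tau>, insert s S) ~= 0"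
      by (rule sum.not_neutral_contains_not_neutral[OF i[unfolded iota_def]])
     hence "y (\<tau>, insert s S) ~= 0" by auto
     hence "card (insert s S) = Suc k" using y unfolding forms_def mem_Collect_eq by blast
     moreover have "finite S" using S(2) finite_subset by auto
     ultimately show ?thesis using S s(1) by simp
    qed
    have "iota d (p u) (\<lambda>S. h y (\<tau>, S)) S = 0" if u: "u \<in> insert v U" and S: "S \<subseteq> {..<d}" for u S
    proof -
     have eq: "iota d (p u) (\<lambda>S. h y (\<tau>, S)) S = iota d (p u) (iota d (p v) (\<lambda>S. y (\<tau>, S))) S"
      unfolding iota_def[of d "p u"] using S by (intro sum.cong) (auto simp: h_def)
     show ?thesis
     proof (cases "u = v")
      case True
      thus ?thesis unfolding eq by (simp add: iota_iota[OF char2])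
     next
      case False
      hence "iota d (p u) (\<lambda>S. y (\<tau>, S)) S' = 0" if "S' \<subseteq> {..<d}" for S'
       using u y that by (simp add: forms_def)
      hence "iota d (p v) (iota d (p u) (\<lambda>S. y (\<tau>, S))) S = 0"
       unfolding iota_def[of d "p v"] using S by (intro sum.neutral) auto
      thus ?thesis unfolding eq using iota_comm[OF char2] by metis
     qed
    qed
    thus "h y \<in> ?L k (insert v U)" using sup unfolding forms_def by simp
   qed
   show "?L k (insert v U) \<subseteq> h ` ?L (Suc k) U"
   proof
    fix y assume y: "y \<in> ?L k (insert v U)"
    define x where "x = (\<lambda>(\<rho>, S). if \<rho> = \<tau> \<and> S \<subseteq> {..<d} then wedge q (\<lambda>S. y (\<tau>, S)) S else 0)"
    have iy: "iota d (p u) (\<lambda>S. y (\<tau>, S)) S = 0" if "u \<in> insert v U" "S \<subseteq> {..<d}" for u S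
     using y that unfolding forms_def mem_Collect_eq by blast
    have ix: "iota d (p u) (\<lambda>S. x (\<tau>, S)) S = (if u = v then y (\<tau>, S) else 0)" if u: "u \<in> insert v U" and S: "S \<subseteq> {..<d}" for u S
    proof -
     have "iota d (p u) (\<lambda>S. x (\<tau>, S)) S = iota d (p u) (wedge q (\<lambda>S. y (\<tau>, S))) S"
      unfolding iota_def using S by (intro sum.cong) (auto simp: x_def)
     moreover have "wedge q (iota d (p u) (\<lambda>S. y (\<tau>, S))) S = 0"
      unfolding wedge_def
     proof (intro sum.neutral ballI)
      fix s assume "s \<in> S"
      have "S - {s} \<subseteq> {..<d}" using S by auto
      from iy[OF u this] show "q s * iota d (p u) (\<lambda>S. y (\<tau>, S)) (S - {s}) = 0" by simp
     qed
     moreover have "u \<in> T" using u insert.prems by blast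
     ultimately show ?thesis using clifford[OF char2 S, of "p u" q "\<lambda>S. y (\<tau>, S)"] q[of u] by simp
    qed
    have sup: "\<rho> = \<tau> \<and> S \<subseteq> {..<d} \<and> card S = Suc k" if nz: "x (\<rho>, S) ~= 0" for \<rho> S
    proof -
     have S: "\<rho> = \<tau>" "S \<subseteq> {..<d}" and i: "wedge q (\<lambda>S. y (\<tau>, S)) S ~= 0"
      using nz by (auto simp: x_def split: if_splits)
     obtain s where s: "s \<in> S" "q s * y (\<tau>, S - {s}) ~= 0"
      by (rule sum.not_neutral_contains_not_neutral[OF i[unfolded wedge_def]])
     hence "y (\<tau>, S - {s}) ~= 0" by auto
     hence "card (S - {s}) = k" using y unfolding forms_def mem_Collect_eq by blast
     moreover have "finite S" using S(2) finite_subset by auto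
     ultimately show ?thesis using S s(1) by (metis card.remove)
    qed
    have "x \<in> ?L (Suc k) U" using sup ix insert.hyps(2) unfolding forms_def by auto
    moreover have "h x = y"
    proof
     fix z show "h x z = y z"
     proof (cases "fst z = \<tau> \<and> snd z \<subseteq> {..<d}")
      case True
      thus ?thesis using ix[of v "snd z"] by (cases z) (simp add: h_def)
     next
      case False
      hence "y z = 0" using y unfolding forms_def mem_Collect_eq by (metis prod.collapse singletonD)
      thus ?thesis using False by (cases z) (auto simp: h_def)
     qed
    qed
    ultimately show "y \<in> h ` ?L (Suc k) U" by blast
   qed
  qed
  have "card (insert v U) \<le> d" using insert.prems T card_mono le_trans by metis
  then obtain e where e: "d - card U = Suc e" "d - card (insert v U) = e"
   using insert.hyps by (metis Suc_diff_Suc Suc_le_lessD card_insert_disjoint)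
  have IH: "fv.dim (?L k U) = Suc e choose k" for k using insert.IH insert.prems e(1) by simp
  have "fv.dim (?L k (insert v U)) = e choose k" for k
  proof (induction k)
   case 0
   have "h ` ?L 0 U \<subseteq> {0}" using im0 by blast
   hence "fv.dim (h ` ?L 0 U) \<le> card ({} :: ('b \<times> nat set => 'f) set)" by (intro fv.dim_le_card) auto
   thus ?case using rk[of 0] IH[of 0] by simp
  next
   case (Suc k)
   thus ?case using rk[of "Suc k"] IH[of "Suc k"] unfolding im by simp
  qed
  thus ?case using e(2) by simp
 qed
qed

lemma dim_forms:
 fixes p :: "'u => nat => 'f::field" and U :: "'b => 'u set"
 assumes char2: "\<And>x::'f. x + x = 0" and "finite F"
  and F: "\<And>\<tau>. \<tau> \<in> F ==> finite (U \<tau>) \<and> card (U \<tau>) = j" "j \<le> d"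
  and dual: "\<And>\<tau> v. \<tau> \<in> F ==> v \<in> U \<tau> ==> \<exists>q. \<forall>u\<in>U \<tau>. (\<Sum>s<d. p u s * q s) = (if u = v then 1 else 0)"
 shows "fv.dim (forms d p F k U) = card F * ((d - j) choose k)"
 using assms(2,3,5)
proof (induction F rule: finite_induct)
 case empty
 have "forms d p {} k U \<subseteq> {0}" by (auto simp: forms_def fun_eq_iff)
 hence "fv.dim (forms d p {} k U) \<le> card ({} :: ('b \<times> nat set => 'f) set)" by (intro fv.dim_le_card) auto
 thus ?case by simp
next
 case (insert \<tau> F)
 define h :: "('b \<times> nat set => 'f) => 'b \<times> nat set => 'f" where "h = (\<lambda>x (\<rho>, S). if \<rho> = \<tau> then x (\<rho>, S) else 0)"
 have lin: "h (x + y) = h x + h y" "h (scale_fun a x) = scale_fun a (h x)" for x y a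
  by (auto simp: h_def fun_eq_iff scale_fun_def)
 have h: "h x (\<rho>, S) = (if \<rho> = \<tau> then x (\<rho>, S) else 0)" for x \<rho> S by (simp add: h_def)
 have ker: "{x\<in>forms d p (insert \<tau> F) k U. h x = 0} = forms d p F k U"
 proof (rule Set.set_eqI, rule iffI)
  fix x assume x: "x \<in> {x\<in>forms d p (insert \<tau> F) k U. h x = 0}"
  have "x (\<tau>, S) = 0" for S
  proof -
   have "h x (\<tau>, S) = 0" using x by simp
   thus ?thesis by (simp add: h)
  qed
  thus "x \<in> forms d p F k U" using x unfolding forms_def mem_Collect_eq by (metis insert_iff)
 next
  fix x assume x: "x \<in> forms d p F k U"
  have 0: "x (\<tau>, S) = 0" for S using x insert.hyps(2) unfolding forms_def mem_Collect_eq by blast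
  hence "h x = 0" by (simp add: h_def fun_eq_iff)
  thus "x \<in> {x\<in>forms d p (insert \<tau> F) k U. h x = 0}" using x 0 unfolding forms_def by simp
 qed
 have im: "h ` forms d p (insert \<tau> F) k U = forms d p {\<tau>} k (\<lambda>_. U \<tau>)"
 proof (rule subset_antisym)
  show "h ` forms d p (insert \<tau> F) k U \<subseteq> forms d p {\<tau>} k (\<lambda>_. U \<tau>)"
   by (rule image_subsetI) (simp add: forms_def h)
  show "forms d p {\<tau>} k (\<lambda>_. U \<tau>) \<subseteq> h ` forms d p (insert \<tau> F) k U"
  proof
   fix y assume y: "y \<in> forms d p {\<tau>} k (\<lambda>_. U \<tau>)"
   have 0: "y (\<rho>, S) = 0" if "\<rho> ~= \<tau>" for \<rho> S using y that unfolding forms_def mem_Collect_eq by blast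
   have hy: "h y = y"
   proof
    fix z show "h y z = y z" using 0[of "fst z" "snd z"] by (cases z) (simp add: h)
   qed
   have "y \<in> forms d p (insert \<tau> F) k U"
    unfolding forms_def mem_Collect_eq
   proof (intro conjI ballI allI impI)
    fix \<rho> S assume "y (\<rho>, S) ~= 0"
    thus "\<rho> \<in> insert \<tau> F" "S \<subseteq> {..<d}" "card S = k" using y unfolding forms_def mem_Collect_eq by blast+
   next
    fix \<rho> u S assume a: "\<rho> \<in> insert \<tau> F" "u \<in> U \<rho>" "S \<subseteq> {..<d}"
    show "iota d (p u) (\<lambda>S. y (\<rho>, S)) S = 0"
    proof (cases "\<rho> = \<tau>")
     case True
     thus ?thesis using y a unfolding forms_def by simp
    next
     case False
     thus ?thesis using 0[OF False] by simp
    qed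
   qed
   thus "y \<in> h ` forms d p (insert \<tau> F) k U" using hy by (metis imageI)
  qed
 qed
 have fin: "finite (insert \<tau> F)" using insert.hyps by simp
 have "fv.dim (forms d p (insert \<tau> F) k U) = fv.dim (h ` forms d p (insert \<tau> F) k U) + fv.dim {x\<in>forms d p (insert \<tau> F) k U. h x = 0}"
  by (rule rank_nullity[OF finite_forms_support[OF fin] forms_supported forms_subspace lin])
 also have "\<dots> = ((d - j) choose k) + card F * ((d - j) choose k)"
 proof -
  have c: "finite (U \<tau>)" "card (U \<tau>) = j" using insert.prems(1)[of \<tau>] by auto
  have "fv.dim (forms d p {\<tau>} k (\<lambda>_. U \<tau>)) = (d - card (U \<tau>)) choose k"
   by (rule dim_forms_fibre[OF char2 c(1)]) (use c F(2) insert.prems(2) in auto)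
  thus ?thesis unfolding im ker using insert.IH insert.prems c by simp
 qed
 finally show ?case using insert.hyps by simp
qed

context weighted_CM
begin

text \<open>Forms are placed at the constant monomial, so that the complex of forms sits in
  polynomial degree 0 of the weighted chains.\<close>

definition mono_chain :: "('a set \<times> nat set => 'f) => 'a set => nat set => ('a => nat) => 'f" where
 "mono_chain x \<tau> S \<mu> = (if \<mu> = (\<lambda>_. 0) then x (\<tau>, S) else 0)"

definition face_forms :: "nat => nat => ('a set \<times> nat set => 'f) set" where
 "face_forms k j = {x. chain_on j k 0 (mono_chain x) \<and> (\<forall>\<tau> S \<mu>. kos (mono_chain x) \<tau> S \<mu> = 0)}"

definition form_bdr :: "('a set \<times> nat set => 'f) => 'a set \<times> nat set => 'f" where
 "form_bdr x = (\<lambda>(\<rho>, S). if \<rho> \<in> \<Psi> then bdr V (\<lambda>\<tau>. x (\<tau>, S)) \<rho> else 0)"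

lemma mono_form_bdr: "mono_chain (form_bdr x) = mbd (mono_chain x)"
 by (rule ext)+ (auto simp: mono_chain_def form_bdr_def mbd_def bdr_def)

lemma face_forms_eq: "face_forms k j = forms d pw {\<tau>\<in>\<Psi>. card \<tau> = j} k (\<lambda>\<tau>. \<tau>)"
proof (rule Set.set_eqI)
 fix x
 have 1: "chain_on j k 0 (mono_chain x) \<longleftrightarrow> (\<forall>\<tau> S. x (\<tau>, S) ~= 0 --> \<tau> \<in> {\<tau>\<in>\<Psi>. card \<tau> = j} \<and> S \<subseteq> {..<d} \<and> card S = k)"
 proof
  assume c: "chain_on j k 0 (mono_chain x)"
  show "\<forall>\<tau> S. x (\<tau>, S) ~= 0 --> \<tau> \<in> {\<tau>\<in>\<Psi>. card \<tau> = j} \<and> S \<subseteq> {..<d} \<and> card S = k"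
  proof (intro allI impI)
   fix \<tau> S assume "x (\<tau>, S) ~= 0"
   hence "mono_chain x \<tau> S (\<lambda>_. 0) ~= 0" by (simp add: mono_chain_def)
   from chain_onD[OF c this] show "\<tau> \<in> {\<tau>\<in>\<Psi>. card \<tau> = j} \<and> S \<subseteq> {..<d} \<and> card S = k" by simp
  qed
 next
  assume r: "\<forall>\<tau> S. x (\<tau>, S) ~= 0 --> \<tau> \<in> {\<tau>\<in>\<Psi>. card \<tau> = j} \<and> S \<subseteq> {..<d} \<and> card S = k"
  show "chain_on j k 0 (mono_chain x)"
   unfolding chain_on_def
  proof (intro allI impI)
   fix \<tau> S \<mu> assume nz: "mono_chain x \<tau> S \<mu> ~= 0"
   hence m: "\<mu> = (\<lambda>_. 0)" by (metis mono_chain_def)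
   hence "x (\<tau>, S) ~= 0" using nz by (simp add: mono_chain_def)
   thus "\<tau> \<in> \<Psi> \<and> card \<tau> = j \<and> S \<subseteq> {..<d} \<and> card S = k \<and> {u. \<mu> u ~= 0} \<subseteq> \<tau> \<and> sum \<mu> V = 0" using r m by simp
  qed
 qed
 have 2: "(\<forall>\<tau> S \<mu>. kos (mono_chain x) \<tau> S \<mu> = 0) \<longleftrightarrow> (\<forall>\<tau>\<in>{\<tau>\<in>\<Psi>. card \<tau> = j}. \<forall>u\<in>\<tau>. \<forall>S\<subseteq>{..<d}. iota d (pw u) (\<lambda>S. x (\<tau>, S)) S = 0)"
  if c: "chain_on j k 0 (mono_chain x)"
 proof
  assume r: "\<forall>\<tau> S \<mu>. kos (mono_chain x) \<tau> S \<mu> = 0"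
  show "\<forall>\<tau>\<in>{\<tau>\<in>\<Psi>. card \<tau> = j}. \<forall>u\<in>\<tau>. \<forall>S\<subseteq>{..<d}. iota d (pw u) (\<lambda>S. x (\<tau>, S)) S = 0"
  proof (intro ballI allI impI)
   fix \<tau> u S assume a: "\<tau> \<in> {\<tau>\<in>\<Psi>. card \<tau> = j}" "u \<in> \<tau>" "S \<subseteq> {..<d}"
   \<comment> \<open>The coefficient of the Koszul differential at the single variable
     \<open>u\<close> is the contraction by \<open>pw u\<close>, so Koszul cycles on the constant
     monomial are the forms killed by all vertices of their face.\<close>
   define \<mu> where "\<mu> = (\<lambda>w. if w = u then 1 else (0::nat))"
   have s: "{w. \<mu> w ~= 0} = {u}" "{w\<in>\<tau>. \<mu> w ~= 0} = {u}" using a(2) by (auto simp: \<mu>_def)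
   have "lower u \<mu> = (\<lambda>_. 0)" by (auto simp: lower_def \<mu>_def)
   hence "kos (mono_chain x) \<tau> S \<mu> = iota d (pw u) (\<lambda>S. x (\<tau>, S)) S"
    unfolding kos_def koszul_def s using a by (simp add: mono_chain_def)
   thus "iota d (pw u) (\<lambda>S. x (\<tau>, S)) S = 0" using r by simp
  qed
 next
  assume r: "\<forall>\<tau>\<in>{\<tau>\<in>\<Psi>. card \<tau> = j}. \<forall>u\<in>\<tau>. \<forall>S\<subseteq>{..<d}. iota d (pw u) (\<lambda>S. x (\<tau>, S)) S = 0"
  show "\<forall>\<tau> S \<mu>. kos (mono_chain x) \<tau> S \<mu> = 0"
  proof (intro allI)
   fix \<tau> S \<mu>
   have "iota d (pw u) (\<lambda>S. mono_chain x \<tau> S (lower u \<mu>)) S = 0" if t: "\<tau> \<in> \<Psi>" and u: "u \<in> \<tau>" and S: "S \<subseteq> {..<d}" for u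
   proof (cases "card \<tau> = j \<and> lower u \<mu> = (\<lambda>_. 0)")
    case True
    thus ?thesis using r t u S by (simp add: mono_chain_def)
   next
    case False
    have "mono_chain x \<tau> S' (lower u \<mu>) = 0" for S'
    proof (rule ccontr)
     assume nz: "mono_chain x \<tau> S' (lower u \<mu>) ~= 0"
     hence "lower u \<mu> = (\<lambda>_. 0)" by (metis mono_chain_def)
     moreover have "card \<tau> = j" using chain_onD[OF c nz] by simp
     ultimately show False using False by simp
    qed
    thus ?thesis by simp
   qed
   thus "kos (mono_chain x) \<tau> S \<mu> = 0" by (simp add: kos_def koszul_def)
  qed
 qed
 show "x \<in> face_forms k j \<longleftrightarrow> x \<in> forms d pw {\<tau>\<in>\<Psi>. card \<tau> = j} k (\<lambda>\<tau>. \<tau>)"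
  unfolding face_forms_def forms_def mem_Collect_eq using 1 2 by blast
qed

lemma fin\<Psi>: "finite \<Psi>"
 using subV finV by (meson finite_Pow_iff finite_subset)

lemma dim_face_forms:
 assumes "j \<le> d"
 shows "fv.dim (face_forms k j) = card {\<tau>\<in>\<Psi>. card \<tau> = j} * ((d - j) choose k)"
 unfolding face_forms_eq
proof (rule dim_forms[OF char2])
 show "finite {\<tau>\<in>\<Psi>. card \<tau> = j}" using fin\<Psi> by simp
 show "finite \<tau> \<and> card \<tau> = j" if "\<tau> \<in> {\<tau>\<in>\<Psi>. card \<tau> = j}" for \<tau> using that fin_face by simp
 show "\<exists>q. \<forall>u\<in>\<tau>. (\<Sum>s<d. pw u s * q s) = (if u = v then 1 else 0)" if "\<tau> \<in> {\<tau>\<in>\<Psi>. card \<tau> = j}" "v \<in> \<tau>" for \<tau> v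
  using that subV assms by (intro dual) auto
qed (rule assms)

lemma exact_face_forms:
 assumes "j + k < d"
 shows "form_bdr ` face_forms k (Suc j) = {x\<in>face_forms k j. form_bdr x = 0}"
proof (rule subset_antisym)
 show "form_bdr ` face_forms k (Suc j) \<subseteq> {x\<in>face_forms k j. form_bdr x = 0}"
 proof (rule image_subsetI)
  fix x assume "x \<in> face_forms k (Suc j)"
  hence x: "chain_on (Suc j) k 0 (mono_chain x)" "\<And>\<tau> S \<mu>. kos (mono_chain x) \<tau> S \<mu> = 0" by (simp_all add: face_forms_def)
  have "chain_on j k 0 (mono_chain (form_bdr x))" unfolding mono_form_bdr by (rule mbd_chain[OF x(1)])
  moreover have "kos (mono_chain (form_bdr x)) \<tau> S \<mu> = 0" for \<tau> S \<mu>
  proof -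
   have "kos (mono_chain x) = (\<lambda>_ _ _. 0)" using x(2) by (intro ext)
   hence "mbd (kos (mono_chain x)) \<tau> S \<mu> = 0" by (simp add: mbd_def bdr_def)
   thus ?thesis unfolding mono_form_bdr kos_mbd[OF x(1)] .
  qed
  moreover have "form_bdr (form_bdr x) = 0"
  proof
   fix z :: "'a set \<times> nat set"
   have "mono_chain (form_bdr (form_bdr x)) (fst z) (snd z) (\<lambda>_. 0) = 0"
    unfolding mono_form_bdr by (rule mbd_mbd[OF x(1)])
   thus "form_bdr (form_bdr x) z = 0 z" by (simp add: mono_chain_def)
  qed
  ultimately show "form_bdr x \<in> {x\<in>face_forms k j. form_bdr x = 0}" by (simp add: face_forms_def)
 qed
 show "{x\<in>face_forms k j. form_bdr x = 0} \<subseteq> form_bdr ` face_forms k (Suc j)"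
 proof
  fix x assume "x \<in> {x\<in>face_forms k j. form_bdr x = 0}"
  hence x: "chain_on j k 0 (mono_chain x)" "\<And>\<tau> S \<mu>. kos (mono_chain x) \<tau> S \<mu> = 0" "form_bdr x = 0" by (simp_all add: face_forms_def)
  have "mbd (mono_chain x) \<rho> S \<mu> = 0" for \<rho> S \<mu>
   unfolding mono_form_bdr[symmetric] x(3) by (simp add: mono_chain_def)
  from exact_koszul_cycles[OF x(1) this x(2) assms]
  obtain b where b: "chain_on (Suc j) k 0 b" "\<And>\<rho> S \<mu>. mbd b \<rho> S \<mu> = mono_chain x \<rho> S \<mu>" "\<And>\<rho> S \<mu>. kos b \<rho> S \<mu> = 0"
   by auto
  define y where "y = (\<lambda>(\<tau>, S). b \<tau> S (\<lambda>_. 0))"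
  have my: "mono_chain y = b"
  proof (intro ext)
   fix \<tau> S \<mu>
   show "mono_chain y \<tau> S \<mu> = b \<tau> S \<mu>"
   proof (cases "\<mu> = (\<lambda>_. 0)")
    case False
    have "b \<tau> S \<mu> = 0"
    proof (rule ccontr)
     assume "b \<tau> S \<mu> ~= 0"
     note f = chain_onD[OF b(1) this]
     have "\<mu> u = 0" for u
     proof (cases "u \<in> V")
      case True
      thus ?thesis using f finV by (simp add: sum_eq_0_iff)
     next
      case False
      have "\<tau> \<subseteq> V" using f subV by blast
      thus ?thesis using f False by blast
     qed
     thus False using False by blast
    qed
    thus ?thesis using False by (simp add: mono_chain_def)
   qed (simp add: mono_chain_def y_def)
  qed
  have "y \<in> face_forms k (Suc j)" unfolding face_forms_def mem_Collect_eq my using b(1,3) by simp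
  moreover have "form_bdr y = x"
  proof
   fix z
   have "mono_chain (form_bdr y) (fst z) (snd z) (\<lambda>_. 0) = mono_chain x (fst z) (snd z) (\<lambda>_. 0)"
    unfolding mono_form_bdr my by (rule b(2))
   thus "form_bdr y z = x z" by (simp add: mono_chain_def)
  qed
  ultimately show "x \<in> form_bdr ` face_forms k (Suc j)" by blast
 qed
qed

lemma form_bdr_linear: "form_bdr (x + y) = form_bdr x + form_bdr y" "form_bdr (scale_fun a x) = scale_fun a (form_bdr x)"
 by (auto simp: form_bdr_def fun_eq_iff bdr_def sum.distrib scale_fun_def sum_distrib_left)

lemma form_bdr_0: "x \<in> face_forms k 0 ==> form_bdr x = 0"
proof
 fix z :: "'a set \<times> nat set"
 assume x: "x \<in> face_forms k 0"
 have "x (insert v (fst z), snd z) = 0" if v: "v \<in> V - fst z" "fst z \<in> \<Psi>" for v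
 proof (rule ccontr)
  assume nz: "x (insert v (fst z), snd z) ~= 0"
  hence "card (insert v (fst z)) = 0" using x unfolding face_forms_eq forms_def mem_Collect_eq by blast
  thus False using fin_face[OF v(2)] by simp
 qed
 thus "form_bdr x z = 0 z" by (simp add: form_bdr_def bdr_def split_def)
qed

text \<open>The complex of forms of degree \<open>k\<close> is exact below level
  \<open>d - k\<close>, so its alternating sum of dimensions is the dimension of the cycles at that
  level.\<close>

theorem alternating_sum_nonneg:
 assumes "k \<le> d"
 shows "0 \<le> (\<Sum>j\<le>d - k. (-1) ^ (d - k - j) * (int (card {\<tau>\<in>\<Psi>. card \<tau> = j}) * int ((d - j) choose k)))"
proof -
 have fin: "finite (\<Psi> \<times> Pow {..<d})" using fin\<Psi> by simp
 have sup: "face_forms k j \<subseteq> supported_on (\<Psi> \<times> Pow {..<d})" for j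
 proof -
  have "face_forms k j \<subseteq> supported_on ({\<tau>\<in>\<Psi>. card \<tau> = j} \<times> {S. S \<subseteq> {..<d} \<and> card S = k})"
   unfolding face_forms_eq by (rule forms_supported)
  moreover have "{\<tau>\<in>\<Psi>. card \<tau> = j} \<times> {S. S \<subseteq> {..<d} \<and> card S = k} \<subseteq> \<Psi> \<times> Pow {..<d}" by auto
  ultimately show ?thesis unfolding supported_on_def by blast
 qed
 have "(\<Sum>j\<le>d - k. (-1) ^ (d - k - j) * int (fv.dim (face_forms k j))) = int (fv.dim {x\<in>face_forms k (d - k). form_bdr x = 0})"
 proof (rule euler_characteristic[OF fin sup _ form_bdr_linear form_bdr_0])
  show "fv.subspace (face_forms k j)" for j unfolding face_forms_eq by (rule forms_subspace)
 qed (auto intro!: exact_face_forms)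
 moreover have "int (fv.dim (face_forms k j)) = int (card {\<tau>\<in>\<Psi>. card \<tau> = j}) * int ((d - j) choose k)" if "j \<le> d - k" for j
  using dim_face_forms[of j k] that by simp
 ultimately show ?thesis by simp
qed

end

text \<open>The coefficient of \<open>t^i\<close> after expanding the powers of
  \<open>1 - t\<close>, as confirmed in \<open>h_number_eq\<close>.\<close>

definition h_entry :: "nat => 'a set set => nat => int" where
 "h_entry d \<Psi> i = (\<Sum>j\<le>i. (-1) ^ (i - j) * (int (card {\<tau>\<in>\<Psi>. card \<tau> = j}) * int ((d - j) choose (i - j))))"

text \<open>Forms of degree \<open>d - i\<close> are used, because
  \<open>(d - j) choose (d - i)\<close> equals \<open>(d - j) choose (i - j)\<close>.\<close>

theorem h_entry_nonneg:
 assumes "relative_CM d V \<Psi>" "i \<le> d"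
 shows "0 \<le> h_entry d \<Psi> i"
proof -
 have "finite V" using assms(1) by (simp add: relative_CM_def)
 then obtain g :: "'a => nat" where g: "inj_on g V" using finite_imp_inj_to_nat_seg by blast
 \<comment> \<open>All vertices need distinct scalars in characteristic 2, for which the two-element
   field is too small in general: powers of the indeterminate in its rational function field
   serve.\<close>
 define t :: "'a => bit poly fract" where "t = (\<lambda>v. Fract (Polynomial.monom 1 (g v)) 1)"
 have char2: "x + x = 0" for x :: "bit poly fract"
 proof (cases x)
  case (Fract a b)
  have "p + p = 0" for p :: "bit poly" by (rule poly_eqI) (simp only: coeff_add bit_add_self coeff_0)
  thus ?thesis using Fract by (simp add: Zero_fract_def eq_fract)
 qed
 have "inj_on t V" using g by (auto simp: inj_on_def t_def eq_fract monom_eq_iff')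
 then interpret weighted_CM d V \<Psi> t using assms(1) char2 by unfold_locales
 have "(d - j) choose (d - i) = (d - j) choose (i - j)" if "j \<le> i" for j
  using binomial_symmetric[of "i - j" "d - j"] that assms(2) by simp
 thus ?thesis
  using alternating_sum_nonneg[of "d - i"] assms(2) by (simp add: h_entry_def)
qed

lemma homology_ball_pure:
 assumes HB: "homology_ball d V \<Delta> B" and \<sigma>: "\<sigma> \<in> \<Delta>"
 shows "\<exists>\<phi>\<in>\<Delta>. \<sigma> \<subseteq> \<phi> \<and> card \<phi> = d"
proof -
 have V: "finite V" and sub: "\<Delta> \<subseteq> Pow V" and cd: "\<forall>\<sigma>\<in>\<Delta>. card \<sigma> \<le> d"
  and ex: "\<forall>\<sigma>\<in>\<Delta>. \<forall>j<d. bit_exact V (faces_above \<sigma> \<Delta>) j"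
  using HB[unfolded homology_ball_def] by simp_all
 have "finite \<Delta>" using V sub by (meson finite_Pow_iff finite_subset)
 then obtain \<phi> where \<phi>: "\<phi> \<in> \<Delta>" "\<sigma> \<subseteq> \<phi>" "\<forall>\<tau>\<in>\<Delta>. \<phi> \<subseteq> \<tau> --> \<tau> = \<phi>"
  using finite_has_maximal2[OF _ \<sigma>] by metis
 have F: "faces_above \<phi> \<Delta> = {\<phi>}" using \<phi> by (auto simp: faces_above_def)
 have "card \<phi> = d"
 proof (rule ccontr)
  assume "card \<phi> ~= d"
  hence j: "card \<phi> < d" using cd \<phi>(1) by (simp add: le_neq_implies_less)
  have "bit_exact V {\<phi>} (card \<phi>)" using ex \<phi>(1) j F by metis
  moreover have "bit_cycle V {\<phi>} (card \<phi>) (\<lambda>\<tau>. if \<tau> = \<phi> then 1 else 0)"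
   by (simp add: bit_cycle_def on_level_def)
  ultimately obtain b :: "'a set => bit" where b: "on_level {\<phi>} (Suc (card \<phi>)) b" "bdr V b \<phi> = 1"
   using bit_exactD by fastforce
  have "b = (\<lambda>_. 0)" using b(1) by (intro ext) (metis b(1) n_not_Suc_n on_level_def singletonD)
  thus False using b(2) by (simp add: bdr_def)
 qed
 thus ?thesis using \<phi> by blast
qed

text \<open>All homology below the top vanishes, so the alternating count is the dimension of the
  top cycles: zero over a boundary face, one over an interior face, where the facet sum spans. The
  Dehn-Sommerville relations come from here.\<close>

theorem euler_links:
 assumes HB: "homology_ball d V \<Delta> B" and \<sigma>: "\<sigma> \<in> \<Delta>"
 shows "(\<Sum>j\<le>d. (-1) ^ (d - j) * int (card {\<tau>\<in>faces_above \<sigma> \<Delta>. card \<tau> = j})) = (if \<sigma> \<in> B then 0 else 1)"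
proof -
 let ?F = "faces_above \<sigma> \<Delta>"
 note H = HB[unfolded homology_ball_def]
 have V: "finite V" and sub: "\<Delta> \<subseteq> Pow V" and down: "down_closed \<Delta>" and cd: "\<forall>\<sigma>\<in>\<Delta>. card \<sigma> \<le> d"
  and ex: "\<forall>\<sigma>\<in>\<Delta>. \<forall>j<d. bit_exact V (faces_above \<sigma> \<Delta>) j"
  and top0: "\<forall>\<sigma>\<in>B. \<forall>z. bit_cycle V (faces_above \<sigma> \<Delta>) d z --> z = (\<lambda>_. 0)"
  and top1: "\<forall>\<sigma>\<in>\<Delta>-B. bit_cycle V (faces_above \<sigma> \<Delta>) d (facet_sum d \<sigma> \<Delta>) \<and>
    (\<forall>z. bit_cycle V (faces_above \<sigma> \<Delta>) d z --> z = (\<lambda>_. 0) \<or> z = facet_sum d \<sigma> \<Delta>)"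
  using H by simp_all
 have finF: "finite ?F" using V sub by (auto simp: faces_above_def intro: finite_subset)
 have Fsub: "\<And>\<tau>. \<tau> \<in> ?F ==> \<tau> \<subseteq> V" using sub by (auto simp: faces_above_def)
 define D :: "nat => ('a set => bit) set" where "D = (\<lambda>j. supported_on {\<tau>\<in>?F. card \<tau> = j})"
 have D: "x \<in> D j \<longleftrightarrow> on_level ?F j x" for x j by (auto simp: D_def supported_on_def on_level_def)
 define h :: "('a set => bit) => 'a set => bit" where "h = (\<lambda>x \<rho>. if \<rho> \<in> ?F then bdr V x \<rho> else 0)"
 have h_app: "h x \<rho> = (if \<rho> \<in> ?F then bdr V x \<rho> else 0)" for x \<rho> by (simp add: h_def)
 have lin: "h (x + y) = h x + h y" "h (scale_fun a x) = scale_fun a (h x)" for x y a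
  by (auto simp: h_def fun_eq_iff bdr_def sum.distrib scale_fun_def sum_distrib_left)
 have low: "h x \<rho> = 0" if x: "on_level ?F j x" and r: "Suc (card \<rho>) ~= j" for x \<rho> j
 proof (cases "\<rho> \<in> ?F")
  case True
  have "finite \<rho>" using Fsub[OF True] V finite_subset by blast
  hence "x (insert v \<rho>) = 0" if "v \<in> V - \<rho>" for v
   using x[unfolded on_level_def, THEN spec, of "insert v \<rho>"] r that by auto
  thus ?thesis by (simp add: h_def bdr_def)
 qed (simp add: h_def)
 have cyc: "bit_cycle V ?F j x \<longleftrightarrow> x \<in> D j \<and> h x = 0" for x j
 proof
  assume c: "bit_cycle V ?F j x"
  hence l: "on_level ?F j x" by (simp add: bit_cycle_def)
  have "h x \<rho> = 0" for \<rho>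
  proof (cases "Suc (card \<rho>) = j")
   case True
   thus ?thesis using c by (simp add: bit_cycle_def h_def)
  qed (rule low[OF l])
  thus "x \<in> D j \<and> h x = 0" using l by (simp add: D fun_eq_iff)
 next
  assume x: "x \<in> D j \<and> h x = 0"
  have "bdr V x \<rho> = 0" if "\<rho> \<in> ?F" for \<rho>
   
  proof -
   have "h x \<rho> = 0" using x by simp
   thus ?thesis using that by (simp add: h_def)
  qed
  thus "bit_cycle V ?F j x" using x by (simp add: bit_cycle_def D)
 qed
 have e: "(\<Sum>j\<le>d. (-1) ^ (d - j) * int (fv.dim (D j))) = int (fv.dim {x\<in>D d. h x = 0})"
 proof (rule euler_characteristic[OF finF _ _ lin])
  show "D j \<subseteq> supported_on ?F" for j by (auto simp: D_def supported_on_def)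
  show "fv.subspace (D j)" for j unfolding D_def by (rule supported_on_subspace)
  show "h x = 0" if "x \<in> D 0" for x
   using low[where x = x and j = 0] that by (simp add: D fun_eq_iff)
  show "h ` D (Suc j) = {x\<in>D j. h x = 0}" if j: "j < d" for j
  proof (rule subset_antisym)
   show "h ` D (Suc j) \<subseteq> {x\<in>D j. h x = 0}"
   proof (rule image_subsetI)
    fix x assume x: "x \<in> D (Suc j)"
    hence l: "on_level ?F (Suc j) x" by (simp add: D)
    have "on_level ?F j (h x)"
     unfolding on_level_def
    proof (intro allI impI)
     fix \<rho> assume nz: "h x \<rho> ~= 0"
     hence "\<rho> \<in> ?F" by (metis h_def)
     moreover have "Suc (card \<rho>) = Suc j" using low[OF l] nz by blast
     ultimately show "\<rho> \<in> ?F \<and> card \<rho> = j" by simp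
    qed
    moreover have "h (h x) = 0"
    proof
     fix \<rho>
     have "bdr V (h x) \<rho> = bdr V (bdr V x) \<rho>" if r: "\<rho> \<in> ?F"
      unfolding bdr_def[of V "h x"] bdr_def[of V "bdr V x"]
     proof (rule sum.cong[OF refl])
      fix v assume v: "v \<in> V - \<rho>"
      show "h x (insert v \<rho>) = bdr V x (insert v \<rho>)"
      proof (cases "insert v \<rho> \<in> ?F")
       case False
       have "x (insert w (insert v \<rho>)) = 0" for w
       proof (rule ccontr)
        assume "x (insert w (insert v \<rho>)) ~= 0"
        hence "insert w (insert v \<rho>) \<in> \<Delta>" using l by (simp add: on_level_def faces_above_def)
        hence "insert v \<rho> \<in> \<Delta>" by (rule down_closedD[OF down]) auto
        thus False using False r by (auto simp: faces_above_def)
       qed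
       thus ?thesis using False by (simp add: h_def bdr_def)
      qed (simp add: h_def)
     qed
     thus "h (h x) \<rho> = 0 \<rho>" using bdr_bdr[OF V bit_add_self, of x \<rho>] by (simp add: h_app[of "h x" \<rho>])
    qed
    ultimately show "h x \<in> {x\<in>D j. h x = 0}" by (simp add: D)
   qed
   show "{x\<in>D j. h x = 0} \<subseteq> h ` D (Suc j)"
   proof
    fix x assume x: "x \<in> {x\<in>D j. h x = 0}"
    hence c: "bit_cycle V ?F j x" using cyc by simp
    have "bit_exact V ?F j" using ex \<sigma> j by simp
    from bit_exactD[OF this c] obtain b :: "'a set => bit" where b: "on_level ?F (Suc j) b" "\<forall>\<rho>\<in>?F. card \<rho> = j --> bdr V b \<rho> = x \<rho>" by blast
    have "h b = x"
    proof
     fix \<rho> show "h b \<rho> = x \<rho>"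
     proof (cases "\<rho> \<in> ?F \<and> card \<rho> = j")
      case True
      thus ?thesis using b(2) by (simp add: h_def)
     next
      case False
      have "x \<rho> = 0" using c False by (auto simp: bit_cycle_def on_level_def)
      moreover have "h b \<rho> = 0"
      proof (cases "\<rho> \<in> ?F")
       case True
       thus ?thesis using False low[OF b(1), of \<rho>] by simp
      qed (simp add: h_def)
      ultimately show ?thesis by simp
     qed
    qed
    thus "x \<in> h ` D (Suc j)" using b(1) by (auto simp: D)
   qed
  qed
 qed
 have dimD: "fv.dim (D j) = card {\<tau>\<in>?F. card \<tau> = j}" for j
  unfolding D_def by (rule dim_supported_on) (use finF in simp)
 have "fv.dim {x\<in>D d. h x = 0} = (if \<sigma> \<in> B then 0 else 1)"
 proof (cases "\<sigma> \<in> B")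
  case True
  hence "{x\<in>D d. h x = 0} \<subseteq> {0}" using top0 cyc unfolding zero_fun_def by blast
  hence "fv.dim {x\<in>D d. h x = 0} \<le> card ({} :: ('a set => bit) set)" by (intro fv.dim_le_card) auto
  thus ?thesis using True by simp
 next
  case False
  let ?z = "facet_sum d \<sigma> \<Delta>"
  have z: "bit_cycle V ?F d ?z" and all: "\<And>x. bit_cycle V ?F d x ==> x = 0 \<or> x = ?z"
   using top1 False \<sigma> unfolding zero_fun_def by blast+
  obtain \<phi> where \<phi>: "\<phi> \<in> \<Delta>" "\<sigma> \<subseteq> \<phi>" "card \<phi> = d" using homology_ball_pure[OF HB \<sigma>] by blast
  hence "?z \<phi> = 1" by (simp add: facet_sum_def)
  hence nz: "?z ~= 0" by (metis zero_fun_def zero_neq_one)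
  have "{x\<in>D d. h x = 0} \<subseteq> fv.span {?z}"
  proof
   fix x assume "x \<in> {x\<in>D d. h x = 0}"
   hence "bit_cycle V ?F d x" using cyc by simp
   thus "x \<in> fv.span {?z}" using all[of x] fv.span_zero fv.span_base[of ?z "{?z}"] by blast
  qed
  moreover have "{?z} \<subseteq> {x\<in>D d. h x = 0}" using cyc z by blast
  moreover have "fv.independent {?z}" using nz by simp
  ultimately have "fv.dim {x\<in>D d. h x = 0} = 1" using fv.basis_card_eq_dim[of "{?z}" "{x\<in>D d. h x = 0}"] by simp
  thus ?thesis using False by simp
 qed
 thus ?thesis using e dimD by simp
qed

section \<open>Links and upper bounds\<close>

definition link_of :: "'a => 'a set set => 'a set set" where
 "link_of v X = {\<tau>. v \<notin> \<tau> \<and> insert v \<tau> \<in> X}"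

definition drop_vertex :: "'a => ('a set => bit) => 'a set => bit" where
 "drop_vertex v z = (\<lambda>\<tau>. if v \<in> \<tau> then 0 else z (insert v \<tau>))"

text \<open>Chains on the link of \<open>v\<close> correspond to chains on the faces containing
  \<open>v\<close>, one level higher; \<open>drop_vertex\<close> is the way back.\<close>

definition cone_chain :: "'a => ('a set => bit) => 'a set => bit" where
 "cone_chain v z = (\<lambda>\<tau>. if v \<in> \<tau> then z (\<tau> - {v}) else 0)"

lemma bdr_drop_vertex:
 assumes "v \<notin> \<rho>"
 shows "bdr (V - {v}) (drop_vertex v z) \<rho> = bdr V z (insert v \<rho>)"
proof -
 have "V - {v} - \<rho> = V - insert v \<rho>" by auto
 thus ?thesis unfolding bdr_def using assms
  by (intro sum.cong) (auto simp: drop_vertex_def insert_commute)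
qed

lemma bdr_cone_chain:
 assumes "v \<notin> \<rho>"
 shows "bdr V (cone_chain v z) (insert v \<rho>) = bdr (V - {v}) z \<rho>"
proof -
 have "V - {v} - \<rho> = V - insert v \<rho>" by auto
 moreover have "cone_chain v z (insert u (insert v \<rho>)) = z (insert u \<rho>)" if "u \<in> V - insert v \<rho>" for u
 proof -
  have "insert u (insert v \<rho>) - {v} = insert u \<rho>" using that assms by auto
  thus ?thesis by (simp add: cone_chain_def)
 qed
 ultimately show ?thesis unfolding bdr_def by (intro sum.cong) auto
qed

lemma on_level_drop:
 assumes "\<And>\<tau>. \<tau> \<in> \<Delta> ==> finite \<tau>" "on_level (faces_above (insert v \<sigma>) \<Delta>) (Suc j) z" "v \<notin> \<sigma>"
 shows "on_level (faces_above \<sigma> (link_of v \<Delta>)) j (drop_vertex v z)"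
 unfolding on_level_def
proof (intro allI impI)
 fix \<tau> assume "drop_vertex v z \<tau> ~= 0"
 hence v: "v \<notin> \<tau>" and nz: "z (insert v \<tau>) ~= 0" by (auto simp: drop_vertex_def split: if_splits)
 hence f: "insert v \<tau> \<in> \<Delta>" "insert v \<sigma> \<subseteq> insert v \<tau>" "card (insert v \<tau>) = Suc j"
  using assms(2)[unfolded on_level_def, THEN spec, THEN mp, OF nz] by (auto simp: faces_above_def)
 have "finite \<tau>" using assms(1)[OF f(1)] by simp
 moreover have "\<sigma> \<subseteq> \<tau>" using f(2) assms(3) v by blast
 ultimately show "\<tau> \<in> faces_above \<sigma> (link_of v \<Delta>) \<and> card \<tau> = j"
  using f v by (simp add: faces_above_def link_of_def)
qed

lemma on_level_cone:
 assumes "\<And>\<tau>. \<tau> \<in> \<Delta> ==> finite \<tau>" "on_level (faces_above \<sigma> (link_of v \<Delta>)) j z"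
 shows "on_level (faces_above (insert v \<sigma>) \<Delta>) (Suc j) (cone_chain v z)"
 unfolding on_level_def
proof (intro allI impI)
 fix \<tau> assume "cone_chain v z \<tau> ~= 0"
 hence v: "v \<in> \<tau>" and nz: "z (\<tau> - {v}) ~= 0" by (auto simp: cone_chain_def split: if_splits)
 have i: "insert v (\<tau> - {v}) = \<tau>" using v by blast
 from nz have f: "\<tau> \<in> \<Delta>" "\<sigma> \<subseteq> \<tau> - {v}" "card (\<tau> - {v}) = j"
  using assms(2)[unfolded on_level_def, THEN spec, THEN mp, OF nz] i by (auto simp: faces_above_def link_of_def)
 have "finite \<tau>" by (rule assms(1)[OF f(1)])
 hence "card \<tau> = Suc j" using f(3) v by (metis card.remove)
 thus "\<tau> \<in> faces_above (insert v \<sigma>) \<Delta> \<and> card \<tau> = Suc j"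
  using f v by (auto simp: faces_above_def)
qed

lemma cycle_drop:
 assumes "\<And>\<tau>. \<tau> \<in> \<Delta> ==> finite \<tau>" "bit_cycle V (faces_above (insert v \<sigma>) \<Delta>) (Suc j) z" "v \<notin> \<sigma>"
 shows "bit_cycle (V - {v}) (faces_above \<sigma> (link_of v \<Delta>)) j (drop_vertex v z)"
 unfolding bit_cycle_def
proof (intro conjI ballI impI)
 show "on_level (faces_above \<sigma> (link_of v \<Delta>)) j (drop_vertex v z)"
  using assms(2) by (intro on_level_drop[OF assms(1) _ assms(3)]) (auto simp: bit_cycle_def)
 fix \<rho> assume \<rho>: "\<rho> \<in> faces_above \<sigma> (link_of v \<Delta>)" "Suc (card \<rho>) = j"
 hence r: "v \<notin> \<rho>" "insert v \<rho> \<in> \<Delta>" "\<sigma> \<subseteq> \<rho>" by (auto simp: faces_above_def link_of_def)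
 hence "finite \<rho>" using assms(1)[OF r(2)] by simp
 hence "insert v \<rho> \<in> faces_above (insert v \<sigma>) \<Delta> \<and> Suc (card (insert v \<rho>)) = Suc j"
  using r \<rho>(2) by (auto simp: faces_above_def)
 thus "bdr (V - {v}) (drop_vertex v z) \<rho> = 0"
  using assms(2) bdr_drop_vertex[OF r(1)] by (simp add: bit_cycle_def)
qed

lemma cycle_cone:
 assumes "\<And>\<tau>. \<tau> \<in> \<Delta> ==> finite \<tau>" "bit_cycle (V - {v}) (faces_above \<sigma> (link_of v \<Delta>)) j z" "v \<notin> \<sigma>"
 shows "bit_cycle V (faces_above (insert v \<sigma>) \<Delta>) (Suc j) (cone_chain v z)"
 unfolding bit_cycle_def
proof (intro conjI ballI impI)
 show "on_level (faces_above (insert v \<sigma>) \<Delta>) (Suc j) (cone_chain v z)"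
  using assms(2) by (intro on_level_cone[OF assms(1)]) (auto simp: bit_cycle_def)
 fix \<rho> assume \<rho>: "\<rho> \<in> faces_above (insert v \<sigma>) \<Delta>" "Suc (card \<rho>) = Suc j"
 define \<rho>' where "\<rho>' = \<rho> - {v}"
 have r: "v \<notin> \<rho>'" "\<rho> = insert v \<rho>'" "\<sigma> \<subseteq> \<rho>'" using \<rho>(1) assms(3) by (auto simp: \<rho>'_def faces_above_def)
 have "\<rho> \<in> \<Delta>" using \<rho>(1) by (simp add: faces_above_def)
 hence "finite \<rho>'" "\<rho>' \<in> link_of v \<Delta>" using assms(1)[of \<rho>] r by (auto simp: link_of_def)
 hence "\<rho>' \<in> faces_above \<sigma> (link_of v \<Delta>) \<and> Suc (card \<rho>') = j" using r \<rho>(2) by (simp add: faces_above_def)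
 thus "bdr V (cone_chain v z) \<rho> = 0"
  using assms(2) bdr_cone_chain[OF r(1), of V z] unfolding r(2) by (simp add: bit_cycle_def)
qed

lemma drop_cone: "on_level (faces_above \<sigma> (link_of v \<Delta>)) j z ==> drop_vertex v (cone_chain v z) = z"
proof
 fix \<tau> assume z: "on_level (faces_above \<sigma> (link_of v \<Delta>)) j z"
 show "drop_vertex v (cone_chain v z) \<tau> = z \<tau>"
 proof (cases "v \<in> \<tau>")
  case True
  hence "z \<tau> = 0" using z[unfolded on_level_def, THEN spec, of \<tau>] by (auto simp: faces_above_def link_of_def)
  thus ?thesis using True by (simp add: drop_vertex_def)
 qed (simp add: drop_vertex_def cone_chain_def)
qed

lemma homology_ballD:
 assumes "homology_ball d V \<Delta> B"
 shows "finite V" "\<Delta> \<subseteq> Pow V" "down_closed \<Delta>" "{} \<in> \<Delta>" "\<And>\<sigma>. \<sigma> \<in> \<Delta> ==> card \<sigma> \<le> d" "B \<subseteq> \<Delta>" "down_closed B"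
  "\<And>\<sigma> j. \<sigma> \<in> \<Delta> ==> j < d ==> bit_exact V (faces_above \<sigma> \<Delta>) j"
  "\<And>\<sigma> z. \<sigma> \<in> B ==> bit_cycle V (faces_above \<sigma> \<Delta>) d z ==> z = (\<lambda>_. 0)"
  "\<And>\<sigma>. \<sigma> \<in> \<Delta> ==> \<sigma> \<notin> B ==> bit_cycle V (faces_above \<sigma> \<Delta>) d (facet_sum d \<sigma> \<Delta>)"
  "\<And>\<sigma> z. \<sigma> \<in> \<Delta> ==> \<sigma> \<notin> B ==> bit_cycle V (faces_above \<sigma> \<Delta>) d z ==> z = (\<lambda>_. 0) \<or> z = facet_sum d \<sigma> \<Delta>"
  "\<And>\<sigma>. \<sigma> \<in> \<Delta> ==> finite \<sigma>" "finite \<Delta>"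
proof -
 note H = assms[unfolded homology_ball_def]
 show V: "finite V" and sub: "\<Delta> \<subseteq> Pow V" using H by simp_all
 show "down_closed \<Delta>" "{} \<in> \<Delta>" "\<And>\<sigma>. \<sigma> \<in> \<Delta> ==> card \<sigma> \<le> d" "B \<subseteq> \<Delta>" "down_closed B"
  "\<And>\<sigma> j. \<sigma> \<in> \<Delta> ==> j < d ==> bit_exact V (faces_above \<sigma> \<Delta>) j"
  "\<And>\<sigma> z. \<sigma> \<in> B ==> bit_cycle V (faces_above \<sigma> \<Delta>) d z ==> z = (\<lambda>_. 0)"
  "\<And>\<sigma>. \<sigma> \<in> \<Delta> ==> \<sigma> \<notin> B ==> bit_cycle V (faces_above \<sigma> \<Delta>) d (facet_sum d \<sigma> \<Delta>)"
  "\<And>\<sigma> z. \<sigma> \<in> \<Delta> ==> \<sigma> \<notin> B ==> bit_cycle V (faces_above \<sigma> \<Delta>) d z ==> z = (\<lambda>_. 0) \<or> z = facet_sum d \<sigma> \<Delta>"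
  using H by simp_all
 show "finite \<Delta>" using V sub by (meson finite_Pow_iff finite_subset)
 show "finite \<sigma>" if "\<sigma> \<in> \<Delta>" for \<sigma> using that V sub by (meson PowD finite_subset subsetD)
qed

lemma bit_exact_empty: "bit_exact V {} j"
 unfolding bit_exact_def by (auto simp: on_level_def)

text \<open>The faces above \<open>\<sigma>\<close> in the link are those above
  \<open>insert v \<sigma>\<close> with \<open>v\<close> removed, so coning and dropping
  \<open>v\<close> transport every clause, with all sizes lowered by one.\<close>

theorem homology_ball_link:
 assumes HB: "homology_ball (Suc d) V \<Delta> B" and v: "{v} \<in> \<Delta>"
 shows "homology_ball d (V - {v}) (link_of v \<Delta>) (link_of v B)"
proof -
 note H = homology_ballD[OF HB]
 let ?L = "link_of v \<Delta>"
 have LD: "\<tau> \<in> ?L ==> v \<notin> \<tau> \<and> insert v \<tau> \<in> \<Delta>" for \<tau> by (simp add: link_of_def)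
 have cyc: "bit_cycle V (faces_above (insert v \<sigma>) \<Delta>) (Suc d) (cone_chain v z)"
  if "\<sigma> \<in> ?L" "bit_cycle (V - {v}) (faces_above \<sigma> ?L) d z" for \<sigma> z
  by (rule cycle_cone[OF H(12) that(2)]) (use LD[OF that(1)] in auto)
 have z_of: "z = drop_vertex v (cone_chain v z)" if "bit_cycle (V - {v}) (faces_above \<sigma> ?L) d z" for \<sigma> z
  using drop_cone[of \<sigma> v \<Delta> d z] that by (simp add: bit_cycle_def)
 have fs: "drop_vertex v (facet_sum (Suc d) (insert v \<sigma>) \<Delta>) = facet_sum d \<sigma> ?L" if "\<sigma> \<in> ?L" for \<sigma>
 proof
  fix \<tau>
  show "drop_vertex v (facet_sum (Suc d) (insert v \<sigma>) \<Delta>) \<tau> = facet_sum d \<sigma> ?L \<tau>"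
  proof (cases "v \<notin> \<tau> \<and> insert v \<tau> \<in> \<Delta>")
   case True
   hence "finite \<tau>" using H(12)[of "insert v \<tau>"] by simp
   moreover have "insert v \<sigma> \<subseteq> insert v \<tau> \<longleftrightarrow> \<sigma> \<subseteq> \<tau>" using True LD[OF that] by blast
   ultimately show ?thesis using True by (simp add: drop_vertex_def facet_sum_def link_of_def)
  qed (auto simp: drop_vertex_def facet_sum_def link_of_def)
 qed
 have z0: "drop_vertex v (\<lambda>_. 0) = (\<lambda>_. 0)" by (simp add: drop_vertex_def)
 show ?thesis
  unfolding homology_ball_def
 proof (intro conjI ballI allI impI)
  show "finite (V - {v})" using H(1) by simp
  show "?L \<subseteq> Pow (V - {v})" using H(2) by (auto simp: link_of_def)
  show "{} \<in> ?L" using v by (simp add: link_of_def)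
  show "link_of v B \<subseteq> ?L" using H(6) by (auto simp: link_of_def)
  show "down_closed ?L" "down_closed (link_of v B)"
   using down_closedD[OF H(3)] down_closedD[OF H(7)] unfolding down_closed_def link_of_def
   by (metis (mono_tags, lifting) insert_mono mem_Collect_eq subsetD)+
 next
  fix \<sigma> assume "\<sigma> \<in> ?L"
  hence "v \<notin> \<sigma>" "insert v \<sigma> \<in> \<Delta>" by (simp_all add: link_of_def)
  thus "card \<sigma> \<le> d" using H(5)[of "insert v \<sigma>"] H(12)[of "insert v \<sigma>"] by simp
 next
  fix \<sigma> j assume s: "\<sigma> \<in> ?L" "j < d"
  have vs: "v \<notin> \<sigma>" "insert v \<sigma> \<in> \<Delta>" using LD[OF s(1)] by auto
  show "bit_exact (V - {v}) (faces_above \<sigma> ?L) j"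
   unfolding bit_exact_alt
  proof (intro allI impI)
   fix z :: "'a set => bit" assume z: "bit_cycle (V - {v}) (faces_above \<sigma> ?L) j z"
   have "bit_cycle V (faces_above (insert v \<sigma>) \<Delta>) (Suc j) (cone_chain v z)" by (rule cycle_cone[OF H(12) z vs(1)])
   from bit_exactD[OF H(8)[OF vs(2)] this] s(2)
   obtain b :: "'a set => bit" where b: "on_level (faces_above (insert v \<sigma>) \<Delta>) (Suc (Suc j)) b"
    "\<And>\<rho>. \<rho> \<in> faces_above (insert v \<sigma>) \<Delta> ==> card \<rho> = Suc j ==> bdr V b \<rho> = cone_chain v z \<rho>" by auto
   have "on_level (faces_above \<sigma> ?L) (Suc j) (drop_vertex v b)" by (rule on_level_drop[OF H(12) b(1) vs(1)])
   moreover have "bdr (V - {v}) (drop_vertex v b) \<rho> = z \<rho>" if r: "\<rho> \<in> faces_above \<sigma> ?L" "card \<rho> = j" for \<rho>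
   proof -
    have "v \<notin> \<rho>" "insert v \<rho> \<in> \<Delta>" "\<sigma> \<subseteq> \<rho>" using r by (auto simp: faces_above_def link_of_def)
    moreover have "finite \<rho>" using H(12)[of "insert v \<rho>"] calculation by simp
    ultimately have "insert v \<rho> \<in> faces_above (insert v \<sigma>) \<Delta>" "card (insert v \<rho>) = Suc j"
     using r(2) by (auto simp: faces_above_def)
    hence "bdr V b (insert v \<rho>) = cone_chain v z (insert v \<rho>)" by (rule b(2))
    thus ?thesis using \<open>v \<notin> \<rho>\<close> by (simp add: bdr_drop_vertex cone_chain_def)
   qed
   ultimately show "\<exists>b. on_level (faces_above \<sigma> ?L) (Suc j) b \<and> (\<forall>\<rho>\<in>faces_above \<sigma> ?L. card \<rho> = j --> bdr (V - {v}) b \<rho> = z \<rho>)"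
    by (intro exI[of _ "drop_vertex v b"]) simp
  qed
 next
  fix \<sigma> z assume s: "\<sigma> \<in> link_of v B" and z: "bit_cycle (V - {v}) (faces_above \<sigma> ?L) d z"
  have sL: "\<sigma> \<in> ?L" "insert v \<sigma> \<in> B" using s H(6) by (auto simp: link_of_def)
  have "cone_chain v z = (\<lambda>_. 0)" by (rule H(9)[OF sL(2) cyc[OF sL(1) z]])
  thus "z = (\<lambda>_. 0)" using z_of[OF z] z0 by simp
 next
  fix \<sigma> assume s: "\<sigma> \<in> ?L - link_of v B"
  have sL: "\<sigma> \<in> ?L" "insert v \<sigma> \<in> \<Delta>" "insert v \<sigma> \<notin> B" "v \<notin> \<sigma>" using s by (auto simp: link_of_def)
  show "bit_cycle (V - {v}) (faces_above \<sigma> ?L) d (facet_sum d \<sigma> ?L)"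
   using cycle_drop[OF H(12) H(10)[OF sL(2,3)] sL(4)] fs[OF sL(1)] by simp
  fix z assume z: "bit_cycle (V - {v}) (faces_above \<sigma> ?L) d z"
  have "cone_chain v z = (\<lambda>_. 0) \<or> cone_chain v z = facet_sum (Suc d) (insert v \<sigma>) \<Delta>"
   by (rule H(11)[OF sL(2,3) cyc[OF sL(1) z]])
  thus "z = (\<lambda>_. 0) \<or> z = facet_sum d \<sigma> ?L" using z_of[OF z] z0 fs[OF sL(1)] by metis
 qed
qed

text \<open>Relative to the closed star of \<open>v\<close>, which is a cone: a relative cycle \<open>z\<close> is completed to a
 cycle by the cone over its boundary.\<close>

theorem relative_CM_off_star:
 assumes HB: "homology_ball d V \<Delta> B" and vV: "v \<in> V"
 shows "relative_CM d V {\<tau>\<in>\<Delta>. insert v \<tau> \<notin> \<Delta>}"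
 unfolding relative_CM_def
proof (intro conjI ballI allI impI)
 note H = homology_ballD[OF HB]
 let ?P = "{\<tau>\<in>\<Delta>. insert v \<tau> \<notin> \<Delta>}"
 show "finite V" "?P \<subseteq> Pow V" "\<And>\<tau>. \<tau> \<in> ?P ==> card \<tau> \<le> d" using H(1,2,5) by auto
 show "\<tau> \<in> ?P" if "\<sigma> \<in> ?P" "\<rho> \<in> ?P" "\<sigma> \<subseteq> \<tau> \<and> \<tau> \<subseteq> \<rho>" for \<sigma> \<rho> \<tau>
 proof -
  have "\<tau> \<in> \<Delta>" using down_closedD[OF H(3)] that by blast
  moreover have "insert v \<tau> \<notin> \<Delta>" using down_closedD[OF H(3), of "insert v \<tau>" "insert v \<sigma>"] that by auto
  ultimately show ?thesis by simp
 qed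
 fix \<sigma> j assume \<sigma>: "\<sigma> \<subseteq> V" and j: "j < d"
 show "bit_exact V (faces_above \<sigma> ?P) j"
 proof (cases "v \<in> \<sigma> \<or> \<sigma> \<notin> \<Delta>")
  case True
  have "\<tau> \<notin> faces_above \<sigma> ?P" for \<tau>
   using True down_closedD[OF H(3), of \<tau> \<sigma>] by (auto simp: faces_above_def insert_absorb)
  hence "faces_above \<sigma> ?P = {}" by blast
  thus ?thesis by (simp add: bit_exact_empty)
 next
  case False
  hence vs: "v \<notin> \<sigma>" and s\<Delta>: "\<sigma> \<in> \<Delta>" by auto
  let ?F = "faces_above \<sigma> \<Delta>"
  show ?thesis
   unfolding bit_exact_alt
  proof (intro allI impI)
   fix z :: "'a set => bit" assume z: "bit_cycle V (faces_above \<sigma> ?P) j z"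
   have zl: "z \<tau> ~= 0 ==> \<tau> \<in> \<Delta> \<and> insert v \<tau> \<notin> \<Delta> \<and> \<sigma> \<subseteq> \<tau> \<and> card \<tau> = j" for \<tau>
    using z[unfolded bit_cycle_def, THEN conjunct1, unfolded on_level_def, THEN spec, of \<tau>] by (simp add: faces_above_def)
   have zv: "z \<tau> = 0" if "v \<in> \<tau>" for \<tau>
    using zl[of \<tau>] that by (auto simp: insert_absorb)
   define w where "w = (\<lambda>\<rho>. if \<sigma> \<subseteq> \<rho> then bdr V z \<rho> else 0)"
   have wD: "\<rho> \<in> \<Delta> \<and> v \<notin> \<rho> \<and> Suc (card \<rho>) = j \<and> \<sigma> \<subseteq> \<rho> \<and> insert v \<rho> \<in> \<Delta>" if nz: "w \<rho> ~= 0" for \<rho>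
   proof -
    have s: "\<sigma> \<subseteq> \<rho>" and b: "bdr V z \<rho> ~= 0" using nz by (auto simp: w_def split: if_splits)
    obtain u where u: "u \<in> V - \<rho>" "z (insert u \<rho>) ~= 0"
     by (rule sum.not_neutral_contains_not_neutral[OF b[unfolded bdr_def]]) simp
    note f = zl[OF u(2)]
    have v: "v \<notin> \<rho>" using zv[of "insert u \<rho>"] u(2) by auto
    have r: "\<rho> \<in> \<Delta>" using down_closedD[OF H(3), of "insert u \<rho>" \<rho>] f by auto
    have c: "Suc (card \<rho>) = j" using f u(1) H(12)[OF r] by simp
    have "insert v \<rho> \<in> \<Delta>"
    proof (rule ccontr)
     assume "insert v \<rho> \<notin> \<Delta>"
     hence "\<rho> \<in> faces_above \<sigma> ?P" using r s by (simp add: faces_above_def)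
     thus False using z c b by (simp add: bit_cycle_def)
    qed
    thus ?thesis using r v c s by simp
   qed
   define c where "c = (\<lambda>\<tau>. z \<tau> + cone_chain v w \<tau>)"
   have cl: "on_level ?F j c"
    unfolding on_level_def
   proof (intro allI impI)
    fix \<tau> assume "c \<tau> ~= 0"
    hence "z \<tau> ~= 0 \<or> cone_chain v w \<tau> ~= 0" by (auto simp: c_def)
    thus "\<tau> \<in> ?F \<and> card \<tau> = j"
    proof
     assume "z \<tau> ~= 0"
     thus ?thesis using zl by (simp add: faces_above_def)
    next
     assume nz: "cone_chain v w \<tau> ~= 0"
     hence v: "v \<in> \<tau>" and "w (\<tau> - {v}) ~= 0" by (auto simp: cone_chain_def split: if_splits)
     note f = wD[OF this(2)]
     have "insert v (\<tau> - {v}) = \<tau>" using v by blast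
     hence "\<tau> \<in> \<Delta>" using f by simp
     moreover have "card \<tau> = j" using f v H(12)[OF \<open>\<tau> \<in> \<Delta>\<close>] by (metis card.remove)
     moreover have "\<sigma> \<subseteq> \<tau>" using f by blast
     ultimately show ?thesis by (simp add: faces_above_def)
    qed
   qed
   have bc: "bdr V c \<rho> = bdr V z \<rho> + bdr V (cone_chain v w) \<rho>" for \<rho>
    by (simp add: c_def bdr_def sum.distrib)
   have "bdr V c \<rho> = 0" if \<rho>: "\<rho> \<in> ?F" for \<rho>
   proof (cases "v \<in> \<rho>")
    case False
    have "bdr V (cone_chain v w) \<rho> = (\<Sum>u\<in>{v}. cone_chain v w (insert u \<rho>))"
     unfolding bdr_def by (rule sum.mono_neutral_right) (use H(1) vV False in \<open>auto simp: cone_chain_def\<close>)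
    also have "\<dots> = w \<rho>" using False by (simp add: cone_chain_def)
    also have "\<dots> = bdr V z \<rho>" using \<rho> by (simp add: w_def faces_above_def)
    finally show ?thesis unfolding bc by simp
   next
    case True
    define \<rho>' where "\<rho>' = \<rho> - {v}"
    have r: "v \<notin> \<rho>'" "\<rho> = insert v \<rho>'" "\<sigma> \<subseteq> \<rho>'" using True \<rho> vs by (auto simp: \<rho>'_def faces_above_def)
    have z0: "bdr V z \<rho> = 0" unfolding bdr_def using zv True by (intro sum.neutral) auto
    have "bdr V (cone_chain v w) \<rho> = bdr (V - {v}) w \<rho>'" unfolding r(2) by (rule bdr_cone_chain[OF r(1)])
    also have "\<dots> = bdr V (bdr V z) \<rho>'"
    proof -
     have "V - \<rho>' = insert v (V - {v} - \<rho>')" "v \<notin> V - {v} - \<rho>'" using vV r(1) by auto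
     hence "bdr V (bdr V z) \<rho>' = bdr V z (insert v \<rho>') + (\<Sum>u\<in>V-{v}-\<rho>'. bdr V z (insert u \<rho>'))"
      unfolding bdr_def[of V "bdr V z"] using H(1) by simp
     also have "bdr V z (insert v \<rho>') = 0" using z0 r(2) by simp
     also have "(\<Sum>u\<in>V-{v}-\<rho>'. bdr V z (insert u \<rho>')) = bdr (V - {v}) w \<rho>'"
      unfolding bdr_def[of "V - {v}" w] using r(3) by (intro sum.cong) (auto simp: w_def)
     finally show ?thesis by simp
    qed
    also have "\<dots> = 0" by (rule bdr_bdr[OF H(1) bit_add_self])
    finally show ?thesis unfolding bc z0 by simp
   qed
   hence "bit_cycle V ?F j c" using cl by (simp add: bit_cycle_def)
   from bit_exactD[OF H(8)[OF s\<Delta> j] this]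
   obtain b :: "'a set => bit" where b: "on_level ?F (Suc j) b" "\<forall>\<rho>\<in>?F. card \<rho> = j --> bdr V b \<rho> = c \<rho>" by auto
   \<comment> \<open>Outside the star of \<open>v\<close> the cone part vanishes, and cofaces of a
     face outside the star are outside too, so cutting \<open>b\<close> down to this part keeps its
     boundary there.\<close>
   define b1 where "b1 = (\<lambda>\<tau>. if insert v \<tau> \<in> \<Delta> then 0 else b \<tau>)"
   have "on_level (faces_above \<sigma> ?P) (Suc j) b1"
    unfolding on_level_def
   proof (intro allI impI)
    fix \<tau> assume "b1 \<tau> ~= 0"
    hence "insert v \<tau> \<notin> \<Delta>" "b \<tau> ~= 0" by (auto simp: b1_def split: if_splits)
    thus "\<tau> \<in> faces_above \<sigma> ?P \<and> card \<tau> = Suc j"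
     using b(1)[unfolded on_level_def, THEN spec, of \<tau>] by (simp add: faces_above_def)
   qed
   moreover have "bdr V b1 \<rho> = z \<rho>" if r: "\<rho> \<in> faces_above \<sigma> ?P" "card \<rho> = j" for \<rho>
   proof -
    have \<rho>: "\<rho> \<in> \<Delta>" "insert v \<rho> \<notin> \<Delta>" "\<sigma> \<subseteq> \<rho>" using r by (auto simp: faces_above_def)
    have "v \<notin> \<rho>" using \<rho>(1,2) by (auto simp: insert_absorb)
    have "insert v (insert u \<rho>) \<notin> \<Delta>" for u
     using down_closedD[OF H(3), of "insert v (insert u \<rho>)" "insert v \<rho>"] \<rho>(2) by auto
    hence "bdr V b1 \<rho> = bdr V b \<rho>" unfolding bdr_def by (intro sum.cong) (auto simp: b1_def)
    also have "\<dots> = c \<rho>" using b(2) \<rho> r(2) by (simp add: faces_above_def)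
    finally show ?thesis using \<open>v \<notin> \<rho>\<close> by (simp add: c_def cone_chain_def)
   qed
   ultimately show "\<exists>b. on_level (faces_above \<sigma> ?P) (Suc j) b \<and> (\<forall>\<rho>\<in>faces_above \<sigma> ?P. card \<rho> = j --> bdr V b \<rho> = z \<rho>)"
    by (intro exI[of _ b1]) simp
  qed
 qed
qed

text \<open>A cycle \<open>z\<close> avoiding \<open>v\<close> is filled by some \<open>b\<close>.
  The faces of \<open>b\<close> that contain \<open>v\<close> form a cycle above
  \<open>insert v \<sigma>\<close>, and \<open>b\<close> must be changed by a cycle \<open>y\<close>
  with the same part at \<open>v\<close>. Below the top this part bounds, and its filling yields
  \<open>y\<close>; in the top degree fullness is needed.\<close>

theorem relative_CM_deletion:
 assumes HB: "homology_ball d V \<Delta> B" and v: "{v} \<in> B"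
  and full: "\<And>\<sigma>. \<sigma> \<in> \<Delta> ==> (\<And>u. u \<in> \<sigma> ==> {u} \<in> B) ==> \<sigma> \<in> B"
 shows "relative_CM d V {\<tau>\<in>\<Delta>. v \<notin> \<tau>}"
 unfolding relative_CM_def
proof (intro conjI ballI allI impI)
 note H = homology_ballD[OF HB]
 let ?P = "{\<tau>\<in>\<Delta>. v \<notin> \<tau>}"
 show "finite V" "?P \<subseteq> Pow V" "\<And>\<tau>. \<tau> \<in> ?P ==> card \<tau> \<le> d" using H(1,2,5) by auto
 show "\<tau> \<in> ?P" if "\<sigma> \<in> ?P" "\<rho> \<in> ?P" "\<sigma> \<subseteq> \<tau> \<and> \<tau> \<subseteq> \<rho>" for \<sigma> \<rho> \<tau>
  using down_closedD[OF H(3), of \<rho> \<tau>] that by auto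
 fix \<sigma> j assume \<sigma>: "\<sigma> \<subseteq> V" and j: "j < d"
 show "bit_exact V (faces_above \<sigma> ?P) j"
 proof (cases "v \<in> \<sigma> \<or> \<sigma> \<notin> \<Delta>")
  case True
  have "\<tau> \<notin> faces_above \<sigma> ?P" for \<tau>
   using True down_closedD[OF H(3), of \<tau> \<sigma>] by (auto simp: faces_above_def)
  hence "faces_above \<sigma> ?P = {}" by blast
  thus ?thesis by (simp add: bit_exact_empty)
 next
  case False
  hence vs: "v \<notin> \<sigma>" and s\<Delta>: "\<sigma> \<in> \<Delta>" by auto
  let ?F = "faces_above \<sigma> \<Delta>" and ?G = "faces_above (insert v \<sigma>) \<Delta>"
  show ?thesis
   unfolding bit_exact_alt
  proof (intro allI impI)
   fix z :: "'a set => bit" assume z: "bit_cycle V (faces_above \<sigma> ?P) j z"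
   have zl: "z \<tau> ~= 0 ==> \<tau> \<in> \<Delta> \<and> v \<notin> \<tau> \<and> \<sigma> \<subseteq> \<tau> \<and> card \<tau> = j" for \<tau>
    using z[unfolded bit_cycle_def, THEN conjunct1, unfolded on_level_def, THEN spec, of \<tau>] by (simp add: faces_above_def)
   have zF: "bit_cycle V ?F j z"
    unfolding bit_cycle_def
   proof (intro conjI ballI impI)
    show "on_level ?F j z" using zl by (simp add: on_level_def faces_above_def)
    fix \<rho> assume r: "\<rho> \<in> ?F" "Suc (card \<rho>) = j"
    show "bdr V z \<rho> = 0"
    proof (cases "v \<in> \<rho>")
     case True
     thus ?thesis unfolding bdr_def using zl by (intro sum.neutral) blast
    next
     case False
     hence "\<rho> \<in> faces_above \<sigma> ?P" using r by (simp add: faces_above_def)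
     thus ?thesis using z r by (simp add: bit_cycle_def)
    qed
   qed
   obtain b :: "'a set => bit" where b: "on_level ?F (Suc j) b" "\<And>\<rho>. \<rho> \<in> ?F ==> card \<rho> = j ==> bdr V b \<rho> = z \<rho>"
    using bit_exactD[OF H(8)[OF s\<Delta> j] zF] by auto
   define bv where "bv = (\<lambda>\<tau>. if v \<in> \<tau> then b \<tau> else 0)"
   have bv: "bit_cycle V ?G (Suc j) bv"
    unfolding bit_cycle_def
   proof (intro conjI ballI impI)
    show "on_level ?G (Suc j) bv"
     unfolding on_level_def
    proof (intro allI impI)
     fix \<tau> assume "bv \<tau> ~= 0"
     hence "v \<in> \<tau>" "b \<tau> ~= 0" by (auto simp: bv_def split: if_splits)
     thus "\<tau> \<in> ?G \<and> card \<tau> = Suc j"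
      using b(1)[unfolded on_level_def, THEN spec, of \<tau>] by (simp add: faces_above_def)
    qed
    fix \<rho> assume r: "\<rho> \<in> ?G" "Suc (card \<rho>) = Suc j"
    hence "\<rho> \<in> ?F" "v \<in> \<rho>" by (auto simp: faces_above_def)
    have "bdr V bv \<rho> = bdr V b \<rho>" unfolding bdr_def using \<open>v \<in> \<rho>\<close> by (intro sum.cong) (auto simp: bv_def)
    also have "\<dots> = z \<rho>" using b(2) \<open>\<rho> \<in> ?F\<close> r(2) by simp
    also have "\<dots> = 0" using zl[of \<rho>] \<open>v \<in> \<rho>\<close> by blast
    finally show "bdr V bv \<rho> = 0" .
   qed
   have fix_b: "\<exists>y. on_level ?F (Suc j) y \<and> (\<forall>\<rho>\<in>?F. card \<rho> = j --> bdr V y \<rho> = 0) \<and> (\<forall>\<tau>. v \<in> \<tau> --> y \<tau> = b \<tau>)"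
   proof (cases "insert v \<sigma> \<in> \<Delta>")
    case False
    hence "?G = {}" using down_closedD[OF H(3)] by (auto simp: faces_above_def)
    hence "bv \<tau> = 0" for \<tau> using bv by (auto simp: bit_cycle_def on_level_def)
    hence "b \<tau> = 0" if "v \<in> \<tau>" for \<tau> using that by (metis bv_def)
    thus ?thesis by (intro exI[of _ "\<lambda>_. 0"]) (simp add: on_level_def bdr_def)
   next
    case vD: True
    show ?thesis
    proof (cases "Suc j < d")
     case True
     obtain e :: "'a set => bit" where e: "on_level ?G (Suc (Suc j)) e" "\<And>\<rho>. \<rho> \<in> ?G ==> card \<rho> = Suc j ==> bdr V e \<rho> = bv \<rho>"
      using bit_exactD[OF H(8)[OF vD True] bv] by auto
     \<comment> \<open>The boundary of the filling \<open>e\<close>, taken among all faces above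
       \<open>\<sigma>\<close>, is a cycle that agrees with \<open>b\<close> on the faces containing
       \<open>v\<close>.\<close>
     define y where "y = (\<lambda>\<tau>. if \<sigma> \<subseteq> \<tau> then bdr V e \<tau> else 0)"
     have eD: "e \<tau> ~= 0 ==> \<tau> \<in> \<Delta> \<and> insert v \<sigma> \<subseteq> \<tau> \<and> card \<tau> = Suc (Suc j)" for \<tau>
      using e(1)[unfolded on_level_def, THEN spec, of \<tau>] by (simp add: faces_above_def)
     have yl: "on_level ?F (Suc j) y"
      unfolding on_level_def
     proof (intro allI impI)
      fix \<tau> assume nz: "y \<tau> ~= 0"
      hence s: "\<sigma> \<subseteq> \<tau>" and k: "bdr V e \<tau> ~= 0" by (auto simp: y_def split: if_splits)
      obtain u where u: "u \<in> V - \<tau>" "e (insert u \<tau>) ~= 0"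
       by (rule sum.not_neutral_contains_not_neutral[OF k[unfolded bdr_def]]) simp
      have "\<tau> \<in> \<Delta>" using eD[OF u(2)] down_closedD[OF H(3), of "insert u \<tau>" \<tau>] by auto
      thus "\<tau> \<in> ?F \<and> card \<tau> = Suc j" using eD[OF u(2)] u(1) H(12)[of \<tau>] s by (simp add: faces_above_def)
     qed
     moreover have "bdr V y \<rho> = 0" if "\<rho> \<in> ?F" for \<rho>
     proof -
      have "bdr V y \<rho> = bdr V (bdr V e) \<rho>"
       unfolding bdr_def[of V y] bdr_def[of V "bdr V e"] using that by (intro sum.cong) (auto simp: y_def faces_above_def)
      thus ?thesis using bdr_bdr[OF H(1) bit_add_self, of e \<rho>] by simp
     qed
     moreover have "y \<tau> = b \<tau>" if "v \<in> \<tau>" for \<tau>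
     proof (cases "\<tau> \<in> ?G \<and> card \<tau> = Suc j")
      case True
      hence "y \<tau> = bdr V e \<tau>" by (auto simp: y_def faces_above_def)
      also have "\<dots> = bv \<tau>" using e(2) True by simp
      finally show ?thesis using that by (simp add: bv_def)
     next
      case False
      hence n: "\<not> (\<tau> \<in> ?F \<and> card \<tau> = Suc j)" using that by (auto simp: faces_above_def)
      hence "y \<tau> = 0" "b \<tau> = 0" using yl b(1) unfolding on_level_def by blast+
      thus ?thesis by simp
     qed
     ultimately show ?thesis by (intro exI[of _ y]) simp
    next
     case False
     hence d: "Suc j = d" using j by simp
     show ?thesis
     proof (cases "insert v \<sigma> \<in> B")
      case True
      have "bv = (\<lambda>_. 0)" by (rule H(9)[OF True]) (use bv d in simp)
      hence "b \<tau> = 0" if "v \<in> \<tau>" for \<tau> using that by (metis bv_def)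
      thus ?thesis by (intro exI[of _ "\<lambda>_. 0"]) (simp add: on_level_def bdr_def)
     next
      case nB: False
      \<comment> \<open>If \<open>\<sigma>\<close> were in \<open>B\<close>, all vertices of
        \<open>insert v \<sigma>\<close> would be boundary vertices and fullness would put it in
        \<open>B\<close>. Hence the facets above \<open>\<sigma>\<close> form a cycle, and it
        extends the facet sum above \<open>insert v \<sigma>\<close>.\<close>
      have "\<sigma> \<notin> B"
      proof
       assume "\<sigma> \<in> B"
       hence "{u} \<in> B" if "u \<in> insert v \<sigma>" for u
        using that v down_closedD[OF H(7), of \<sigma> "{u}"] by auto
       thus False using full[OF vD] nB by blast
      qed
      note top = H(10)[OF s\<Delta> this, folded d]
      have "bv = (\<lambda>_. 0) \<or> bv = facet_sum d (insert v \<sigma>) \<Delta>" by (rule H(11)[OF vD nB]) (use bv d in simp)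
      thus ?thesis
      proof
       assume "bv = (\<lambda>_. 0)"
       hence "b \<tau> = 0" if "v \<in> \<tau>" for \<tau> using that by (metis bv_def)
       thus ?thesis by (intro exI[of _ "\<lambda>_. 0"]) (simp add: on_level_def bdr_def)
      next
       assume e: "bv = facet_sum d (insert v \<sigma>) \<Delta>"
       have "facet_sum d \<sigma> \<Delta> \<tau> = b \<tau>" if "v \<in> \<tau>" for \<tau>
       proof -
        have "b \<tau> = facet_sum d (insert v \<sigma>) \<Delta> \<tau>" using fun_cong[OF e, of \<tau>] that by (simp add: bv_def)
        thus ?thesis using that by (simp add: facet_sum_def)
       qed
       thus ?thesis using top d by (intro exI[of _ "facet_sum d \<sigma> \<Delta>"]) (simp add: bit_cycle_def)
      qed
     qed
    qed
   qed
   then obtain y where y: "on_level ?F (Suc j) y" "\<And>\<rho>. \<rho> \<in> ?F ==> card \<rho> = j ==> bdr V y \<rho> = 0" "\<And>\<tau>. v \<in> \<tau> ==> y \<tau> = b \<tau>"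
    by auto
   let ?x = "\<lambda>\<tau>. b \<tau> + y \<tau>"
   have "on_level (faces_above \<sigma> ?P) (Suc j) ?x"
    unfolding on_level_def
   proof (intro allI impI)
    fix \<tau> assume nz: "b \<tau> + y \<tau> ~= 0"
    hence "v \<notin> \<tau>" using y(3)[of \<tau>] by (metis bit_add_self)
    moreover have "b \<tau> ~= 0 \<or> y \<tau> ~= 0" using nz by auto
    hence "\<tau> \<in> ?F \<and> card \<tau> = Suc j" using y(1) b(1) unfolding on_level_def by blast
    ultimately show "\<tau> \<in> faces_above \<sigma> ?P \<and> card \<tau> = Suc j" by (simp add: faces_above_def)
   qed
   moreover have "bdr V ?x \<rho> = z \<rho>" if r: "\<rho> \<in> faces_above \<sigma> ?P" "card \<rho> = j" for \<rho>
   proof -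
    have "\<rho> \<in> ?F" using r by (simp add: faces_above_def)
    thus ?thesis using b(2)[of \<rho>] y(2)[of \<rho>] r(2) by (simp add: bdr_def sum.distrib)
   qed
   ultimately show "\<exists>b. on_level (faces_above \<sigma> ?P) (Suc j) b \<and> (\<forall>\<rho>\<in>faces_above \<sigma> ?P. card \<rho> = j --> bdr V b \<rho> = z \<rho>)"
    by (intro exI[of _ ?x]) simp
  qed
 qed
qed

section \<open>Calculus of h-numbers\<close>

definition f_count :: "'a set set => nat => int" where
 "f_count X j = int (card {\<tau>\<in>X. card \<tau> = j})"

text \<open>The passage from f to h for an arbitrary sequence, so that linear relations between face
  numbers carry over even when a combination belongs to no complex.\<close>

definition h_of_f :: "nat => (nat => int) => nat => int" where
 "h_of_f d f i = (\<Sum>j\<le>i. (-1) ^ (i - j) * (f j * int ((d - j) choose (i - j))))"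

text \<open>The face numbers of the faces containing a vertex, when \<open>f\<close> is the sequence
  of its link.\<close>

definition shift_f :: "(nat => int) => nat => int" where
 "shift_f f j = (if j = 0 then 0 else f (j - 1))"

lemma h_entry_eq: "h_entry d X i = h_of_f d (f_count X) i"
 by (simp add: h_entry_def h_of_f_def f_count_def)

lemma h_of_f_0 [simp]: "h_of_f d f 0 = f 0"
 by (simp add: h_of_f_def)

lemma h_of_f_add: "h_of_f d (\<lambda>j. f j + g j) i = h_of_f d f i + h_of_f d g i"
 by (simp add: h_of_f_def distrib_left distrib_right sum.distrib)

lemma h_of_f_diff: "h_of_f d (\<lambda>j. f j - g j) i = h_of_f d f i - h_of_f d g i"
 by (simp add: h_of_f_def algebra_simps sum_subtractf)

lemma h_of_f_sum: "h_of_f d (\<lambda>j. \<Sum>v\<in>I. f v j) i = (\<Sum>v\<in>I. h_of_f d (f v) i)"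
 by (induction I rule: infinite_finite_induct) (simp_all add: h_of_f_add, simp_all add: h_of_f_def)

lemma h_of_f_cong: "(\<And>j. j \<le> i ==> f j = g j) ==> h_of_f d f i = h_of_f d g i"
 by (simp add: h_of_f_def)

lemma h_of_f_shift: "h_of_f (Suc d) (shift_f f) (Suc i) = h_of_f d f i"
 unfolding h_of_f_def by (subst sum.atMost_Suc_shift) (simp add: shift_f_def)

lemma h_of_f_Suc_dim:
 assumes "i \<le> d"
 shows "h_of_f (Suc d) f (Suc i) = h_of_f d f (Suc i) - h_of_f d f i"
proof -
 have "(-1) ^ (Suc i - j) * (f j * int ((Suc d - j) choose (Suc i - j))) =
   (-1) ^ (Suc i - j) * (f j * int ((d - j) choose (Suc i - j))) - (-1) ^ (i - j) * (f j * int ((d - j) choose (i - j)))" if "j \<le> i" for j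
  using that assms by (simp add: Suc_diff_le algebra_simps)
 thus ?thesis by (simp add: h_of_f_def sum_subtractf)
qed

text \<open>\<open>f + shift_f f\<close> belongs to a cone. Raising the dimension subtracts the
  previous h-number, and the faces through the apex add it back.\<close>

lemma h_of_f_star:
 assumes "i \<le> Suc d"
 shows "h_of_f (Suc d) (\<lambda>j. f j + shift_f f j) i = h_of_f d f i"
proof (cases i)
 case 0
 thus ?thesis by (simp add: shift_f_def)
next
 case (Suc k)
 thus ?thesis using assms h_of_f_Suc_dim[of k d f] by (simp add: h_of_f_add h_of_f_shift)
qed

text \<open>The derivative of the f-polynomial expressed in h-numbers. With
  \<open>sum_f_count_link\<close> it becomes McMullen's formula for the sum over vertex
  links.\<close>

lemma h_of_f_derivative:
 assumes "j \<le> d"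
 shows "h_of_f d (\<lambda>i. int (Suc i) * f (Suc i)) j = int (Suc j) * h_of_f (Suc d) f (Suc j) + int (Suc d - j) * h_of_f (Suc d) f j"
proof -
 have "h_of_f d (\<lambda>i. int (Suc i) * f (Suc i)) j = (\<Sum>i\<le>Suc j. (-1) ^ (Suc j - i) * (int i * f i * int ((Suc d - i) choose (Suc j - i))))"
  unfolding h_of_f_def by (subst sum.atMost_Suc_shift) simp
 also have "\<dots> = int (Suc j) * f (Suc j) + (\<Sum>i\<le>j. (-1) ^ (Suc j - i) * (int i * f i * int ((Suc d - i) choose (Suc j - i))))"
  by simp
 also have "(\<Sum>i\<le>j. (-1) ^ (Suc j - i) * (int i * f i * int ((Suc d - i) choose (Suc j - i)))) =
   (\<Sum>i\<le>j. int (Suc j) * ((-1) ^ (Suc j - i) * (f i * int ((Suc d - i) choose (Suc j - i)))) + int (Suc d - j) * ((-1) ^ (j - i) * (f i * int ((Suc d - i) choose (j - i)))))"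
 proof (rule sum.cong[OF refl])
  fix i assume "i \<in> {..j}"
  hence ij: "i \<le> j" by simp
  define n r where "n = Suc d - i" and "r = j - i"
  have e: "Suc j - i = Suc r" "int i = int (Suc j) - int (Suc r)" "Suc d - j = n - r" using ij assms by (auto simp: n_def r_def)
  \<comment> \<open>With \<open>i\<close> split as \<open>Suc j - Suc r\<close>, the absorption
    identity converts the second part into the binomial coefficient belonging to the index
    \<open>j\<close>.\<close>
  have "Suc r * (n choose Suc r) = (n - r) * (n choose r)"
   using binomial_absorption[of r n] binomial_absorb_comp[of n r] by simp
  hence b: "int (Suc r) * int (n choose Suc r) = int (n - r) * int (n choose r)" by (metis of_nat_mult)
  have "int i * int (n choose Suc r) = int (Suc j) * int (n choose Suc r) - int (n - r) * int (n choose r)"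
   unfolding e(2) left_diff_distrib b ..
  hence "(-1) ^ r * f i * (int i * int (n choose Suc r)) = (-1) ^ r * f i * (int (Suc j) * int (n choose Suc r) - int (n - r) * int (n choose r))"
   by simp
  thus "(-1) ^ (Suc j - i) * (int i * f i * int ((Suc d - i) choose (Suc j - i))) =
    int (Suc j) * ((-1) ^ (Suc j - i) * (f i * int ((Suc d - i) choose (Suc j - i)))) + int (Suc d - j) * ((-1) ^ (j - i) * (f i * int ((Suc d - i) choose (j - i))))"
   unfolding e(1,3) n_def[symmetric] r_def[symmetric] by (simp add: algebra_simps)
 qed
 finally show ?thesis by (simp add: h_of_f_def sum.distrib sum_distrib_left distrib_left)
qed

text \<open>Inclusion and exclusion: both sides count the \<open>k\<close>-subsets of a set of
  \<open>d\<close> elements that avoid \<open>i\<close> given elements, because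
  \<open>(d - j) choose (k - j)\<close> counts those containing \<open>j\<close> given ones.\<close>

lemma alternating_vandermonde:
 assumes "i \<le> d" "k \<le> d"
 shows "(\<Sum>j\<le>k. (-1) ^ j * (int ((d - j) choose (k - j)) * int (i choose j))) = int ((d - i) choose k)"
 using assms
proof (induction i arbitrary: d k)
 case 0
 have "(\<Sum>j\<le>k. (-1) ^ j * (int ((d - j) choose (k - j)) * int (0 choose j))) = (\<Sum>j\<in>{0}. (-1) ^ j * (int ((d - j) choose (k - j)) * int (0 choose j)))"
  by (rule sum.mono_neutral_right) (auto simp: binomial_eq_0_iff)
 thus ?case by simp
next
 case (Suc i)
 show ?case
 proof (cases k)
  case 0
  thus ?thesis by simp
 next
  case (Suc k')
  obtain d' where d': "d = Suc d'" using Suc.prems by (cases d) auto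
  have "(\<Sum>j\<le>k. (-1) ^ j * (int ((d - j) choose (k - j)) * int (Suc i choose j))) =
   (\<Sum>j\<le>k. (-1) ^ j * (int ((d - j) choose (k - j)) * int (i choose j))) +
   (\<Sum>j\<le>k. (-1) ^ j * (int ((d - j) choose (k - j)) * int (if j = 0 then 0 else i choose (j - 1))))"
   unfolding sum.distrib[symmetric]
  proof (rule sum.cong[OF refl])
   fix j show "(-1) ^ j * (int ((d - j) choose (k - j)) * int (Suc i choose j)) = (-1) ^ j * (int ((d - j) choose (k - j)) * int (i choose j)) + (-1) ^ j * (int ((d - j) choose (k - j)) * int (if j = 0 then 0 else i choose (j - 1)))"
    by (cases j) (simp_all add: algebra_simps)
  qed
  also have "(\<Sum>j\<le>k. (-1) ^ j * (int ((d - j) choose (k - j)) * int (if j = 0 then 0 else i choose (j - 1)))) =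
    - (\<Sum>j\<le>k'. (-1) ^ j * (int ((d' - j) choose (k' - j)) * int (i choose j)))"
   unfolding Suc d' by (subst sum.atMost_Suc_shift) (simp add: sum_negf)
  also have "\<dots> = - int ((d' - i) choose k')" using Suc.IH[of d' k'] Suc.prems Suc d' by simp
  also have "(\<Sum>j\<le>k. (-1) ^ j * (int ((d - j) choose (k - j)) * int (i choose j))) = int ((d - i) choose k)"
   using Suc.IH[of d k] Suc.prems by simp
  finally show ?thesis using Suc d' Suc.prems by (simp add: Suc_diff_le)
 qed
qed

lemma card_incidence:
 assumes "finite A" "finite C"
 shows "(\<Sum>a\<in>A. card {c\<in>C. R a c}) = (\<Sum>c\<in>C. card {a\<in>A. R a c})"
proof -
 have "(\<Sum>a\<in>A. card {c\<in>C. R a c}) = (\<Sum>a\<in>A. \<Sum>c\<in>C. if R a c then 1 else 0)"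
  using assms by (simp flip: sum.inter_filter)
 also have "\<dots> = (\<Sum>c\<in>C. \<Sum>a\<in>A. if R a c then 1 else 0)" by (rule sum.swap)
 finally show ?thesis using assms by (simp flip: sum.inter_filter)
qed

lemma f_count_link:
 assumes "finite V" "X \<subseteq> Pow V"
 shows "f_count (link_of v X) i = int (card {\<tau>\<in>X. v \<in> \<tau> \<and> card \<tau> = Suc i})"
proof -
 have fin: "finite \<tau>" if "insert v \<tau> \<in> X" for \<tau>
  using that assms by (meson PowD finite_insert finite_subset subsetD)
 have "bij_betw (insert v) {\<tau>\<in>link_of v X. card \<tau> = i} {\<tau>\<in>X. v \<in> \<tau> \<and> card \<tau> = Suc i}"
 proof (rule bij_betw_byWitness[where f' = "\<lambda>\<tau>. \<tau> - {v}"])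
  show "insert v ` {\<tau>\<in>link_of v X. card \<tau> = i} \<subseteq> {\<tau>\<in>X. v \<in> \<tau> \<and> card \<tau> = Suc i}"
   using fin by (auto simp: link_of_def)
  show "(\<lambda>\<tau>. \<tau> - {v}) ` {\<tau>\<in>X. v \<in> \<tau> \<and> card \<tau> = Suc i} \<subseteq> {\<tau>\<in>link_of v X. card \<tau> = i}"
   by (auto simp: link_of_def insert_absorb)
 qed (auto simp: link_of_def)
 thus ?thesis using bij_betw_same_card unfolding f_count_def by fastforce
qed

lemma sum_f_count_link:
 assumes "finite V" "X \<subseteq> Pow V"
 shows "(\<Sum>v\<in>V. f_count (link_of v X) i) = int (Suc i) * f_count X (Suc i)"
proof -
 have finX: "finite X" using assms by (meson finite_Pow_iff finite_subset)
 have "(\<Sum>v\<in>V. card {\<tau>\<in>{\<tau>\<in>X. card \<tau> = Suc i}. v \<in> \<tau>}) = (\<Sum>\<tau>\<in>{\<tau>\<in>X. card \<tau> = Suc i}. card {v\<in>V. v \<in> \<tau>})"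
  by (rule card_incidence) (use assms finX in auto)
 also have "\<dots> = (\<Sum>\<tau>\<in>{\<tau>\<in>X. card \<tau> = Suc i}. Suc i)"
 proof (rule sum.cong[OF refl])
  fix \<tau> assume "\<tau> \<in> {\<tau>\<in>X. card \<tau> = Suc i}"
  moreover from this have "{v\<in>V. v \<in> \<tau>} = \<tau>" using assms(2) by auto
  ultimately show "card {v\<in>V. v \<in> \<tau>} = Suc i" by simp
 qed
 finally have e: "(\<Sum>v\<in>V. card {\<tau>\<in>{\<tau>\<in>X. card \<tau> = Suc i}. v \<in> \<tau>}) = card {\<tau>\<in>X. card \<tau> = Suc i} * Suc i" by simp
 have "(\<Sum>v\<in>V. f_count (link_of v X) i) = int (\<Sum>v\<in>V. card {\<tau>\<in>{\<tau>\<in>X. card \<tau> = Suc i}. v \<in> \<tau>})"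
  unfolding of_nat_sum f_count_link[OF assms]
  by (intro sum.cong refl arg_cong[of _ _ int] arg_cong[of _ _ card]) auto
 thus ?thesis unfolding e f_count_def of_nat_mult by (simp only: mult.commute)
qed

lemma sum_h_links:
 assumes "finite V" "X \<subseteq> Pow V" "j \<le> d"
 shows "(\<Sum>v\<in>V. h_entry d (link_of v X) j) = int (Suc j) * h_entry (Suc d) X (Suc j) + int (Suc d - j) * h_entry (Suc d) X j"
 unfolding h_entry_eq h_of_f_sum[symmetric] sum_f_count_link[OF assms(1,2)] by (rule h_of_f_derivative[OF assms(3)])

lemma f_count_split: "finite X ==> f_count X j = f_count {\<tau>\<in>X. P \<tau>} j + f_count {\<tau>\<in>X. \<not> P \<tau>} j"
 unfolding f_count_def of_nat_add[symmetric]
 by (subst card_Un_disjoint[symmetric]) (auto intro!: arg_cong[of _ _ card])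

lemma f_count_containing:
 assumes "finite V" "X \<subseteq> Pow V"
 shows "f_count {\<tau>\<in>X. v \<in> \<tau>} j = shift_f (f_count (link_of v X)) j"
proof (cases j)
 case 0
 have "{\<tau>\<in>{\<tau>\<in>X. v \<in> \<tau>}. card \<tau> = 0} = {}"
 proof -
  have "card \<tau> ~= 0" if t: "\<tau> \<in> X" "v \<in> \<tau>" for \<tau>
  proof -
   have "finite \<tau>" using t(1) assms by (meson PowD finite_subset subsetD)
   thus ?thesis using t(2) by auto
  qed
  thus ?thesis by blast
 qed
 hence "f_count {\<tau>\<in>X. v \<in> \<tau>} 0 = 0" by (simp only: f_count_def card.empty of_nat_0)
 thus ?thesis unfolding 0 by (simp add: shift_f_def)
next
 case (Suc i)
 have "{\<tau>\<in>{\<tau>\<in>X. v \<in> \<tau>}. card \<tau> = Suc i} = {\<tau>\<in>X. v \<in> \<tau> \<and> card \<tau> = Suc i}" by auto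
 thus ?thesis using f_count_link[OF assms, of v i] Suc by (simp add: f_count_def shift_f_def)
qed

section \<open>Comparison of a ball with its vertex links\<close>

context
 fixes d :: nat and V :: "'a set" and \<Delta> B :: "'a set set"
 assumes HB: "homology_ball (Suc d) V \<Delta> B"
begin

text \<open>The closed star is a cone over the link and has its h-numbers, so the difference is the
  h-number of the faces off the star, which are relative Cohen-Macaulay.\<close>

lemma h_link_le:
 assumes v: "v \<in> V" and i: "i \<le> d"
 shows "h_entry d (link_of v \<Delta>) i \<le> h_entry (Suc d) \<Delta> i"
proof -
 note H = homology_ballD[OF HB]
 let ?P = "{\<tau>\<in>\<Delta>. insert v \<tau> \<notin> \<Delta>}"
 have "0 \<le> h_entry (Suc d) ?P i" by (rule h_entry_nonneg[OF relative_CM_off_star[OF HB v]]) (use i in simp)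
 moreover have "f_count ?P j = f_count \<Delta> j - (f_count (link_of v \<Delta>) j + shift_f (f_count (link_of v \<Delta>)) j)" for j
 proof -
  let ?S = "{\<tau>\<in>\<Delta>. insert v \<tau> \<in> \<Delta>}"
  have "f_count \<Delta> j = f_count ?S j + f_count ?P j" by (rule f_count_split[OF H(13)])
  moreover have "f_count ?S j = f_count {\<tau>\<in>?S. v \<in> \<tau>} j + f_count {\<tau>\<in>?S. v \<notin> \<tau>} j"
   by (rule f_count_split) (use H(13) in simp)
  moreover have "{\<tau>\<in>?S. v \<in> \<tau>} = {\<tau>\<in>\<Delta>. v \<in> \<tau>}" by (auto simp: insert_absorb)
  moreover have "{\<tau>\<in>?S. v \<notin> \<tau>} = link_of v \<Delta>"
   using down_closedD[OF H(3)] by (auto simp: link_of_def)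
  ultimately show ?thesis using f_count_containing[OF H(1,2), of v j] by simp
 qed
 hence "h_entry (Suc d) ?P i = h_of_f (Suc d) (\<lambda>j. f_count \<Delta> j - (f_count (link_of v \<Delta>) j + shift_f (f_count (link_of v \<Delta>)) j)) i"
  unfolding h_entry_eq by presburger
 ultimately show ?thesis using i by (simp add: h_of_f_diff h_of_f_star h_entry_eq)
qed

text \<open>The faces containing \<open>v\<close> contribute the h-numbers of the link with the
  index raised by one, so the difference is an h-number of the deletion of \<open>v\<close>,
  Cohen-Macaulay by fullness.\<close>

lemma h_link_boundary_le:
 assumes v: "{v} \<in> B" and full: "\<And>\<sigma>. \<sigma> \<in> \<Delta> ==> (\<And>u. u \<in> \<sigma> ==> {u} \<in> B) ==> \<sigma> \<in> B" and i: "i \<le> d"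
 shows "h_entry d (link_of v \<Delta>) i \<le> h_entry (Suc d) \<Delta> (Suc i)"
proof -
 note H = homology_ballD[OF HB]
 let ?P = "{\<tau>\<in>\<Delta>. v \<notin> \<tau>}"
 have "0 \<le> h_entry (Suc d) ?P (Suc i)" by (rule h_entry_nonneg[OF relative_CM_deletion[OF HB v full]]) (use i in simp_all)
 moreover have "f_count ?P j = f_count \<Delta> j - shift_f (f_count (link_of v \<Delta>)) j" for j
  using f_count_split[OF H(13), of j "\<lambda>\<tau>. v \<in> \<tau>"] f_count_containing[OF H(1,2), of v j] by simp
 hence "h_entry (Suc d) ?P (Suc i) = h_of_f (Suc d) (\<lambda>j. f_count \<Delta> j - shift_f (f_count (link_of v \<Delta>)) j) (Suc i)"
  unfolding h_entry_eq by presburger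
 ultimately show ?thesis by (simp add: h_of_f_diff h_of_f_shift h_entry_eq)
qed

end

text \<open>The Euler relation above each face writes interior face numbers as signed binomial sums
  of all face numbers; \<open>alternating_vandermonde\<close> then turns the index \<open>k\<close>
  into \<open>d - k\<close>.\<close>

theorem h_interior_dual:
 assumes HB: "homology_ball d V \<Delta> B" and k: "k \<le> d"
 shows "h_entry d (\<Delta> - B) k = h_entry d \<Delta> (d - k)"
proof -
 note H = homology_ballD[OF HB]
 have fin: "finite {\<tau>\<in>\<Delta>. P \<tau>}" for P using H(13) by simp
 have f: "f_count (\<Delta> - B) j = (\<Sum>i\<le>d. (-1) ^ (d - i) * (f_count \<Delta> i * int (i choose j)))" for j
 proof -
  have "f_count (\<Delta> - B) j = (\<Sum>\<sigma>\<in>{\<sigma>\<in>\<Delta>. card \<sigma> = j}. if \<sigma> \<in> B then 0 else 1)"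
  proof -
   have "{\<sigma>\<in>\<Delta> - B. card \<sigma> = j} = {\<sigma>\<in>{\<sigma>\<in>\<Delta>. card \<sigma> = j}. \<sigma> \<notin> B}" by auto
   hence "f_count (\<Delta> - B) j = (\<Sum>\<sigma>\<in>{\<sigma>\<in>{\<sigma>\<in>\<Delta>. card \<sigma> = j}. \<sigma> \<notin> B}. 1)" by (simp add: f_count_def)
   also have "\<dots> = (\<Sum>\<sigma>\<in>{\<sigma>\<in>\<Delta>. card \<sigma> = j}. if \<sigma> \<notin> B then 1 else 0)" using fin by (simp only: sum.inter_filter)
   finally show ?thesis by (simp only: if_not_P if_P if_distrib cong: if_cong) (auto intro!: sum.cong)
  qed
  \<comment> \<open>The indicator of interior faces is replaced by the Euler sum over the faces
    above; exchanging the sums will count the \<open>j\<close>-subsets of each face.\<close>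
  also have "\<dots> = (\<Sum>\<sigma>\<in>{\<sigma>\<in>\<Delta>. card \<sigma> = j}. \<Sum>i\<le>d. (-1) ^ (d - i) * int (card {\<tau>\<in>{\<tau>\<in>\<Delta>. card \<tau> = i}. \<sigma> \<subseteq> \<tau>}))"
  proof (rule sum.cong[OF refl])
   fix \<sigma> assume "\<sigma> \<in> {\<sigma>\<in>\<Delta>. card \<sigma> = j}"
   hence s: "\<sigma> \<in> \<Delta>" by simp
   have "{\<tau>\<in>faces_above \<sigma> \<Delta>. card \<tau> = i} = {\<tau>\<in>{\<tau>\<in>\<Delta>. card \<tau> = i}. \<sigma> \<subseteq> \<tau>}" for i by (auto simp: faces_above_def)
   thus "(if \<sigma> \<in> B then 0 else 1) = (\<Sum>i\<le>d. (-1) ^ (d - i) * int (card {\<tau>\<in>{\<tau>\<in>\<Delta>. card \<tau> = i}. \<sigma> \<subseteq> \<tau>}))"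
    using euler_links[OF HB s] by simp
  qed
  also have "\<dots> = (\<Sum>i\<le>d. (-1) ^ (d - i) * int (\<Sum>\<sigma>\<in>{\<sigma>\<in>\<Delta>. card \<sigma> = j}. card {\<tau>\<in>{\<tau>\<in>\<Delta>. card \<tau> = i}. \<sigma> \<subseteq> \<tau>}))"
   by (subst sum.swap) (simp add: sum_distrib_left)
  also have "\<dots> = (\<Sum>i\<le>d. (-1) ^ (d - i) * (f_count \<Delta> i * int (i choose j)))"
  proof (rule sum.cong[OF refl])
   fix i
   have "(\<Sum>\<sigma>\<in>{\<sigma>\<in>\<Delta>. card \<sigma> = j}. card {\<tau>\<in>{\<tau>\<in>\<Delta>. card \<tau> = i}. \<sigma> \<subseteq> \<tau>}) = (\<Sum>\<tau>\<in>{\<tau>\<in>\<Delta>. card \<tau> = i}. card {\<sigma>\<in>{\<sigma>\<in>\<Delta>. card \<sigma> = j}. \<sigma> \<subseteq> \<tau>})"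
    by (rule card_incidence) (rule fin)+
   also have "\<dots> = (\<Sum>\<tau>\<in>{\<tau>\<in>\<Delta>. card \<tau> = i}. i choose j)"
   proof (rule sum.cong[OF refl])
    fix \<tau> assume t: "\<tau> \<in> {\<tau>\<in>\<Delta>. card \<tau> = i}"
    hence "{\<sigma>\<in>{\<sigma>\<in>\<Delta>. card \<sigma> = j}. \<sigma> \<subseteq> \<tau>} = {\<sigma>. \<sigma> \<subseteq> \<tau> \<and> card \<sigma> = j}" using down_closedD[OF H(3)] by auto
    thus "card {\<sigma>\<in>{\<sigma>\<in>\<Delta>. card \<sigma> = j}. \<sigma> \<subseteq> \<tau>} = i choose j" using n_subsets[of \<tau> j] H(12)[of \<tau>] t by simp
   qed
   finally show "(-1) ^ (d - i) * int (\<Sum>\<sigma>\<in>{\<sigma>\<in>\<Delta>. card \<sigma> = j}. card {\<tau>\<in>{\<tau>\<in>\<Delta>. card \<tau> = i}. \<sigma> \<subseteq> \<tau>}) = (-1) ^ (d - i) * (f_count \<Delta> i * int (i choose j))"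
    by (simp add: f_count_def)
  qed
  finally show ?thesis .
 qed
 have "h_entry d (\<Delta> - B) k = (\<Sum>j\<le>k. \<Sum>i\<le>d. (-1) ^ (d - i) * f_count \<Delta> i * (-1) ^ k * ((-1) ^ j * (int ((d - j) choose (k - j)) * int (i choose j))))"
  unfolding h_entry_eq h_of_f_def f
 proof (rule sum.cong[OF refl])
  fix j assume "j \<in> {..k}"
  hence s: "(-1) ^ (k - j) = (-1) ^ k * ((-1) ^ j :: int)" by (simp add: minus_one_power_iff)
  show "(-1) ^ (k - j) * ((\<Sum>i\<le>d. (-1) ^ (d - i) * (f_count \<Delta> i * int (i choose j))) * int ((d - j) choose (k - j))) =
    (\<Sum>i\<le>d. (-1) ^ (d - i) * f_count \<Delta> i * (-1) ^ k * ((-1) ^ j * (int ((d - j) choose (k - j)) * int (i choose j))))"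
   unfolding s sum_distrib_left sum_distrib_right by (intro sum.cong) (simp_all add: mult_ac)
 qed
 also have "\<dots> = (\<Sum>i\<le>d. (-1) ^ (d - i) * f_count \<Delta> i * (-1) ^ k * int ((d - i) choose k))"
  by (subst sum.swap) (simp add: sum_distrib_left[symmetric] alternating_vandermonde k)
 also have "\<dots> = (\<Sum>i\<le>d - k. (-1) ^ (d - i) * f_count \<Delta> i * (-1) ^ k * int ((d - i) choose k))"
  by (rule sum.mono_neutral_right) (auto simp: binomial_eq_0_iff)
 also have "\<dots> = h_entry d \<Delta> (d - k)"
  unfolding h_entry_eq h_of_f_def
 proof (rule sum.cong[OF refl])
  fix i assume "i \<in> {..d - k}"
  hence i: "i \<le> d - k" "k \<le> d - i" using k by auto
  have "(-1) ^ (d - i) = (-1) ^ (d - k - i) * ((-1) ^ k :: int)" using i by (simp flip: power_add)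
  moreover have "(d - i) choose k = (d - i) choose (d - k - i)" using binomial_symmetric[OF i(2)] by (simp add: add.commute)
  moreover have "(-1) ^ k * (-1) ^ k = (1::int)" by (simp flip: power_mult_distrib)
  ultimately show "(-1) ^ (d - i) * f_count \<Delta> i * (-1) ^ k * int ((d - i) choose k) = (-1) ^ (d - k - i) * (f_count \<Delta> i * int ((d - i) choose (d - k - i)))"
   by (simp add: mult_ac)
 qed
 finally show ?thesis .
qed

text \<open>The binomial coefficient \<open>(x + k - 1) choose k\<close> as a polynomial in
  \<open>x\<close>, hence meaningful for the negative values that \<open>defect\<close> can
  take.\<close>

definition rising :: "rat => nat => rat" where
 "rising x k = pochhammer x k / fact k"

lemma rising_0 [simp]: "rising x 0 = 1"
 by (simp add: rising_def)

lemma rising_Suc: "of_nat (Suc k) * rising x (Suc k) = (x + of_nat k) * rising x k"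
proof -
 have "of_nat (Suc k) * (pochhammer x (Suc k) / fact (Suc k)) = pochhammer x (Suc k) / fact k"
  unfolding fact_Suc using of_nat_neq_0[of k, where 'a = rat] by (simp only: times_divide_eq_right mult_divide_mult_cancel_left_if if_False refl)
 thus ?thesis by (simp only: rising_def pochhammer_Suc) (simp add: mult_ac)
qed

lemma rising_pos: "0 < x ==> 0 < rising x k"
 by (simp add: rising_def pochhammer_pos)

text \<open>The number of vertices beyond those of a facet. It is unchanged in vertex links, so one
  value serves the whole induction.\<close>

definition defect :: "'a set => nat => rat" where
 "defect V d = of_nat (card V) - of_nat d"

lemma defect_link: "finite V ==> v \<in> V ==> defect (V - {v}) d = defect V (Suc d)"
proof -
 assume "finite V" "v \<in> V"
 hence "card V = Suc (card (V - {v}))" by (metis card.remove)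
 thus ?thesis by (simp add: defect_def)
qed

definition neighborly :: "nat => 'a set => 'a set set => bool" where
 "neighborly k V X \<longleftrightarrow> (\<forall>\<sigma>. \<sigma> \<subseteq> V \<and> card \<sigma> \<le> k --> \<sigma> \<in> X)"

text \<open>Links of neighborly families are neighborly with \<open>k\<close> lowered by one, so
  McMullen's formula becomes the recursion \<open>rising_Suc\<close>.\<close>

lemma h_neighborly:
 assumes "finite V" "X \<subseteq> Pow V" "neighborly k V X" "k \<le> d"
 shows "of_int (h_entry d X k) = rising (defect V d) k"
 using assms
proof (induction k arbitrary: d V X)
 case 0
 have "{\<tau>\<in>X. card \<tau> = 0} = {{}}"
 proof -
  have "finite \<tau>" if "\<tau> \<in> X" for \<tau> using that 0 by (meson PowD finite_subset subsetD)
  moreover have "{} \<in> X" using 0(3) by (simp add: neighborly_def)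
  ultimately show ?thesis by auto
 qed
 thus ?case by (simp add: h_entry_eq f_count_def)
next
 case (Suc k)
 obtain e where e: "d = Suc e" "k \<le> e" using Suc.prems(4) by (cases d) auto
 have hk: "of_int (h_entry d X k) = rising (defect V d) k"
  using Suc.IH[of V X d] Suc.prems by (simp add: neighborly_def)
 have "of_int (h_entry e (link_of v X) k) = rising (defect V d) k" if v: "v \<in> V" for v
 proof -
  have "link_of v X \<subseteq> Pow (V - {v})" using Suc.prems(2) by (auto simp: link_of_def)
  moreover have "neighborly k (V - {v}) (link_of v X)"
   unfolding neighborly_def
  proof (intro allI impI)
   fix \<sigma> assume s: "\<sigma> \<subseteq> V - {v} \<and> card \<sigma> \<le> k"
   hence "finite \<sigma>" using Suc.prems(1) finite_subset by blast
   hence "insert v \<sigma> \<subseteq> V \<and> card (insert v \<sigma>) \<le> Suc k" using s v by (auto simp: card_insert_if)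
   hence "insert v \<sigma> \<in> X" using Suc.prems(3) by (simp add: neighborly_def)
   thus "\<sigma> \<in> link_of v X" using s by (auto simp: link_of_def)
  qed
  ultimately have "of_int (h_entry e (link_of v X) k) = rising (defect (V - {v}) e) k"
   using Suc.IH[of "V - {v}" "link_of v X" e] Suc.prems(1) e(2) by simp
  thus ?thesis using defect_link[OF Suc.prems(1) v] e(1) by simp
 qed
 hence "(\<Sum>v\<in>V. of_int (h_entry e (link_of v X) k)) = of_nat (card V) * rising (defect V d) k" by simp
 moreover have "(\<Sum>v\<in>V. of_int (h_entry e (link_of v X) k)) = (of_int (\<Sum>v\<in>V. h_entry e (link_of v X) k) :: rat)" by simp
 ultimately have "of_nat (Suc k) * of_int (h_entry d X (Suc k)) + of_nat (d - k) * rising (defect V d) k = of_nat (card V) * rising (defect V d) k"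
  unfolding sum_h_links[OF Suc.prems(1,2) e(2)] using hk e(1) by simp
 moreover have "of_nat (card V) - of_nat (d - k) = defect V d + of_nat k"
  using e by (simp add: defect_def of_nat_diff)
 ultimately have "of_nat (Suc k) * of_int (h_entry d X (Suc k)) = of_nat (Suc k) * rising (defect V d) (Suc k)"
  unfolding rising_Suc by (metis add_diff_cancel_right' left_diff_distrib)
 thus ?case by (simp only: mult_cancel_left of_nat_eq_0_iff nat.distinct simp_thms)
qed

section \<open>Upper bounds and their equality cases\<close>

lemma h_empty: "h_entry d {} i = 0"
 by (simp add: h_entry_def)

lemma link_of_empty: "down_closed \<Delta> ==> {v} \<notin> \<Delta> ==> link_of v \<Delta> = {}"
 unfolding link_of_def using down_closedD[of \<Delta>] by blast

lemma ball_defect_nonneg: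
 assumes "homology_ball d V \<Delta> B"
 shows "0 \<le> defect V d"
proof -
 note H = homology_ballD[OF assms]
 obtain \<phi> where "\<phi> \<in> \<Delta>" "card \<phi> = d" using homology_ball_pure[OF assms H(4)] by blast
 hence "d \<le> card V" using H(1,2) card_mono by blast
 thus ?thesis by (simp add: defect_def)
qed

text \<open>McMullen's formula and \<open>h_link_le\<close> bound \<open>Suc j\<close> times the
  next h-number by \<open>defect V d + j\<close> times the present one, which is the recursion of
  \<open>rising\<close>. Equality makes the present h-number extremal and shared by all vertex
  links; by induction these are neighborly, and a set is a face once its rest lies in the link of
  one of its elements.\<close>

theorem upper_bound:
 assumes "homology_ball d V \<Delta> B" "j \<le> d"
 shows "of_int (h_entry d \<Delta> j) \<le> rising (defect V d) j \<and> (of_int (h_entry d \<Delta> j) = rising (defect V d) j --> neighborly j V \<Delta>)"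
 using assms
proof (induction j arbitrary: d V \<Delta> B)
 case 0
 note H = homology_ballD[OF 0(1)]
 have "{\<tau>\<in>\<Delta>. card \<tau> = 0} = {{}}" using H(4,12) by auto
 moreover have "neighborly 0 V \<Delta>"
 proof -
  have "\<sigma> = {}" if "\<sigma> \<subseteq> V" "card \<sigma> \<le> 0" for \<sigma> using that H(1) finite_subset[of \<sigma> V] by auto
  thus ?thesis using H(4) unfolding neighborly_def by blast
 qed
 ultimately show ?case by (simp add: h_entry_eq f_count_def)
next
 case (Suc j)
 note H = homology_ballD[OF Suc.prems(1)]
 obtain e where e: "d = Suc e" "j \<le> e" using Suc.prems(2) by (cases d) auto
 have HB: "homology_ball (Suc e) V \<Delta> B" using Suc.prems(1) e(1) by simp
 let ?x = "defect V d" and ?h = "of_int (h_entry d \<Delta> j) :: rat"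
 have x0: "0 \<le> ?x" by (rule ball_defect_nonneg[OF Suc.prems(1)])
 have IH: "?h \<le> rising ?x j" using Suc.IH[OF Suc.prems(1)] Suc.prems(2) by simp
 have le: "h_entry e (link_of v \<Delta>) j \<le> h_entry d \<Delta> j" if "v \<in> V" for v
  using h_link_le[OF HB that e(2)] e(1) by simp
 have "(\<Sum>v\<in>V. h_entry e (link_of v \<Delta>) j) \<le> (\<Sum>v\<in>V. h_entry d \<Delta> j)" by (rule sum_mono) (rule le)
 hence "of_int (\<Sum>v\<in>V. h_entry e (link_of v \<Delta>) j) \<le> (of_int (\<Sum>v\<in>V. h_entry d \<Delta> j) :: rat)" by (simp only: of_int_le_iff)
 hence 1: "of_nat (Suc j) * of_int (h_entry d \<Delta> (Suc j)) + of_nat (d - j) * ?h \<le> of_nat (card V) * ?h"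
  unfolding sum_h_links[OF H(1,2) e(2)] using e(1) by simp
 have c: "of_nat (card V) - of_nat (d - j) = ?x + of_nat j" using e by (simp add: defect_def of_nat_diff)
 have c': "of_nat (card V) * ?h = (?x + of_nat j) * ?h + of_nat (d - j) * ?h"
  unfolding c[symmetric] by (simp add: algebra_simps)
 have 2: "of_nat (Suc j) * of_int (h_entry d \<Delta> (Suc j)) \<le> (?x + of_nat j) * ?h" using 1 c' by simp
 have 3: "(?x + of_nat j) * ?h \<le> (?x + of_nat j) * rising ?x j" by (rule mult_left_mono[OF IH]) (use x0 in simp)
 have "of_nat (Suc j) * of_int (h_entry d \<Delta> (Suc j)) \<le> of_nat (Suc j) * rising ?x (Suc j)"
  unfolding rising_Suc using 2 3 by simp
 hence bound: "of_int (h_entry d \<Delta> (Suc j)) \<le> rising ?x (Suc j)" by (simp only: mult_le_cancel_left_pos of_nat_0_less_iff zero_less_Suc)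
 have "neighborly (Suc j) V \<Delta>" if eq: "of_int (h_entry d \<Delta> (Suc j)) = rising ?x (Suc j)"
 proof (cases "?x = 0")
  \<comment> \<open>With no excess vertices the factor may vanish and equality carries no
    information, but then \<open>\<Delta>\<close> is a full simplex.\<close>
  case True
  obtain \<phi> where \<phi>: "\<phi> \<in> \<Delta>" "card \<phi> = d" using homology_ball_pure[OF Suc.prems(1) H(4)] by blast
  have "card V = d" using True by (simp add: defect_def)
  hence "\<phi> = V" using \<phi> H(1,2) by (intro card_subset_eq) auto
  thus ?thesis using \<phi>(1) down_closedD[OF H(3)] by (simp add: neighborly_def)
 next
  case False
  hence xp: "0 < ?x" using x0 by simp
  hence cp: "0 < ?x + of_nat j" by (simp add: add_pos_nonneg)
  have eq': "of_nat (Suc j) * of_int (h_entry d \<Delta> (Suc j)) = (?x + of_nat j) * rising ?x j" unfolding eq rising_Suc ..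
  have e3: "(?x + of_nat j) * ?h = (?x + of_nat j) * rising ?x j" by (rule antisym[OF 3]) (use 2 eq' in simp)
  have e2: "of_nat (Suc j) * of_int (h_entry d \<Delta> (Suc j)) = (?x + of_nat j) * ?h" by (rule trans[OF eq' e3[symmetric]])
  have h: "?h = rising ?x j" by (rule mult_left_cancel[THEN iffD1, OF _ e3]) (use cp in simp)
  have "of_int (\<Sum>v\<in>V. h_entry e (link_of v \<Delta>) j) = (of_int (\<Sum>v\<in>V. h_entry d \<Delta> j) :: rat)"
   unfolding sum_h_links[OF H(1,2) e(2)] using e2 c' e(1) by simp
  hence s: "(\<Sum>v\<in>V. h_entry e (link_of v \<Delta>) j) = (\<Sum>v\<in>V. h_entry d \<Delta> j)" by (simp only: of_int_eq_iff)
  have hl: "h_entry e (link_of v \<Delta>) j = h_entry d \<Delta> j" if "v \<in> V" for v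
   by (rule sum_mono_inv[OF s le that H(1)])
  show ?thesis
   unfolding neighborly_def
  proof (intro allI impI)
   fix \<sigma> assume s: "\<sigma> \<subseteq> V \<and> card \<sigma> \<le> Suc j"
   show "\<sigma> \<in> \<Delta>"
   proof (cases "\<sigma> = {}")
    case True
    thus ?thesis using H(4) by simp
   next
    case False
    then obtain v where v: "v \<in> \<sigma>" by blast
    hence vV: "v \<in> V" using s by blast
    \<comment> \<open>\<open>V\<close> might contain points that are not vertices; their links are
      empty with h-number 0, which the positive value excludes.\<close>
    have "?h > 0" using h rising_pos[OF xp] by simp
    hence "link_of v \<Delta> ~= {}" using hl[OF vV] by (auto simp: h_empty)
    hence v\<Delta>: "{v} \<in> \<Delta>" using link_of_empty[OF H(3)] by blast
    have "of_int (h_entry e (link_of v \<Delta>) j) = rising (defect (V - {v}) e) j"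
     using hl[OF vV] h defect_link[OF H(1) vV] e(1) by simp
    hence "neighborly j (V - {v}) (link_of v \<Delta>)"
     using Suc.IH[OF homology_ball_link[OF HB v\<Delta>] e(2)] by simp
    moreover have "\<sigma> - {v} \<subseteq> V - {v}" using s by blast
    moreover have "card (\<sigma> - {v}) \<le> j" using s v by (simp add: le_diff_conv)
    ultimately have "\<sigma> - {v} \<in> link_of v \<Delta>" by (simp add: neighborly_def)
    thus ?thesis using v by (simp add: link_of_def insert_absorb)
   qed
  qed
 qed
 thus ?case using bound by simp
qed

theorem upper_bound_eq_iff:
 assumes "homology_ball d V \<Delta> B" "j \<le> d"
 shows "of_int (h_entry d \<Delta> j) = rising (defect V d) j \<longleftrightarrow> neighborly j V \<Delta>"
 using upper_bound[OF assms] h_neighborly[OF homology_ballD(1,2)[OF assms(1)] _ assms(2)] by blast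

text \<open>\<open>W_card\<close> will be supplied by the \<open>d - 1\<close> vertices of a
  boundary ridge. It makes \<open>defect W d\<close> at least -1, so that
  \<open>defect W d + j\<close> is nonnegative for positive \<open>j\<close>.\<close>

locale full_ball =
 fixes d :: nat and V :: "'a set" and \<Delta> B :: "'a set set" and W :: "'a set"
 assumes HB: "homology_ball d V \<Delta> B" and vertices: "V = \<Union>\<Delta>" and W: "W = \<Union>B"
  and full: "\<sigma> \<in> \<Delta> ==> \<sigma> \<subseteq> W ==> \<sigma> \<in> B" and B0: "{} \<in> B" and W_card: "d \<le> Suc (card W)"
begin

lemmas H = homology_ballD[OF HB]

lemma WV: "W \<subseteq> V" and finW: "finite W"
 using H(1,2,6) W by (auto intro: finite_subset)

lemma vertex_face: "v \<in> V ==> {v} \<in> \<Delta>"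
 using vertices down_closedD[OF H(3)] by blast

lemma boundary_vertex: "{v} \<in> B \<longleftrightarrow> v \<in> W"
 using W down_closedD[OF H(7)] by blast

lemma h_interior_0: "h_entry d (\<Delta> - B) 0 = 0"
proof -
 have "{\<tau>\<in>\<Delta> - B. card \<tau> = 0} = {}" using B0 H(12) by auto
 thus ?thesis by (simp only: h_entry_eq h_of_f_0 f_count_def card.empty of_nat_0)
qed

text \<open>McMullen's formula with two kinds of vertices. At an interior vertex
  \<open>upper_bound\<close> applies to the link; at a boundary vertex duality in the link,
  \<open>h_link_boundary_le\<close> and duality in the ball bound the term by the present interior
  h-number. Equality makes the links of interior vertices neighborly and says nothing about sets
  inside \<open>W\<close>.\<close>

theorem interior_bound:
 assumes "k \<le> d"
 shows "of_int (h_entry d (\<Delta> - B) k) \<le> rising (defect V d) k - rising (defect W d) k \<and>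
  (of_int (h_entry d (\<Delta> - B) k) = rising (defect V d) k - rising (defect W d) k -->
   (\<forall>\<sigma>. \<sigma> \<subseteq> V \<and> card \<sigma> \<le> k \<and> \<not> \<sigma> \<subseteq> W --> \<sigma> \<in> \<Delta>))"
 using assms
proof (induction k)
 case 0
 have "\<sigma> \<in> \<Delta>" if "\<sigma> \<subseteq> V" "card \<sigma> \<le> 0" for \<sigma>
 proof -
  have "\<sigma> = {}" using that H(1) finite_subset[of \<sigma> V] by auto
  thus ?thesis using H(4) by simp
 qed
 thus ?case by (simp add: h_interior_0)
next
 case (Suc j)
 obtain e where e: "d = Suc e" "j \<le> e" using Suc.prems by (cases d) auto
 have HBe: "homology_ball (Suc e) V \<Delta> B" using HB e(1) by simp
 let ?P = "\<Delta> - B" and ?x = "defect V d" and ?y = "defect W d"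
 let ?h = "of_int (h_entry d ?P j) :: rat" and ?b = "\<lambda>j. rising ?x j - rising ?y j"
 have subP: "?P \<subseteq> Pow V" using H(2) by auto
 define t where "t = (\<lambda>v. if v \<in> W then ?h else rising ?x j)"
 have ball: "homology_ball e (V - {v}) (link_of v \<Delta>) (link_of v B)" if "v \<in> V" for v
  by (rule homology_ball_link[OF HBe vertex_face[OF that]])
 have int: "link_of v ?P = link_of v \<Delta>" if "v \<notin> W" for v
  using that boundary_vertex[of v] link_of_empty[OF H(7), of v] by (auto simp: link_of_def)
 have le: "of_int (h_entry e (link_of v ?P) j) \<le> t v" if v: "v \<in> V" for v
 proof (cases "v \<in> W")
  case False
  thus ?thesis
   using upper_bound[OF ball[OF v] e(2)] defect_link[OF H(1) v, of e] int[OF False] e(1) by (simp add: t_def)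
 next
  case True
  have "link_of v ?P = link_of v \<Delta> - link_of v B" by (auto simp: link_of_def)
  hence "h_entry e (link_of v ?P) j = h_entry e (link_of v \<Delta>) (e - j)"
   using h_interior_dual[OF ball[OF v] e(2)] by simp
  also have "\<dots> \<le> h_entry (Suc e) \<Delta> (Suc (e - j))"
  proof (rule h_link_boundary_le[OF HBe])
   show "{v} \<in> B" using True boundary_vertex by simp
   show "\<sigma> \<in> B" if "\<sigma> \<in> \<Delta>" "\<And>u. u \<in> \<sigma> ==> {u} \<in> B" for \<sigma>
    using full[OF that(1)] that(2) boundary_vertex by blast
  qed simp
  also have "\<dots> = h_entry d ?P j" using h_interior_dual[OF HB, of j] e by (simp add: Suc_diff_le)
  finally show ?thesis using True by (simp add: t_def)
 qed
 have "(\<Sum>v\<in>V. of_int (h_entry e (link_of v ?P) j)) \<le> (\<Sum>v\<in>V. t v)" by (rule sum_mono) (rule le)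
 moreover have st: "(\<Sum>v\<in>V. t v) = of_nat (card W) * ?h + (of_nat (card V) - of_nat (card W)) * rising ?x j"
 proof -
  have "(\<Sum>v\<in>V. t v) = (\<Sum>v\<in>V - W. t v) + (\<Sum>v\<in>W. t v)" by (rule sum.subset_diff[OF WV H(1)])
  moreover have "(\<Sum>v\<in>V - W. t v) = of_nat (card (V - W)) * rising ?x j" by (simp add: t_def)
  moreover have "(\<Sum>v\<in>W. t v) = of_nat (card W) * ?h" by (simp add: t_def)
  moreover have "of_nat (card (V - W)) = (of_nat (card V) - of_nat (card W) :: rat)"
   using card_Diff_subset[OF finW WV] card_mono[OF H(1) WV] by (simp add: of_nat_diff)
  ultimately show ?thesis by simp
 qed
 moreover have sl: "(\<Sum>v\<in>V. of_int (h_entry e (link_of v ?P) j)) = of_nat (Suc j) * of_int (h_entry d ?P (Suc j)) + of_nat (d - j) * ?h"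
 proof -
  have "(\<Sum>v\<in>V. of_int (h_entry e (link_of v ?P) j)) = (of_int (\<Sum>v\<in>V. h_entry e (link_of v ?P) j) :: rat)" by simp
  thus ?thesis unfolding sum_h_links[OF H(1) subP e(2)] using e(1) by simp
 qed
 ultimately have 1: "of_nat (Suc j) * of_int (h_entry d ?P (Suc j)) + of_nat (d - j) * ?h \<le> of_nat (card W) * ?h + (of_nat (card V) - of_nat (card W)) * rising ?x j"
  by simp
 have c: "of_nat (card W) = (?y + of_nat j) + of_nat (d - j)" using e by (simp add: defect_def of_nat_diff)
 have m: "of_nat (card V) - of_nat (card W) = (?x + of_nat j) - (?y + of_nat j)" by (simp add: defect_def)
 have 2: "of_nat (Suc j) * of_int (h_entry d ?P (Suc j)) \<le> (?y + of_nat j) * ?h + ((?x + of_nat j) - (?y + of_nat j)) * rising ?x j"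
  using 1 unfolding m unfolding c by (simp add: algebra_simps)
 have IH: "?h \<le> ?b j" using Suc.IH Suc.prems by simp
 have 3: "(?y + of_nat j) * ?h \<le> (?y + of_nat j) * ?b j"
 proof (cases "j = 0")
  \<comment> \<open>For \<open>j = 0\<close> the factor can be -1, but both sides are zero.\<close>
  case True
  have "?h = 0" unfolding True h_interior_0 by simp
  thus ?thesis using True by simp
 next
  case False
  have "of_nat d \<le> (1 + of_nat (card W) :: rat)" using W_card by (metis of_nat_Suc of_nat_mono)
  moreover have "1 \<le> (of_nat j :: rat)" using False by (simp add: Suc_leI)
  ultimately have "0 \<le> ?y + of_nat j" by (simp add: defect_def)
  thus ?thesis by (rule mult_left_mono[OF IH])
 qed
 \<comment> \<open>The recursions of the two \<open>rising\<close> terms combine: the interior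
   vertices contribute exactly the difference of the two factors.\<close>
 have 4: "(?y + of_nat j) * ?b j + ((?x + of_nat j) - (?y + of_nat j)) * rising ?x j = of_nat (Suc j) * ?b (Suc j)"
  unfolding right_diff_distrib[of "of_nat (Suc j)"] rising_Suc by (simp add: algebra_simps)
 have 5: "(?y + of_nat j) * ?h + ((?x + of_nat j) - (?y + of_nat j)) * rising ?x j \<le> of_nat (Suc j) * ?b (Suc j)"
  unfolding 4[symmetric] by (rule add_right_mono[OF 3])
 have "of_nat (Suc j) * of_int (h_entry d ?P (Suc j)) \<le> of_nat (Suc j) * ?b (Suc j)" by (rule order_trans[OF 2 5])
 hence bound: "of_int (h_entry d ?P (Suc j)) \<le> ?b (Suc j)" by (simp only: mult_le_cancel_left_pos of_nat_0_less_iff zero_less_Suc)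
 have "\<sigma> \<in> \<Delta>" if eq: "of_int (h_entry d ?P (Suc j)) = ?b (Suc j)" and \<sigma>: "\<sigma> \<subseteq> V" "card \<sigma> \<le> Suc j" "\<not> \<sigma> \<subseteq> W" for \<sigma>
 proof -
  have "of_nat (Suc j) * of_int (h_entry d ?P (Suc j)) = (?y + of_nat j) * ?h + ((?x + of_nat j) - (?y + of_nat j)) * rising ?x j"
   by (rule antisym[OF 2]) (unfold eq, rule 5)
  hence sums: "(\<Sum>v\<in>V. of_int (h_entry e (link_of v ?P) j)) = (\<Sum>v\<in>V. t v)"
   unfolding sl st m unfolding c by (simp add: algebra_simps)
  have termwise: "of_int (h_entry e (link_of u ?P) j) = t u" if u: "u \<in> V" for u
   by (rule sum_mono_inv[OF sums le u H(1)])
  obtain v where v: "v \<in> \<sigma>" "v \<notin> W" using \<sigma>(3) by blast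
  hence vV: "v \<in> V" using \<sigma>(1) by blast
  have "of_int (h_entry e (link_of v \<Delta>) j) = rising (defect (V - {v}) e) j"
   using termwise[OF vV] int[OF v(2)] v(2) defect_link[OF H(1) vV, of e] e(1) by (simp add: t_def)
  hence "neighborly j (V - {v}) (link_of v \<Delta>)" using upper_bound[OF ball[OF vV] e(2)] by simp
  moreover have "\<sigma> - {v} \<subseteq> V - {v}" using \<sigma> by blast
  moreover have "card (\<sigma> - {v}) \<le> j" using \<sigma>(2) v by (simp add: le_diff_conv)
  ultimately have "\<sigma> - {v} \<in> link_of v \<Delta>" by (simp add: neighborly_def)
  thus ?thesis using v by (simp add: link_of_def insert_absorb)
 qed
 thus ?case using bound by blast
qed

text \<open>Up to size \<open>k\<close> the interior faces are exactly the subsets of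
  \<open>V\<close> not contained in \<open>W\<close>, so the face numbers are those of one full
  simplex minus another, and \<open>h_neighborly\<close> evaluates both.\<close>

theorem interior_neighborly:
 assumes k: "k \<le> d" and all: "\<And>\<sigma>. \<sigma> \<subseteq> V ==> card \<sigma> \<le> k ==> \<not> \<sigma> \<subseteq> W ==> \<sigma> \<in> \<Delta>"
 shows "of_int (h_entry d (\<Delta> - B) k) = rising (defect V d) k - rising (defect W d) k"
proof -
 have "f_count (\<Delta> - B) j = f_count (Pow V) j - f_count (Pow W) j" if j: "j \<le> k" for j
 proof -
  have "f_count (Pow V) j = f_count {\<tau>\<in>Pow V. \<tau> \<subseteq> W} j + f_count {\<tau>\<in>Pow V. \<not> \<tau> \<subseteq> W} j"
   by (rule f_count_split) (use H(1) in simp)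
  moreover have "{\<tau>\<in>Pow V. \<tau> \<subseteq> W} = Pow W" using WV by auto
  moreover have "{\<tau>\<in>\<Delta> - B. card \<tau> = j} = {\<tau>\<in>{\<tau>\<in>Pow V. \<not> \<tau> \<subseteq> W}. card \<tau> = j}"
  proof (rule Set.set_eqI, rule iffI)
   fix \<tau> assume "\<tau> \<in> {\<tau>\<in>\<Delta> - B. card \<tau> = j}"
   thus "\<tau> \<in> {\<tau>\<in>{\<tau>\<in>Pow V. \<not> \<tau> \<subseteq> W}. card \<tau> = j}" using full H(2) by blast
  next
   fix \<tau> assume t: "\<tau> \<in> {\<tau>\<in>{\<tau>\<in>Pow V. \<not> \<tau> \<subseteq> W}. card \<tau> = j}"
   hence "\<tau> \<in> \<Delta>" using all j by simp
   moreover have "\<tau> \<notin> B" using t W by blast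
   ultimately show "\<tau> \<in> {\<tau>\<in>\<Delta> - B. card \<tau> = j}" using t by simp
  qed
  ultimately show ?thesis unfolding f_count_def by presburger
 qed
 hence "h_entry d (\<Delta> - B) k = h_entry d (Pow V) k - h_entry d (Pow W) k"
  unfolding h_entry_eq h_of_f_diff[symmetric] by (rule h_of_f_cong)
 moreover have "of_int (h_entry d (Pow V) k) = rising (defect V d) k" by (rule h_neighborly) (use H(1) k in \<open>auto simp: neighborly_def\<close>)
 moreover have "of_int (h_entry d (Pow W) k) = rising (defect W d) k" by (rule h_neighborly) (use finW k in \<open>auto simp: neighborly_def\<close>)
 ultimately show ?thesis by simp
qed

end

section \<open>Translation to the polynomial definition of h-numbers\<close>

lemma coeff_weighted_power:
 assumes "j \<le> d" "k \<le> d"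
 shows "poly.coeff (of_nat f * [:0, 1::int:] ^ j * [:1, -1:] ^ (d - j)) k =
  (if j \<le> k then (-1) ^ (k - j) * (int f * int ((d - j) choose (k - j))) else 0)"
proof -
 have "of_nat f * [:0, 1::int:] ^ j = Polynomial.monom (int f) j"
  by (simp add: monom_altdef of_nat_poly)
 thus ?thesis using assms
  by (auto simp: coeff_monom_mult coeff_linear_poly_power not_le)
qed

lemma h_number_eq:
 assumes "k \<le> d"
 shows "h_number d \<Delta> \<Gamma> k = h_entry d (\<Delta> - \<Gamma>) k"
proof -
 have "f_number \<Delta> \<Gamma> (int j - 1) = card {\<tau>\<in>\<Delta> - \<Gamma>. card \<tau> = j}" for j
  unfolding f_number_def face_dim_def by (intro arg_cong[of _ _ card]) auto
 hence "h_number d \<Delta> \<Gamma> k = (\<Sum>j\<le>d. if j \<le> k then (-1) ^ (k - j) * (int (card {\<tau>\<in>\<Delta> - \<Gamma>. card \<tau> = j}) * int ((d - j) choose (k - j))) else 0)"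
  unfolding h_number_def coeff_sum using assms by (intro sum.cong) (simp_all add: coeff_weighted_power)
 also have "\<dots> = (\<Sum>j\<le>k. if j \<le> k then (-1) ^ (k - j) * (int (card {\<tau>\<in>\<Delta> - \<Gamma>. card \<tau> = j}) * int ((d - j) choose (k - j))) else 0)"
  using assms by (intro sum.mono_neutral_right) auto
 finally show ?thesis by (simp add: h_entry_def)
qed

lemma gbinomial_rising: "(of_int a :: rat) gchoose k = rising (of_int (a - int k + 1)) k"
 by (simp add: gbinomial_pochhammer' rising_def)

lemma ball_with_full_boundary_full_ball:
 assumes "ball_with_full_boundary d m n \<Delta>"
 shows "full_ball d (\<Union>\<Delta>) \<Delta> (boundary_complex (d - 1) \<Delta>) (\<Union>(boundary_complex (d - 1) \<Delta>))"
proof -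
 have d: "1 \<le> d" and ball: "simplicial_ball (d - 1) \<Delta>" and full: "full_subcomplex (boundary_complex (d - 1) \<Delta>) \<Delta>"
  using assms by (simp_all add: ball_with_full_boundary_def)
 obtain f f' where "homeomorphic_maps (geometric_realization \<Delta>) (closed_unit_ball (d - 1)) f f'"
  using ball unfolding simplicial_ball_def homeomorphic_space_def by blast
 then interpret triangulated_ball \<Delta> "d - 1" f f'
  using ball unfolding simplicial_ball_def by unfold_locales (simp_all add: geometric_realization_eq closed_unit_ball_eq)
 show ?thesis
 proof
  show "homology_ball d (\<Union>\<Delta>) \<Delta> (boundary_complex (d - 1) \<Delta>)" using homology_ball d by simp
  show "{} \<in> boundary_complex (d - 1) \<Delta>" by (rule empty_boundary)
  show "\<sigma> \<in> boundary_complex (d - 1) \<Delta>" if "\<sigma> \<in> \<Delta>" "\<sigma> \<subseteq> \<Union>(boundary_complex (d - 1) \<Delta>)" for \<sigma>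
   using full that unfolding full_subcomplex_def complex_vertices_def by simp
  \<comment> \<open>The empty face lies in the boundary, hence in some boundary ridge, whose
    \<open>d - 1\<close> vertices give \<open>W_card\<close>.\<close>
  obtain \<rho> where \<rho>: "\<rho> \<in> \<Delta>" "card \<rho> = d - 1" "\<exists>!\<phi>. \<phi> \<in> \<Delta> \<and> card \<phi> = d - 1 + 1 \<and> \<rho> \<subseteq> \<phi>"
   by (rule boundaryE[OF empty_boundary])
  have "\<rho> \<in> boundary_complex (d - 1) \<Delta>" by (rule boundaryI[OF \<rho>(1) order_refl \<rho>(2,3)])
  hence "\<rho> \<subseteq> \<Union>(boundary_complex (d - 1) \<Delta>)" by blast
  moreover have "finite (\<Union>(boundary_complex (d - 1) \<Delta>))" using finV boundary_down(2) by (meson Union_mono finite_subset)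
  ultimately have "d - 1 \<le> card (\<Union>(boundary_complex (d - 1) \<Delta>))" using \<rho>(2) card_mono by metis
  thus "d \<le> Suc (card (\<Union>(boundary_complex (d - 1) \<Delta>)))" by simp
 qed simp_all
qed

theorem bounds_and_equality:
 fixes \<Delta> :: "'a set set"
 assumes B: "ball_with_full_boundary d m n \<Delta>"
 shows "k \<le> d ==> of_int (h_number d \<Delta> (boundary_complex (d - 1) \<Delta>) k) \<le> bound_lower_half d m n k \<and>
      (of_int (h_number d \<Delta> (boundary_complex (d - 1) \<Delta>) k) = bound_lower_half d m n k \<longleftrightarrow>
       (\<forall>\<sigma>. nonface \<Delta> \<sigma> \<and> face_dim \<sigma> < int k -->
         \<sigma> \<subseteq> complex_vertices (boundary_complex (d - 1) \<Delta>)))"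
  and "k \<le> d ==> of_int (h_number d \<Delta> (boundary_complex (d - 1) \<Delta>) k) \<le> bound_upper_half d m n k \<and>
      (of_int (h_number d \<Delta> (boundary_complex (d - 1) \<Delta>) k) = bound_upper_half d m n k \<longleftrightarrow>
       \<not> (\<exists>\<sigma>. nonface \<Delta> \<sigma> \<and> face_dim \<sigma> < int d - int k))"
proof -
 interpret full_ball d "\<Union>\<Delta>" \<Delta> "boundary_complex (d - 1) \<Delta>" "\<Union>(boundary_complex (d - 1) \<Delta>)"
  by (rule ball_with_full_boundary_full_ball[OF B])
 have N: "card (\<Union>\<Delta>) = m + n" "card (\<Union>(boundary_complex (d - 1) \<Delta>)) = n"
  using B by (simp_all add: ball_with_full_boundary_def complex_vertices_def)
 have defects: "defect (\<Union>\<Delta>) d = of_int (int m + int n - int d)" "defect (\<Union>(boundary_complex (d - 1) \<Delta>)) d = of_int (int n - int d)"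
  unfolding defect_def N by simp_all
 let ?h = "of_int (h_number d \<Delta> (boundary_complex (d - 1) \<Delta>) k) :: rat"
 show "?h \<le> bound_lower_half d m n k \<and> (?h = bound_lower_half d m n k \<longleftrightarrow>
   (\<forall>\<sigma>. nonface \<Delta> \<sigma> \<and> face_dim \<sigma> < int k --> \<sigma> \<subseteq> complex_vertices (boundary_complex (d - 1) \<Delta>)))" if k: "k \<le> d"
 proof -
  have b: "bound_lower_half d m n k = rising (defect (\<Union>\<Delta>) d) k - rising (defect (\<Union>(boundary_complex (d - 1) \<Delta>)) d) k"
   unfolding bound_lower_half_def gbinomial_rising defects by (simp add: algebra_simps)
  have c: "(\<forall>\<sigma>. nonface \<Delta> \<sigma> \<and> face_dim \<sigma> < int k --> \<sigma> \<subseteq> complex_vertices (boundary_complex (d - 1) \<Delta>)) \<longleftrightarrow>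
    (\<forall>\<sigma>. \<sigma> \<subseteq> \<Union>\<Delta> \<and> card \<sigma> \<le> k \<and> \<not> \<sigma> \<subseteq> \<Union>(boundary_complex (d - 1) \<Delta>) --> \<sigma> \<in> \<Delta>)"
  proof -
   have "face_dim \<sigma> < int k \<longleftrightarrow> card \<sigma> \<le> k" for \<sigma> :: "'a set" by (auto simp: face_dim_def)
   thus ?thesis unfolding nonface_def complex_vertices_def by blast
  qed
  show ?thesis unfolding b c h_number_eq[OF k] using interior_bound[OF k] interior_neighborly[OF k] by blast
 qed
 show "?h \<le> bound_upper_half d m n k \<and> (?h = bound_upper_half d m n k \<longleftrightarrow>
   \<not> (\<exists>\<sigma>. nonface \<Delta> \<sigma> \<and> face_dim \<sigma> < int d - int k))" if k: "k \<le> d"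
 proof -
  have "bound_upper_half d m n k = rising (of_int (int m + int n - 1 - int k - int (d - k) + 1)) (d - k)"
   unfolding bound_upper_half_def gbinomial_rising ..
  also have "int m + int n - 1 - int k - int (d - k) + 1 = int m + int n - int d" using k by simp
  finally have b: "bound_upper_half d m n k = rising (defect (\<Union>\<Delta>) d) (d - k)" unfolding defects .
  have c: "\<not> (\<exists>\<sigma>. nonface \<Delta> \<sigma> \<and> face_dim \<sigma> < int d - int k) \<longleftrightarrow> neighborly (d - k) (\<Union>\<Delta>) \<Delta>"
  proof -
   have "face_dim \<sigma> < int d - int k \<longleftrightarrow> card \<sigma> \<le> d - k" for \<sigma> :: "'a set" using k by (auto simp: face_dim_def)
   thus ?thesis unfolding nonface_def complex_vertices_def neighborly_def by blast
  qed
  show ?thesis unfolding b c h_number_eq[OF k] h_interior_dual[OF HB k]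
   using upper_bound[OF HB, of "d - k"] upper_bound_eq_iff[OF HB, of "d - k"] by simp
 qed
qed

section \<open>Sewing\<close>

text \<open>A bistellar move as a piecewise linear map: the common part \<open>s\<close> of the
  coordinates in \<open>A\<close> is removed and its mass \<open>s * card A\<close> spread evenly
  over \<open>B\<close>, which preserves the coordinate sum.\<close>

definition flip :: "'a set => 'a set => ('a => real) => 'a => real" where
 "flip A B x = (let s = Min (x ` A) in (\<lambda>v. if v \<in> A then x v - s else if v \<in> B then x v + s * card A / card B else x v))"

text \<open>The map zeroes exactly the set \<open>C\<close> of coordinates in \<open>A\<close> where
  the minimum is attained and makes all of \<open>B\<close> positive; the condition asks that the
  resulting supports be in \<open>L\<close>. That no face contains \<open>B\<close> makes the move
  reversible.\<close>

definition flip_ready :: "'a set => 'a set => 'a set set => 'a set set => bool" where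
 "flip_ready A B K L \<longleftrightarrow> (\<forall>S\<in>K. \<not> B \<subseteq> S \<and> (\<not> A \<subseteq> S --> S \<in> L) \<and> (A \<subseteq> S --> (\<forall>C\<subseteq>A. C ~= {} --> (S - C) \<union> B \<in> L)))"

locale flip_sets =
 fixes U A B :: "'a set"
 assumes fin: "finite U" and sub: "A \<subseteq> U" "B \<subseteq> U" and disj: "A \<inter> B = {}" and ne: "A ~= {}" "B ~= {}"
begin

lemma finAB: "finite A" "finite B"
 using fin sub finite_subset by auto

lemma flip_app: "flip A B x v = (if v \<in> A then x v - Min (x ` A) else if v \<in> B then x v + Min (x ` A) * card A / card B else x v)"
 by (simp add: flip_def Let_def)

lemma Min_nonneg: "\<forall>v. 0 \<le> x v ==> 0 \<le> Min (x ` A)"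
 using finAB ne by simp

lemma Min_zero:
 assumes "\<forall>v. 0 \<le> x v" "\<not> A \<subseteq> {v. x v ~= 0}"
 shows "Min (x ` A) = (0::real)"
proof (rule antisym[OF _ Min_nonneg[OF assms(1)]])
 obtain a where "a \<in> A" "x a = 0" using assms(2) by blast
 thus "Min (x ` A) \<le> 0" using finAB Min_le[of "x ` A" "x a"] by simp
qed

lemma flip_id:
 assumes "Min (x ` A) = (0::real)"
 shows "flip A B x = x"
 using assms by (simp add: flip_app fun_eq_iff)

lemma flip_realization:
 assumes x: "x \<in> realization U K" and K: "flip_ready A B K L"
 shows "flip A B x \<in> realization U L"
proof -
 have x0: "\<forall>v. 0 \<le> x v" and xK: "{v. x v ~= 0} \<in> K" and xs: "sum x U = 1" using x by (auto simp: realization_def)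
 let ?S = "{v. x v ~= 0}" and ?s = "Min (x ` A)"
 have r: "\<not> B \<subseteq> ?S" "\<not> A \<subseteq> ?S ==> ?S \<in> L" "A \<subseteq> ?S ==> C \<subseteq> A ==> C ~= {} ==> (?S - C) \<union> B \<in> L" for C
  using K[unfolded flip_ready_def, THEN bspec, OF xK] by auto
 show ?thesis
 proof (cases "A \<subseteq> ?S")
  case False
  hence "flip A B x = x" using flip_id Min_zero[OF x0] by simp
  thus ?thesis using r(2)[OF False] x by (simp add: realization_def)
 next
  case True
  have sA: "?s \<in> x ` A" using finAB ne by (intro Min_in) auto
  hence s: "0 < ?s" using True x0 by (metis (mono_tags, lifting) imageE less_le mem_Collect_eq subsetD)
  have le: "a \<in> A ==> ?s \<le> x a" for a using finAB by simp
  define C where "C = {a\<in>A. x a = ?s}"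
  have C: "C \<subseteq> A" "C ~= {}" using sA by (auto simp: C_def)
  have cB: "0 < real (card B)" and cA: "0 < real (card A)" using finAB ne by (simp_all add: card_gt_0_iff)
  have pos: "0 < ?s * card A / card B" using s cA cB by simp
  have "{v. flip A B x v ~= 0} = (?S - C) \<union> B"
  proof (rule Set.set_eqI)
   fix v
   have "x v + ?s * card A / card B ~= 0" using pos x0[rule_format, of v] by linarith
   thus "v \<in> {v. flip A B x v ~= 0} \<longleftrightarrow> v \<in> (?S - C) \<union> B"
    using disj True by (auto simp: flip_app C_def)
  qed
  hence "{v. flip A B x v ~= 0} \<in> L" using r(3)[OF True C] by simp
  moreover have "0 \<le> flip A B x v" for v
   using le[of v] x0[rule_format, of v] pos by (simp add: flip_app)
  moreover have "sum (flip A B x) U = 1"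
  proof -
   have "flip A B x = (\<lambda>v. x v - (if v \<in> A then ?s else 0) + (if v \<in> B then ?s * card A / card B else 0))"
    using disj by (auto simp: flip_app fun_eq_iff)
   hence "sum (flip A B x) U = sum x U - (\<Sum>v\<in>U. if v \<in> A then ?s else 0) + (\<Sum>v\<in>U. if v \<in> B then ?s * card A / card B else 0)"
    by (simp add: sum.distrib sum_subtractf)
   also have "(\<Sum>v\<in>U. if v \<in> A then ?s else 0) = card A * ?s"
    using fin sub(1) by (simp add: sum.If_cases inf.absorb2)
   also have "(\<Sum>v\<in>U. if v \<in> B then ?s * card A / card B else 0) = card B * (?s * card A / card B)"
    using fin sub(2) by (simp add: sum.If_cases inf.absorb2)
   finally show ?thesis using xs cB by simp
  qed
  ultimately show ?thesis by (simp add: realization_def)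
 qed
qed

text \<open>Before the move some coordinate in \<open>B\<close> is zero, so afterwards the minimum
  over \<open>B\<close> is exactly the amount added, and the reverse move subtracts it
  again.\<close>

lemma flip_inverse:
 assumes x: "x \<in> realization U K" and K: "flip_ready A B K L"
 shows "flip B A (flip A B x) = x"
proof -
 have x0: "\<forall>v. 0 \<le> x v" and xK: "{v. x v ~= 0} \<in> K" using x by (auto simp: realization_def)
 have "\<not> B \<subseteq> {v. x v ~= 0}" using K xK by (auto simp: flip_ready_def)
 interpret r: flip_sets U B A using fin sub disj ne by unfold_locales auto
 have mB: "Min (x ` B) = 0" by (rule r.Min_zero[OF x0 \<open>\<not> B \<subseteq> {v. x v ~= 0}\<close>])
 let ?t = "Min (x ` A) * card A / card B"
 define y where "y = flip A B x"
 have y: "y v = (if v \<in> A then x v - Min (x ` A) else if v \<in> B then x v + ?t else x v)" for v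
  unfolding y_def by (rule flip_app)
 have "y ` B = (\<lambda>v. x v + ?t) ` B" using disj by (intro image_cong) (auto simp: y)
 hence "Min (y ` B) = Min (x ` B) + ?t" using Min_add_commute[of B x ?t] finAB ne by simp
 hence m: "Min (y ` B) = ?t" using mB by simp
 have c: "real (card B) ~= 0" "real (card A) ~= 0" using finAB ne by auto
 have f: "flip B A y v = (if v \<in> B then y v - ?t else if v \<in> A then y v + ?t * card B / card A else y v)" for v
  unfolding r.flip_app m by (rule refl)
 have "flip B A y = x"
 proof
  fix v
  consider "v \<in> A" "v \<notin> B" | "v \<in> B" "v \<notin> A" | "v \<notin> A" "v \<notin> B" using disj by blast
  thus "flip B A y v = x v"
   by cases (use c in \<open>simp_all add: f y\<close>)
 qed
 thus ?thesis by (simp add: y_def)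
qed

lemma continuous_flip: "continuous_on X (flip A B)"
proof (rule continuous_on_coords)
 fix v
 have m: "continuous_on X (\<lambda>x::'a => real. Min (x ` A))"
  by (rule continuous_on_Min_image[of A X "\<lambda>a x. x a"]) (use finAB ne in \<open>simp_all add: continuous_on_coord\<close>)
 show "continuous_on X (\<lambda>x. flip A B x v)"
 proof (cases "v \<in> A")
  case True
  thus ?thesis unfolding flip_app using m by (auto intro!: continuous_intros)
 next
  case False
  have "card B ~= 0" using finAB ne by simp
  thus ?thesis unfolding flip_app using m False by (cases "v \<in> B") (auto intro!: continuous_intros)
 qed
qed

end

text \<open>A ball with the subcomplex on its sphere. The homeomorphism is kept in the notion so
  that moves can be composed with it; that \<open>S\<close> is the combinatorial boundary follows at
  the end, in \<open>ball_pair_boundary\<close>.\<close>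

definition ball_pair :: "nat => 'a set set => 'a set set => bool" where
 "ball_pair e K S \<longleftrightarrow> finite (\<Union>K) \<and> down_closed K \<and> {} \<in> K \<and> down_closed S \<and> {} \<in> S \<and> S \<subseteq> K \<and>
   (\<exists>f f'. homeomorphic_maps (top_of_set (realization (\<Union>K) K)) (top_of_set (ball_set e)) f f' \<and>
    (\<forall>x\<in>realization (\<Union>K) K. {v. x v ~= 0} \<in> S \<longleftrightarrow> (\<Sum>i<e. (f x i)\<^sup>2) = 1))"

lemma realization_superset:
 assumes "finite U" "\<Union>K \<subseteq> U"
 shows "realization U K = realization (\<Union>K) K"
proof -
 have "sum x U = sum x (\<Union>K)" if "{v. x v ~= 0} \<in> K" for x :: "'a => real"
  using assms that by (intro sum.mono_neutral_right) auto
 thus ?thesis unfolding realization_def by auto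
qed

text \<open>One and the same map moves \<open>K\<close> to \<open>K'\<close> and \<open>S\<close> to
  \<open>S'\<close>, so the points of norm one remain those supported in the subcomplex.\<close>

lemma ball_pair_flip:
 assumes P: "ball_pair e K S" and fs: "flip_sets U A B" and U: "\<Union>K \<subseteq> U" "\<Union>K' \<subseteq> U"
  and r: "flip_ready A B K K'" "flip_ready B A K' K" "flip_ready A B S S'" "flip_ready B A S' S"
  and c: "down_closed K'" "{} \<in> K'" "down_closed S'" "{} \<in> S'" "S' \<subseteq> K'"
 shows "ball_pair e K' S'"
proof -
 interpret A: flip_sets U A B by (rule fs)
 interpret B: flip_sets U B A using A.fin A.sub A.disj A.ne by unfold_locales auto
 let ?X = "realization U K" and ?Y = "realization U K'"
 have eq: "?X = realization (\<Union>K) K" "?Y = realization (\<Union>K') K'"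
  using realization_superset[OF A.fin] U by auto
 obtain f f' where f: "homeomorphic_maps (top_of_set ?X) (top_of_set (ball_set e)) f f'"
  "\<And>x. x \<in> ?X ==> {v. x v ~= 0} \<in> S \<longleftrightarrow> (\<Sum>i<e. (f x i)\<^sup>2) = 1"
  using P unfolding ball_pair_def eq by blast
 have g: "homeomorphic_maps (top_of_set ?Y) (top_of_set ?X) (flip B A) (flip A B)"
  unfolding homeomorphic_maps_def
 proof (intro conjI ballI)
  show "continuous_map (top_of_set ?Y) (top_of_set ?X) (flip B A)"
   using B.continuous_flip B.flip_realization[OF _ r(2)] by (auto simp: image_subset_iff)
  show "continuous_map (top_of_set ?X) (top_of_set ?Y) (flip A B)"
   using A.continuous_flip A.flip_realization[OF _ r(1)] by (auto simp: image_subset_iff)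
  show "flip A B (flip B A x) = x" if "x \<in> topspace (top_of_set ?Y)" for x using B.flip_inverse[OF _ r(2)] that by simp
  show "flip B A (flip A B x) = x" if "x \<in> topspace (top_of_set ?X)" for x using A.flip_inverse[OF _ r(1)] that by simp
 qed
 have h: "homeomorphic_maps (top_of_set ?Y) (top_of_set (ball_set e)) (f \<circ> flip B A) (flip A B \<circ> f')"
  by (rule homeomorphic_maps_compose[OF conjI[OF g f(1)]])
 have n: "{v. y v ~= 0} \<in> S' \<longleftrightarrow> (\<Sum>i<e. ((f \<circ> flip B A) y i)\<^sup>2) = 1" if y: "y \<in> ?Y" for y
 proof -
  have x: "flip B A y \<in> ?X" by (rule B.flip_realization[OF y r(2)])
  have "{v. y v ~= 0} \<in> S' \<longleftrightarrow> {v. flip B A y v ~= 0} \<in> S"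
  proof
   assume "{v. y v ~= 0} \<in> S'"
   hence "y \<in> realization U S'" using y by (simp add: realization_def)
   thus "{v. flip B A y v ~= 0} \<in> S" using B.flip_realization[OF _ r(4)] by (simp add: realization_def)
  next
   assume "{v. flip B A y v ~= 0} \<in> S"
   hence "flip B A y \<in> realization U S" using x by (simp add: realization_def)
   hence "flip A B (flip B A y) \<in> realization U S'" by (rule A.flip_realization[OF _ r(3)])
   thus "{v. y v ~= 0} \<in> S'" using B.flip_inverse[OF y r(2)] by (simp add: realization_def)
  qed
  thus ?thesis using f(2)[OF x] by simp
 qed
 have "finite (\<Union>K')" using U(2) A.fin by (rule finite_subset)
 thus ?thesis unfolding ball_pair_def eq[symmetric]
  by (intro conjI c exI[of _ "f \<circ> flip B A"] exI[of _ "flip A B \<circ> f'"] ballI h n)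
qed

section \<open>Sewing as a sequence of moves\<close>

definition flag_union :: "(nat => 'a set) => nat => 'a set" where
 "flag_union E i = (\<Union>k<i. E k)"

text \<open>Two interleaved ascending chains: the odd sets start with \<open>{u}\<close> and collect
  the blocks of odd index, the even ones start empty and collect those of even index.\<close>

definition sew_set :: "(nat => 'a set) => 'a => nat => 'a set" where
 "sew_set E u j = {v. (v = u \<and> odd j) \<or> (\<exists>k. k + 2 \<le> j \<and> even (k + j) \<and> v \<in> E k)}"

text \<open>Shemer's sewing of the vertex \<open>u\<close> along the flag \<open>flag_union E\<close>, cut into bistellar steps:
 step \<open>i\<close> replaces the faces containing \<open>sew_set E u (Suc i)\<close> by faces containing \<open>sew_set E u i\<close>.\<close>

definition sew :: "(nat => 'a set) => 'a => 'a set set => nat => 'a set set" where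
 "sew E u K i = {F. \<not> sew_set E u (Suc i) \<subseteq> F \<and> (\<forall>j\<le>i. sew_set E u j \<subseteq> F --> (F - {u}) \<union> flag_union E j \<in> K)}"

lemma flag_union_0 [simp]: "flag_union E 0 = {}" and flag_union_Suc: "flag_union E (Suc i) = flag_union E i \<union> E i"
 by (auto simp: flag_union_def less_Suc_eq)

lemma flag_union_mono: "i \<le> j ==> flag_union E i \<subseteq> flag_union E j"
 by (fastforce simp: flag_union_def)

lemma sew_set_0 [simp]: "sew_set E u 0 = {}" and sew_set_1 [simp]: "sew_set E u (Suc 0) = {u}"
 by (auto simp: sew_set_def)

lemma sew_set_step: "sew_set E u (Suc (Suc j)) = sew_set E u j \<union> E j"
proof (rule Set.set_eqI)
 fix v
 have e: "k + 2 \<le> Suc (Suc j) \<and> even (k + Suc (Suc j)) \<longleftrightarrow> (k + 2 \<le> j \<and> even (k + j)) \<or> k = j" for k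
  by presburger
 have "(\<exists>k. k + 2 \<le> Suc (Suc j) \<and> even (k + Suc (Suc j)) \<and> v \<in> E k) \<longleftrightarrow> (\<exists>k. k + 2 \<le> j \<and> even (k + j) \<and> v \<in> E k) \<or> v \<in> E j"
  unfolding conj_assoc[symmetric] e by blast
 thus "v \<in> sew_set E u (Suc (Suc j)) \<longleftrightarrow> v \<in> sew_set E u j \<union> E j"
  unfolding sew_set_def Un_iff mem_Collect_eq by simp
qed

lemma sew_set_flag: "sew_set E u (Suc j) - {u} \<subseteq> flag_union E j"
 by (auto simp: sew_set_def flag_union_def)

lemma sew_0: "u \<notin> \<Union>K ==> sew E u K 0 = K"
 by (auto simp: sew_def)

lemma sew_down:
 assumes "down_closed K"
 shows "down_closed (sew E u K i)"
 unfolding down_closed_def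
proof (intro ballI allI impI)
 fix F G assume F: "F \<in> sew E u K i" and G: "G \<subseteq> F"
 have "(G - {u}) \<union> flag_union E j \<in> K" if j: "j \<le> i" "sew_set E u j \<subseteq> G" for j
 proof -
  have "(F - {u}) \<union> flag_union E j \<in> K" using F G j by (auto simp: sew_def)
  thus ?thesis by (rule down_closedD[OF assms]) (use G in auto)
 qed
 thus "G \<in> sew E u K i" using F G by (auto simp: sew_def)
qed

lemma sew_minus: "F \<in> sew E u K i ==> F - {u} \<in> K"
 by (force simp: sew_def)

locale sewing =
 fixes E :: "nat => 'a set" and u :: 'a and s :: nat
 assumes E0: "1 \<le> s ==> E 0 ~= {}" and uE: "\<And>k. k < s ==> u \<notin> E k"
  and disjE: "\<And>j k. j < s ==> k < s ==> j ~= k ==> E j \<inter> E k = {}"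
begin

abbreviation "M \<equiv> sew_set E u"
abbreviation "T \<equiv> flag_union E"

lemma M_ne: "j \<le> s ==> M (Suc j) ~= {}"
proof (induction j rule: induct_nat_012)
 case 1
 thus ?case using E0 by (simp add: sew_set_step[of _ _ 0, simplified])
next
 case (ge2 n)
 thus ?case by (simp add: sew_set_step[of E u "Suc n"])
qed simp

lemma M_disjoint: "j \<le> s ==> M j \<inter> M (Suc j) = {}"
proof -
 assume j: "j \<le> s"
 have False if v: "v \<in> M j" "v \<in> M (Suc j)" for v
 proof (cases "v = u")
  case True
  have "\<exists>k. k + 2 \<le> Suc j \<and> v \<in> E k"
  proof (cases "odd j")
   case odd: True
   hence "even (Suc j)" by simp
   thus ?thesis using v(2) unfolding sew_set_def by blast
  next
   case False
   then obtain k where "k + 2 \<le> j" "v \<in> E k" using v(1) unfolding sew_set_def by blast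
   thus ?thesis by (intro exI[of _ k]) simp
  qed
  then obtain k where "k + 2 \<le> Suc j" "v \<in> E k" by blast
  thus False using uE[of k] j True by simp
 next
  case False
  then obtain k l where "k + 2 \<le> j" "even (k + j)" "v \<in> E k" "l + 2 \<le> Suc j" "even (l + Suc j)" "v \<in> E l"
   using v by (auto simp: sew_set_def)
  moreover from this have "k ~= l" by auto
  ultimately show False using disjE[of k l] j by auto
 qed
 thus ?thesis by blast
qed

text \<open>Up to \<open>u\<close>, both exchanged sets lie in \<open>T (Suc i)\<close>, so the
  membership of \<open>(S - {u}) \<union> T (Suc i)\<close> in \<open>K\<close> controls all faces
  produced by the exchange.\<close>

lemma sew_flip:
 assumes K: "down_closed K" and i: "Suc i \<le> s"
 shows "flip_ready (M (Suc (Suc i))) (M (Suc i)) (sew E u K i) (sew E u K (Suc i))" (is "flip_ready ?A ?B ?K ?L")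
  and "flip_ready (M (Suc i)) (M (Suc (Suc i))) (sew E u K (Suc i)) (sew E u K i)"
proof -
 have disj: "?A \<inter> ?B = {}" using M_disjoint[of "Suc i"] i by auto
 have A: "?A = M i \<union> E i" by (rule sew_set_step)
 have A': "?A - {u} \<subseteq> T (Suc i)" by (rule sew_set_flag)
 have B': "?B - {u} \<subseteq> T (Suc i)" by (rule subset_trans[OF sew_set_flag flag_union_mono]) simp
 have uEi: "u \<notin> E i" by (rule uE) (use i in simp)
 have absorb: "(((S - C) \<union> N) - {u}) \<union> T j \<subseteq> (S - {u}) \<union> T (Suc i)" if "N - {u} \<subseteq> T (Suc i)" "j \<le> Suc i" for S C N j
 proof -
  have "T j \<subseteq> T (Suc i)" by (rule flag_union_mono[OF that(2)])
  thus ?thesis using that(1) by blast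
 qed
 show "flip_ready ?A ?B ?K ?L"
  unfolding flip_ready_def
 proof (intro ballI conjI impI allI)
  fix S assume S: "S \<in> ?K"
  hence nB: "\<not> ?B \<subseteq> S" and k: "\<And>j. j \<le> i ==> M j \<subseteq> S ==> (S - {u}) \<union> T j \<in> K" by (auto simp: sew_def)
  show "\<not> ?B \<subseteq> S" by (rule nB)
  show "S \<in> ?L" if "\<not> ?A \<subseteq> S" using that nB k unfolding sew_def mem_Collect_eq le_Suc_eq by blast
  fix C assume a: "?A \<subseteq> S" and C: "C \<subseteq> ?A" "C ~= {}"
  \<comment> \<open>Since \<open>E i\<close> is part of \<open>M (Suc (Suc i))\<close> and hence of
    \<open>S\<close>, the known membership with \<open>T i\<close> is already the one with
    \<open>T (Suc i)\<close>.\<close>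
  have "(S - {u}) \<union> T i \<in> K" using k[of i] a A by simp
  moreover have "E i \<subseteq> S - {u}" using a A uEi by blast
  moreover from this have "(S - {u}) \<union> T (Suc i) = (S - {u}) \<union> T i" unfolding flag_union_Suc by blast
  ultimately have big: "(S - {u}) \<union> T (Suc i) \<in> K" by simp
  have "(((S - C) \<union> ?B) - {u}) \<union> T j \<in> K" if "j \<le> Suc i" for j
   by (rule down_closedD[OF K big absorb[OF B' that]])
  moreover have "\<not> ?A \<subseteq> (S - C) \<union> ?B" using C disj by blast
  ultimately show "(S - C) \<union> ?B \<in> ?L" by (simp add: sew_def)
 qed
 show "flip_ready ?B ?A ?L ?K"
  unfolding flip_ready_def
 proof (intro ballI conjI impI allI)
  fix S assume S: "S \<in> ?L"
  hence nA: "\<not> ?A \<subseteq> S" and k: "\<And>j. j \<le> Suc i ==> M j \<subseteq> S ==> (S - {u}) \<union> T j \<in> K" by (auto simp: sew_def)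
  show "\<not> ?A \<subseteq> S" by (rule nA)
  show "S \<in> ?K" if "\<not> ?B \<subseteq> S" using that k by (simp add: sew_def)
  fix C assume b: "?B \<subseteq> S" and C: "C \<subseteq> ?B" "C ~= {}"
  have big: "(S - {u}) \<union> T (Suc i) \<in> K" using k[of "Suc i"] b by simp
  have "(((S - C) \<union> ?A) - {u}) \<union> T j \<in> K" if "j \<le> i" for j
   by (rule down_closedD[OF K big absorb[OF A']]) (use that in simp)
  moreover have "\<not> ?B \<subseteq> (S - C) \<union> ?A" using C disj by blast
  ultimately show "(S - C) \<union> ?A \<in> ?K" by (simp add: sew_def)
 qed
qed

text \<open>\<open>K\<close> and \<open>S\<close> are sewn with the same flag, so each move carries
  the ball and its sphere along. Step 0 changes nothing because \<open>u\<close> is a new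
  vertex.\<close>

theorem ball_pair_sew:
 assumes P: "ball_pair e K S" and u: "u \<notin> \<Union>K" and EK: "\<And>k. k < s ==> E k \<subseteq> \<Union>K" and i: "i \<le> s"
 shows "ball_pair e (sew E u K i) (sew E u S i)"
 using i
proof (induction i)
 case 0
 have "u \<notin> \<Union>S" using u P unfolding ball_pair_def by blast
 thus ?case using P u by (simp add: sew_0)
next
 case (Suc i)
 note p = P[unfolded ball_pair_def]
 have K: "down_closed K" and S: "down_closed S" and SK: "S \<subseteq> K" and fin: "finite (\<Union>K)" and e: "{} \<in> K" "{} \<in> S"
  using p by simp_all
 let ?U = "insert u (\<Union>K)"
 have in_U: "\<Union>(sew E u K i) \<subseteq> ?U" for i
 proof (rule Union_least)
  fix F assume "F \<in> sew E u K i"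
  from sew_minus[OF this] have "F - {u} \<subseteq> \<Union>K" by (rule Union_upper)
  thus "F \<subseteq> ?U" by blast
 qed
 have M_U: "j \<le> Suc s ==> M j \<subseteq> ?U" for j
 proof
  fix v assume j: "j \<le> Suc s" and "v \<in> M j"
  then consider "v = u" | k where "k + 2 \<le> j" "v \<in> E k" unfolding sew_set_def by blast
  thus "v \<in> ?U"
  proof cases
   case 2
   thus ?thesis using EK[of k] j by auto
  qed simp
 qed
 have "flip_sets ?U (M (Suc (Suc i))) (M (Suc i))"
 proof
  show "M (Suc (Suc i)) \<inter> M (Suc i) = {}" using M_disjoint[of "Suc i"] Suc.prems by auto
  show "M (Suc (Suc i)) ~= {}" "M (Suc i) ~= {}" using M_ne Suc.prems by auto
  show "M (Suc (Suc i)) \<subseteq> ?U" "M (Suc i) \<subseteq> ?U" using M_U Suc.prems by auto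
 qed (use fin in simp)
 moreover have "ball_pair e (sew E u K i) (sew E u S i)" using Suc by simp
 moreover have "{} \<in> sew E u L (Suc i)" if L: "{} \<in> L" for L
 proof -
  have "j = 0" if "j \<le> Suc i" "M j \<subseteq> {}" for j
   using that M_ne[of "j - 1"] Suc.prems by (cases j) auto
  hence "T j \<in> L" if "j \<le> Suc i" "M j \<subseteq> {}" for j using that L by (metis flag_union_0)
  moreover have "\<not> M (Suc (Suc i)) \<subseteq> {}" using M_ne[of "Suc i"] Suc.prems by blast
  ultimately show ?thesis by (simp add: sew_def)
 qed
 moreover have "sew E u S (Suc i) \<subseteq> sew E u K (Suc i)" using SK by (auto simp: sew_def)
 ultimately show ?case
  using sew_flip[OF K Suc.prems] sew_flip[OF S Suc.prems] in_U[of i] in_U[of "Suc i"] sew_down[OF K] sew_down[OF S] e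
  by (intro ball_pair_flip[of e "sew E u K i" "sew E u S i" ?U "M (Suc (Suc i))" "M (Suc i)" "sew E u K (Suc i)" "sew E u S (Suc i)"]) simp_all
qed

end

section \<open>The starting ball: a cone over the boundary of a simplex\<close>

lemma continuous_on_quotient_null:
 fixes q c b :: "'x::topological_space => real"
 assumes "continuous_on X q" "continuous_on X c" "continuous_on X b"
  and bound: "\<And>x. x \<in> X ==> \<bar>q x / c x\<bar> \<le> b x" and null: "\<And>x. x \<in> X ==> c x = 0 ==> b x = 0"
 shows "continuous_on X (\<lambda>x. q x / c x)"
 unfolding continuous_on_def
proof
 fix x assume x: "x \<in> X"
 have t: "(q \<longlongrightarrow> q x) (at x within X)" "(c \<longlongrightarrow> c x) (at x within X)" "(b \<longlongrightarrow> b x) (at x within X)"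
  using assms(1-3) x by (auto simp: continuous_on_def)
 show "((\<lambda>x. q x / c x) \<longlongrightarrow> q x / c x) (at x within X)"
 proof (cases "c x = 0")
  case False
  thus ?thesis using t by (intro tendsto_divide)
 next
  \<comment> \<open>Division by zero gives 0, and the bound \<open>b\<close> tends to 0 here, so the
    quotient is continuous at a zero of the denominator.\<close>
  case True
  have "((\<lambda>x. q x / c x) \<longlongrightarrow> 0) (at x within X)"
  proof (rule Lim_null_comparison)
   show "\<forall>\<^sub>F y in at x within X. norm (q y / c y) \<le> b y"
    using bound by (simp add: eventually_at_filter)
   show "(b \<longlongrightarrow> 0) (at x within X)" using t(3) null[OF x True] by simp
  qed
  thus ?thesis using True by simp
 qed
qed

text \<open>The cone with apex \<open>e + 1\<close> over the boundary of the simplex on \<open>0, \<dots>, e\<close>. Subtracting the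
 coordinate at \<open>e\<close> flattens it onto a neighbourhood of the origin that is star-shaped, and a
 radial rescaling turns this into the ball.\<close>

definition cone_base :: "nat => nat set set" where
 "cone_base e = {F. F \<subseteq> {..Suc e} \<and> \<not> {..e} \<subseteq> F}"

definition sphere_base :: "nat => nat set set" where
 "sphere_base e = {F. F \<subset> {..e}}"

definition l2 :: "nat => (nat => real) => real" where
 "l2 e y = sqrt (\<Sum>i<e. (y i)\<^sup>2)"

text \<open>The direction is that of \<open>x i - x e\<close>; the length is
  \<open>1 - x (Suc e)\<close>, written as the sum of the coordinates up to \<open>e\<close>. At the
  apex numerator and denominator both vanish and the value is the origin.\<close>

definition base_map :: "nat => (nat => real) => nat => real" where
 "base_map e x = (\<lambda>i. if i < e then (\<Sum>j\<le>e. x j) * (x i - x e) / l2 e (\<lambda>i. x i - x e) else 0)"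

definition low :: "nat => (nat => real) => real" where
 "low e z = Min (z ` {..e})"

text \<open>Every point of the cone has a vanishing coordinate among \<open>0\<close> to
  \<open>e\<close>, so subtracting the minimum recovers these coordinates up to scale, and this sum
  is the scale.\<close>

definition gauge_base :: "nat => (nat => real) => real" where
 "gauge_base e z = (\<Sum>j\<le>e. z j - low e z)"

definition base_inv :: "nat => (nat => real) => nat => real" where
 "base_inv e z = (\<lambda>i. if i \<le> e then l2 e z * (z i - low e z) / gauge_base e z else if i = Suc e then 1 - l2 e z else 0)"

lemma l2_nonneg [simp]: "0 \<le> l2 e y"
 by (simp add: l2_def sum_nonneg)

lemma l2_scale: "l2 e (\<lambda>i. t * y i) = \<bar>t\<bar> * l2 e y"
 by (simp add: l2_def power_mult_distrib real_sqrt_mult flip: sum_distrib_left)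

lemma l2_coord: "i < e ==> \<bar>y i\<bar> \<le> l2 e y"
proof -
 assume "i < e"
 hence "(y i)\<^sup>2 \<le> (\<Sum>i<e. (y i)\<^sup>2)" by (intro member_le_sum) auto
 thus ?thesis unfolding l2_def by (metis real_sqrt_abs real_sqrt_le_iff)
qed

lemma l2_cong: "(\<And>i. i < e ==> y i = z i) ==> l2 e y = l2 e z"
 by (simp add: l2_def)

lemma low_le: "i \<le> e ==> low e z \<le> z i"
 by (simp add: low_def)

lemma low_scale: "0 \<le> t ==> low e (\<lambda>i. t * z i) = t * low e z"
proof -
 assume t: "0 \<le> t"
 have "Min ((\<lambda>i. t * z i) ` {..e}) = Min ((\<lambda>y. t * y) ` z ` {..e})" by (simp add: image_image)
 also have "\<dots> = t * Min (z ` {..e})" using t by (intro mono_Min_commute[symmetric]) (auto intro: monoI mult_left_mono)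
 finally show ?thesis by (simp add: low_def)
qed

lemma low_minus: "low e (\<lambda>i. z i - a) = low e z - a"
proof -
 have "Min ((\<lambda>i. z i - a) ` {..e}) = Min ((\<lambda>y. y - a) ` z ` {..e})" by (simp add: image_image)
 also have "\<dots> = Min (z ` {..e}) - a" by (intro mono_Min_commute[symmetric]) (auto intro: monoI)
 finally show ?thesis by (simp add: low_def)
qed

lemma low_cong: "(\<And>i. i \<le> e ==> y i = z i) ==> low e y = low e z"
 unfolding low_def by (intro arg_cong[of _ _ Min] image_cong) auto

lemma gauge_coord: "i \<le> e ==> z i - low e z \<le> gauge_base e z"
 unfolding gauge_base_def using low_le by (intro member_le_sum[where f = "\<lambda>j. z j - low e z"]) auto

lemma gauge_0:
 assumes "gauge_base e z = 0" "i \<le> e"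
 shows "z i = z e"
 using gauge_coord[of i e z] gauge_coord[of e e z] low_le[of i e z] low_le[of e e z] assms by simp

lemma low_base:
 assumes "x \<in> realization {..Suc e} (cone_base e)"
 shows "low e x = 0"
proof (rule antisym)
 have "\<not> {..e} \<subseteq> {v. x v ~= 0}" using assms by (auto simp: realization_def cone_base_def)
 then obtain i where i: "i \<le> e" "x i = 0" by auto
 thus "low e x \<le> 0" using low_le[OF i(1), of x] by simp
 show "0 \<le> low e x" using assms by (simp add: low_def realization_def)
qed

lemma base_facts:
 assumes "x \<in> realization {..Suc e} (cone_base e)"
 shows "\<forall>v. 0 \<le> x v" "(\<Sum>j\<le>e. x j) = 1 - x (Suc e)" "i > Suc e ==> x i = 0" "0 \<le> (\<Sum>j\<le>e. x j)"
 using assms by (auto simp: realization_def cone_base_def intro!: sum_nonneg)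

lemma l2_base_map:
 assumes "x \<in> realization {..Suc e} (cone_base e)"
 shows "l2 e (base_map e x) = (\<Sum>j\<le>e. x j)" "l2 e (\<lambda>i. x i - x e) = 0 ==> (\<Sum>j\<le>e. x j) = 0"
proof -
 let ?L = "l2 e (\<lambda>i. x i - x e)" and ?t = "\<Sum>j\<le>e. x j"
 note b = base_facts[OF assms]
 show z: "?t = 0" if L0: "?L = 0"
 proof -
  have eq: "x i = x e" if i: "i \<le> e" for i
  proof (cases "i = e")
   case False
   thus ?thesis using l2_coord[of i e "\<lambda>i. x i - x e"] L0 i by simp
  qed simp
  have "x ` {..e} = (\<lambda>_. x e) ` {..e}" by (rule image_cong[OF refl]) (rule eq, simp)
  also have "\<dots> = {x e}" by auto
  finally have "x ` {..e} = {x e}" .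
  hence "low e x = x e" by (simp add: low_def)
  hence xe: "x e = 0" using low_base[OF assms] by simp
  show ?thesis
  proof (rule sum.neutral, rule ballI)
   fix i assume "i \<in> {..e}"
   thus "x i = 0" using eq[of i] xe by simp
  qed
 qed
 have "l2 e (base_map e x) = l2 e (\<lambda>i. (?t / ?L) * (x i - x e))" by (rule l2_cong) (simp add: base_map_def)
 also have "\<dots> = \<bar>?t / ?L\<bar> * ?L" by (rule l2_scale)
 also have "\<dots> = ?t" using z b(4) by (cases "?L = 0") (auto simp: abs_mult)
 finally show "l2 e (base_map e x) = ?t" .
qed

lemma gauge_base_nonneg: "0 \<le> gauge_base e z"
 unfolding gauge_base_def by (intro sum_nonneg) (use low_le in auto)

text \<open>Subtracting the coordinate at \<open>e\<close> and subtracting the minimum undo each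
  other up to scale, because \<open>z e = 0\<close> in the ball and the minimum is 0 in the cone.
  Continuity is critical only where a denominator vanishes, at the apex and at the origin, and there
  the length bounds the quotient.\<close>

theorem base_homeomorphism:
 "homeomorphic_maps (top_of_set (realization {..Suc e} (cone_base e))) (top_of_set (ball_set e)) (base_map e) (base_inv e)"
proof -
 let ?X = "realization {..Suc e} (cone_base e)"
 have sq: "(\<Sum>i<e. (y i)\<^sup>2) = (l2 e y)\<^sup>2" for y by (simp add: l2_def sum_nonneg)
 have f_in: "base_map e x \<in> ball_set e" if x: "x \<in> ?X" for x
 proof -
  have "(\<Sum>j\<le>e. x j) \<le> 1" using base_facts[OF x] by simp
  thus ?thesis unfolding ball_set_def mem_Collect_eq sq l2_base_map(1)[OF x]
   using base_facts(4)[OF x] by (simp add: base_map_def power_le_one)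
 qed
 have gz: "l2 e z = 0" if z: "z \<in> ball_set e" "gauge_base e z = 0" for z
 proof -
  have "z e = 0" using z(1) by (simp add: ball_set_def)
  hence "z i = 0" if "i < e" for i using gauge_0[OF z(2), of i] that by simp
  thus ?thesis by (simp add: l2_def)
 qed
 have sum_g: "(\<Sum>j\<le>e. base_inv e z j) = l2 e z" if z: "z \<in> ball_set e" for z
 proof -
  have "(\<Sum>j\<le>e. base_inv e z j) = (\<Sum>j\<le>e. l2 e z / gauge_base e z * (z j - low e z))"
   by (intro sum.cong) (auto simp: base_inv_def)
  also have "\<dots> = l2 e z / gauge_base e z * gauge_base e z" unfolding gauge_base_def sum_distrib_left ..
  finally show ?thesis using gz[OF z] by (cases "gauge_base e z = 0") auto
 qed
 have l1: "l2 e z \<le> 1" if "z \<in> ball_set e" for z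
  using that unfolding ball_set_def l2_def by simp
 have g_in: "base_inv e z \<in> ?X" if z: "z \<in> ball_set e" for z
 proof -
  have "0 \<le> base_inv e z v" for v
   using low_le[of v e z] l1[OF z] gauge_base_nonneg[of e z] by (auto simp: base_inv_def intro!: divide_nonneg_nonneg mult_nonneg_nonneg)
  moreover have "(\<Sum>j\<le>Suc e. base_inv e z j) = 1"
  proof -
   have "base_inv e z (Suc e) = 1 - l2 e z" by (simp add: base_inv_def)
   thus ?thesis using sum_g[OF z] by simp
  qed
  moreover have "{v. base_inv e z v ~= 0} \<in> cone_base e"
  proof -
   have "low e z \<in> z ` {..e}" unfolding low_def by (intro Min_in) auto
   then obtain i where i: "i \<le> e" "z i = low e z" by auto
   hence "base_inv e z i = 0" by (simp add: base_inv_def)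
   hence "\<not> {..e} \<subseteq> {v. base_inv e z v ~= 0}" using i(1) by auto
   moreover have "{v. base_inv e z v ~= 0} \<subseteq> {..Suc e}" by (auto simp: base_inv_def split: if_splits)
   ultimately show ?thesis by (simp add: cone_base_def)
  qed
  ultimately show ?thesis by (simp add: realization_def)
 qed
 have fg: "base_map e (base_inv e z) = z" if z: "z \<in> ball_set e" for z
 proof
  fix i
  let ?x = "base_inv e z" and ?N = "gauge_base e z" and ?l = "l2 e z"
  have ze: "z e = 0" using z by (simp add: ball_set_def)
  have d: "?x i - ?x e = ?l / ?N * z i" if "i \<le> e" for i
   using that by (simp add: base_inv_def ze right_diff_distrib diff_divide_distrib)
  have L: "l2 e (\<lambda>i. ?x i - ?x e) = ?l / ?N * ?l"
  proof -
   have "l2 e (\<lambda>i. ?x i - ?x e) = l2 e (\<lambda>i. (?l / ?N) * z i)" by (rule l2_cong) (rule d, simp)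
   also have "\<dots> = \<bar>?l / ?N\<bar> * ?l" by (rule l2_scale)
   finally show ?thesis using gauge_base_nonneg[of e z] by simp
  qed
  show "base_map e ?x i = z i"
  proof (cases "i < e")
   case False
   thus ?thesis using z by (simp add: base_map_def ball_set_def)
  next
   case True
   hence "base_map e ?x i = ?l * (?l / ?N * z i) / (?l / ?N * ?l)"
    using d[of i] by (simp add: base_map_def sum_g[OF z] L)
   also have "\<dots> = z i"
   proof (cases "?l = 0")
    case l: True
    hence "z i = 0" using l2_coord[OF True, of z] by simp
    thus ?thesis by simp
   next
    case False
    hence "?N ~= 0" using gz[OF z] by blast
    thus ?thesis using False by simp
   qed
   finally show ?thesis .
  qed
 qed
 have gf: "base_inv e (base_map e x) = x" if x: "x \<in> ?X" for x
 proof
  fix i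
  let ?z = "base_map e x" and ?t = "\<Sum>j\<le>e. x j" and ?L = "l2 e (\<lambda>i. x i - x e)"
  note b = base_facts[OF x]
  have zi: "?z j = ?t / ?L * (x j - x e)" if "j \<le> e" for j
   using that by (cases "j = e") (auto simp: base_map_def)
  have q: "0 \<le> ?t / ?L" using b(4) by simp
  have "low e ?z = low e (\<lambda>j. ?t / ?L * (x j - x e))" by (rule low_cong) (rule zi)
  also have "\<dots> = ?t / ?L * (low e x - x e)" by (simp only: low_scale[OF q] low_minus)
  finally have lz: "low e ?z = - (?t / ?L * x e)" using low_base[OF x] by simp
  have d: "?z j - low e ?z = ?t / ?L * x j" if "j \<le> e" for j
   unfolding lz zi[OF that] by (simp only: right_diff_distrib diff_minus_eq_add diff_add_cancel)
  have N: "gauge_base e ?z = ?t / ?L * ?t"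
   unfolding gauge_base_def sum_distrib_left by (intro sum.cong) (auto simp: d)
  show "base_inv e ?z i = x i"
  proof (cases "i \<le> e")
   case True
   have "base_inv e ?z i = ?t * (?t / ?L * x i) / (?t / ?L * ?t)"
    using True by (simp only: base_inv_def if_True l2_base_map(1)[OF x] d N)
   also have "\<dots> = x i"
   proof (cases "?t = 0")
    case t: True
    hence "x i = 0" using True b(1) sum_nonneg_eq_0_iff[of "{..e}" x] by simp
    thus ?thesis by simp
   next
    case False
    hence "?L ~= 0" using l2_base_map(2)[OF x] by blast
    thus ?thesis using False by simp
   qed
   finally show ?thesis .
  next
   case False
   thus ?thesis using b(2) b(3)[of i] by (auto simp: base_inv_def l2_base_map(1)[OF x])
  qed
 qed
 have cl2: "continuous_on Y (\<lambda>x. l2 e (h x))" if "\<And>i. continuous_on Y (\<lambda>x. h x i)" for Y :: "(nat => real) set" and h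
  unfolding l2_def by (intro continuous_intros that)
 have clow: "continuous_on Y (low e)" for Y
  unfolding low_def by (rule continuous_on_Min_image[of "{..e}" Y "\<lambda>a x. x a"]) (simp_all add: continuous_on_coord)
 have cf: "continuous_on ?X (base_map e)"
 proof (rule continuous_on_coords)
  fix i
  show "continuous_on ?X (\<lambda>x. base_map e x i)"
  proof (cases "i < e")
   case True
   have "continuous_on ?X (\<lambda>x. (\<Sum>j\<le>e. x j) * (x i - x e) / l2 e (\<lambda>i. x i - x e))"
   proof (rule continuous_on_quotient_null[where b = "\<lambda>x. \<Sum>j\<le>e. x j"])
    show "continuous_on ?X (\<lambda>x. (\<Sum>j\<le>e. x j) * (x i - x e))" "continuous_on ?X (\<lambda>x. \<Sum>j\<le>e. x j)"
     by (intro continuous_intros)+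
    show "continuous_on ?X (\<lambda>x. l2 e (\<lambda>i. x i - x e))" by (rule cl2) (intro continuous_intros)
    fix x assume x: "x \<in> ?X"
    show "\<bar>(\<Sum>j\<le>e. x j) * (x i - x e) / l2 e (\<lambda>i. x i - x e)\<bar> \<le> (\<Sum>j\<le>e. x j)"
     using l2_coord[OF True, of "base_map e x"] l2_base_map(1)[OF x] True by (simp add: base_map_def)
    show "(\<Sum>j\<le>e. x j) = 0" if "l2 e (\<lambda>i. x i - x e) = 0" by (rule l2_base_map(2)[OF x that])
   qed
   thus ?thesis using True by (simp add: base_map_def)
  qed (simp add: base_map_def)
 qed
 have cg: "continuous_on (ball_set e) (base_inv e)"
 proof (rule continuous_on_coords)
  fix i
  have cl: "continuous_on (ball_set e) (l2 e)" using cl2[of "ball_set e" "\<lambda>x. x", OF continuous_on_coord] by simp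
  show "continuous_on (ball_set e) (\<lambda>z. base_inv e z i)"
  proof (cases "i \<le> e")
   case True
   have "continuous_on (ball_set e) (\<lambda>z. l2 e z * (z i - low e z) / gauge_base e z)"
   proof (rule continuous_on_quotient_null[where b = "l2 e"])
    show "continuous_on (ball_set e) (\<lambda>z. l2 e z * (z i - low e z))" by (intro continuous_intros cl clow)
    show "continuous_on (ball_set e) (gauge_base e)" unfolding gauge_base_def by (intro continuous_intros clow)
    fix z assume z: "z \<in> ball_set e"
    show "\<bar>l2 e z * (z i - low e z) / gauge_base e z\<bar> \<le> l2 e z"
    proof (cases "gauge_base e z = 0")
     case False
     hence p: "0 < gauge_base e z" using gauge_base_nonneg[of e z] by simp
     have "0 \<le> z i - low e z" "z i - low e z \<le> gauge_base e z" using low_le[OF True, of z] gauge_coord[OF True, of z] by auto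
     hence "(z i - low e z) / gauge_base e z \<le> 1" "0 \<le> (z i - low e z) / gauge_base e z" using p by auto
     hence "l2 e z * ((z i - low e z) / gauge_base e z) \<le> l2 e z * 1" "0 \<le> l2 e z * ((z i - low e z) / gauge_base e z)"
      by (intro mult_left_mono mult_nonneg_nonneg; simp)+
     thus ?thesis by simp
    qed simp
    show "l2 e z = 0" if "gauge_base e z = 0" by (rule gz[OF z that])
   qed (rule cl)
   thus ?thesis using True by (simp add: base_inv_def)
  next
   case False
   thus ?thesis using cl by (cases "i = Suc e") (auto simp: base_inv_def intro!: continuous_intros)
  qed
 qed
 show ?thesis
  unfolding homeomorphic_maps_def using cf cg f_in g_in fg gf by (auto simp: image_subset_iff)
qed

text \<open>The norm of the image is \<open>1 - x (Suc e)\<close>, so it is one exactly when the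
  apex is not in the support.\<close>

theorem ball_pair_base: "ball_pair e (cone_base e) (sphere_base e)"
proof -
 let ?X = "realization {..Suc e} (cone_base e)"
 have "{Suc e} \<in> cone_base e" "i \<le> e ==> {} \<in> cone_base e" for i by (auto simp: cone_base_def)
 have X: "realization (\<Union>(cone_base e)) (cone_base e) = ?X"
  by (rule realization_superset[symmetric]) (auto simp: cone_base_def)
 have "{v. x v ~= 0} \<in> sphere_base e \<longleftrightarrow> (\<Sum>i<e. (base_map e x i)\<^sup>2) = 1" if x: "x \<in> ?X" for x
 proof -
  note b = base_facts[OF x]
  have "(\<Sum>i<e. (base_map e x i)\<^sup>2) = (\<Sum>j\<le>e. x j)\<^sup>2"
   unfolding l2_base_map(1)[OF x, symmetric] by (simp add: l2_def sum_nonneg)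
  also have "\<dots> = 1 \<longleftrightarrow> (\<Sum>j\<le>e. x j) = 1" using b(4) by (simp add: power2_eq_1_iff)
  also have "\<dots> \<longleftrightarrow> x (Suc e) = 0" using b(2) by auto
  also have "\<dots> \<longleftrightarrow> {v. x v ~= 0} \<in> sphere_base e"
  proof
   assume 0: "x (Suc e) = 0"
   have s: "{v. x v ~= 0} \<subseteq> {..Suc e}" "\<not> {..e} \<subseteq> {v. x v ~= 0}" using x by (auto simp: realization_def cone_base_def)
   have "v \<le> e" if "x v ~= 0" for v using that s(1) 0 by (cases "v = Suc e") auto
   thus "{v. x v ~= 0} \<in> sphere_base e" using s(2) by (auto simp: sphere_base_def)
  qed (auto simp: sphere_base_def)
  finally show ?thesis by blast
 qed
 moreover have "finite (\<Union>(cone_base e))" by (rule finite_subset[of _ "{..Suc e}"]) (auto simp: cone_base_def)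
 moreover have "down_closed (cone_base e)" "down_closed (sphere_base e)"
  by (auto simp: down_closed_def cone_base_def sphere_base_def)
 moreover have "{} \<in> cone_base e" "{} \<in> sphere_base e" "sphere_base e \<subseteq> cone_base e"
  by (auto simp: cone_base_def sphere_base_def)
 ultimately show ?thesis unfolding ball_pair_def X using base_homeomorphism by blast
qed

text \<open>Shemer's universal faces in an ascending flag: \<open>flag_union E i\<close> remains a
  face after adding any set of at most \<open>s - i\<close> vertices. The first block has
  \<open>\<epsilon>\<close> vertices to adjust parity, all others two.\<close>

definition universal_flag :: "nat => nat => 'a set => 'a set set => (nat => 'a set) => bool" where
 "universal_flag s \<epsilon> V K E \<longleftrightarrow> (\<forall>k<s. E k \<subseteq> V \<and> card (E k) = (if k = 0 then \<epsilon> else 2)) \<and>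
   (\<forall>j<s. \<forall>k<s. j ~= k --> E j \<inter> E k = {}) \<and>
   (\<forall>i G. 1 \<le> i \<and> i \<le> s \<and> G \<subseteq> V \<and> card G + i \<le> s --> flag_union E i \<union> G \<in> K)"

locale universal_sewing =
 fixes s \<epsilon> :: nat and V :: "'a set" and K :: "'a set set" and E :: "nat => 'a set" and u :: 'a
 assumes finV: "finite V" and flag: "universal_flag s \<epsilon> V K E" and s: "1 \<le> s" and eps: "1 \<le> \<epsilon>" "\<epsilon> \<le> 2"
  and u: "u \<notin> V" and down: "down_closed K"
begin

lemma E_sub: "k < s ==> E k \<subseteq> V" and E_card: "k < s ==> card (E k) = (if k = 0 then \<epsilon> else 2)"
 and E_disj: "j < s ==> k < s ==> j ~= k ==> E j \<inter> E k = {}"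
 and universal: "1 \<le> i ==> i \<le> s ==> G \<subseteq> V ==> card G + i \<le> s ==> flag_union E i \<union> G \<in> K"
 using flag by (simp_all add: universal_flag_def)

lemma E_unique: "v \<in> E j ==> v \<in> E k ==> j < s ==> k < s ==> j = k"
 using E_disj by blast

sublocale sewing E u s
proof
 show "E 0 ~= {}" if "1 \<le> s" using E_card[of 0] that eps by auto
 show "u \<notin> E k" if "k < s" for k using E_sub[OF that] u by blast
qed (rule E_disj)

lemma M_iff: "v \<in> M j \<longleftrightarrow> (v = u \<and> odd j) \<or> (\<exists>k. k + 2 \<le> j \<and> even (k + j) \<and> v \<in> E k)"
 by (simp add: sew_set_def)

lemma M_sub: "j \<le> Suc s ==> M j \<subseteq> insert u V"
proof
 fix v assume "j \<le> Suc s" "v \<in> M j"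
 then consider "v = u" | k where "k + 2 \<le> j" "v \<in> E k" unfolding M_iff by blast
 thus "v \<in> insert u V"
 proof cases
  case 2
  thus ?thesis using E_sub[of k] \<open>j \<le> Suc s\<close> by auto
 qed simp
qed

lemma finM: "j \<le> Suc s ==> finite (M j)"
 using M_sub finV by (meson finite_insert finite_subset)

lemma M_T: "M j \<subseteq> insert u (T j)"
proof (cases j)
 case (Suc i)
 have "T i \<subseteq> T j" by (rule flag_union_mono) (simp add: Suc)
 thus ?thesis using sew_set_flag[of E u i] Suc by blast
qed simp

lemma M_E_disjoint:
 assumes "k < s"
 shows "M k \<inter> E k = {}"
proof -
 have False if v: "v \<in> M k" "v \<in> E k" for v
 proof -
  have "v ~= u" using v(2) uE[OF assms] by blast
  then obtain l where "l + 2 \<le> k" "v \<in> E l" using v(1) unfolding M_iff by blast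
  thus False using E_unique[of v l k] v(2) assms by simp
 qed
 thus ?thesis by blast
qed

text \<open>Each step from \<open>M j\<close> to \<open>M (j + 2)\<close> adds a new block of two,
  and the starting sizes are 1 for \<open>j = 1\<close> and \<open>\<epsilon>\<close> for
  \<open>j = 2\<close>.\<close>

lemma card_M:
 assumes "1 \<le> j" "j \<le> Suc s"
 shows "j + \<epsilon> \<le> card (M j) + 2"
 using assms
proof (induction j rule: less_induct)
 case (less j)
 consider "j = 1" | "j = 2" | k where "j = Suc (Suc k)" "1 \<le> k"
  using less.prems by (metis One_nat_def Suc_1 Suc_le_D le_SucE not_less_eq_eq numeral_2_eq_2)
 thus ?case
 proof cases
  case 1
  thus ?thesis using eps by simp
 next
  case 2
  hence "M j = E 0" using sew_set_step[of E u 0] by (simp add: numeral_2_eq_2)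
  thus ?thesis using 2 E_card[of 0] s by simp
 next
  case 3
  hence k: "k < s" "k ~= 0" using less.prems by auto
  have "finite (E k)" using E_sub[OF k(1)] finV finite_subset by blast
  hence "card (M k \<union> E k) = card (M k) + card (E k)"
   using finM[of k] M_E_disjoint[OF k(1)] k(1) by (intro card_Un_disjoint) auto
  hence "card (M j) = card (M k) + 2" using E_card[OF k(1)] k(2) 3(1) by (simp add: sew_set_step)
  thus ?thesis using less.IH[of k] 3 k by simp
 qed
qed

lemma member:
 assumes "1 \<le> j" "j \<le> s" "F \<subseteq> insert u V" "card (F - {u} - T j) + j \<le> s"
 shows "(F - {u}) \<union> T j \<in> K"
proof -
 have "T j \<union> (F - {u} - T j) \<in> K" using assms by (intro universal) auto
 thus ?thesis by (simp add: Un_commute)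
qed

text \<open>If \<open>F\<close> contains \<open>M j\<close>, at most
  \<open>card F - card (M j)\<close> of its vertices other than \<open>u\<close> lie outside
  \<open>T j\<close>; by \<open>card_M\<close> this is at most \<open>s - j\<close>, exactly what
  universality tolerates. The same count shows that \<open>F\<close> is too small to contain
  \<open>M (Suc s)\<close>.\<close>

lemma sew_neighborly:
 assumes F: "F \<subseteq> insert u V" "card F + 2 \<le> s + \<epsilon>" "u \<in> F \<or> F \<in> K"
 shows "F \<in> sew E u K s"
proof -
 have finF: "finite F" using F(1) finV finite_subset by blast
 have c: "card (F - {u} - T j) + j \<le> s" if j: "1 \<le> j" "j \<le> Suc s" "M j \<subseteq> F" for j
 proof -
  have "card (F - {u} - T j) \<le> card (F - M j)" using finF M_T[of j] by (intro card_mono) auto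
  moreover have "card (F - M j) = card F - card (M j)" "card (M j) \<le> card F"
   using finM[OF j(2)] j(3) finF by (auto simp: card_Diff_subset card_mono)
  ultimately show ?thesis using card_M[OF j(1,2)] F(2) by simp
 qed
 have "\<not> M (Suc s) \<subseteq> F" using c[of "Suc s"] by auto
 moreover have "(F - {u}) \<union> T j \<in> K" if j: "j \<le> s" "M j \<subseteq> F" for j
 proof (cases "j = 0")
  case False
  thus ?thesis using member[OF _ j(1) F(1) c] j by simp
 next
  case True
  show ?thesis
  proof (cases "u \<in> F")
   case u: True
   hence "(F - {u}) \<union> T 1 \<in> K" using member[OF _ s F(1) c[of 1]] s by simp
   thus ?thesis unfolding True by (rule down_closedD[OF down]) auto
  next
   case False
   thus ?thesis using F(3) True by simp
  qed
 qed
 ultimately show ?thesis by (simp add: sew_def)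
qed

text \<open>The new flag puts \<open>u\<close> into the first block and passes one vertex
  \<open>c k\<close> from each block to the next, so the union of its first \<open>Suc i\<close>
  blocks is \<open>T (Suc i)\<close> with \<open>c i\<close> replaced by \<open>u\<close>. The
  missing vertex keeps \<open>M (Suc (Suc i))\<close> from being contained in it.\<close>

theorem universal_flag_sew:
 "\<exists>E'. universal_flag s \<epsilon> (insert u V) (sew E u K s) E' \<and> u \<in> E' 0"
proof -
 define c where "c = (\<lambda>k. SOME x. x \<in> E k)"
 have c: "c k \<in> E k" if "k < s" for k
 proof -
  have "E k ~= {}" using E_card[OF that] eps by (auto split: if_splits)
  thus ?thesis unfolding c_def by (simp add: some_in_eq)
 qed
 define E' where "E' = (\<lambda>k. insert (if k = 0 then u else c (k - 1)) (E k - {c k}))"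
 let ?T = "flag_union E'"
 have T': "?T (Suc i) = insert u (T i \<union> (E i - {c i}))" if "i < s" for i
  using that
 proof (induction i)
  case 0
  thus ?case by (simp add: flag_union_Suc E'_def)
 next
  case (Suc i)
  have "E' (Suc i) = insert (c i) (E (Suc i) - {c (Suc i)})" by (simp add: E'_def)
  moreover have "?T (Suc i) = insert u (T i \<union> (E i - {c i}))" using Suc by simp
  ultimately have "?T (Suc (Suc i)) = insert u (T i \<union> (E i - {c i})) \<union> insert (c i) (E (Suc i) - {c (Suc i)})"
   unfolding flag_union_Suc[of E' "Suc i"] by simp
  thus ?case using c[of i] Suc.prems by (auto simp: flag_union_Suc)
 qed
 have sub: "E' k \<subseteq> insert u V" if "k < s" for k
 proof (cases k)
  case 0
  thus ?thesis using E_sub[OF that] by (auto simp: E'_def)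
 next
  case (Suc a)
  hence "c a \<in> V" using c[of a] E_sub[of a] that by auto
  thus ?thesis using E_sub[OF that] Suc by (auto simp: E'_def)
 qed
 have card': "card (E' k) = (if k = 0 then \<epsilon> else 2)" if k: "k < s" for k
 proof -
  have fin: "finite (E k)" using E_sub[OF k] finV finite_subset by blast
  have "(if k = 0 then u else c (k - 1)) \<notin> E k"
  proof (cases k)
   case 0
   thus ?thesis using uE[OF k] by simp
  next
   case (Suc a)
   hence "a < s" "a ~= k" using k by auto
   thus ?thesis using c[of a] E_unique[of "c a" a k] k Suc by auto
  qed
  hence "card (E' k) = Suc (card (E k - {c k}))" using fin by (simp add: E'_def)
  also have "\<dots> = card (E k)" using c[OF k] fin by (metis card.remove)
  finally show ?thesis using E_card[OF k] by simp
 qed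
 have mem: "(k = 0 \<and> v = u) \<or> (\<exists>a. k = Suc a \<and> v = c a) \<or> (v \<in> E k \<and> v ~= c k)" if "v \<in> E' k" for v k
  using that by (cases k) (auto simp: E'_def)
 have disj': "E' j \<inter> E' k = {}" if jk: "j < s" "k < s" "j ~= k" for j k
 proof -
  have False if v: "v \<in> E' j" "v \<in> E' k" for v
  proof (cases "v = u")
   case True
   have "i = 0" if "v \<in> E' i" "i < s" for i
    using mem[OF that(1)] uE[OF that(2)] c uE that(2) True by (auto dest: Suc_lessD)
   thus False using v jk by metis
  next
   case False
   have h: "(\<exists>a. i = Suc a \<and> v = c a) \<or> (v \<in> E i \<and> v ~= c i)" if "v \<in> E' i" for i
    using mem[OF that] False by blast
   from h[OF v(1)] h[OF v(2)] show False
    using c E_unique jk by (metis Suc_lessD)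
  qed
  thus ?thesis by blast
 qed
 have univ: "?T i' \<union> G \<in> sew E u K s" if i': "1 \<le> i'" "i' \<le> s" "G \<subseteq> insert u V" "card G + i' \<le> s" for i' G
 proof -
  obtain i where i: "i' = Suc i" "i < s" using i' by (cases i') auto
  define F0 F where "F0 = ?T i'" and "F = F0 \<union> G"
  have F0: "F0 = insert u (T i \<union> (E i - {c i}))" unfolding F0_def i(1) by (rule T'[OF i(2)])
  have finG: "finite G" using i'(3) finV finite_subset by blast
  have TV: "T j \<subseteq> V" if "j \<le> s" for j
   unfolding flag_union_def
  proof (rule UN_least)
   fix k assume "k \<in> {..<j}"
   thus "E k \<subseteq> V" using that by (intro E_sub) simp
  qed
  have F0T: "F0 \<subseteq> insert u (T (Suc i))" unfolding F0 flag_union_Suc by blast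
  have FV: "F \<subseteq> insert u V" using i'(3) F0T TV[of "Suc i"] i unfolding F_def by auto
  have EF0: "E k \<inter> F0 = {}" if k: "i < k" "k < s" for k
  proof -
   have "v \<notin> T (Suc i)" if v: "v \<in> E k" for v
   proof
    assume "v \<in> T (Suc i)"
    then obtain l where "l < Suc i" "v \<in> E l" by (auto simp: flag_union_def)
    thus False using E_unique[of v l k] v k i(2) by simp
   qed
   thus ?thesis using F0T uE[OF k(2)] by blast
  qed
  \<comment> \<open>Counts the vertices of \<open>M j\<close> that \<open>G\<close> must supply: at
    least one, namely \<open>c i\<close>, for \<open>j = Suc (Suc i)\<close>, and two more from the
    block \<open>E k\<close> on passing from \<open>k\<close> to \<open>Suc (Suc k)\<close>.\<close>
  have claim: "j \<le> card (M j - F0) + Suc i" if "Suc i \<le> j" "j \<le> Suc s" for j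
   using that
  proof (induction j rule: less_induct)
   case (less j)
   consider "j = Suc i" | "j = Suc (Suc i)" | k where "j = Suc (Suc k)" "Suc i \<le> k"
    using less.prems by (metis Suc_leD Suc_le_D le_SucE not_less_eq_eq)
   thus ?case
   proof cases
    case 1
    thus ?thesis by simp
   next
    case 2
    have ci: "c i \<in> E i" by (rule c[OF i(2)])
    have "c i \<notin> T i"
    proof
     assume "c i \<in> T i"
     then obtain l where "l < i" "c i \<in> E l" by (auto simp: flag_union_def)
     thus False using E_unique[of "c i" l i] ci i(2) by simp
    qed
    moreover have "c i ~= u" using ci uE[OF i(2)] by blast
    ultimately have "c i \<in> M j - F0" using ci unfolding F0 2 sew_set_step by blast
    hence "card (M j - F0) ~= 0" using finM[OF less.prems(2)] by auto
    thus ?thesis using 2 by simp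
   next
    case 3
    hence k: "i < k" "k < s" using less.prems by auto
    have "M j - F0 = (M k - F0) \<union> E k" unfolding 3(1) sew_set_step using EF0[OF k] by blast
    moreover have "card ((M k - F0) \<union> E k) = card (M k - F0) + card (E k)"
     using finM[of k] M_E_disjoint[OF k(2)] k E_sub[OF k(2)] finV by (intro card_Un_disjoint) (auto intro: finite_subset)
    ultimately show ?thesis using less.IH[of k] 3 k E_card[OF k(2)] by simp
   qed
  qed
  have bnd: "card (F - {u} - T j) + j \<le> s" if j: "Suc i \<le> j" "j \<le> Suc s" and m: "M j \<subseteq> F \<or> j = Suc i" for j
  proof -
   have Tj: "T (Suc i) \<subseteq> T j" by (rule flag_union_mono[OF j(1)])
   show ?thesis
   proof (cases "M j \<subseteq> F")
    case True
    have "M j - F0 \<subseteq> G" using True by (auto simp: F_def)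
    moreover have "F - {u} - T j \<subseteq> G - (M j - F0)"
     using F0T Tj M_T[of j] unfolding F_def F0 by blast
    ultimately have "card (F - {u} - T j) \<le> card G - card (M j - F0)" "card (M j - F0) \<le> card G"
     using finG by (metis card_Diff_subset card_mono finite_Diff finite_subset) (use finG \<open>M j - F0 \<subseteq> G\<close> in \<open>simp add: card_mono\<close>)
    thus ?thesis using claim[OF j] i'(4) i(1) by simp
   next
    case False
    hence ji: "j = Suc i" using m by blast
    have "F - {u} - T j \<subseteq> G" using F0T Tj unfolding F_def by blast
    thus ?thesis using card_mono[OF finG, of "F - {u} - T j"] i'(4) i(1) ji by simp
   qed
  qed
  have base: "(F - {u}) \<union> T (Suc i) \<in> K" using member[OF _ _ FV bnd[of "Suc i"]] i by simp
  have "(F - {u}) \<union> T j \<in> K" if j: "j \<le> s" "M j \<subseteq> F" for j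
  proof (cases "Suc i \<le> j")
   case True
   thus ?thesis using member[OF _ j(1) FV bnd[OF True]] j by simp
  next
   case False
   hence "T j \<subseteq> T (Suc i)" by (intro flag_union_mono) simp
   thus ?thesis using down_closedD[OF down base] by (meson Un_mono order_refl)
  qed
  moreover have "\<not> M (Suc s) \<subseteq> F" using bnd[of "Suc s"] i(2) by auto
  ultimately show ?thesis unfolding F0_def[symmetric] F_def[symmetric] by (simp add: sew_def)
 qed
 have "u \<in> E' 0" by (simp add: E'_def)
 thus ?thesis unfolding universal_flag_def using sub card' disj' univ by (intro exI[of _ E']) simp
qed

end

section \<open>Neighborly spheres and balls attaining the bounds\<close>

definition cone_over :: "'a => 'a set set => 'a set set" where
 "cone_over v S = {F. F - {v} \<in> S}"

text \<open>The apex lies in no block of the flag, so the conditions of sewing ignore it. This lets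
  a sphere be sewn together with the ball that cones it.\<close>

lemma sew_cone:
 assumes "v ~= u" "\<And>k. k < s ==> v \<notin> E k" "i \<le> s"
 shows "sew E u (cone_over v S) i = cone_over v (sew E u S i)"
proof -
 have M: "v \<notin> sew_set E u j" if "j \<le> Suc i" for j
  using assms that by (auto simp: sew_set_def)
 have T: "v \<notin> flag_union E j" if "j \<le> i" for j
  using assms that by (auto simp: flag_union_def)
 have Mi: "sew_set E u j \<subseteq> F - {v} \<longleftrightarrow> sew_set E u j \<subseteq> F" if "j \<le> Suc i" for j F using M[OF that] by blast
 have Ti: "(F - {u}) \<union> flag_union E j - {v} = (F - {v} - {u}) \<union> flag_union E j" if "j \<le> i" for j F using T[OF that] by blast
 show ?thesis
  unfolding sew_def cone_over_def using Mi Ti by simp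
qed

text \<open>Vertices of the construction: \<open>d\<close> is the apex, the other vertices up to \<open>n\<close> lie on the
 boundary, and the vertices above \<open>n\<close> are interior.\<close>

definition rim :: "nat => nat => nat set" where
 "rim d n = {..n} - {d}"

text \<open>Chosen so that \<open>half_flag d + 2 * (d div 2) = Suc d\<close>: the last member of
  the flag has \<open>d - 1\<close> vertices, the size of a facet of the boundary sphere.\<close>

definition half_flag :: "nat => nat" where
 "half_flag d = (if even d then 1 else 2)"

text \<open>The sphere is recorded through the ball that cones it, so it needs no topology of its
  own.\<close>

definition neighborly_sphere :: "nat => nat => nat set set => bool" where
 "neighborly_sphere d n S \<longleftrightarrow> \<Union>S = rim d n \<and> neighborly ((d - 1) div 2) (rim d n) S \<and>
   (\<exists>E. universal_flag (d div 2) (half_flag d) (rim d n) S E) \<and> ball_pair (d - 1) (cone_over d S) S"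

text \<open>The two neighborliness clauses match the two bounds: sets not inside the boundary up to
  size \<open>d div 2\<close>, and all sets up to size \<open>(d - 1) div 2\<close>; the sizes
  differ for even \<open>d\<close>. The flag begins with a block that leaves \<open>rim d n\<close>,
  so that further sewing does not touch the boundary.\<close>

definition neighborly_ball :: "nat => nat => nat => nat set set => nat set set => bool" where
 "neighborly_ball d n m K S \<longleftrightarrow> ball_pair (d - 1) K S \<and> \<Union>S = rim d n \<and> \<Union>K = {..<n + m} \<and>
   (\<forall>\<sigma>\<in>K. \<sigma> \<subseteq> rim d n --> \<sigma> \<in> S) \<and>
   (\<forall>F. F \<subseteq> {..<n + m} \<and> card F \<le> d div 2 \<and> \<not> F \<subseteq> rim d n --> F \<in> K) \<and>
   neighborly ((d - 1) div 2) {..<n + m} K \<and>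
   (\<exists>E. universal_flag (d div 2) 2 {..<n + m} K E \<and> \<not> E 0 \<subseteq> rim d n)"

lemma neighborlyD: "neighborly k V X ==> F \<subseteq> V ==> card F \<le> k ==> F \<in> X"
 by (simp add: neighborly_def)

lemma half_flag: "2 \<le> d ==> d div 2 + half_flag d = (d - 1) div 2 + 2" "1 \<le> half_flag d" "half_flag d \<le> 2"
 by (auto simp: half_flag_def elim!: evenE oddE)

lemma half_flag_sum: "2 \<le> d ==> half_flag d + 2 * (d div 2) = Suc d"
 by (auto simp: half_flag_def elim!: evenE oddE)

text \<open>Every set of fewer than \<open>d\<close> vertices is a face here, so disjoint blocks of
  the right sizes serve; consecutive intervals are taken.\<close>

lemma base_sphere:
 assumes d: "2 \<le> d"
 shows "neighborly_sphere d d (sphere_base (d - 1))"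
proof -
 obtain e where e: "d = Suc e" "1 \<le> e" using d by (cases d) auto
 have rim: "rim d d = {..e}" by (auto simp: rim_def e(1))
 let ?s = "d div 2" and ?h = "half_flag d"
 have hs: "?h + 2 * ?s = Suc d" by (rule half_flag_sum[OF d])
 have "\<Union>(sphere_base e) = {..e}"
 proof -
  have "v \<in> \<Union>(sphere_base e)" if "v \<le> e" for v
  proof -
   have "{..e} ~= {v}"
   proof
    assume a: "{..e} = {v}"
    have "0 \<in> {..e}" "1 \<in> {..e}" using e(2) by auto
    thus False unfolding a by simp
   qed
   hence "{v} \<in> sphere_base e" using that by (auto simp: sphere_base_def)
   thus ?thesis by blast
  qed
  thus ?thesis by (auto simp: sphere_base_def)
 qed
 moreover
 have small: "F \<in> sphere_base e" if "F \<subseteq> {..e}" "card F < d" for F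
  using that e(1) by (auto simp: sphere_base_def psubset_eq)
 have "neighborly ((d - 1) div 2) {..e} (sphere_base e)"
  unfolding neighborly_def
 proof (intro allI impI)
  fix F assume F: "F \<subseteq> {..e} \<and> card F \<le> (d - 1) div 2"
  hence "card F < d" using d by linarith
  thus "F \<in> sphere_base e" using F by (intro small) simp_all
 qed
 \<comment> \<open>Natural subtraction truncates at \<open>k = 0\<close>, so the first block is
   \<open>{0..<?h}\<close>.\<close>
 moreover have "universal_flag ?s ?h {..e} (sphere_base e) (\<lambda>k. {?h + 2 * k - 2..<?h + 2 * k})"
  unfolding universal_flag_def
 proof (intro conjI allI impI)
  fix k assume k: "k < ?s"
  show "{?h + 2 * k - 2..<?h + 2 * k} \<subseteq> {..e}" using k hs e(1) by auto
  show "card {?h + 2 * k - 2..<?h + 2 * k} = (if k = 0 then ?h else 2)" using half_flag(2,3)[of d] by auto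
 next
  fix j k assume "j < ?s" "k < ?s" "j ~= k"
  thus "{?h + 2 * j - 2..<?h + 2 * j} \<inter> {?h + 2 * k - 2..<?h + 2 * k} = {}" by (cases "j < k") auto
 next
  fix i G assume a: "1 \<le> i \<and> i \<le> ?s \<and> G \<subseteq> {..e} \<and> card G + i \<le> ?s"
  let ?T = "flag_union (\<lambda>k. {?h + 2 * k - 2..<?h + 2 * k}) i"
  have T: "?T \<subseteq> {..<?h + 2 * i - 2}" by (auto simp: flag_union_def)
  hence cT: "card ?T \<le> ?h + 2 * i - 2" using card_mono[OF _ T] by simp
  have "card (?T \<union> G) \<le> card ?T + card G" by (rule card_Un_le)
  also have "\<dots> < d" using cT a hs by linarith
  finally have "card (?T \<union> G) < d" .
  moreover have "{..<?h + 2 * i - 2} \<subseteq> {..e}" using a hs e(1) by auto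
  hence "?T \<union> G \<subseteq> {..e}" using T a by blast
  ultimately show "?T \<union> G \<in> sphere_base e" by (intro small)
 qed
 moreover have "cone_over d (sphere_base e) = cone_base e"
 proof (rule Set.set_eqI)
  fix F
  have "F - {Suc e} \<subset> {..e} \<longleftrightarrow> F \<subseteq> {..Suc e} \<and> \<not> {..e} \<subseteq> F" by (auto simp: le_Suc_eq)
  thus "F \<in> cone_over d (sphere_base e) \<longleftrightarrow> F \<in> cone_base e" by (simp add: cone_over_def sphere_base_def cone_base_def e(1))
 qed
 ultimately show ?thesis unfolding neighborly_sphere_def rim using ball_pair_base[of e] e(1) by auto
qed

text \<open>The new vertex is sewn to the sphere and to its cone at once, which keeps the ball;
  \<open>half_flag\<close> makes \<open>sew_neighborly\<close> reach size
  \<open>(d - 1) div 2\<close>. From \<open>d = 3\<close> on this covers singletons, so the new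
  point becomes a vertex.\<close>

lemma sphere_step:
 assumes d: "3 \<le> d" "d \<le> n" and S: "neighborly_sphere d n S"
 shows "\<exists>S'. neighborly_sphere d (Suc n) S'"
proof -
 let ?s = "d div 2" and ?W = "rim d n" and ?u = "Suc n"
 obtain E where E: "universal_flag ?s (half_flag d) ?W S E" using S by (auto simp: neighborly_sphere_def)
 have P: "ball_pair (d - 1) (cone_over d S) S" and US: "\<Union>S = ?W" and nb: "neighborly ((d - 1) div 2) ?W S"
  using S by (auto simp: neighborly_sphere_def)
 have down: "down_closed S" using P by (simp add: ball_pair_def)
 have uW: "?u \<notin> ?W" "insert ?u ?W = rim d ?u" and dW: "d \<notin> ?W" using d by (auto simp: rim_def)
 interpret universal_sewing ?s "half_flag d" ?W S E ?u
  using E half_flag(2,3)[of d] uW down d by unfold_locales (auto simp: rim_def)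
 let ?S = "sew E ?u S ?s"
 have "neighborly ((d - 1) div 2) (rim d ?u) ?S"
  unfolding neighborly_def
 proof (intro allI impI)
  fix F assume F: "F \<subseteq> rim d ?u \<and> card F \<le> (d - 1) div 2"
  show "F \<in> ?S"
  proof (rule sew_neighborly)
   show "F \<subseteq> insert ?u ?W" using F uW by simp
   have h: "?s + half_flag d = (d - 1) div 2 + 2" by (rule half_flag(1)) (use d in simp)
   show "card F + 2 \<le> ?s + half_flag d" unfolding h using F by (simp only: add_le_mono1)
   show "?u \<in> F \<or> F \<in> S"
   proof (cases "?u \<in> F")
    case False
    have "F \<subseteq> insert ?u ?W" unfolding uW(2) using F by (rule conjunct1)
    hence "F \<subseteq> ?W" using False by blast
    thus ?thesis using neighborlyD[OF nb _ conjunct2[OF F]] by (intro disjI2)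
   qed simp
  qed
 qed
 moreover from this have "\<Union>?S = rim d ?u"
 proof -
  have "1 \<le> (d - 1) div 2" using d by linarith
  hence "{v} \<in> ?S" if "v \<in> rim d ?u" for v
   using that by (intro neighborlyD[OF \<open>neighborly ((d - 1) div 2) (rim d ?u) ?S\<close>]) simp_all
  moreover have "F \<subseteq> rim d ?u" if "F \<in> ?S" for F
   using sew_minus[OF that] US uW(2) by blast
  ultimately show ?thesis by blast
 qed
 moreover have "\<exists>E'. universal_flag ?s (half_flag d) (rim d ?u) ?S E'"
  using universal_flag_sew uW(2) by auto
 moreover have "ball_pair (d - 1) (cone_over d ?S) ?S"
 proof -
  have Ed: "d \<notin> E k" if "k < ?s" for k using E_sub[OF that] dW by blast
  have UK: "\<Union>(cone_over d S) \<subseteq> insert d ?W" using US by (auto simp: cone_over_def)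
  have "ball_pair (d - 1) (sew E ?u (cone_over d S) ?s) ?S"
  proof (rule ball_pair_sew[OF P])
   show "?u \<notin> \<Union>(cone_over d S)" using UK uW(1) d by auto
   have "S \<subseteq> cone_over d S" using P by (simp add: ball_pair_def)
   thus "E k \<subseteq> \<Union>(cone_over d S)" if "k < ?s" for k using E_sub[OF that] US by blast
  qed simp
  moreover have "sew E ?u (cone_over d S) ?s = cone_over d ?S" by (rule sew_cone[OF _ Ed]) (use d in auto)
  ultimately show ?thesis by simp
 qed
 ultimately show ?thesis unfolding neighborly_sphere_def by blast
qed

text \<open>For \<open>d = 2\<close> the sphere consists of two points and admits no further vertex,
  hence \<open>n = 2\<close>.\<close>

lemma sphere_exists:
 assumes "2 \<le> d" "d \<le> n" "d = 2 --> n = 2"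
 shows "\<exists>S. neighborly_sphere d n S"
 using assms(2,3)
proof (induction n rule: dec_induct)
 case base
 thus ?case using base_sphere[OF assms(1)] by blast
next
 case (step n)
 hence "3 \<le> d" using assms(1) by (cases "d = 2") auto
 thus ?case using step sphere_step by auto
qed

text \<open>The apex \<open>d\<close> is the first interior vertex. A set through it loses one
  element on passing to the sphere, which accounts for the step from \<open>(d - 1) div 2\<close> to
  \<open>d div 2\<close>.\<close>

lemma first_ball:
 assumes d: "2 \<le> d" "d \<le> n" and S: "neighborly_sphere d n S"
 shows "neighborly_ball d n 1 (cone_over d S) S"
proof -
 let ?s = "d div 2" and ?W = "rim d n"
 obtain E where E: "universal_flag ?s (half_flag d) ?W S E" using S by (auto simp: neighborly_sphere_def)
 note f = E[unfolded universal_flag_def]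
 have P: "ball_pair (d - 1) (cone_over d S) S" and US: "\<Union>S = ?W" and nb: "neighborly ((d - 1) div 2) ?W S"
  using S by (auto simp: neighborly_sphere_def)
 have down: "down_closed S" "{} \<in> S" using P by (simp_all add: ball_pair_def)
 have V: "{..<n + 1} = insert d ?W" "d \<notin> ?W" using d by (auto simp: rim_def)
 have c: "F \<in> cone_over d S \<longleftrightarrow> F - {d} \<in> S" for F by (simp add: cone_over_def)
 have UK: "\<Union>(cone_over d S) = insert d ?W"
 proof -
  have "S \<subseteq> cone_over d S" using P by (simp add: ball_pair_def)
  moreover have "{d} \<in> cone_over d S" using down c by simp
  ultimately show ?thesis using US c by blast
 qed
 have finW: "finite ?W" by (simp add: rim_def)
 have s1: "1 \<le> ?s" "?s \<le> Suc ((d - 1) div 2)" using d by linarith+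
 have "E 0 ~= {}" using f s1 half_flag(2)[of d] by fastforce
 then obtain b where b: "b \<in> E 0" by blast
 \<comment> \<open>The first block becomes a pair containing the apex. Since \<open>b\<close> is
   from \<open>E 0\<close>, removing the apex from the new flag leaves part of the old one, and
   universality is inherited.\<close>
 define E' where "E' = E(0 := {d, b})"
 have subE: "E k \<subseteq> ?W" if "k < ?s" for k using f that by blast
 have dE: "d \<notin> E k" if "k < ?s" for k using subE[OF that] V(2) by blast
 have flag: "universal_flag ?s 2 (insert d ?W) (cone_over d S) E'"
  unfolding universal_flag_def
 proof (intro conjI allI impI)
  fix k assume k: "k < ?s"
  show "E' k \<subseteq> insert d ?W" using subE[OF k] subE[of 0] b s1 by (auto simp: E'_def)
  have "d ~= b" using dE[of 0] b s1 by auto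
  thus "card (E' k) = (if k = 0 then 2 else 2)" using f k by (auto simp: E'_def)
 next
  fix j k assume jk: "j < ?s" "k < ?s" "j ~= k"
  hence "E j \<inter> E k = {}" "d \<notin> E j" "d \<notin> E k" using f dE by blast+
  thus "E' j \<inter> E' k = {}" using jk b by (auto simp: E'_def)
 next
  fix i G assume a: "1 \<le> i \<and> i \<le> ?s \<and> G \<subseteq> insert d ?W \<and> card G + i \<le> ?s"
  have "card (G - {d}) \<le> card G" using a finW by (intro card_mono) (auto intro: finite_subset)
  hence "card (G - {d}) + i \<le> ?s" "G - {d} \<subseteq> ?W" using a by auto
  hence "flag_union E i \<union> (G - {d}) \<in> S"
   using a by (intro f[THEN conjunct2, THEN conjunct2, THEN spec, THEN spec, THEN mp] conjI) simp_all
  moreover have "flag_union E' i \<union> G - {d} \<subseteq> flag_union E i \<union> (G - {d})"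
  proof -
   have "E' k - {d} \<subseteq> E k" for k using b by (auto simp: E'_def)
   thus ?thesis by (auto simp: flag_union_def)
  qed
  ultimately show "flag_union E' i \<union> G \<in> cone_over d S" unfolding c by (rule down_closedD[OF down(1)])
 qed
 have "F \<in> cone_over d S" if F: "F \<subseteq> insert d ?W" "card F \<le> ?s" "\<not> F \<subseteq> ?W" for F
 proof -
  have "d \<in> F" using F by blast
  moreover have "finite F" using F(1) finW finite_subset by blast
  ultimately have "Suc (card (F - {d})) = card F" by (metis card.remove)
  hence "card (F - {d}) \<le> (d - 1) div 2" using F(2) s1(2) by linarith
  moreover have "F - {d} \<subseteq> ?W" using F(1) by blast
  ultimately show ?thesis unfolding c by (intro neighborlyD[OF nb])
 qed
 moreover have "neighborly ((d - 1) div 2) (insert d ?W) (cone_over d S)"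
  unfolding neighborly_def
 proof (intro allI impI)
  fix F assume F: "F \<subseteq> insert d ?W \<and> card F \<le> (d - 1) div 2"
  have "card (F - {d}) \<le> card F" using F finW by (intro card_mono) (auto intro: finite_subset)
  moreover have "F - {d} \<subseteq> ?W" using F by blast
  ultimately show "F \<in> cone_over d S" unfolding c using F by (intro neighborlyD[OF nb]) simp_all
 qed
 moreover have "\<sigma> \<in> S" if "\<sigma> \<in> cone_over d S" "\<sigma> \<subseteq> ?W" for \<sigma>
 proof -
  have "\<sigma> - {d} = \<sigma>" using that(2) V(2) by blast
  thus ?thesis using that(1) c by simp
 qed
 moreover have "\<not> E' 0 \<subseteq> ?W" using V(2) by (simp add: E'_def)
 ultimately show ?thesis unfolding neighborly_ball_def V(1) using P US UK flag by blast
qed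

text \<open>Every \<open>M j\<close> with positive \<open>j\<close> contains \<open>u\<close> or the
  block \<open>E 0\<close>, neither of which fits in the boundary, so sewing leaves \<open>S\<close>
  alone and only adds an interior vertex. The new first block contains \<open>u\<close>, so the
  situation persists.\<close>

lemma ball_step:
 assumes d: "2 \<le> d" "d \<le> n" and K: "neighborly_ball d n m K S" and m: "1 \<le> m"
 shows "\<exists>K'. neighborly_ball d n (Suc m) K' S"
proof -
 let ?s = "d div 2" and ?W = "rim d n" and ?V = "{..<n + m}" and ?u = "n + m"
 have P: "ball_pair (d - 1) K S" and US: "\<Union>S = ?W" and UK: "\<Union>K = ?V"
  and full: "\<And>\<sigma>. \<sigma> \<in> K ==> \<sigma> \<subseteq> ?W ==> \<sigma> \<in> S"
  and int: "\<And>F. F \<subseteq> ?V ==> card F \<le> ?s ==> \<not> F \<subseteq> ?W ==> F \<in> K"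
  and nb: "neighborly ((d - 1) div 2) ?V K"
  using K by (auto simp: neighborly_ball_def)
 obtain E where E: "universal_flag ?s 2 ?V K E" "\<not> E 0 \<subseteq> ?W" using K by (auto simp: neighborly_ball_def)
 have down: "down_closed K" "down_closed S" and SK: "S \<subseteq> K" using P by (simp_all add: ball_pair_def)
 have V': "{..<n + Suc m} = insert ?u ?V" by auto
 have WV: "?W \<subseteq> ?V" using m by (auto simp: rim_def)
 interpret universal_sewing ?s 2 ?V K E ?u
  using E down d by unfold_locales auto
 have uW: "?u \<notin> ?W" using WV by auto
 let ?K = "sew E ?u K ?s"
 have s1: "1 \<le> ?s" "(d - 1) div 2 \<le> ?s" using d by linarith+
 have SS: "sew E ?u S ?s = S"
 proof (rule Set.set_eqI, rule iffI)
  fix F assume F: "F \<in> sew E ?u S ?s"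
  have k: "\<And>j. j \<le> ?s ==> M j \<subseteq> F ==> (F - {?u}) \<union> T j \<in> S" using F by (simp add: sew_def)
  \<comment> \<open>A face through \<open>u\<close> contains \<open>M 1\<close>, and sewing into
    \<open>S\<close> would make \<open>E 0\<close> part of a boundary face.\<close>
  have "?u \<notin> F"
  proof
   assume "?u \<in> F"
   hence "(F - {?u}) \<union> T 1 \<in> S" using k[of 1] s1 by simp
   hence "T 1 \<subseteq> ?W" using US by blast
   moreover have "T 1 = E 0" using flag_union_Suc[of E 0] by simp
   ultimately show False using E(2) by simp
  qed
  thus "F \<in> S" using k[of 0] by simp
 next
  fix F assume F: "F \<in> S"
  hence FW: "F \<subseteq> ?W" using US by blast
  have no: "j = 0" if j: "j \<le> Suc ?s" "M j \<subseteq> F" for j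
  proof (rule ccontr)
   assume "j ~= 0"
   show False
   proof (cases "odd j")
    case True
    hence "?u \<in> M j" by (simp add: M_iff)
    thus False using j FW uW by blast
   next
    case False
    hence "E 0 \<subseteq> M j" using \<open>j ~= 0\<close> M_iff[of _ j] by (auto intro!: exI[of _ 0] elim!: evenE)
    thus False using j FW E(2) by blast
   qed
  qed
  have "F - {?u} = F" using FW uW by blast
  hence "(F - {?u}) \<union> T j \<in> S" if "j \<le> ?s" "M j \<subseteq> F" for j
   using no[of j] that F by simp
  moreover have "\<not> M (Suc ?s) \<subseteq> F" using no[of "Suc ?s"] by blast
  ultimately show "F \<in> sew E ?u S ?s" by (simp add: sew_def)
 qed
 have P': "ball_pair (d - 1) ?K S"
 proof -
  have "ball_pair (d - 1) ?K (sew E ?u S ?s)"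
   by (rule ball_pair_sew[OF P]) (use UK E_sub in auto)
  thus ?thesis unfolding SS .
 qed
 have nK: "F \<in> ?K" if F: "F \<subseteq> insert ?u ?V" "card F \<le> ?s" "?u \<in> F \<or> F \<in> K" for F
  using sew_neighborly[OF F(1) _ F(3)] F(2) by simp
 have int': "F \<in> ?K" if F: "F \<subseteq> insert ?u ?V" "card F \<le> ?s" "\<not> F \<subseteq> ?W" for F
  using nK[OF F(1,2)] int[of F] F by blast
 have nb': "neighborly ((d - 1) div 2) (insert ?u ?V) ?K"
  unfolding neighborly_def
 proof (intro allI impI)
  fix F assume F: "F \<subseteq> insert ?u ?V \<and> card F \<le> (d - 1) div 2"
  have "?u \<in> F \<or> F \<in> K"
  proof (cases "?u \<in> F")
   case False
   hence "F \<subseteq> ?V" using F by blast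
   thus ?thesis using neighborlyD[OF nb] F by simp
  qed simp
  moreover have "card F \<le> ?s" using F s1(2) by linarith
  ultimately show "F \<in> ?K" using nK F by simp
 qed
 have UK': "\<Union>?K = insert ?u ?V"
 proof -
  have above: "v \<in> \<Union>?K" if v: "v \<in> insert ?u ?V" for v
  proof (cases "v \<in> ?W")
   case True
   thus ?thesis using US P' unfolding ball_pair_def by blast
  next
   case False
   hence "{v} \<in> ?K" using int'[of "{v}"] v s1 by simp
   thus ?thesis by blast
  qed
  have below: "F \<subseteq> insert ?u ?V" if "F \<in> ?K" for F
  proof -
   have "F - {?u} \<subseteq> ?V" unfolding UK[symmetric] by (rule Union_upper[OF sew_minus[OF that]])
   thus ?thesis by blast
  qed
  show ?thesis by (rule subset_antisym[OF Union_least[OF below] subsetI[OF above]])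
 qed
 have full': "\<sigma> \<in> S" if s: "\<sigma> \<in> ?K" "\<sigma> \<subseteq> ?W" for \<sigma>
 proof -
  have "\<sigma> - {?u} \<in> K" by (rule sew_minus[OF s(1)])
  moreover have "\<sigma> - {?u} = \<sigma>" using s(2) uW by blast
  ultimately show ?thesis using full s(2) by simp
 qed
 obtain E' where "universal_flag ?s 2 (insert ?u ?V) ?K E'" "?u \<in> E' 0" using universal_flag_sew by blast
 hence "\<exists>E'. universal_flag ?s 2 (insert ?u ?V) ?K E' \<and> \<not> E' 0 \<subseteq> ?W" using uW by blast
 thus ?thesis unfolding neighborly_ball_def V'
  using P' US UK' full' int' nb' by (intro exI[of _ ?K]) simp
qed

lemma ball_exists:
 assumes d: "2 \<le> d" "d \<le> n" "d = 2 --> n = 2" and m: "1 \<le> m"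
 shows "\<exists>K S. neighborly_ball d n m K S"
 using m
proof (induction m rule: dec_induct)
 case base
 obtain S where "neighborly_sphere d n S" using sphere_exists[OF d] by blast
 thus ?case using first_ball[OF d(1,2)] by blast
next
 case (step m)
 thus ?case using ball_step[OF d(1,2)] by blast
qed

text \<open>Each nonempty face is tested at its barycenter: by \<open>boundary_norm_iff\<close> it
  is a boundary face exactly when the norm there is one, which is how \<open>S\<close> was
  specified.\<close>

lemma ball_pair_boundary:
 assumes "ball_pair e K S"
 shows "simplicial_ball e K" "boundary_complex e K = S"
proof -
 note p = assms[unfolded ball_pair_def]
 have ac: "abstract_complex K" using p by (simp add: abstract_complex_def down_closed_def)
 obtain f f' where f: "homeomorphic_maps (top_of_set (realization (\<Union>K) K)) (top_of_set (ball_set e)) f f'"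
  and n: "\<forall>x\<in>realization (\<Union>K) K. {v. x v ~= 0} \<in> S \<longleftrightarrow> (\<Sum>i<e. (f x i)\<^sup>2) = 1"
  using p by (elim conjE exE)
 show "simplicial_ball e K"
  unfolding simplicial_ball_def geometric_realization_eq closed_unit_ball_eq homeomorphic_space_def using ac f by blast
 interpret triangulated_ball K e f f' using ac f by unfold_locales
 have S: "{} \<in> S" "S \<subseteq> K" using p by simp_all
 have "\<sigma> \<in> boundary_complex e K \<longleftrightarrow> \<sigma> \<in> S" if s: "\<sigma> \<in> K" for \<sigma>
 proof (cases "\<sigma> = {}")
  case True
  thus ?thesis using S(1) empty_boundary by simp
 next
  case False
  have b: "barycenter \<sigma> \<in> realization (\<Union>K) K" "{v. barycenter \<sigma> v ~= 0} = \<sigma>" using bary[OF s False] by auto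
  show ?thesis using boundary_norm_iff[OF s False b] n[rule_format, OF b(1)] b(2) by simp
 qed
 thus "boundary_complex e K = S" using S(2) boundary_down(2) by blast
qed

text \<open>The restrictions exclude cases where no such ball exists: for \<open>d = 1\<close> the
  ball is a point without boundary vertices, so \<open>n \<ge> d\<close> fails; for
  \<open>d = 2\<close> it is a path with two end points; for \<open>m = 0\<close> a full boundary on
  all vertices would contain the facets.\<close>

theorem tightness:
 assumes "2 \<le> d" "d \<le> n" "1 \<le> m" "d = 2 --> n = 2"
 shows "\<exists>\<Delta> :: nat set set. ball_with_full_boundary d m n \<Delta> \<and>
   (\<forall>k. 2 * k \<le> d --> of_int (h_number d \<Delta> (boundary_complex (d - 1) \<Delta>) k) = bound_lower_half d m n k) \<and>
   (\<forall>k. d < 2 * k \<and> k \<le> d --> of_int (h_number d \<Delta> (boundary_complex (d - 1) \<Delta>) k) = bound_upper_half d m n k)"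
proof -
 obtain K S where K: "neighborly_ball d n m K S" using ball_exists assms by blast
 note k = K[unfolded neighborly_ball_def]
 have P: "ball_pair (d - 1) K S" using k by simp
 note b = ball_pair_boundary[OF P]
 have US: "\<Union>S = rim d n" and UK: "\<Union>K = {..<n + m}" using k by simp_all
 have ball: "ball_with_full_boundary d m n K"
  unfolding ball_with_full_boundary_def full_subcomplex_def complex_vertices_def b(2) US UK
 proof (intro conjI)
  show "card (rim d n) = n" using assms by (simp add: rim_def)
  show "abstract_complex S" using P US by (simp add: ball_pair_def abstract_complex_def down_closed_def rim_def)
  show "S \<subseteq> K" using P by (simp add: ball_pair_def)
  show "\<forall>\<sigma>\<in>K. \<sigma> \<subseteq> rim d n --> \<sigma> \<in> S" using k by simp
 qed (use assms b(1) in simp_all)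
 have "of_int (h_number d K (boundary_complex (d - 1) K) j) = bound_lower_half d m n j" if j: "2 * j \<le> d" for j
 proof -
  have "\<sigma> \<subseteq> complex_vertices (boundary_complex (d - 1) K)" if \<sigma>: "nonface K \<sigma> \<and> face_dim \<sigma> < int j" for \<sigma>
  proof (rule ccontr)
   assume "\<not> \<sigma> \<subseteq> complex_vertices (boundary_complex (d - 1) K)"
   hence "\<not> \<sigma> \<subseteq> rim d n" unfolding complex_vertices_def b(2) US .
   moreover have "\<sigma> \<subseteq> {..<n + m}" "\<sigma> \<notin> K" "card \<sigma> \<le> d div 2"
    using \<sigma> j by (auto simp: nonface_def complex_vertices_def UK face_dim_def)
   ultimately show False using k by blast
  qed
  thus ?thesis using bounds_and_equality(1)[OF ball, of j] j by auto
 qed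
 moreover have "of_int (h_number d K (boundary_complex (d - 1) K) j) = bound_upper_half d m n j" if j: "d < 2 * j \<and> j \<le> d" for j
 proof -
  have "\<not> (nonface K \<sigma> \<and> face_dim \<sigma> < int d - int j)" for \<sigma>
  proof
   assume \<sigma>: "nonface K \<sigma> \<and> face_dim \<sigma> < int d - int j"
   hence "card \<sigma> \<le> d - j" using j by (auto simp: face_dim_def)
   hence "card \<sigma> \<le> (d - 1) div 2" using j by linarith
   moreover have "\<sigma> \<subseteq> {..<n + m}" "\<sigma> \<notin> K" using \<sigma> by (auto simp: nonface_def complex_vertices_def UK)
   moreover have "neighborly ((d - 1) div 2) {..<n + m} K" using k by simp
   ultimately show False using neighborlyD by blast
  qed
  thus ?thesis using bounds_and_equality(2)[OF ball, of j] j by auto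
 qed
 ultimately show ?thesis using ball by (intro exI[of _ K]) simp
qed

theorem theorem3p9:
  shows
    "(\<forall>(\<Delta> :: 'a set set) (d::nat) (m::nat) (n::nat). ball_with_full_boundary d m n \<Delta> \<longrightarrow>
        (\<forall>k. 2 * k \<le> d \<longrightarrow>
           of_int (h_number d \<Delta> (boundary_complex (d - 1) \<Delta>) k) \<le> bound_lower_half d m n k \<and>
           (of_int (h_number d \<Delta> (boundary_complex (d - 1) \<Delta>) k) = bound_lower_half d m n k \<longleftrightarrow>
              (\<forall>\<sigma>. nonface \<Delta> \<sigma> \<and> face_dim \<sigma> < int k \<longrightarrow>
                 \<sigma> \<subseteq> complex_vertices (boundary_complex (d - 1) \<Delta>)))) \<and>
        (\<forall>k. d < 2 * k \<and> k \<le> d \<longrightarrow>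
           of_int (h_number d \<Delta> (boundary_complex (d - 1) \<Delta>) k) \<le> bound_upper_half d m n k \<and>
           (of_int (h_number d \<Delta> (boundary_complex (d - 1) \<Delta>) k) = bound_upper_half d m n k \<longleftrightarrow>
              \<not> (\<exists>\<sigma>. nonface \<Delta> \<sigma> \<and> face_dim \<sigma> < int d - int k)))) \<and>
     (\<forall>(d::nat) (m::nat) (n::nat). 2 \<le> d \<and> d \<le> n \<and> 1 \<le> m \<and> (d = 2 \<longrightarrow> n = 2) \<longrightarrow>
        (\<exists>\<Delta> :: nat set set. ball_with_full_boundary d m n \<Delta> \<and>
           (\<forall>k. 2 * k \<le> d \<longrightarrow>
              of_int (h_number d \<Delta> (boundary_complex (d - 1) \<Delta>) k) = bound_lower_half d m n k) \<and>
           (\<forall>k. d < 2 * k \<and> k \<le> d \<longrightarrow>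
              of_int (h_number d \<Delta> (boundary_complex (d - 1) \<Delta>) k) = bound_upper_half d m n k)))"
proof (intro conjI allI impI)
  fix \<Delta> :: "'a set set" and d m n k :: nat
  assume ball: "ball_with_full_boundary d m n \<Delta>"
  let ?h = "of_int (h_number d \<Delta> (boundary_complex (d - 1) \<Delta>) k) :: rat"
  show "?h \<le> bound_lower_half d m n k"
    "?h = bound_lower_half d m n k \<longleftrightarrow> (\<forall>\<sigma>. nonface \<Delta> \<sigma> \<and> face_dim \<sigma> < int k \<longrightarrow>
       \<sigma> \<subseteq> complex_vertices (boundary_complex (d - 1) \<Delta>))" if "2 * k \<le> d"
    using bounds_and_equality(1)[OF ball, of k] that by simp_all
  show "?h \<le> bound_upper_half d m n k"
    "?h = bound_upper_half d m n k \<longleftrightarrow> \<not> (\<exists>\<sigma>. nonface \<Delta> \<sigma> \<and> face_dim \<sigma> < int d - int k)" if "d < 2 * k \<and> k \<le> d"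
    using bounds_and_equality(2)[OF ball, of k] that by blast+
next
  fix d m n :: nat
  assume "2 \<le> d \<and> d \<le> n \<and> 1 \<le> m \<and> (d = 2 \<longrightarrow> n = 2)"
  then show "\<exists>\<Delta> :: nat set set. ball_with_full_boundary d m n \<Delta> \<and>
     (\<forall>k. 2 * k \<le> d \<longrightarrow> of_int (h_number d \<Delta> (boundary_complex (d - 1) \<Delta>) k) = bound_lower_half d m n k) \<and>
     (\<forall>k. d < 2 * k \<and> k \<le> d \<longrightarrow> of_int (h_number d \<Delta> (boundary_complex (d - 1) \<Delta>) k) = bound_upper_half d m n k)"
    by (intro tightness) simp_all
qed

end
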